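(* Let $n\ge 1$. If $V\subseteq \mathbb{C}^{2n}$ is a $j$-broad and $j$-free algebraic variety and $G$ is a subgroup of $\mathrm{GL}_2(\mathbb{C})$ which is dense in $\mathrm{GL}_2(\mathbb{C})$ in the complex topology, then $V\cap \mathrm{B}_j^G$ is dense in $V$ (in the complex topology), and hence it is non-empty.
   Context: Algebraic varieties are identified with their sets of $\mathbb{C}$-points. $\mathbb{H}$ is the complex upper half-plane and $j:\mathbb{H}\to\mathbb{C}$ is the modular $j$-function. $\mathrm{GL}_2(\mathbb{C})$ acts on the Riemann sphere by linear fractional transformations, written $z\mapsto gz$. Blurring: for a subgroup $G\subseteq \mathrm{GL}_2(\mathbb{C})$ and $n\ge 1$, $$\mathrm{B}_j^G=\{(z_1,\dots,z_n,j(g_1z_1),\dots,j(g_nz_n)) : z_k\in\mathbb{C},\ g_k\in G,\ g_kz_k\in\mathbb{H}\text{ for all }k\}\subseteq\mathbb{C}^{2n}.$$ Modular polynomials: $\Phi_N\in\mathbb{Z}[X,Y]$ ($N\ge1$) denotes the $N$-th classical modular polynomial; these are irreducible, and for $z_1,z_2\in\mathbb{H}$ one has $\Phi_N(j(z_1),j(z_2))=0$ for some $N$ iff $z_2=gz_1$ for some $g\in\mathrm{GL}_2^+(\mathbb{Q})$ (rational matrices with positive determinant). A special subvariety of $\mathbb{C}^n$ (coordinates $w_1,\dots,w_n$) is an irreducible component of a variety defined by equations of the form $\Phi_N(w_k,w_l)=0$ with $1\le k,l\le n$ and $N\geq 1$. Coordinates on $\mathbb{C}^{2n}$ are $(z_1,\dots,z_n,w_1,\dots,w_n)$.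 For $\bar k=(k_1,\dots,k_l)$ with $1\le k_1<\dots<k_l\le n$, let $\mathrm{pr}_{\bar k}:\mathbb{C}^{2n}\to\mathbb{C}^{2l}$ be $(\bar z,\bar w)\mapsto(z_{k_1},\dots,z_{k_l},w_{k_1},\dots,w_{k_l})$, and let $\mathrm{pr}_w$ be the projection to $(w_1,\dots,w_n)$. An algebraic variety $V\subseteq\mathbb{C}^{2n}$ is $j$-broad if $\dim \mathrm{pr}_{\bar k}V\ge l$ for every such $\bar k$ of length $l$. It is $j$-free if no coordinate is constant on $\mathrm{pr}_wV$ and $\mathrm{pr}_wV$ is not contained in any proper special subvariety of $\mathbb{C}^n$.
   Formalization: The algebraic variety V is taken to be irreducible; for reducible V the claim can fail (for n=1, add to the line w=z an isolated point (0,c) with c not a value j(g0), g in a countable dense G), while V with all components j-broad and j-free follows componentwise. *)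

theory Defs
  imports
    "HOL-Analysis.Analysis"
    "HOL-Library.Poly_Mapping"
    "HOL-Library.Extended_Nat"
    "HOL-Computational_Algebra.Polynomial"
    "HOL-Algebra.Group"
begin

section \<open>Affine space and algebraic varieties\<close>

text \<open>Coordinates are numbered from 0. A point of complex affine m-space is a function on
  the index set that is extensional (equal to undefined outside of it). Closures are
  taken in the product topology of the type of all functions from nat to complex, which induces the
  usual complex topology on each of these spaces.\<close>

definition affine_space :: "nat \<Rightarrow> (nat \<Rightarrow> complex) set" where
  "affine_space m = {..<m} \<rightarrow>\<^sub>E UNIV"

text \<open>Polynomials over the complex numbers: finitely supported families of coefficients,
  indexed by the exponent vectors, which are finitely supported themselves.\<close>

type_synonym cpoly = "(nat \<Rightarrow>\<^sub>0 nat) \<Rightarrow>\<^sub>0 complex"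

definition cpolys :: "nat \<Rightarrow> cpoly set" where
  "cpolys m = {p. \<forall>e\<in>Poly_Mapping.keys p. Poly_Mapping.keys e \<subseteq> {..<m}}"

definition cpoly_eval :: "cpoly \<Rightarrow> (nat \<Rightarrow> complex) \<Rightarrow> complex" where
  "cpoly_eval p x = (\<Sum>e\<in>Poly_Mapping.keys p.
      Poly_Mapping.lookup p e * (\<Prod>i\<in>Poly_Mapping.keys e. x i ^ Poly_Mapping.lookup e i))"

definition zero_locus :: "nat \<Rightarrow> cpoly set \<Rightarrow> (nat \<Rightarrow> complex) set" where
  "zero_locus m F = {x \<in> affine_space m. \<forall>p\<in>F. cpoly_eval p x = 0}"

definition zariski_closed :: "nat \<Rightarrow> (nat \<Rightarrow> complex) set \<Rightarrow> bool" where
  "zariski_closed m V \<longleftrightarrow> (\<exists>F. F \<subseteq> cpolys m \<and> V = zero_locus m F)"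

definition zariski_closure :: "nat \<Rightarrow> (nat \<Rightarrow> complex) set \<Rightarrow> (nat \<Rightarrow> complex) set" where
  "zariski_closure m S = \<Inter>{A. zariski_closed m A \<and> S \<subseteq> A}"

definition irreducible_variety :: "nat \<Rightarrow> (nat \<Rightarrow> complex) set \<Rightarrow> bool" where
  "irreducible_variety m V \<longleftrightarrow> zariski_closed m V \<and> V \<noteq> {} \<and>
     (\<forall>A B. zariski_closed m A \<and> zariski_closed m B \<and> V \<subseteq> A \<union> B \<longrightarrow> V \<subseteq> A \<or> V \<subseteq> B)"

definition irreducible_component ::
    "nat \<Rightarrow> (nat \<Rightarrow> complex) set \<Rightarrow> (nat \<Rightarrow> complex) set \<Rightarrow> bool" where
  "irreducible_component m L Z \<longleftrightarrow> irreducible_variety m Z \<and> Z \<subseteq> L \<and>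
     (\<forall>Z'. irreducible_variety m Z' \<and> Z \<subseteq> Z' \<and> Z' \<subseteq> L \<longrightarrow> Z' = Z)"

text \<open>Krull dimension of the Zariski closure, for an arbitrary set S. This is the usual
  dimension of a constructible set, such as the projection of a variety. The supremum is
  taken in enat, and the empty set gets dimension 0.\<close>

definition zariski_dim :: "nat \<Rightarrow> (nat \<Rightarrow> complex) set \<Rightarrow> enat" where
  "zariski_dim m S = Sup {enat d | d. \<exists>C :: nat \<Rightarrow> (nat \<Rightarrow> complex) set.
     (\<forall>i\<le>d. irreducible_variety m (C i) \<and> C i \<subseteq> zariski_closure m S) \<and>
     (\<forall>i<d. C i \<subset> C (Suc i))}"

section \<open>The modular function j and the modular polynomials\<close>

definition upper_half_plane :: "complex set" where
  "upper_half_plane = {z. Im z > 0}"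

definition eisenstein_sum :: "nat \<Rightarrow> complex \<Rightarrow> complex" where
  "eisenstein_sum k z =
     infsum (\<lambda>(a, b). 1 / (of_int a + of_int b * z) ^ k) (UNIV - {(0 :: int, 0 :: int)})"

definition modular_j :: "complex \<Rightarrow> complex" where
  "modular_j z =
     (let g2 = 60 * eisenstein_sum 4 z; g3 = 140 * eisenstein_sum 6 z
      in 1728 * g2 ^ 3 / (g2 ^ 3 - 27 * g3 ^ 2))"

text \<open>A polynomial in X and Y is represented as a polynomial in X whose coefficients are
  polynomials in Y.\<close>

definition bipoly_eval :: "int poly poly \<Rightarrow> complex \<Rightarrow> complex \<Rightarrow> complex" where
  "bipoly_eval P x y = poly (map_poly (\<lambda>c. poly (map_poly of_int c) y) P) x"

text \<open>The triple (a, b, d) stands for the matrix with rows (a, b) and (0, d). These matrices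
  represent the classes of primitive integral matrices of determinant N modulo the left action of
  the modular group.\<close>

definition modular_reps :: "nat \<Rightarrow> (nat \<times> nat \<times> nat) set" where
  "modular_reps N = {(a, b, d). a * d = N \<and> b < d \<and> gcd a (gcd b d) = 1}"

text \<open>The classical modular polynomial is the unique one satisfying the identity
  that expresses the product of all X - j(rz) as the polynomial in X and j(z).\<close>

definition modular_poly :: "nat \<Rightarrow> int poly poly" where
  "modular_poly N = (THE P. \<forall>x. \<forall>z\<in>upper_half_plane.
     bipoly_eval P x (modular_j z) =
       (\<Prod>(a, b, d)\<in>modular_reps N. x - modular_j ((of_nat a * z + of_nat b) / of_nat d)))"

lemma finite_modular_reps:
  assumes "N \<ge> 1"
  shows "finite (modular_reps N)"
proof (rule finite_subset)
  show "modular_reps N \<subseteq> {..N} \<times> {..N} \<times> {..N}"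
  proof
    fix t assume "t \<in> modular_reps N"
    then obtain a b d where t: "t = (a, b, d)" and e: "a * d = N" and l: "b < d"
      by (auto simp: modular_reps_def)
    have "a dvd N" "d dvd N" using e by auto
    then have "a \<le> N" "d \<le> N" using assms by (auto intro: dvd_imp_le)
    then show "t \<in> {..N} \<times> {..N} \<times> {..N}" using t l by simp
  qed
qed simp

definition special_subvariety :: "nat \<Rightarrow> (nat \<Rightarrow> complex) set \<Rightarrow> bool" where
  "special_subvariety n Z \<longleftrightarrow>
     (\<exists>E \<subseteq> {(N, k, l). N \<ge> 1 \<and> k < n \<and> l < n}.
        irreducible_component n
          {w \<in> affine_space n. \<forall>(N, k, l)\<in>E. bipoly_eval (modular_poly N) (w k) (w l) = 0} Z)"

section \<open>Broad and free varieties\<close>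

text \<open>In affine 2n-space the first n coordinates are the z-coordinates and the last n ones
  are the w-coordinates.\<close>

definition pr_idx :: "nat \<Rightarrow> nat list \<Rightarrow> (nat \<Rightarrow> complex) \<Rightarrow> (nat \<Rightarrow> complex)" where
  "pr_idx n ks x = (\<lambda>i\<in>{..<2 * length ks}.
     if i < length ks then x (ks ! i) else x (n + ks ! (i - length ks)))"

definition pr_w :: "nat \<Rightarrow> (nat \<Rightarrow> complex) \<Rightarrow> (nat \<Rightarrow> complex)" where
  "pr_w n x = (\<lambda>i\<in>{..<n}. x (n + i))"

definition j_broad :: "nat \<Rightarrow> (nat \<Rightarrow> complex) set \<Rightarrow> bool" where
  "j_broad n V \<longleftrightarrow> (\<forall>ks. ks \<noteq> [] \<and> sorted_wrt (<) ks \<and> set ks \<subseteq> {..<n} \<longrightarrow>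
     zariski_dim (2 * length ks) (pr_idx n ks ` V) \<ge> enat (length ks))"

definition j_free :: "nat \<Rightarrow> (nat \<Rightarrow> complex) set \<Rightarrow> bool" where
  "j_free n V \<longleftrightarrow>
     (\<forall>k<n. \<not> (\<exists>c. \<forall>w \<in> pr_w n ` V. w k = c)) \<and>
     (\<forall>Z. special_subvariety n Z \<and> Z \<noteq> affine_space n \<longrightarrow> \<not> pr_w n ` V \<subseteq> Z)"

section \<open>The general linear group and blurrings\<close>

definition GL2 :: "(complex^2^2) monoid" where
  "GL2 = \<lparr>carrier = {A. invertible A}, monoid.mult = (**), one = mat 1\<rparr>"

lemma group_GL2: "group GL2"
proof (rule groupI)
  fix A assume "A \<in> carrier GL2"
  then obtain B where "A ** B = mat 1" "B ** A = mat 1"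
    by (auto simp: GL2_def invertible_def)
  then show "\<exists>B\<in>carrier GL2. B \<otimes>\<^bsub>GL2\<^esub> A = \<one>\<^bsub>GL2\<^esub>"
    by (auto simp: GL2_def invertible_def)
qed (auto simp: GL2_def invertible_mult matrix_mul_assoc invertible_def[of "mat 1"])

text \<open>If the denominator vanishes, the point is mapped to infinity; here its value is 0 by
  the convention for division. Neither lies in the upper half-plane, so the
  condition that the image lies there is not affected.\<close>

definition moebius :: "complex^2^2 \<Rightarrow> complex \<Rightarrow> complex" where
  "moebius g z = (g $ 1 $ 1 * z + g $ 1 $ 2) / (g $ 2 $ 1 * z + g $ 2 $ 2)"

definition blurring :: "nat \<Rightarrow> (complex^2^2) set \<Rightarrow> (nat \<Rightarrow> complex) set" where
  "blurring n G = {x \<in> affine_space (2 * n). \<exists>g. \<forall>k<n.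
     g k \<in> G \<and> moebius (g k) (x k) \<in> upper_half_plane \<and>
     x (n + k) = modular_j (moebius (g k) (x k))}"

end

theory Submission
  imports Defs "HOL-Complex_Analysis.Complex_Analysis" "HOL-Computational_Algebra.Fundamental_Theorem_Algebra"
begin

no_notation fps_nth (infixl "$" 75)

text \<open>Near a point of \<open>V\<close> choose a generic point \<open>(z, w)\<close> of \<open>V\<close> such that \<open>j\<close> has a local inverse \<open>\<tau>\<^sub>k\<close> at every \<open>w\<^sub>k\<close>.
  This is possible because no \<open>w\<^sub>k\<close> is constant and the values at which \<open>j\<close> is locally invertible are dense: otherwise
  \<open>1 / (j - c)\<close> would be bounded and hence constant by the maximum principle.
  Solutions on \<open>V\<close> of the equations \<open>g\<^sub>k z\<^sub>k = \<tau>\<^sub>k (w\<^sub>k)\<close> belong to the blurring. The matrices \<open>g\<^sub>k\<close> with rows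
  \<open>(\<kappa>\<^sub>k, \<tau>\<^sub>k (w\<^sub>k) - \<kappa>\<^sub>k z\<^sub>k)\<close> and \<open>(0, 1)\<close> solve them at the given point, where the linearized equations are
  given by the forms \<open>\<kappa>\<^sub>k dz\<^sub>k - \<tau>'\<^sub>k (w\<^sub>k) dw\<^sub>k\<close> on the tangent space. Since \<open>V\<close> is broad, the differentials
  \<open>dz\<^sub>k\<close>, \<open>dw\<^sub>k\<close> for \<open>k \<in> K\<close> span a space of dimension at least \<open>card K\<close> for every \<open>K\<close>, so that these forms are independent
  for suitable nonzero \<open>\<kappa>\<^sub>k\<close>. By Newton's method the equations stay solvable near the point for all nearby matrices,
  in particular for some matrices in the dense subgroup.\<close>

section \<open>Polynomial functions\<close>

text \<open>Two devices shape the proof. The coordinates beyond the ambient space are left free and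
  act as indeterminates, so that the linear form of Kronecker's trick is generic without a choice
  and its relation can be differentiated with respect to its own coefficients. Local geometry rests
  on \<open>pt\<close>, a rational inverse of the projection to a hypersurface: tangent vectors are
  velocities of explicit curves, and equations on the variety become equations in affine
  coordinates. Dimension enters as algebraic independence of coordinates. The main obstacle is that
  generic points must be found near every point, singular ones included. There Noether normalization
  is used: over a finite projection, approximating points stay bounded and have a limit, and a
  suitable form tells the intended limit from the rest of its fibre. For \<open>j\<close> the
  obstacle is that zeros of its denominator are not excluded; forms of weight 12 are compared in
  place of values of \<open>j\<close>, and the numerical input is that \<open>g2\<close> is nonzero
  at \<open>\<i>\<close>, where \<open>g3\<close> vanishes, and that \<open>g3\<close> is nonzero at
  \<open>2 * \<i>\<close>.\<close>

inductive_set poly_funs :: "((nat \<Rightarrow> complex) \<Rightarrow> complex) set" where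
  const: "(\<lambda>x. c) \<in> poly_funs"
| coord: "(\<lambda>x. x i) \<in> poly_funs"
| add: "f \<in> poly_funs \<Longrightarrow> g \<in> poly_funs \<Longrightarrow> (\<lambda>x. f x + g x) \<in> poly_funs"
| mult: "f \<in> poly_funs \<Longrightarrow> g \<in> poly_funs \<Longrightarrow> (\<lambda>x. f x * g x) \<in> poly_funs"

text \<open>Lines reduce questions about many variables to complex polynomials in one, where a
  nonzero polynomial has finitely many roots.\<close>

lemma poly_funs_restrict_line:
  assumes "f \<in> poly_funs"
  shows "\<exists>q::complex poly. \<forall>s. f (\<lambda>i. a i + s * b i) = poly q s"
  using assms
proof induction
  case (const c)
  show ?case by (rule exI[of _ "[:c:]"]) simp
next
  case (coord i)
  show ?case by (rule exI[of _ "[:a i, b i:]"]) simp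
next
  case (add f g)
  then obtain p q where "\<forall>s. f (\<lambda>i. a i + s * b i) = poly p s" "\<forall>s. g (\<lambda>i. a i + s * b i) = poly q s" by blast
  then show ?case by (intro exI[of _ "p + q"]) simp
next
  case (mult f g)
  then obtain p q where "\<forall>s. f (\<lambda>i. a i + s * b i) = poly p s" "\<forall>s. g (\<lambda>i. a i + s * b i) = poly q s" by blast
  then show ?case by (intro exI[of _ "p * q"]) simp
qed

text \<open>Over an infinite field a polynomial is determined by its values. Taking polynomials as
  functions of infinitely many variables makes ring identities pointwise, and the free coordinates
  of a cylinder need no separate polynomial ring.\<close>

typedef pfun = poly_funs
  morphisms pev Abs_pfun
  by (rule exI[of _ "\<lambda>x. 0"], rule poly_funs.const)

setup_lifting type_definition_pfun

lemma pfun_eqI: "(\<And>x. pev P x = pev Q x) \<Longrightarrow> P = Q"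
  by (metis ext pev_inject)

lift_definition pconst :: "complex \<Rightarrow> pfun" is "\<lambda>c x. c" by (rule poly_funs.const)
lift_definition pvar :: "nat \<Rightarrow> pfun" is "\<lambda>i x. x i" by (rule poly_funs.coord)

instantiation pfun :: comm_ring_1
begin

lift_definition zero_pfun :: pfun is "\<lambda>x. 0" by (rule poly_funs.const)
lift_definition one_pfun :: pfun is "\<lambda>x. 1" by (rule poly_funs.const)
lift_definition plus_pfun :: "pfun \<Rightarrow> pfun \<Rightarrow> pfun" is "\<lambda>f g x. f x + g x" by (rule poly_funs.add)
lift_definition times_pfun :: "pfun \<Rightarrow> pfun \<Rightarrow> pfun" is "\<lambda>f g x. f x * g x" by (rule poly_funs.mult)
lift_definition uminus_pfun :: "pfun \<Rightarrow> pfun" is "\<lambda>f x. - f x"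
proof -
  fix f :: "(nat \<Rightarrow> complex) \<Rightarrow> complex" assume "f \<in> poly_funs"
  from poly_funs.mult[OF poly_funs.const[of "-1"] this] show "(\<lambda>x. - f x) \<in> poly_funs" by simp
qed
definition minus_pfun :: "pfun \<Rightarrow> pfun \<Rightarrow> pfun" where "minus_pfun P Q = P + - Q"

instance
  by standard (unfold minus_pfun_def, (transfer, simp add: fun_eq_iff algebra_simps)+)

end

lemma pev_simps [simp]:
  "pev 0 x = 0" "pev 1 x = 1" "pev (P + Q) x = pev P x + pev Q x" "pev (P * Q) x = pev P x * pev Q x"
  "pev (- P) x = - pev P x" "pev (P - Q) x = pev P x - pev Q x"
  "pev (pconst c) x = c" "pev (pvar i) x = x i"
proof -
  have "pev (P + - Q) x = pev P x - pev Q x" by (simp only: plus_pfun.rep_eq uminus_pfun.rep_eq) simp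
  then show "pev (P - Q) x = pev P x - pev Q x" by (simp only: minus_pfun_def)
qed (simp_all add: zero_pfun.rep_eq one_pfun.rep_eq plus_pfun.rep_eq times_pfun.rep_eq
    uminus_pfun.rep_eq pconst.rep_eq pvar.rep_eq)

lemma pev_sum [simp]: "pev (sum f A) x = (\<Sum>a\<in>A. pev (f a) x)"
  by (induction A rule: infinite_finite_induct) auto

lemma pev_prod [simp]: "pev (prod f A) x = (\<Prod>a\<in>A. pev (f a) x)"
  by (induction A rule: infinite_finite_induct) auto

lemma pev_power [simp]: "pev (P ^ k) x = pev P x ^ k"
  by (induction k) auto

lemma pfun_induct [case_names const var add mult, induct type: pfun]:
  assumes "\<And>c. Pr (pconst c)" "\<And>i. Pr (pvar i)"
    and "\<And>P Q. Pr P \<Longrightarrow> Pr Q \<Longrightarrow> Pr (P + Q)" "\<And>P Q. Pr P \<Longrightarrow> Pr Q \<Longrightarrow> Pr (P * Q)"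
  shows "Pr P"
proof -
  have "f \<in> poly_funs \<Longrightarrow> Pr (Abs_pfun f)" for f
  proof (induction rule: poly_funs.induct)
    case (const c)
    then show ?case using assms(1)[of c] by (simp add: pconst.abs_eq)
  next
    case (coord i)
    then show ?case using assms(2)[of i] by (simp add: pvar.abs_eq)
  next
    case (add f g)
    then show ?case using assms(3)[OF add.IH] by (simp add: plus_pfun.abs_eq eq_onp_same_args)
  next
    case (mult f g)
    then show ?case using assms(4)[OF mult.IH] by (simp add: times_pfun.abs_eq eq_onp_same_args)
  qed
  from this[OF pev[of P]] show ?thesis by (simp add: pev_inverse)
qed

lemma pev_line: "\<exists>q::complex poly. \<forall>s. pev P (\<lambda>i. a i + s * b i) = poly q s"
  by (rule poly_funs_restrict_line[OF pev])

lemma pfun_neq0: "P \<noteq> 0 \<longleftrightarrow> (\<exists>x. pev P x \<noteq> 0)"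
  using pfun_eqI[of P 0] by auto

text \<open>The line through a point where \<open>P\<close> is nonzero and a point where
  \<open>Q\<close> is nonzero carries two nonzero polynomials in one variable, whose product is
  nonzero somewhere.\<close>

instance pfun :: idom
proof
  fix P Q :: pfun
  assume "P \<noteq> 0" "Q \<noteq> 0"
  then obtain a b where ab: "pev P a \<noteq> 0" "pev Q b \<noteq> 0" by (auto simp: pfun_neq0)
  define c where "c = (\<lambda>i. b i - a i)"
  obtain p q where p: "\<forall>s. pev P (\<lambda>i. a i + s * c i) = poly p s"
    and q: "\<forall>s. pev Q (\<lambda>i. a i + s * c i) = poly q s"
    using pev_line by meson
  have "poly p 0 \<noteq> 0" "poly q 1 \<noteq> 0"
    using p[rule_format, of 0] q[rule_format, of 1] ab by (simp_all add: c_def)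
  then have "p * q \<noteq> 0" by auto
  then obtain s where "poly (p * q) s \<noteq> 0" using poly_all_0_iff_0 by blast
  then have "pev (P * Q) (\<lambda>i. a i + s * c i) \<noteq> 0" using p q by simp
  then show "P * Q \<noteq> 0" by (auto simp: pfun_neq0)
qed

lemma finite_zeros_line:
  assumes "pev P (\<lambda>i. a i + s0 * b i) \<noteq> 0"
  shows "finite {s. pev P (\<lambda>i. a i + s * b i) = 0}"
proof -
  obtain q where q: "\<forall>s. pev P (\<lambda>i. a i + s * b i) = poly q s" using pev_line by blast
  then have "q \<noteq> 0" using assms by auto
  then show ?thesis using poly_roots_finite[of q] q by simp
qed

text \<open>This is how generic points are reached from a given one: a single nonzero value anywhere
  on the line leaves finitely many exceptions.\<close>

lemma eventually_line_neq0:
  assumes "pev P (\<lambda>i. a i + s0 * b i) \<noteq> 0"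
  shows "\<forall>\<^sub>F s in at s1. pev P (\<lambda>i. a i + s * b i) \<noteq> 0"
proof -
  have fin: "finite ({s. pev P (\<lambda>i. a i + s * b i) = 0} - {s1})"
    using finite_zeros_line[OF assms] by simp
  then have "open (- ({s. pev P (\<lambda>i. a i + s * b i) = 0} - {s1}))"
    by (intro open_Compl finite_imp_closed)
  then have "\<forall>\<^sub>F s in at s1. s \<in> - ({s. pev P (\<lambda>i. a i + s * b i) = 0} - {s1})"
    by (intro eventually_at_in_open') auto
  moreover have "\<forall>\<^sub>F s in at s1. s \<noteq> s1" by (simp add: eventually_at_filter)
  ultimately show ?thesis by eventually_elim auto
qed

lemma tendsto_pev:
  assumes "\<And>i. ((\<lambda>t. x t i) \<longlongrightarrow> l i) F"
  shows "((\<lambda>t. pev P (x t)) \<longlongrightarrow> pev P l) F"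
  by (induction P) (auto intro: tendsto_intros assms)

lemma tendsto_fun_iff:
  fixes x :: "'a \<Rightarrow> nat \<Rightarrow> complex"
  shows "(x \<longlongrightarrow> l) F \<longleftrightarrow> (\<forall>i. ((\<lambda>t. x t i) \<longlongrightarrow> l i) F)"
proof -
  have "(x \<longlongrightarrow> l) F \<longleftrightarrow> limitin (product_topology (\<lambda>_. euclidean) UNIV) x l F"
    by (simp add: euclidean_product_topology)
  then show ?thesis by (simp only: limitin_componentwise) auto
qed

lemma continuous_on_pev: "continuous_on A (pev P)"
proof -
  have "(pev P \<longlongrightarrow> pev P x) (at x within A)" for x
    by (rule tendsto_pev) (use tendsto_fun_iff[of "\<lambda>x. x" x "at x within A"] in auto)
  then show ?thesis by (auto simp: continuous_on_def)
qed

text \<open>\<open>G i\<close> is the i-th partial derivative.\<close>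
lemma pev_deriv_exists:
  "\<exists>N (G :: nat \<Rightarrow> pfun). \<forall>M\<ge>N. \<forall>x \<tau> s S. (\<forall>i. ((\<lambda>t. x t i) has_field_derivative \<tau> i) (at s within S)) \<longrightarrow>
     ((\<lambda>t. pev P (x t)) has_field_derivative (\<Sum>i<M. pev (G i) (x s) * \<tau> i)) (at s within S)"
proof (induction P)
  case (const c)
  show ?case by (rule exI[of _ 0], rule exI[of _ "\<lambda>i. 0"]) simp
next
  case (var j)
  show ?case
  proof (rule exI[of _ "Suc j"], rule exI[of _ "\<lambda>i. if i = j then 1 else 0"], intro allI impI)
    fix M and x :: "complex \<Rightarrow> nat \<Rightarrow> complex" and \<tau> s S
    assume M: "Suc j \<le> M" and *: "\<forall>i. ((\<lambda>t. x t i) has_field_derivative \<tau> i) (at s within S)"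
    have "(\<Sum>i<M. pev (if i = j then 1 else 0) (x s) * \<tau> i) = (\<Sum>i<M. if i = j then \<tau> i else 0)"
      by (intro sum.cong) auto
    also have "\<dots> = \<tau> j" using M by (simp add: sum.delta)
    finally show "((\<lambda>t. pev (pvar j) (x t)) has_field_derivative
      (\<Sum>i<M. pev (if i = j then 1 else 0) (x s) * \<tau> i)) (at s within S)" using * by simp
  qed
next
  case (add P Q)
  then obtain N G N' G' where
    1: "\<forall>M\<ge>N. \<forall>x \<tau> s S. (\<forall>i. ((\<lambda>t. x t i) has_field_derivative \<tau> i) (at s within S)) \<longrightarrow>
     ((\<lambda>t. pev P (x t)) has_field_derivative (\<Sum>i<M. pev (G i) (x s) * \<tau> i)) (at s within S)" and
    2: "\<forall>M\<ge>N'. \<forall>x \<tau> s S. (\<forall>i. ((\<lambda>t. x t i) has_field_derivative \<tau> i) (at s within S)) \<longrightarrow>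
     ((\<lambda>t. pev Q (x t)) has_field_derivative (\<Sum>i<M. pev (G' i) (x s) * \<tau> i)) (at s within S)" by blast
  show ?case
  proof (rule exI[of _ "max N N'"], rule exI[of _ "\<lambda>i. G i + G' i"], intro allI impI)
    fix M and x :: "complex \<Rightarrow> nat \<Rightarrow> complex" and \<tau> s S
    assume M: "max N N' \<le> M" and *: "\<forall>i. ((\<lambda>t. x t i) has_field_derivative \<tau> i) (at s within S)"
    show "((\<lambda>t. pev (P + Q) (x t)) has_field_derivative
      (\<Sum>i<M. pev (G i + G' i) (x s) * \<tau> i)) (at s within S)"
      using DERIV_add[OF 1[rule_format, OF _ *[rule_format], of M] 2[rule_format, OF _ *[rule_format], of M]] M
      by (simp add: ring_distribs sum.distrib)
  qed
next
  case (mult P Q)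
  then obtain N G N' G' where
    1: "\<forall>M\<ge>N. \<forall>x \<tau> s S. (\<forall>i. ((\<lambda>t. x t i) has_field_derivative \<tau> i) (at s within S)) \<longrightarrow>
     ((\<lambda>t. pev P (x t)) has_field_derivative (\<Sum>i<M. pev (G i) (x s) * \<tau> i)) (at s within S)" and
    2: "\<forall>M\<ge>N'. \<forall>x \<tau> s S. (\<forall>i. ((\<lambda>t. x t i) has_field_derivative \<tau> i) (at s within S)) \<longrightarrow>
     ((\<lambda>t. pev Q (x t)) has_field_derivative (\<Sum>i<M. pev (G' i) (x s) * \<tau> i)) (at s within S)" by blast
  show ?case
  proof (rule exI[of _ "max N N'"], rule exI[of _ "\<lambda>i. Q * G i + P * G' i"], intro allI impI)
    fix M and x :: "complex \<Rightarrow> nat \<Rightarrow> complex" and \<tau> s S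
    assume M: "max N N' \<le> M" and *: "\<forall>i. ((\<lambda>t. x t i) has_field_derivative \<tau> i) (at s within S)"
    show "((\<lambda>t. pev (P * Q) (x t)) has_field_derivative
      (\<Sum>i<M. pev (Q * G i + P * G' i) (x s) * \<tau> i)) (at s within S)"
      using DERIV_mult[OF 1[rule_format, OF _ *[rule_format], of M] 2[rule_format, OF _ *[rule_format], of M]] M
      by (simp add: ring_distribs sum.distrib sum_distrib_left sum_distrib_right mult_ac)
  qed
qed

lemma psubst_exists: "\<exists>P'. \<forall>x. pev P' x = pev P (\<lambda>i. pev (\<sigma> i) x)"
proof (induction P)
  case (const c) show ?case by (rule exI[of _ "pconst c"]) simp
next
  case (var i) show ?case by (rule exI[of _ "\<sigma> i"]) simp
next
  case (add P Q) then show ?case by (metis pev_simps(3))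
next
  case (mult P Q) then show ?case by (metis pev_simps(4))
qed

definition psubst :: "(nat \<Rightarrow> pfun) \<Rightarrow> pfun \<Rightarrow> pfun" where
  "psubst \<sigma> P = (SOME P'. \<forall>x. pev P' x = pev P (\<lambda>i. pev (\<sigma> i) x))"

lemma pev_psubst [simp]: "pev (psubst \<sigma> P) x = pev P (\<lambda>i. pev (\<sigma> i) x)"
  using someI_ex[OF psubst_exists[of P \<sigma>]] by (simp add: psubst_def)

section \<open>Polynomials in one variable over the ring of polynomial functions\<close>

definition spec :: "pfun poly \<Rightarrow> (nat \<Rightarrow> complex) \<Rightarrow> complex poly" where
  "spec Q y = map_poly (\<lambda>c. pev c y) Q"

definition ev2 :: "pfun poly \<Rightarrow> (nat \<Rightarrow> complex) \<Rightarrow> complex \<Rightarrow> complex" where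
  "ev2 Q y X = poly (spec Q y) X"

lemma coeff_spec [simp]: "coeff (spec Q y) i = pev (coeff Q i) y"
  by (simp add: spec_def coeff_map_poly)

lemma spec_simps [simp]:
  "spec 0 y = 0" "spec 1 y = 1" "spec (P + Q) y = spec P y + spec Q y" "spec (P - Q) y = spec P y - spec Q y"
  "spec (- P) y = - spec P y"
  "spec (P * Q) y = spec P y * spec Q y" "spec (smult c Q) y = smult (pev c y) (spec Q y)"
  "spec (pCons c Q) y = pCons (pev c y) (spec Q y)" "spec (monom c k) y = monom (pev c y) k"
  by (rule poly_eqI; simp add: coeff_mult coeff_pCons coeff_1 split: nat.split)+

lemma spec_power [simp]: "spec (Q ^ k) y = spec Q y ^ k"
  by (induction k) auto

lemma spec_sum [simp]: "spec (sum f A) y = (\<Sum>a\<in>A. spec (f a) y)"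
  by (induction A rule: infinite_finite_induct) auto

lemma degree_spec_le: "degree (spec Q y) \<le> degree Q"
  by (rule degree_le) (simp add: coeff_eq_0)

lemma ev2_simps [simp]:
  "ev2 0 y X = 0" "ev2 1 y X = 1" "ev2 (P + Q) y X = ev2 P y X + ev2 Q y X" "ev2 (P - Q) y X = ev2 P y X - ev2 Q y X"
  "ev2 (- P) y X = - ev2 P y X"
  "ev2 (P * Q) y X = ev2 P y X * ev2 Q y X" "ev2 (smult c Q) y X = pev c y * ev2 Q y X"
  "ev2 (pCons c Q) y X = pev c y + X * ev2 Q y X" "ev2 (monom c k) y X = pev c y * X ^ k"
  "ev2 (Q ^ k) y X = ev2 Q y X ^ k" "ev2 (sum f A) y X = (\<Sum>a\<in>A. ev2 (f a) y X)"
  by (simp_all add: ev2_def poly_monom poly_sum)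

lemma ev2_altdef: "degree Q \<le> n \<Longrightarrow> ev2 Q y X = (\<Sum>i\<le>n. pev (coeff Q i) y * X ^ i)"
proof -
  assume n: "degree Q \<le> n"
  have "ev2 Q y X = (\<Sum>i\<le>degree (spec Q y). pev (coeff Q i) y * X ^ i)"
    by (simp add: ev2_def poly_altdef)
  also have "\<dots> = (\<Sum>i\<le>n. pev (coeff Q i) y * X ^ i)"
    using n degree_spec_le[of Q y]
    by (intro sum.mono_neutral_left) (auto simp flip: coeff_spec intro!: coeff_eq_0)
  finally show ?thesis .
qed

lemma ev2_neq0: "Q \<noteq> 0 \<Longrightarrow> \<exists>y X. ev2 Q y X \<noteq> 0"
proof -
  assume "Q \<noteq> 0"
  then obtain i where "coeff Q i \<noteq> 0" by (auto simp: poly_eq_iff)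
  then obtain y where "pev (coeff Q i) y \<noteq> 0" by (auto simp: pfun_neq0)
  then have "spec Q y \<noteq> 0" by (auto simp: poly_eq_iff intro!: exI[of _ i])
  then show ?thesis using poly_all_0_iff_0 unfolding ev2_def by blast
qed

text \<open>The chain rule with coefficients and variable moving at once. \<open>N\<close> bounds
  the indices that occur in \<open>Q\<close>; allowing every \<open>M \<ge> N\<close> lets the
  induction merge two bounds.\<close>

lemma ev2_deriv_exists:
  "\<exists>N (G :: nat \<Rightarrow> pfun poly). \<forall>M\<ge>N. \<forall>x \<tau> \<xi> \<xi>' s S. (\<forall>i. ((\<lambda>t. x t i) has_field_derivative \<tau> i) (at s within S)) \<longrightarrow>
     (\<xi> has_field_derivative \<xi>') (at s within S) \<longrightarrow>
     ((\<lambda>t. ev2 Q (x t) (\<xi> t)) has_field_derivative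
       ((\<Sum>i<M. ev2 (G i) (x s) (\<xi> s) * \<tau> i) + ev2 (pderiv Q) (x s) (\<xi> s) * \<xi>')) (at s within S)"
proof (induction Q)
  case 0
  show ?case by (rule exI[of _ 0], rule exI[of _ "\<lambda>i. 0"]) simp
next
  case (pCons c Q)
  obtain N and G :: "nat \<Rightarrow> pfun" where
    1: "\<forall>M\<ge>N. \<forall>x \<tau> s S. (\<forall>i. ((\<lambda>t. x t i) has_field_derivative \<tau> i) (at s within S)) \<longrightarrow>
     ((\<lambda>t. pev c (x t)) has_field_derivative (\<Sum>i<M. pev (G i) (x s) * \<tau> i)) (at s within S)" using pev_deriv_exists[of c] by (elim exE) blast
  obtain N' and G' :: "nat \<Rightarrow> pfun poly" where
    2: "\<forall>M\<ge>N'. \<forall>x \<tau> \<xi> \<xi>' s S. (\<forall>i. ((\<lambda>t. x t i) has_field_derivative \<tau> i) (at s within S)) \<longrightarrow>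
     (\<xi> has_field_derivative \<xi>') (at s within S) \<longrightarrow>
     ((\<lambda>t. ev2 Q (x t) (\<xi> t)) has_field_derivative
       ((\<Sum>i<M. ev2 (G' i) (x s) (\<xi> s) * \<tau> i) + ev2 (pderiv Q) (x s) (\<xi> s) * \<xi>')) (at s within S)"
    using pCons.IH by (elim exE) blast
  show ?case
  proof (rule exI[of _ "max N N'"], rule exI[of _ "\<lambda>i. pCons (G i) (G' i)"], intro allI impI)
    fix M and x :: "complex \<Rightarrow> nat \<Rightarrow> complex" and \<tau> \<xi> \<xi>' s S
    assume M: "max N N' \<le> M" and *: "\<forall>i. ((\<lambda>t. x t i) has_field_derivative \<tau> i) (at s within S)"
      and \<xi>: "(\<xi> has_field_derivative \<xi>') (at s within S)"
    have "((\<lambda>t. pev c (x t) + \<xi> t * ev2 Q (x t) (\<xi> t)) has_field_derivative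
      ((\<Sum>i<M. pev (G i) (x s) * \<tau> i) + (\<xi>' * ev2 Q (x s) (\<xi> s) +
        ((\<Sum>i<M. ev2 (G' i) (x s) (\<xi> s) * \<tau> i) + ev2 (pderiv Q) (x s) (\<xi> s) * \<xi>') * \<xi> s))) (at s within S)"
      by (rule DERIV_add[OF 1[rule_format, OF _ *[rule_format], of M] DERIV_mult[OF \<xi> 2[rule_format, OF _ *[rule_format] \<xi>, of M]]])
        (use M in auto)
    then show "((\<lambda>t. ev2 (pCons c Q) (x t) (\<xi> t)) has_field_derivative
       ((\<Sum>i<M. ev2 (pCons (G i) (G' i)) (x s) (\<xi> s) * \<tau> i) + ev2 (pderiv (pCons c Q)) (x s) (\<xi> s) * \<xi>')) (at s within S)"
      by (simp add: pderiv_pCons ring_distribs sum.distrib sum_distrib_left sum_distrib_right mult_ac add_ac)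
  qed
qed

lemma tendsto_ev2:
  assumes "\<And>i. ((\<lambda>t. x t i) \<longlongrightarrow> l i) F" "(\<xi> \<longlongrightarrow> X) F"
  shows "((\<lambda>t. ev2 Q (x t) (\<xi> t)) \<longlongrightarrow> ev2 Q l X) F"
  by (induction Q) (auto intro!: tendsto_intros assms tendsto_pev)

text \<open>Pseudo-division multiplies the dividend by a power of the leading coefficient of the
  divisor. Here this power is a nonzero constant and can be divided out, so that no denominators
  remain.\<close>

lemma poly_division_const_lead:
  fixes \<alpha> \<beta> :: "pfun poly"
  assumes "lead_coeff \<beta> = pconst c" "c \<noteq> 0"
  shows "\<exists>\<gamma> \<rho>. \<alpha> = \<beta> * \<gamma> + \<rho> \<and> (\<rho> = 0 \<or> degree \<rho> < degree \<beta>)"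
proof -
  have inv: "pconst (1 / c ^ k) * pconst c ^ k = 1" for k
    by (rule pfun_eqI) (use assms in simp)
  have "pconst c \<noteq> 0" using assms(2) by (auto simp: pfun_neq0)
  then have \<beta>: "\<beta> \<noteq> 0" using assms(1) by auto
  obtain q r where qr: "pseudo_divmod \<alpha> \<beta> = (q, r)" by fastforce
  define k where "k = Suc (degree \<alpha>) - degree \<beta>"
  have e: "smult (pconst c ^ k) \<alpha> = \<beta> * q + r" and d: "r = 0 \<or> degree r < degree \<beta>"
    using pseudo_divmod[OF \<beta> qr] assms(1) by (auto simp: k_def)
  have "\<alpha> = smult (pconst (1 / c ^ k)) (smult (pconst c ^ k) \<alpha>)"
    using inv[of k] by simp
  also have "\<dots> = \<beta> * smult (pconst (1 / c ^ k)) q + smult (pconst (1 / c ^ k)) r"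
    by (simp add: e smult_add_right)
  finally show ?thesis using d degree_smult_le[of "pconst (1 / c ^ k)" r] by (metis le_less_trans smult_0_right)
qed

text \<open>Elimination with cross-multiplication in place of division, so that it works over an
  integral domain. It is applied both with polynomial coefficients and with complex numbers.\<close>

lemma lin_dep:
  fixes A :: "'i \<Rightarrow> 'j \<Rightarrow> 'a::idom"
  assumes "finite J" "finite I" "card J < card I"
  shows "\<exists>cc. (\<exists>i\<in>I. cc i \<noteq> 0) \<and> (\<forall>j\<in>J. (\<Sum>i\<in>I. cc i * A i j) = 0)"
  using assms
proof (induction J arbitrary: I A rule: finite_induct)
  case empty
  then have "I \<noteq> {}" by auto
  then show ?case by (intro exI[of _ "\<lambda>_. 1"]) auto
next
  case (insert j0 J)
  show ?case
  proof (cases "\<forall>i\<in>I. A i j0 = 0")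
    case True
    obtain cc where "\<exists>i\<in>I. cc i \<noteq> 0" "\<forall>j\<in>J. (\<Sum>i\<in>I. cc i * A i j) = 0"
      using insert.IH[of I A] insert.prems insert.hyps by auto
    then show ?thesis using True by (intro exI[of _ cc]) auto
  next
    case False
    then obtain i0 where i0: "i0 \<in> I" "A i0 j0 \<noteq> 0" by auto
    define I' where "I' = I - {i0}"
    define B where "B i j = A i0 j0 * A i j - A i j0 * A i0 j" for i j
    have fin: "finite I'" "card J < card I'" "i0 \<notin> I'" "I = insert i0 I'"
      using insert.prems insert.hyps i0 by (auto simp: I'_def)
    then obtain \<mu> where \<mu>: "\<exists>i\<in>I'. \<mu> i \<noteq> 0" "\<forall>j\<in>J. (\<Sum>i\<in>I'. \<mu> i * B i j) = 0"
      using insert.IH[of I' B] by auto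
    \<comment> \<open>The coefficient at \<open>i0\<close> is chosen to annihilate column
      \<open>j0\<close>; scaling the others by the pivot keeps a nonzero one nonzero, as there are
      no zero divisors.\<close>
    define cc where "cc i = (if i = i0 then - (\<Sum>i\<in>I'. \<mu> i * A i j0) else A i0 j0 * \<mu> i)" for i
    have *: "(\<Sum>i\<in>I. cc i * A i j) = (\<Sum>i\<in>I'. \<mu> i * B i j)" for j
    proof -
      have "(\<Sum>i\<in>I. cc i * A i j) = cc i0 * A i0 j + (\<Sum>i\<in>I'. cc i * A i j)"
        using fin by simp
      also have "(\<Sum>i\<in>I'. cc i * A i j) = (\<Sum>i\<in>I'. A i0 j0 * \<mu> i * A i j)"
        using fin by (intro sum.cong) (auto simp: cc_def)
      finally show ?thesis
        by (simp add: cc_def B_def ring_distribs sum_subtractf sum_distrib_left sum_distrib_right mult_ac)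
    qed
    have "(\<Sum>i\<in>I'. \<mu> i * B i j0) = 0" by (simp add: B_def)
    moreover have "\<exists>i\<in>I. cc i \<noteq> 0" using \<mu>(1) i0 fin by (auto simp: cc_def)
    ultimately show ?thesis using * \<mu>(2) by (intro exI[of _ cc]) auto
  qed
qed

section \<open>Homogeneous polynomials and their restriction to lines\<close>

inductive phom :: "nat \<Rightarrow> pfun \<Rightarrow> bool" where
  zero: "phom k 0"
| const: "phom 0 (pconst c)"
| var: "phom 1 (pvar i)"
| add: "phom k P \<Longrightarrow> phom k Q \<Longrightarrow> phom k (P + Q)"
| mult: "phom k P \<Longrightarrow> phom l Q \<Longrightarrow> phom (k + l) (P * Q)"

lemma phom_decomp: "\<exists>K f. (\<forall>k. phom k (f k)) \<and> P = (\<Sum>k\<le>K. f k)"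
proof -
  define C where "C = {P. \<exists>K f. (\<forall>k. phom k (f k)) \<and> P = (\<Sum>k\<le>(K::nat). f k)}"
  have C_hom: "P \<in> C" if "phom k P" for k P
    unfolding C_def using that
    by (auto intro!: exI[of _ k] exI[of _ "\<lambda>j. if j = k then P else 0"] phom.zero simp: sum.delta)
  have C_add: "P + Q \<in> C" if "P \<in> C" "Q \<in> C" for P Q
  proof -
    from that obtain K f L g where *: "\<And>k. phom k (f k)" "P = (\<Sum>k\<le>(K::nat). f k)"
        "\<And>k. phom k (g k)" "Q = (\<Sum>k\<le>(L::nat). g k)"
      unfolding C_def by blast
    define h where "h k = (if k \<le> K then f k else 0) + (if k \<le> L then g k else 0)" for k
    have "phom k (h k)" for k unfolding h_def by (intro phom.add) (auto intro: phom.zero *)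
    moreover have "P + Q = (\<Sum>k\<le>max K L. h k)"
    proof -
      have "P = (\<Sum>k\<le>max K L. if k \<le> K then f k else 0)" unfolding *(2)
        by (rule sum.mono_neutral_cong_left) auto
      moreover have "Q = (\<Sum>k\<le>max K L. if k \<le> L then g k else 0)" unfolding *(4)
        by (rule sum.mono_neutral_cong_left) auto
      ultimately show ?thesis by (simp add: h_def sum.distrib)
    qed
    ultimately show ?thesis unfolding C_def by blast
  qed
  have C_sum: "sum f A \<in> C" if "\<And>a. a \<in> A \<Longrightarrow> f a \<in> C" for A :: "nat set" and f
    using that by (induction A rule: infinite_finite_induct) (auto intro: C_add C_hom[OF phom.zero])
  have C_mult: "P * Q \<in> C" if "P \<in> C" "Q \<in> C" for P Q
  proof -
    from that obtain K f L g where *: "\<And>k. phom k (f k)" "P = (\<Sum>k\<le>(K::nat). f k)"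
        "\<And>k. phom k (g k)" "Q = (\<Sum>k\<le>(L::nat). g k)"
      unfolding C_def by blast
    have "P * Q = (\<Sum>k\<le>K. \<Sum>l\<le>L. f k * g l)" unfolding *(2,4) by (rule sum_product)
    also have "\<dots> \<in> C" by (intro C_sum) (rule C_hom[OF phom.mult[OF *(1) *(3)]])
    finally show ?thesis .
  qed
  have "P \<in> C"
    by (induction P) (auto intro: C_add C_mult C_hom phom.intros)
  then show ?thesis by (simp add: C_def)
qed

lemma phom_psubst:
  assumes "phom k P" "\<And>i. phom 1 (\<sigma> i)"
  shows "phom k (psubst \<sigma> P)"
  using assms(1)
proof induction
  case (zero k)
  have "psubst \<sigma> 0 = 0" by (rule pfun_eqI) simp
  then show ?case by (simp add: phom.zero)
next
  case (const c)
  have "psubst \<sigma> (pconst c) = pconst c" by (rule pfun_eqI) simp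
  then show ?case by (simp add: phom.const)
next
  case (var i)
  have "psubst \<sigma> (pvar i) = \<sigma> i" by (rule pfun_eqI) simp
  then show ?case using assms by simp
next
  case (add k P Q)
  have "psubst \<sigma> (P + Q) = psubst \<sigma> P + psubst \<sigma> Q" by (rule pfun_eqI) simp
  then show ?case using add by (simp add: phom.add)
next
  case (mult k P l Q)
  have "psubst \<sigma> (P * Q) = psubst \<sigma> P * psubst \<sigma> Q" by (rule pfun_eqI) simp
  then show ?case using mult by (simp add: phom.mult)
qed

lemma coeff_mult_top:
  assumes "degree p \<le> k" "degree q \<le> l"
  shows "coeff (p * q) (k + l) = coeff p k * coeff q l"
proof -
  have "coeff (p * q) (k + l) = (\<Sum>i\<le>k + l. coeff p i * coeff q (k + l - i))" by (rule coeff_mult)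
  also have "\<dots> = (\<Sum>i\<le>k + l. if i = k then coeff p k * coeff q l else 0)"
  proof (rule sum.cong)
    fix i assume "i \<in> {..k + l}"
    then show "coeff p i * coeff q (k + l - i) = (if i = k then coeff p k * coeff q l else 0)"
      using assms by (cases i k rule: linorder_cases) (auto simp: coeff_eq_0)
  qed simp
  finally show ?thesis by (simp add: sum.delta)
qed

text \<open>For a form of degree \<open>k\<close> the coefficient of \<open>s ^ k\<close> on a line
  is the value at the direction \<open>u\<close>, independent of the starting point. A direction
  with nonzero value therefore yields a constant leading coefficient, which is what Noether
  normalization needs.\<close>

lemma phom_line:
  assumes "phom k P"
  shows "\<exists>\<alpha>. degree \<alpha> \<le> k \<and> coeff \<alpha> k = pconst (pev P u) \<and> (\<forall>y s. pev P (\<lambda>i. y i + s * u i) = ev2 \<alpha> y s)"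
  using assms
proof induction
  case (zero k)
  have "pconst 0 = 0" by (rule pfun_eqI) simp
  then show ?case by (intro exI[of _ 0]) simp
next
  case (const c)
  show ?case by (intro exI[of _ "[:pconst c:]"]) simp
next
  case (var i)
  show ?case by (intro exI[of _ "[:pvar i, pconst (u i):]"]) simp
next
  case (add k P Q)
  then obtain \<alpha> \<beta> where
    "degree \<alpha> \<le> k \<and> coeff \<alpha> k = pconst (pev P u) \<and> (\<forall>y s. pev P (\<lambda>i. y i + s * u i) = ev2 \<alpha> y s)"
    "degree \<beta> \<le> k \<and> coeff \<beta> k = pconst (pev Q u) \<and> (\<forall>y s. pev Q (\<lambda>i. y i + s * u i) = ev2 \<beta> y s)"
    by blast
  moreover have "pconst (pev P u) + pconst (pev Q u) = pconst (pev P u + pev Q u)"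
    by (rule pfun_eqI) simp
  ultimately show ?case by (intro exI[of _ "\<alpha> + \<beta>"]) (auto intro: degree_add_le)
next
  case (mult k P l Q)
  then obtain \<alpha> \<beta> where *:
    "degree \<alpha> \<le> k \<and> coeff \<alpha> k = pconst (pev P u) \<and> (\<forall>y s. pev P (\<lambda>i. y i + s * u i) = ev2 \<alpha> y s)"
    "degree \<beta> \<le> l \<and> coeff \<beta> l = pconst (pev Q u) \<and> (\<forall>y s. pev Q (\<lambda>i. y i + s * u i) = ev2 \<beta> y s)"
    by blast
  moreover have "pconst (pev P u) * pconst (pev Q u) = pconst (pev P u * pev Q u)"
    by (rule pfun_eqI) simp
  moreover have "degree (\<alpha> * \<beta>) \<le> k + l" using * degree_mult_le[of \<alpha> \<beta>] by linarith
  ultimately show ?case by (intro exI[of _ "\<alpha> * \<beta>"]) (auto simp: coeff_mult_top)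
qed

text \<open>\<open>T\<close> is the homogeneous component of top degree of \<open>P\<close>.\<close>
lemma pfun_top:
  assumes "P \<noteq> 0" "\<And>i. phom 1 (\<sigma> i)" "\<And>i. psubst \<sigma> (\<sigma> i) = \<sigma> i" "psubst \<sigma> P = P"
  obtains K T where "T \<noteq> 0" "psubst \<sigma> T = T"
    "\<And>u. \<exists>\<alpha>. degree \<alpha> \<le> K \<and> coeff \<alpha> K = pconst (pev T u) \<and> (\<forall>y s. pev P (\<lambda>i. y i + s * u i) = ev2 \<alpha> y s)"
proof -
  have idem: "pev P (\<lambda>i. pev (\<sigma> i) x) = pev P x" for x
    by (metis assms(4) pev_psubst)
  have \<sigma>\<sigma>: "pev (\<sigma> i) (\<lambda>j. pev (\<sigma> j) x) = pev (\<sigma> i) x" for i x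
    by (metis assms(3) pev_psubst)
  obtain K0 f0 where f0: "\<And>k. phom k (f0 k)" "P = (\<Sum>k\<le>(K0::nat). f0 k)" using phom_decomp by blast
  \<comment> \<open>Substituting \<sigma> into the components keeps their degrees and, as
    \<open>P\<close> is invariant, their sum; it makes each of them invariant.\<close>
  define f where "f k = psubst \<sigma> (f0 k)" for k
  have f: "phom k (f k)" for k using phom_psubst[OF f0(1) assms(2)] by (simp add: f_def)
  have P: "P = (\<Sum>k\<le>K0. f k)"
  proof (rule pfun_eqI)
    fix x
    have "pev P x = pev P (\<lambda>i. pev (\<sigma> i) x)" by (simp add: idem)
    also have "\<dots> = pev (\<Sum>k\<le>K0. f k) x" by (subst f0(2)) (simp add: f_def)
    finally show "pev P x = pev (\<Sum>k\<le>K0. f k) x" .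
  qed
  have fin: "finite {k. k \<le> K0 \<and> f k \<noteq> 0}" by simp
  have ne: "{k. k \<le> K0 \<and> f k \<noteq> 0} \<noteq> {}" using P assms(1) by (metis (mono_tags, lifting) atMost_iff empty_Collect_eq sum.neutral)
  define K where "K = Max {k. k \<le> K0 \<and> f k \<noteq> 0}"
  have K: "K \<le> K0" "f K \<noteq> 0" using Max_in[OF fin ne] by (auto simp: K_def)
  have "f k = 0" if "k \<le> K0" "k > K" for k
    using that Max_ge[OF fin, of k] by (metis (mono_tags, lifting) K_def leD mem_Collect_eq)
  then have P: "P = (\<Sum>k\<le>K. f k)" unfolding P using K by (intro sum.mono_neutral_right) auto
  have "psubst \<sigma> (f K) = f K" by (rule pfun_eqI) (simp add: f_def \<sigma>\<sigma>)
  moreover have "\<exists>\<alpha>. degree \<alpha> \<le> K \<and> coeff \<alpha> K = pconst (pev (f K) u) \<and> (\<forall>y s. pev P (\<lambda>i. y i + s * u i) = ev2 \<alpha> y s)" for u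
  proof -
    obtain a where a: "\<And>k. degree (a k) \<le> k" "\<And>k. coeff (a k) k = pconst (pev (f k) u)"
      "\<And>k y s. pev (f k) (\<lambda>i. y i + s * u i) = ev2 (a k) y s"
    proof -
      have "\<forall>k. \<exists>\<alpha>. degree \<alpha> \<le> k \<and> coeff \<alpha> k = pconst (pev (f k) u) \<and>
          (\<forall>y s. pev (f k) (\<lambda>i. y i + s * u i) = ev2 \<alpha> y s)"
        using phom_line[OF f] by blast
      from choice[OF this] show thesis using that by blast
    qed
    have "coeff (\<Sum>k\<le>K. a k) K = (\<Sum>k\<le>K. coeff (a k) K)" by (simp add: coeff_sum)
    also have "\<dots> = (\<Sum>k\<le>K. if k = K then coeff (a K) K else 0)"
    proof (rule sum.cong)
      fix k assume "k \<in> {..K}"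
      then show "coeff (a k) K = (if k = K then coeff (a K) K else 0)"
        using a(1)[of k] by (cases "k = K") (auto intro!: coeff_eq_0)
    qed simp
    finally have "coeff (\<Sum>k\<le>K. a k) K = pconst (pev (f K) u)" by (simp add: a sum.delta)
    moreover have "degree (\<Sum>k\<le>K. a k) \<le> K"
      using a(1) by (intro degree_sum_le) (auto intro: order_trans)
    ultimately show ?thesis
      by (intro exI[of _ "\<Sum>k\<le>K. a k"]) (simp add: P a(3))
  qed
  ultimately show thesis using that[of "f K" K] K by blast
qed

section \<open>Algebraic dependence on an irreducible set\<close>

instance pfun :: ring_char_0
proof
  have "pev (of_nat n) x = of_nat n" for n x by (induction n) auto
  then show "inj (of_nat :: nat \<Rightarrow> pfun)" by (metis injI of_nat_eq_iff)
qed

definition pmap :: "(nat \<Rightarrow> pfun) \<Rightarrow> (nat \<Rightarrow> complex) \<Rightarrow> nat \<Rightarrow> complex" where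
  "pmap \<eta> x = (\<lambda>i. pev (\<eta> i) x)"

text \<open>In other words, the vanishing ideal of \<open>X\<close> is prime.\<close>

definition irr :: "(nat \<Rightarrow> complex) set \<Rightarrow> bool" where
  "irr X \<longleftrightarrow> X \<noteq> {} \<and> (\<forall>P Q. (\<forall>x\<in>X. pev (P * Q) x = 0) \<longrightarrow> (\<forall>x\<in>X. pev P x = 0) \<or> (\<forall>x\<in>X. pev Q x = 0))"

text \<open>The family \<eta> is infinite, but every polynomial involves finitely many members; this
  is algebraic independence of their restrictions to \<open>X\<close>.\<close>

definition indep :: "(nat \<Rightarrow> complex) set \<Rightarrow> (nat \<Rightarrow> pfun) \<Rightarrow> bool" where
  "indep X \<eta> \<longleftrightarrow> (\<forall>P. (\<forall>x\<in>X. pev P (pmap \<eta> x) = 0) \<longrightarrow> P = 0)"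

definition relation :: "(nat \<Rightarrow> complex) set \<Rightarrow> (nat \<Rightarrow> pfun) \<Rightarrow> pfun \<Rightarrow> pfun poly \<Rightarrow> bool" where
  "relation X \<eta> h Q \<longleftrightarrow> (\<forall>x\<in>X. ev2 Q (pmap \<eta> x) (pev h x) = 0)"

definition alg :: "(nat \<Rightarrow> complex) set \<Rightarrow> (nat \<Rightarrow> pfun) \<Rightarrow> pfun \<Rightarrow> bool" where
  "alg X \<eta> h \<longleftrightarrow> (\<exists>Q. Q \<noteq> 0 \<and> relation X \<eta> h Q)"

text \<open>A minimal polynomial of \<open>h\<close> over the field generated by \<eta>, with
  denominators cleared and hence in general not monic.\<close>

definition minrel :: "(nat \<Rightarrow> complex) set \<Rightarrow> (nat \<Rightarrow> pfun) \<Rightarrow> pfun \<Rightarrow> pfun poly \<Rightarrow> bool" where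
  "minrel X \<eta> h F \<longleftrightarrow> F \<noteq> 0 \<and> relation X \<eta> h F \<and> (\<forall>Q. relation X \<eta> h Q \<longrightarrow> Q = 0 \<or> degree F \<le> degree Q)"

definition psubst2 :: "(nat \<Rightarrow> pfun) \<Rightarrow> pfun \<Rightarrow> pfun poly \<Rightarrow> pfun" where
  "psubst2 \<eta> h Q = (\<Sum>i\<le>degree Q. psubst \<eta> (coeff Q i) * h ^ i)"

lemma pev_psubst2 [simp]: "pev (psubst2 \<eta> h Q) x = ev2 Q (pmap \<eta> x) (pev h x)"
  by (simp add: psubst2_def ev2_altdef[OF order_refl] pmap_def)

lemma irr_mult:
  assumes "irr X" "\<And>x. x \<in> X \<Longrightarrow> pev P x * pev Q x = 0"
  shows "(\<forall>x\<in>X. pev P x = 0) \<or> (\<forall>x\<in>X. pev Q x = 0)"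
  using assms unfolding irr_def by fastforce

lemma irr_power:
  assumes "irr X" "\<And>x. x \<in> X \<Longrightarrow> pev P x ^ k * pev Q x = 0" "x0 \<in> X" "pev P x0 \<noteq> 0" "x \<in> X"
  shows "pev Q x = 0"
proof -
  have "\<forall>x\<in>X. pev Q x = 0" using assms(2)
  proof (induction k)
    case (Suc k)
    have "(\<forall>x\<in>X. pev P x = 0) \<or> (\<forall>x\<in>X. pev (P ^ k * Q) x = 0)"
      using Suc.prems by (intro irr_mult[OF assms(1)]) (simp add: mult_ac)
    then show ?case using assms Suc.IH by auto
  qed auto
  then show ?thesis using assms by blast
qed

lemma irr_prod:
  assumes "irr X" "finite A" "\<And>a. a \<in> A \<Longrightarrow> \<exists>x\<in>X. pev (f a) x \<noteq> 0"
  shows "\<exists>x\<in>X. pev (prod f A) x \<noteq> 0"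
  using assms(2,3)
proof (induction A rule: finite_induct)
  case empty
  then show ?case using assms(1) by (auto simp: irr_def)
next
  case (insert a A)
  then have "\<not> ((\<forall>x\<in>X. pev (f a) x = 0) \<or> (\<forall>x\<in>X. pev (prod f A) x = 0))" by auto
  then have "\<exists>x\<in>X. pev (f a) x * pev (prod f A) x \<noteq> 0" using irr_mult[OF assms(1)] by blast
  then show ?case using insert.hyps by simp
qed

lemma relation_mult:
  assumes "irr X" "relation X \<eta> h (S * T)"
  shows "relation X \<eta> h S \<or> relation X \<eta> h T"
  using irr_mult[OF assms(1), of "psubst2 \<eta> h S" "psubst2 \<eta> h T"] assms(2) by (auto simp: relation_def)

lemma relation_const: "indep X \<eta> \<Longrightarrow> relation X \<eta> h [:c:] \<Longrightarrow> c = 0"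
  by (auto simp: relation_def indep_def)

lemma alg_minrel:
  assumes "alg X \<eta> h"
  obtains F where "minrel X \<eta> h F"
proof -
  obtain Q where Q: "Q \<noteq> 0 \<and> relation X \<eta> h Q" using assms by (auto simp: alg_def)
  obtain F where "F \<noteq> 0 \<and> relation X \<eta> h F"
    "\<forall>Q. Q \<noteq> 0 \<and> relation X \<eta> h Q \<longrightarrow> degree F \<le> degree Q"
    using ex_has_least_nat[of "\<lambda>Q. Q \<noteq> 0 \<and> relation X \<eta> h Q" Q degree] Q by blast
  then show thesis by (intro that[of F]) (auto simp: minrel_def)
qed

locale min_relation =
  fixes X :: "(nat \<Rightarrow> complex) set" and \<eta> :: "nat \<Rightarrow> pfun" and h :: pfun and F :: "pfun poly"
  assumes irr: "irr X" and indep: "indep X \<eta>" and minrel: "minrel X \<eta> h F"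
begin

lemma F_neq0: "F \<noteq> 0" and F_rel: "relation X \<eta> h F"
  using minrel by (auto simp: minrel_def)

lemma F_min: "relation X \<eta> h Q \<Longrightarrow> degree Q < degree F \<Longrightarrow> Q = 0"
  using minrel by (auto simp: minrel_def)

lemma degree_F: "degree F > 0"
proof (rule ccontr)
  assume "\<not> degree F > 0"
  then obtain c where "F = [:c:]" by (metis degree_eq_zeroE not_gr0)
  then show False using relation_const[OF indep, of h c] F_rel F_neq0 by auto
qed

text \<open>The remainder of pseudo-division by \<open>F\<close> is a relation of smaller degree and
  so vanishes.\<close>

lemma relation_dvd:
  assumes "relation X \<eta> h S"
  shows "\<exists>k q. smult (lead_coeff F ^ k) S = F * q"
proof -
  obtain q r where qr: "pseudo_divmod S F = (q, r)" by fastforce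
  define k where "k = Suc (degree S) - degree F"
  have e: "smult (lead_coeff F ^ k) S = F * q + r" and d: "r = 0 \<or> degree r < degree F"
    using pseudo_divmod[OF F_neq0 qr] by (auto simp: k_def)
  have "r = smult (lead_coeff F ^ k) S - F * q" by (simp add: e)
  then have "relation X \<eta> h r" using assms F_rel by (simp add: relation_def)
  then have "r = 0" using d F_min by auto
  then show ?thesis using e by auto
qed

text \<open>In characteristic zero the derivative is a nonzero polynomial of smaller degree, which
  minimality forbids as a relation.\<close>

lemma pderiv_not_relation: "\<not> relation X \<eta> h (pderiv F)"
proof
  assume "relation X \<eta> h (pderiv F)"
  moreover have "degree (pderiv F) < degree F" using degree_F by (simp add: degree_pderiv)
  ultimately have "pderiv F = 0" using F_min by blast
  then show False using degree_F by (simp add: pderiv_eq_0_iff)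
qed

text \<open>\<open>R\<close> plays the part of the discriminant. It is a nonzero element
  \<open>s\<close> of least degree in the ideal of \<open>F\<close> and \<open>pderiv F\<close>:
  such an \<open>s\<close> divides \<open>F\<close> up to a coefficient factor, with a cofactor that
  is a relation because \<open>s\<close> is not, and comparing degrees shows that \<open>s\<close>
  has degree zero.\<close>

lemma separable: "\<exists>a c R. R \<noteq> 0 \<and> [:R:] = a * F + c * pderiv F"
proof -
  let ?I = "\<lambda>s. s \<noteq> 0 \<and> (\<exists>a c. s = a * F + c * pderiv F)"
  have F'0: "pderiv F \<noteq> 0" using degree_F by (simp add: pderiv_eq_0_iff)
  have F': "?I (pderiv F)"
  proof (intro conjI exI)
    show "pderiv F = 0 * F + 1 * pderiv F" by simp
  qed (fact F'0)
  obtain s where s: "?I s" and min: "\<And>t. ?I t \<Longrightarrow> degree s \<le> degree t"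
    using ex_has_least_nat[of ?I "pderiv F" degree] F' by blast
  obtain a c where ac: "s = a * F + c * pderiv F" using s by blast
  have ds: "degree s < degree F"
    using min[OF F'] degree_F by (simp add: degree_pderiv)
  obtain q r where qr: "pseudo_divmod F s = (q, r)" by fastforce
  define l where "l = lead_coeff s ^ (Suc (degree F) - degree s)"
  have e: "smult l F = s * q + r" and d: "r = 0 \<or> degree r < degree s"
    using pseudo_divmod[of s F q r] qr s by (auto simp: l_def)
  have "r = smult l F - s * q" by (simp add: e)
  then have "r = (smult l 1 - a * q) * F + (- c * q) * pderiv F" by (simp add: ac algebra_simps)
  then have "r = 0" using d min[of r] by (metis leD)
  then have lF: "smult l F = s * q" using e by simp
  have "l \<noteq> 0" using s by (simp add: l_def)
  then have q0: "q \<noteq> 0" using lF F_neq0 by auto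
  have "relation X \<eta> h (s * q)" using F_rel by (simp add: relation_def flip: lF)
  moreover have "\<not> relation X \<eta> h s" using ds s F_min by blast
  ultimately have "relation X \<eta> h q" using relation_mult[OF irr] by blast
  then have "degree F \<le> degree q" using F_min q0 by (meson not_le)
  moreover have "degree F = degree s + degree q"
    using arg_cong[OF lF, of degree] \<open>l \<noteq> 0\<close> s q0 by (simp add: degree_mult_eq)
  ultimately have "degree s = 0" by simp
  then obtain R where "s = [:R:]" by (metis degree_eq_zeroE)
  then show ?thesis using s ac by (intro exI[of _ a] exI[of _ c] exI[of _ R]) auto
qed

end

lemma alg_const: "alg X \<eta> (pconst c)"
  unfolding alg_def by (rule exI[of _ "[:- pconst c, 1:]"]) (auto simp: relation_def)

lemma alg_base: "alg X \<eta> (\<eta> i)"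
  unfolding alg_def by (rule exI[of _ "[:- pvar i, 1:]"]) (auto simp: relation_def pmap_def)

text \<open>After multiplication with a power of the leading coefficients, all powers of an element of the
  ring generated by two algebraic elements \<open>g\<close> and \<open>h\<close> lie in the finite module spanned by the
  monomials in \<open>g\<close> and \<open>h\<close> of degree less than those of their relations.\<close>

lemma alg_pair:
  assumes X: "irr X" and ind: "indep X \<eta>" and g: "alg X \<eta> g" and h: "alg X \<eta> h"
  shows "alg X \<eta> (g + h)" "alg X \<eta> (g * h)"
proof -
  obtain Qg where Qg: "minrel X \<eta> g Qg" using alg_minrel[OF g] .
  obtain Qh where Qh: "minrel X \<eta> h Qh" using alg_minrel[OF h] .
  interpret g: min_relation X \<eta> g Qg by standard (fact X ind Qg)+
  interpret h: min_relation X \<eta> h Qh by standard (fact X ind Qh)+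
  define p q where "p = degree Qg" and "q = degree Qh"
  define c where "c = lead_coeff Qg * lead_coeff Qh"
  have c0: "c \<noteq> 0" using g.F_neq0 h.F_neq0 by (simp add: c_def)
  let ?y = "pmap \<eta>"
  let ?J = "{..<p} \<times> {..<q}"
  define M where "M \<phi> \<longleftrightarrow> (\<exists>k A. \<forall>x\<in>X. pev c (?y x) ^ k * \<phi> x =
      (\<Sum>e\<in>?J. pev (A e) (?y x) * (pev g x ^ fst e * pev h x ^ snd e)))" for \<phi> :: "(nat \<Rightarrow> complex) \<Rightarrow> complex"
  have M_add: "M (\<lambda>x. \<phi> x + \<psi> x)" if \<phi>: "M \<phi>" and \<psi>: "M \<psi>" for \<phi> \<psi>
  proof -
    from \<phi> obtain k A where 1: "\<And>x. x \<in> X \<Longrightarrow> pev c (?y x) ^ k * \<phi> x = (\<Sum>e\<in>?J. pev (A e) (?y x) * (pev g x ^ fst e * pev h x ^ snd e))"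
      unfolding M_def by blast
    from \<psi> obtain l B where 2: "\<And>x. x \<in> X \<Longrightarrow> pev c (?y x) ^ l * \<psi> x = (\<Sum>e\<in>?J. pev (B e) (?y x) * (pev g x ^ fst e * pev h x ^ snd e))"
      unfolding M_def by blast
    have "pev c (?y x) ^ (k + l) * (\<phi> x + \<psi> x) =
        (\<Sum>e\<in>?J. pev (c ^ l * A e + c ^ k * B e) (?y x) * (pev g x ^ fst e * pev h x ^ snd e))" if "x \<in> X" for x
    proof -
      have "pev c (?y x) ^ (k + l) * (\<phi> x + \<psi> x) = pev c (?y x) ^ l * (pev c (?y x) ^ k * \<phi> x)
          + pev c (?y x) ^ k * (pev c (?y x) ^ l * \<psi> x)"
        by (simp add: power_add algebra_simps)
      then show ?thesis unfolding 1[OF that] 2[OF that]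
        by (simp add: sum_distrib_left sum.distrib ring_distribs mult_ac)
    qed
    then show ?thesis unfolding M_def
      by (intro exI[of _ "k + l"] exI[of _ "\<lambda>e. c ^ l * A e + c ^ k * B e"]) blast
  qed
  have M_scal: "M (\<lambda>x. pev P (?y x) * \<phi> x)" if \<phi>: "M \<phi>" for P \<phi>
  proof -
    from \<phi> obtain k A where 1: "\<And>x. x \<in> X \<Longrightarrow> pev c (?y x) ^ k * \<phi> x = (\<Sum>e\<in>?J. pev (A e) (?y x) * (pev g x ^ fst e * pev h x ^ snd e))"
      unfolding M_def by blast
    have "pev c (?y x) ^ k * (pev P (?y x) * \<phi> x) =
        (\<Sum>e\<in>?J. pev (P * A e) (?y x) * (pev g x ^ fst e * pev h x ^ snd e))" if "x \<in> X" for x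
    proof -
      have "pev c (?y x) ^ k * (pev P (?y x) * \<phi> x) = pev P (?y x) * (pev c (?y x) ^ k * \<phi> x)" by simp
      then show ?thesis unfolding 1[OF that] by (simp add: sum_distrib_left mult_ac)
    qed
    then show ?thesis unfolding M_def by (intro exI[of _ k] exI[of _ "\<lambda>e. P * A e"]) blast
  qed
  have M_cong: "M \<phi>" if "M \<psi>" "\<And>x. x \<in> X \<Longrightarrow> \<phi> x = \<psi> x" for \<phi> \<psi>
    using that unfolding M_def by simp
  have M_div: "M \<phi>" if \<phi>: "M (\<lambda>x. pev c (?y x) ^ l * \<phi> x)" for \<phi> l
  proof -
    from \<phi> obtain k A where 1: "\<And>x. x \<in> X \<Longrightarrow> pev c (?y x) ^ k * (pev c (?y x) ^ l * \<phi> x) = (\<Sum>e\<in>?J. pev (A e) (?y x) * (pev g x ^ fst e * pev h x ^ snd e))"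
      unfolding M_def by blast
    show ?thesis unfolding M_def
      by (rule exI[of _ "k + l"], rule exI[of _ A]) (simp add: power_add mult.assoc 1)
  qed
  have M_0: "M (\<lambda>x. 0)" unfolding M_def by (rule exI[of _ 0], rule exI[of _ "\<lambda>_. 0"]) simp
  have M_sum: "M (\<lambda>x. \<Sum>a\<in>S. f a x)" if "finite S" "\<And>a. a \<in> S \<Longrightarrow> M (f a)" for S :: "'b set" and f
    using that by (induction S rule: finite_induct) (auto intro: M_0 M_add)
  have M_gen: "M (\<lambda>x. pev g x ^ i * pev h x ^ j)" if "i < p" "j < q" for i j
  proof -
    have "(\<Sum>e\<in>?J. pev (if e = (i, j) then 1 else 0) (?y x) * (pev g x ^ fst e * pev h x ^ snd e)) =
      (\<Sum>e\<in>?J. if e = (i, j) then pev g x ^ i * pev h x ^ j else 0)" for x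
      by (rule sum.cong) auto
    then show ?thesis unfolding M_def
      using that by (intro exI[of _ 0] exI[of _ "\<lambda>e. if e = (i, j) then 1 else 0"]) (simp add: sum.delta)
  qed
  \<comment> \<open>A relation solved for its top power. The leading coefficient on the left is a
    factor of \<open>c\<close>, so that \<open>M_div\<close> absorbs it later.\<close>
  have red: "pev (lead_coeff Q) y * z ^ degree Q = - (\<Sum>l<degree Q. pev (coeff Q l) y * z ^ l)"
    if "ev2 Q y z = 0" for Q y z
    using that by (simp add: ev2_altdef[OF order_refl] lessThan_Suc_atMost[symmetric] eq_neg_iff_add_eq_0 add.commute)
  have M_g: "M (\<lambda>x. pev g x ^ i * pev h x ^ j)" if "i \<le> p" "j < q" for i j
  proof (cases "i = p")
    case True
    have "M (\<lambda>x. \<Sum>l<p. pev (- lead_coeff Qh * coeff Qg l) (?y x) * (pev g x ^ l * pev h x ^ j))"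
      using that by (intro M_sum M_scal M_gen) auto
    then have "M (\<lambda>x. pev c (?y x) ^ 1 * (pev g x ^ i * pev h x ^ j))"
    proof (rule M_cong)
      fix x assume "x \<in> X"
      then have *: "pev (lead_coeff Qg) (?y x) * pev g x ^ p = - (\<Sum>l<p. pev (coeff Qg l) (?y x) * pev g x ^ l)"
        using red[of Qg "?y x" "pev g x"] g.F_rel by (auto simp: relation_def p_def)
      have "pev c (?y x) ^ 1 * (pev g x ^ i * pev h x ^ j) =
         pev (lead_coeff Qh) (?y x) * (pev (lead_coeff Qg) (?y x) * pev g x ^ p) * pev h x ^ j"
        using True by (simp add: c_def)
      then show "pev c (?y x) ^ 1 * (pev g x ^ i * pev h x ^ j) =
        (\<Sum>l<p. pev (- lead_coeff Qh * coeff Qg l) (?y x) * (pev g x ^ l * pev h x ^ j))"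
        unfolding * by (simp add: sum_distrib_left sum_distrib_right sum_negf mult_ac)
    qed
    then show ?thesis by (rule M_div)
  qed (use that M_gen in auto)
  have M_h: "M (\<lambda>x. pev g x ^ i * pev h x ^ j)" if "i < p" "j \<le> q" for i j
  proof (cases "j = q")
    case True
    have "M (\<lambda>x. \<Sum>l<q. pev (- lead_coeff Qg * coeff Qh l) (?y x) * (pev g x ^ i * pev h x ^ l))"
      using that by (intro M_sum M_scal M_gen) auto
    then have "M (\<lambda>x. pev c (?y x) ^ 1 * (pev g x ^ i * pev h x ^ j))"
    proof (rule M_cong)
      fix x assume "x \<in> X"
      then have *: "pev (lead_coeff Qh) (?y x) * pev h x ^ q = - (\<Sum>l<q. pev (coeff Qh l) (?y x) * pev h x ^ l)"
        using red[of Qh "?y x" "pev h x"] h.F_rel by (auto simp: relation_def q_def)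
      have "pev c (?y x) ^ 1 * (pev g x ^ i * pev h x ^ j) =
         pev (lead_coeff Qg) (?y x) * (pev (lead_coeff Qh) (?y x) * pev h x ^ q) * pev g x ^ i"
        using True by (simp add: c_def)
      then show "pev c (?y x) ^ 1 * (pev g x ^ i * pev h x ^ j) =
        (\<Sum>l<q. pev (- lead_coeff Qg * coeff Qh l) (?y x) * (pev g x ^ i * pev h x ^ l))"
        unfolding * by (simp add: sum_distrib_left sum_distrib_right sum_negf mult_ac)
    qed
    then show ?thesis by (rule M_div)
  qed (use that M_gen in auto)
  have M_mult: "M (\<lambda>x. pev z x * \<phi> x)" if \<phi>: "M \<phi>"
    and z: "\<And>i j. i < p \<Longrightarrow> j < q \<Longrightarrow> M (\<lambda>x. pev z x * (pev g x ^ i * pev h x ^ j))" for \<phi> z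
  proof -
    from \<phi> obtain k A where 1: "\<And>x. x \<in> X \<Longrightarrow> pev c (?y x) ^ k * \<phi> x = (\<Sum>e\<in>?J. pev (A e) (?y x) * (pev g x ^ fst e * pev h x ^ snd e))"
      unfolding M_def by blast
    have "M (\<lambda>x. \<Sum>e\<in>?J. pev (A e) (?y x) * (pev z x * (pev g x ^ fst e * pev h x ^ snd e)))"
      using z by (intro M_sum M_scal) auto
    then have "M (\<lambda>x. pev c (?y x) ^ k * (pev z x * \<phi> x))"
    proof (rule M_cong)
      fix x assume "x \<in> X"
      have "pev c (?y x) ^ k * (pev z x * \<phi> x) = pev z x * (pev c (?y x) ^ k * \<phi> x)" by simp
      then show "pev c (?y x) ^ k * (pev z x * \<phi> x) =
         (\<Sum>e\<in>?J. pev (A e) (?y x) * (pev z x * (pev g x ^ fst e * pev h x ^ snd e)))"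
        unfolding 1[OF \<open>x \<in> X\<close>] by (simp add: sum_distrib_left mult_ac)
    qed
    then show ?thesis by (rule M_div)
  qed
  have zg: "M (\<lambda>x. pev g x * (pev g x ^ i * pev h x ^ j))" if "i < p" "j < q" for i j
    using M_g[of "Suc i" j] that by (simp add: mult_ac)
  have zh: "M (\<lambda>x. pev h x * (pev g x ^ i * pev h x ^ j))" if "i < p" "j < q" for i j
    using M_h[of i "Suc j"] that by (simp add: mult_ac)
  have M_1: "M (\<lambda>x. 1)" using M_gen[of 0 0] g.degree_F h.degree_F by (simp add: p_def q_def)
  have alg: "alg X \<eta> w" if w: "\<And>\<phi>. M \<phi> \<Longrightarrow> M (\<lambda>x. pev w x * \<phi> x)" for w
  proof -
    have pw: "M (\<lambda>x. pev w x ^ l)" for l by (induction l) (auto intro: M_1 w)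
    have "\<forall>l. \<exists>kA. \<forall>x\<in>X. pev c (?y x) ^ fst kA * pev w x ^ l =
      (\<Sum>e\<in>?J. pev (snd kA e) (?y x) * (pev g x ^ fst e * pev h x ^ snd e))"
      using pw unfolding M_def by simp
    from choice[OF this] obtain kA where kA: "\<And>l x. x \<in> X \<Longrightarrow> pev c (?y x) ^ fst (kA l) * pev w x ^ l =
      (\<Sum>e\<in>?J. pev (snd (kA l) e) (?y x) * (pev g x ^ fst e * pev h x ^ snd e))" by blast
    \<comment> \<open>There are \<open>p * q + 1\<close> powers of \<open>w\<close> but only
      \<open>p * q\<close> monomials.\<close>
    obtain \<mu> where \<mu>: "\<exists>l\<in>{..p * q}. \<mu> l \<noteq> 0" "\<And>e. e \<in> ?J \<Longrightarrow> (\<Sum>l\<in>{..p * q}. \<mu> l * snd (kA l) e) = 0"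
      using lin_dep[of ?J "{..p * q}" "\<lambda>l. snd (kA l)"] by auto
    define Q where "Q = (\<Sum>l\<le>p * q. monom (\<mu> l * c ^ fst (kA l)) l)"
    have "coeff Q l = \<mu> l * c ^ fst (kA l)" if "l \<le> p * q" for l
      using that by (simp add: Q_def coeff_sum sum.delta)
    then have "Q \<noteq> 0" using \<mu>(1) c0 by (metis atMost_iff coeff_0 mult_eq_0_iff power_not_zero)
    moreover have "relation X \<eta> w Q" unfolding relation_def
    proof
      fix x assume x: "x \<in> X"
      have "ev2 Q (?y x) (pev w x) = (\<Sum>l\<le>p * q. pev (\<mu> l) (?y x) * (pev c (?y x) ^ fst (kA l) * pev w x ^ l))"
        by (simp add: Q_def mult.assoc)
      also have "\<dots> = (\<Sum>l\<le>p * q. \<Sum>e\<in>?J. pev (\<mu> l * snd (kA l) e) (?y x) * (pev g x ^ fst e * pev h x ^ snd e))"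
        by (simp only: kA[OF x] sum_distrib_left) (simp add: mult.assoc)
      also have "\<dots> = (\<Sum>e\<in>?J. pev (\<Sum>l\<le>p * q. \<mu> l * snd (kA l) e) (?y x) * (pev g x ^ fst e * pev h x ^ snd e))"
        by (subst sum.swap) (simp add: sum_distrib_right)
      also have "\<dots> = 0" using \<mu>(2) by (intro sum.neutral) auto
      finally show "ev2 Q (?y x) (pev w x) = 0" .
    qed
    ultimately show ?thesis by (auto simp: alg_def)
  qed
  have "M (\<lambda>x. pev (g + h) x * \<phi> x)" if "M \<phi>" for \<phi>
    using M_add[OF M_mult[OF that zg] M_mult[OF that zh]] by (simp add: ring_distribs)
  then show "alg X \<eta> (g + h)" by (rule alg)
  have "M (\<lambda>x. pev (g * h) x * \<phi> x)" if "M \<phi>" for \<phi>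
    using M_mult[OF M_mult[OF that zh] zg] by (simp add: mult_ac)
  then show "alg X \<eta> (g * h)" by (rule alg)
qed

lemma alg_all:
  assumes "irr X" "indep X \<eta>" "\<And>i. alg X \<eta> (pvar i)"
  shows "alg X \<eta> P"
  by (induction P) (auto intro: assms alg_const alg_pair)

section \<open>Varieties as cylinders\<close>

definition monom_eval :: "(nat \<Rightarrow>\<^sub>0 nat) \<Rightarrow> (nat \<Rightarrow> complex) \<Rightarrow> complex" where
  "monom_eval e x = (\<Prod>i\<in>Poly_Mapping.keys e. x i ^ Poly_Mapping.lookup e i)"

lemma monom_eval_superset:
  "finite S \<Longrightarrow> Poly_Mapping.keys e \<subseteq> S \<Longrightarrow> monom_eval e x = (\<Prod>i\<in>S. x i ^ Poly_Mapping.lookup e i)"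
  unfolding monom_eval_def by (rule prod.mono_neutral_left) (auto simp: in_keys_iff)

lemma monom_eval_add: "monom_eval (e + e') x = monom_eval e x * monom_eval e' x"
proof -
  let ?S = "Poly_Mapping.keys e \<union> Poly_Mapping.keys e'"
  have "monom_eval (e + e') x = (\<Prod>i\<in>?S. x i ^ Poly_Mapping.lookup (e + e') i)"
    using Poly_Mapping.keys_add[of e e'] by (intro monom_eval_superset) auto
  also have "\<dots> = (\<Prod>i\<in>?S. x i ^ Poly_Mapping.lookup e i) * (\<Prod>i\<in>?S. x i ^ Poly_Mapping.lookup e' i)"
    by (simp add: lookup_add power_add prod.distrib)
  finally show ?thesis by (simp add: monom_eval_superset[of ?S])
qed

lemma cpoly_eval_altdef:
  "cpoly_eval p x = (\<Sum>e\<in>Poly_Mapping.keys p. Poly_Mapping.lookup p e * monom_eval e x)"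
  by (simp add: cpoly_eval_def monom_eval_def)

lemma cpoly_eval_superset:
  "finite S \<Longrightarrow> Poly_Mapping.keys p \<subseteq> S \<Longrightarrow> cpoly_eval p x = (\<Sum>e\<in>S. Poly_Mapping.lookup p e * monom_eval e x)"
  unfolding cpoly_eval_altdef by (rule sum.mono_neutral_left) (auto simp: in_keys_iff)

lemma cpoly_eval_add: "cpoly_eval (p + q) x = cpoly_eval p x + cpoly_eval q x"
proof -
  let ?S = "Poly_Mapping.keys p \<union> Poly_Mapping.keys q"
  have "cpoly_eval (p + q) x = (\<Sum>e\<in>?S. Poly_Mapping.lookup (p + q) e * monom_eval e x)"
    using Poly_Mapping.keys_add[of p q] by (intro cpoly_eval_superset) auto
  then show ?thesis by (simp add: lookup_add ring_distribs sum.distrib cpoly_eval_superset[of ?S])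
qed

lemma cpoly_eval_single: "cpoly_eval (Poly_Mapping.single e c) x = c * monom_eval e x"
  by (simp add: cpoly_eval_altdef)

lemma cpoly_eval_pfun: "\<exists>P. \<forall>x. pev P x = cpoly_eval p x"
  by (rule exI[of _ "\<Sum>e\<in>Poly_Mapping.keys p. pconst (Poly_Mapping.lookup p e) *
        (\<Prod>i\<in>Poly_Mapping.keys e. pvar i ^ Poly_Mapping.lookup e i)"]) (simp add: cpoly_eval_def)

lemma pfun_cpoly: "\<exists>p\<in>cpolys m. \<forall>x\<in>affine_space m. cpoly_eval p x = pev P x"
proof -
  define C where "C = {f. \<exists>p\<in>cpolys m. \<forall>x\<in>affine_space m. cpoly_eval p x = f x}"
  have C_mon: "(\<lambda>x. c * monom_eval e x) \<in> C" if "Poly_Mapping.keys e \<subseteq> {..<m}" for c e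
    unfolding C_def mem_Collect_eq
  proof (rule bexI)
    show "Poly_Mapping.single e c \<in> cpolys m" using that by (auto simp: cpolys_def split: if_splits)
  qed (simp add: cpoly_eval_single)
  have C_add: "(\<lambda>x. f x + g x) \<in> C" if "f \<in> C" "g \<in> C" for f g
  proof -
    from that obtain p q where pq: "p \<in> cpolys m" "q \<in> cpolys m"
      "\<forall>x\<in>affine_space m. cpoly_eval p x = f x" "\<forall>x\<in>affine_space m. cpoly_eval q x = g x"
      by (auto simp: C_def)
    have "p + q \<in> cpolys m" using pq(1,2) Poly_Mapping.keys_add[of p q] unfolding cpolys_def by blast
    then show ?thesis unfolding C_def using pq by (auto simp: cpoly_eval_add intro!: bexI[of _ "p + q"])
  qed
  have C_sum: "(\<lambda>x. \<Sum>a\<in>A. f a x) \<in> C" if "finite A" "\<And>a. a \<in> A \<Longrightarrow> f a \<in> C" for A :: "'b set" and f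
    using that
  proof (induction A rule: finite_induct)
    case empty
    then show ?case using C_mon[of 0 0] by simp
  qed (auto intro: C_add)
  have C_mult: "(\<lambda>x. f x * g x) \<in> C" if "f \<in> C" "g \<in> C" for f g
  proof -
    from that obtain p q where pq: "p \<in> cpolys m" "q \<in> cpolys m"
      "\<forall>x\<in>affine_space m. cpoly_eval p x = f x" "\<forall>x\<in>affine_space m. cpoly_eval q x = g x"
      by (auto simp: C_def)
    have "(\<lambda>x. \<Sum>e\<in>Poly_Mapping.keys p. \<Sum>e'\<in>Poly_Mapping.keys q.
        Poly_Mapping.lookup p e * Poly_Mapping.lookup q e' * monom_eval (e + e') x) \<in> C"
    proof (intro C_sum C_mon)
      fix e e' assume "e \<in> Poly_Mapping.keys p" "e' \<in> Poly_Mapping.keys q"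
      then show "Poly_Mapping.keys (e + e') \<subseteq> {..<m}"
        using pq(1,2) Poly_Mapping.keys_add[of e e'] unfolding cpolys_def by blast
    qed auto
    then have "(\<lambda>x. cpoly_eval p x * cpoly_eval q x) \<in> C"
      by (simp add: cpoly_eval_altdef sum_product monom_eval_add mult_ac)
    then show ?thesis using pq(3,4) by (simp add: C_def)
  qed
  have "pev P \<in> C"
  proof (induction P)
    case (const c)
    then show ?case using C_mon[of 0 c] by (simp add: monom_eval_def pconst.rep_eq)
  next
    case (var i)
    show ?case
    proof (cases "i < m")
      case True
      then show ?thesis using C_mon[of "Poly_Mapping.single i 1" 1] by (simp add: monom_eval_def pvar.rep_eq)
    next
      case False
      \<comment> \<open>Points of \<open>affine_space m\<close> take the default value
        \<open>undefined\<close> outside of \<open>{..<m}\<close>, so a variable with a larger index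
        is a constant on them.\<close>
      have "(\<lambda>x. undefined * monom_eval 0 x) \<in> C" by (rule C_mon) simp
      then obtain p where p: "p \<in> cpolys m" "\<forall>x\<in>affine_space m. cpoly_eval p x = undefined"
        unfolding C_def monom_eval_def by auto
      have und: "x i = undefined" if "x \<in> affine_space m" for x
        using PiE_arb[of x "{..<m}" _ i] that False unfolding affine_space_def by simp
      have "\<forall>x\<in>affine_space m. cpoly_eval p x = pev (pvar i) x"
        using p(2) by (intro ballI) (simp add: und)
      then show ?thesis using p(1) unfolding C_def by blast
    qed
  next
    case (add P Q)
    then show ?case using C_add by (simp add: plus_pfun.rep_eq)
  next
    case (mult P Q)
    then show ?case using C_mult by (simp add: times_pfun.rep_eq)
  qed
  then show ?thesis by (auto simp: C_def)
qed

text \<open>On the cylinder over a subset of affine m-space the coordinates with index at least \<open>m\<close> are free.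
  They play the role of independent transcendental constants. The functions \<open>base m ss\<close> below are the
  coordinates with index in \<open>ss\<close>, followed by these constants.\<close>

definition cyl :: "nat \<Rightarrow> (nat \<Rightarrow> complex) set \<Rightarrow> (nat \<Rightarrow> complex) set" where
  "cyl m V = {x. restrict x {..<m} \<in> V}"

lemma cyl_cong: "x \<in> cyl m V \<Longrightarrow> (\<And>i. i < m \<Longrightarrow> x' i = x i) \<Longrightarrow> x' \<in> cyl m V"
proof -
  assume "x \<in> cyl m V" "\<And>i. i < m \<Longrightarrow> x' i = x i"
  moreover from this have "restrict x' {..<m} = restrict x {..<m}" by (intro ext) simp
  ultimately show ?thesis by (simp add: cyl_def)
qed

lemma cyl_mono: "V \<subseteq> W \<Longrightarrow> cyl m V \<subseteq> cyl m W"
  by (auto simp: cyl_def)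

lemma cyl_superset: "V \<subseteq> affine_space m \<Longrightarrow> V \<subseteq> cyl m V"
proof
  fix x assume "V \<subseteq> affine_space m" "x \<in> V"
  then have "x \<in> extensional {..<m}" by (auto simp: affine_space_def PiE_def)
  then show "x \<in> cyl m V" using \<open>x \<in> V\<close> by (simp add: cyl_def extensional_restrict)
qed

lemma pfun_restrict: "\<exists>P'. \<forall>x. pev P' x = pev P (restrict x {..<m})"
  by (rule exI[of _ "psubst (\<lambda>i. if i < m then pvar i else pconst undefined) P"])
     (auto simp: restrict_def intro!: arg_cong[of _ _ "pev P"])

lemma zero_locus_affine: "zero_locus m F \<subseteq> affine_space m"
  by (auto simp: zero_locus_def)

lemma zariski_closed_affine: "zariski_closed m V \<Longrightarrow> V \<subseteq> affine_space m"
  using zero_locus_affine by (auto simp: zariski_closed_def)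

lemma restrict_affine [simp]: "restrict x {..<m} \<in> affine_space m"
  by (simp add: affine_space_def)

text \<open>A cylinder over a closed set is recovered from its vanishing ideal; the locales below
  assume closedness in this form.\<close>

lemma zariski_closed_cyl:
  assumes "zariski_closed m V" "\<And>P. (\<forall>z\<in>cyl m V. pev P z = 0) \<Longrightarrow> pev P x = 0"
  shows "x \<in> cyl m V"
proof -
  obtain F where F: "V = zero_locus m F" using assms(1) by (auto simp: zariski_closed_def)
  have "cpoly_eval p (restrict x {..<m}) = 0" if "p \<in> F" for p
  proof -
    obtain P where P: "\<forall>x. pev P x = cpoly_eval p x" using cpoly_eval_pfun by blast
    obtain P' where P': "\<forall>x. pev P' x = pev P (restrict x {..<m})" using pfun_restrict by blast
    have "pev P' x = 0"
      by (rule assms(2)) (use that in \<open>auto simp: P P' F cyl_def zero_locus_def\<close>)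
    then show ?thesis using P P' by simp
  qed
  then show ?thesis by (auto simp: cyl_def F zero_locus_def)
qed

lemma zariski_closed_pfun: "zariski_closed m {x \<in> affine_space m. pev P x = 0}"
proof -
  obtain p where p: "p \<in> cpolys m" "\<forall>x\<in>affine_space m. cpoly_eval p x = pev P x" using pfun_cpoly by blast
  then have "{x \<in> affine_space m. pev P x = 0} = zero_locus m {p}" by (auto simp: zero_locus_def)
  then show ?thesis using p unfolding zariski_closed_def by (intro exI[of _ "{p}"]) simp
qed

lemma pfun_fix_params:
  "\<exists>Q. \<forall>x. pev Q x = pev P (\<lambda>i. if i < m then x i else u i)"
  by (rule exI[of _ "psubst (\<lambda>i. if i < m then pvar i else pconst (u i)) P"])
     (auto intro!: arg_cong[of _ _ "pev P"])

lemma pfun_fix_vars: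
  "\<exists>Q. \<forall>x. pev Q x = pev P (\<lambda>i. if i < m then v i else x i)"
  by (rule exI[of _ "psubst (\<lambda>i. if i < m then pconst (v i) else pvar i) P"])
     (auto intro!: arg_cong[of _ _ "pev P"])

text \<open>The product of an irreducible variety with an affine space is irreducible: freezing the
  free coordinates at suitable values turns two factors that are nonzero on the cylinder into two
  that are nonzero on \<open>V\<close>.\<close>

lemma irreducible_variety_irr:
  assumes "irreducible_variety m V"
  shows "irr (cyl m V)"
proof -
  have V: "zariski_closed m V" "V \<noteq> {}" and VA: "V \<subseteq> affine_space m"
    and irred: "\<And>A B. zariski_closed m A \<Longrightarrow> zariski_closed m B \<Longrightarrow> V \<subseteq> A \<union> B \<Longrightarrow> V \<subseteq> A \<or> V \<subseteq> B"
    using assms zariski_closed_affine by (auto simp: irreducible_variety_def)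
  have irrV: "(\<forall>x\<in>V. pev P x = 0) \<or> (\<forall>x\<in>V. pev Q x = 0)" if "\<And>x. x \<in> V \<Longrightarrow> pev P x * pev Q x = 0" for P Q
    using irred[OF zariski_closed_pfun[of m P] zariski_closed_pfun[of m Q]] VA that by auto
  show ?thesis unfolding irr_def
  proof (intro conjI allI impI)
    show "cyl m V \<noteq> {}" using V(2) cyl_superset[OF VA] by auto
    fix P Q assume PQ: "\<forall>x\<in>cyl m V. pev (P * Q) x = 0"
    show "(\<forall>x\<in>cyl m V. pev P x = 0) \<or> (\<forall>x\<in>cyl m V. pev Q x = 0)"
    proof (rule ccontr)
      assume "\<not> ?thesis"
      then obtain x y where xy: "x \<in> cyl m V" "pev P x \<noteq> 0" "y \<in> cyl m V" "pev Q y \<noteq> 0" by auto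
      obtain P1 where P1: "\<forall>z. pev P1 z = pev P (\<lambda>i. if i < m then x i else z i)" using pfun_fix_vars by blast
      obtain Q1 where Q1: "\<forall>z. pev Q1 z = pev Q (\<lambda>i. if i < m then y i else z i)" using pfun_fix_vars by blast
      have "pev P1 x \<noteq> 0" "pev Q1 y \<noteq> 0" using xy P1 Q1 by simp_all
      then have "P1 \<noteq> 0" "Q1 \<noteq> 0" by auto
      then have "P1 * Q1 \<noteq> 0" by simp
      \<comment> \<open>\<open>P1\<close> and \<open>Q1\<close> live on the free coordinates, so one
        choice of these serves both factors although \<open>x\<close> and \<open>y\<close>
        differ.\<close>
      then obtain u where "pev (P1 * Q1) u \<noteq> 0" using pfun_neq0 by blast
      then have u: "pev P1 u \<noteq> 0" "pev Q1 u \<noteq> 0" by auto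
      obtain P2 where P2: "\<forall>z. pev P2 z = pev P (\<lambda>i. if i < m then z i else u i)" using pfun_fix_params by blast
      obtain Q2 where Q2: "\<forall>z. pev Q2 z = pev Q (\<lambda>i. if i < m then z i else u i)" using pfun_fix_params by blast
      have "pev P2 v * pev Q2 v = 0" if "v \<in> V" for v
      proof -
        have "(\<lambda>i. if i < m then v i else u i) \<in> cyl m V"
          using cyl_cong[of v m V "\<lambda>i. if i < m then v i else u i"] cyl_superset[OF VA] that by auto
        then show ?thesis using PQ P2 Q2 by auto
      qed
      then have *: "(\<forall>v\<in>V. pev P2 v = 0) \<or> (\<forall>v\<in>V. pev Q2 v = 0)" by (rule irrV)
      have "pev P2 (restrict x {..<m}) = pev P1 u" unfolding P2[rule_format] P1[rule_format]
        by (rule arg_cong[of _ _ "pev P"]) auto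
      moreover have "pev Q2 (restrict y {..<m}) = pev Q1 u" unfolding Q2[rule_format] Q1[rule_format]
        by (rule arg_cong[of _ _ "pev Q"]) auto
      ultimately show False using * xy u by (auto simp: cyl_def)
    qed
  qed
qed

definition base :: "nat \<Rightarrow> nat list \<Rightarrow> nat \<Rightarrow> pfun" where
  "base m ss i = (if i < length ss then pvar (ss ! i) else pvar (m + (i - length ss)))"

lemma pmap_base: "pmap (base m ss) x i = (if i < length ss then x (ss ! i) else x (m + (i - length ss)))"
  by (simp add: pmap_def base_def)

text \<open>The variable number \<open>d\<close> is renamed \<open>X\<close> and the later ones move
  down. This matches \<open>base m ss\<close> with \<open>base m (ss @ [i])\<close>, whose
  parameters start one place later.\<close>

lemma expand_var: "\<exists>Q. \<forall>y X. ev2 Q y X = pev P (\<lambda>i. if i < d then y i else if i = d then X else y (i - 1))"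
proof (induction P)
  case (const c) show ?case by (rule exI[of _ "[:pconst c:]"]) simp
next
  case (var i)
  show ?case
    by (rule exI[of _ "if i < d then [:pvar i:] else if i = d then [:0, 1:] else [:pvar (i - 1):]"]) simp
next
  case (add P Q)
  then obtain A B where "\<forall>y X. ev2 A y X = pev P (\<lambda>i. if i < d then y i else if i = d then X else y (i - 1))"
    "\<forall>y X. ev2 B y X = pev Q (\<lambda>i. if i < d then y i else if i = d then X else y (i - 1))" by blast
  then show ?case by (intro exI[of _ "A + B"]) simp
next
  case (mult P Q)
  then obtain A B where "\<forall>y X. ev2 A y X = pev P (\<lambda>i. if i < d then y i else if i = d then X else y (i - 1))"
    "\<forall>y X. ev2 B y X = pev Q (\<lambda>i. if i < d then y i else if i = d then X else y (i - 1))" by blast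
  then show ?case by (intro exI[of _ "A * B"]) simp
qed

lemma dependent_alg:
  assumes "\<not> indep X (base m (ss @ [i]))"
  shows "alg X (base m ss) (pvar i)"
proof -
  obtain P where P: "P \<noteq> 0" "\<And>x. x \<in> X \<Longrightarrow> pev P (pmap (base m (ss @ [i])) x) = 0"
    using assms by (auto simp: indep_def)
  let ?f = "\<lambda>y X j. if j < length ss then y j else if j = length ss then X else y (j - 1)"
  obtain Q where Q: "\<And>y X. ev2 Q y X = pev P (?f y X)" using expand_var[of P "length ss"] by blast
  have *: "?f (pmap (base m ss) x) (x i) = pmap (base m (ss @ [i])) x" for x
    by (rule ext) (auto simp: pmap_base nth_append)
  obtain x where x: "pev P x \<noteq> 0" using P(1) by (auto simp: pfun_neq0)
  have "?f (\<lambda>j. if j < length ss then x j else x (Suc j)) (x (length ss)) = x"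
    by (rule ext) auto
  then have "ev2 Q (\<lambda>j. if j < length ss then x j else x (Suc j)) (x (length ss)) \<noteq> 0"
    using x by (simp add: Q)
  then have "Q \<noteq> 0" by auto
  moreover have "relation X (base m ss) (pvar i) Q"
    unfolding relation_def using P(2) by (simp add: Q *)
  ultimately show ?thesis by (auto simp: alg_def)
qed

lemma alg_params: "i \<ge> m \<Longrightarrow> alg X (base m ss) (pvar i)"
proof -
  assume "i \<ge> m"
  then have "base m ss (length ss + (i - m)) = pvar i"
    by (simp add: base_def del: Nat.add_diff_assoc)
  then show ?thesis using alg_base[of X "base m ss" "length ss + (i - m)"] by simp
qed

lemma alg_coords:
  assumes "\<And>i. i < m \<Longrightarrow> i \<notin> set ss \<Longrightarrow> \<not> indep X (base m (ss @ [i]))"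
  shows "alg X (base m ss) (pvar i)"
proof (cases "i \<in> set ss")
  case True
  then obtain k where "k < length ss" "ss ! k = i" by (auto simp: in_set_conv_nth)
  then show ?thesis using alg_base[of X "base m ss" k] by (simp add: base_def)
qed (use assms dependent_alg alg_params[of m i X ss] in \<open>cases "i < m"; auto\<close>)

lemma indep_mono: "indep X \<eta> \<Longrightarrow> X \<subseteq> Y \<Longrightarrow> indep Y \<eta>"
  by (auto simp: indep_def)

text \<open>Otherwise \<open>h\<close> would be algebraic over the coordinates in \<open>ss\<close>
  on \<open>X\<close>, by a relation with nonzero constant coefficient. On \<open>X0\<close>, where
  \<open>h\<close> is zero, that coefficient would vanish, against the independence there.\<close>

lemma transcendence_step:
  assumes X: "irr X" and ind: "indep X0 (base m ss)" and sub: "X0 \<subseteq> X"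
    and h: "\<And>x. x \<in> X0 \<Longrightarrow> pev h x = 0" and x1: "x1 \<in> X" "pev h x1 \<noteq> 0"
  shows "\<exists>i<m. i \<notin> set ss \<and> indep X (base m (ss @ [i]))"
proof (rule ccontr)
  assume "\<not> ?thesis"
  then have "alg X (base m ss) (pvar i)" for i by (intro alg_coords) auto
  then have "alg X (base m ss) h" by (rule alg_all[OF X indep_mono[OF ind sub]])
  then obtain Q where Q: "Q \<noteq> 0" "relation X (base m ss) h Q" by (auto simp: alg_def)
  \<comment> \<open>Powers of the variable are split off from the relation; they can be cancelled
    since \<open>h\<close> is not zero on the irreducible set \<open>X\<close>.\<close>
  define k where "k = order 0 Q"
  obtain Q' where Q': "Q = [:- 0, 1:] ^ k * Q'" "\<not> [:- 0, 1:] dvd Q'"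
    using order_decomp[OF Q(1), of 0] unfolding k_def by blast
  have c: "coeff Q' 0 \<noteq> 0" using Q'(2) by (simp only: poly_eq_0_iff_dvd[symmetric] poly_0_coeff_0) simp
  have rel: "ev2 Q' (pmap (base m ss) x) (pev h x) = 0" if "x \<in> X" for x
  proof -
    have "pev h x ^ k * pev (psubst2 (base m ss) h Q') x = 0" if "x \<in> X" for x
      using Q(2) that by (auto simp: relation_def Q')
    from irr_power[OF X this x1 that] show ?thesis by simp
  qed
  have ev0: "ev2 Q' y 0 = pev (coeff Q' 0) y" for y
    by (simp add: ev2_def poly_0_coeff_0)
  have "pev (coeff Q' 0) (pmap (base m ss) x) = 0" if "x \<in> X0" for x
  proof -
    have "ev2 Q' (pmap (base m ss) x) (pev h x) = 0" using rel sub that by blast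
    then show ?thesis using h[OF that] ev0 by simp
  qed
  then show False using ind c by (auto simp: indep_def)
qed

lemma extend_to_base:
  assumes "indep X (base m ss)" "distinct ss" "set ss \<subseteq> {..<m}"
  obtains ext where "indep X (base m (ss @ ext))" "distinct (ss @ ext)" "set (ss @ ext) \<subseteq> {..<m}"
    "\<And>i. alg X (base m (ss @ ext)) (pvar i)"
proof -
  let ?P = "\<lambda>ext. indep X (base m (ss @ ext)) \<and> distinct (ss @ ext) \<and> set (ss @ ext) \<subseteq> {..<m}"
  have bd: "length ext < Suc m" if "?P ext" for ext
  proof -
    have "length (ss @ ext) \<le> card {..<m}"
      using that by (metis card_mono distinct_card finite_lessThan)
    then show ?thesis by simp
  qed
  have "?P []" using assms by simp
  then obtain ext where ext: "?P ext" and max: "\<And>ext'. ?P ext' \<Longrightarrow> length ext' \<le> length ext"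
    using ex_has_greatest_nat[of ?P "[]" length "Suc m"] bd by blast
  have "alg X (base m (ss @ ext)) (pvar i)" for i
  proof (rule alg_coords)
    fix i assume "i < m" "i \<notin> set (ss @ ext)"
    then show "\<not> indep X (base m ((ss @ ext) @ [i]))" using max[of "ext @ [i]"] ext by auto
  qed
  then show thesis using that ext by blast
qed

lemma indep_empty:
  assumes "cyl m V \<noteq> {}"
  shows "indep (cyl m V) (base m [])"
proof -
  obtain x where x: "x \<in> cyl m V" using assms by auto
  have "pev P y = 0" if "\<forall>x\<in>cyl m V. pev P (pmap (base m []) x) = 0" for P y
  proof -
    have "(\<lambda>i. if i < m then x i else y (i - m)) \<in> cyl m V" by (rule cyl_cong[OF x]) simp
    moreover have "pmap (base m []) (\<lambda>i. if i < m then x i else y (i - m)) = y"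
      by (rule ext) (simp add: pmap_base)
    ultimately show ?thesis using that by metis
  qed
  then show ?thesis by (auto simp: indep_def intro: pfun_eqI)
qed

text \<open>Each strict inclusion of irreducible closed sets is witnessed by a function vanishing on
  the smaller one only, and so brings a further independent coordinate.\<close>

lemma chain_indep:
  assumes "\<And>i. i \<le> d \<Longrightarrow> irreducible_variety m (C i)" "\<And>i. i < d \<Longrightarrow> C i \<subset> C (Suc i)" "k \<le> d"
  shows "\<exists>ss. distinct ss \<and> set ss \<subseteq> {..<m} \<and> length ss = k \<and> indep (cyl m (C k)) (base m ss)"
  using assms(3)
proof (induction k)
  case 0
  have "cyl m (C 0) \<noteq> {}" using irreducible_variety_irr[OF assms(1)[of 0]] by (simp add: irr_def)
  then show ?case using indep_empty by (intro exI[of _ "[]"]) simp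
next
  case (Suc k)
  then obtain ss where ss: "distinct ss" "set ss \<subseteq> {..<m}" "length ss = k" "indep (cyl m (C k)) (base m ss)"
    by auto
  have zc: "zariski_closed m (C k)" "zariski_closed m (C (Suc k))"
    using assms(1) Suc.prems by (auto simp: irreducible_variety_def)
  have lt: "C k \<subset> C (Suc k)" using assms(2) Suc.prems by auto
  then obtain x where x: "x \<in> C (Suc k)" "x \<notin> C k" by auto
  have xA: "restrict x {..<m} = x" using x(1) zariski_closed_affine[OF zc(2)]
    by (intro extensional_restrict) (auto simp: affine_space_def PiE_def)
  have "x \<notin> cyl m (C k)" using x by (simp add: cyl_def xA)
  then obtain h where h: "\<forall>z\<in>cyl m (C k). pev h z = 0" "pev h x \<noteq> 0"
    using zariski_closed_cyl[OF zc(1)] by blast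
  have "x \<in> cyl m (C (Suc k))" using x by (simp add: cyl_def xA)
  then obtain i where "i < m" "i \<notin> set ss" "indep (cyl m (C (Suc k))) (base m (ss @ [i]))"
    using transcendence_step[OF irreducible_variety_irr[OF assms(1)[OF Suc.prems]] ss(4) cyl_mono[of "C k"] _ _ h(2)]
      h(1) lt by auto
  then show ?case using ss by (intro exI[of _ "ss @ [i]"]) auto
qed

text \<open>With the parameters fixed, a relation cuts out a closed subset of the affine space; as
  it contains \<open>S\<close>, it contains the closure.\<close>

lemma indep_zariski_closure:
  assumes "indep (cyl m (zariski_closure m S)) (base m ss)" "set ss \<subseteq> {..<m}" "S \<subseteq> affine_space m"
  shows "indep (cyl m S) (base m ss)"
  unfolding indep_def
proof (intro allI impI)
  fix P assume P: "\<forall>x\<in>cyl m S. pev P (pmap (base m ss) x) = 0"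
  have "pev P (pmap (base m ss) z) = 0" if z: "z \<in> cyl m (zariski_closure m S)" for z
  proof -
    obtain Q where Q: "\<And>x. pev Q x = pev (psubst (base m ss) P) (\<lambda>i. if i < m then x i else z i)"
      using pfun_fix_params by blast
    have "S \<subseteq> {x \<in> affine_space m. pev Q x = 0}"
    proof
      fix x assume x: "x \<in> S"
      then have "x \<in> cyl m S" using cyl_superset[OF assms(3)] by auto
      then have "(\<lambda>i. if i < m then x i else z i) \<in> cyl m S" by (rule cyl_cong) simp
      then show "x \<in> {x \<in> affine_space m. pev Q x = 0}" using P Q x assms(3) by (auto simp: pmap_def)
    qed
    then have "zariski_closure m S \<subseteq> {x \<in> affine_space m. pev Q x = 0}"
      unfolding zariski_closure_def using zariski_closed_pfun[of m Q] by blast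
    then have "pev Q (restrict z {..<m}) = 0" using z by (auto simp: cyl_def)
    moreover have "(\<lambda>i. if i < m then restrict z {..<m} i else z i) = z" by auto
    ultimately show ?thesis unfolding Q by (simp add: pmap_def)
  qed
  then show "P = 0" using assms(1) by (auto simp: indep_def)
qed

text \<open>The Krull dimension occurring in \<open>j_broad\<close> is converted here into
  independent coordinates, the form in which the rest of the proof uses it.\<close>

lemma zariski_dim_indep:
  assumes "enat l \<le> zariski_dim m S" "l > 0" "S \<subseteq> affine_space m"
  shows "\<exists>ss. distinct ss \<and> set ss \<subseteq> {..<m} \<and> length ss \<ge> l \<and> indep (cyl m S) (base m ss)"
proof -
  have "\<exists>d\<ge>l. \<exists>C. (\<forall>i\<le>d. irreducible_variety m (C i) \<and> C i \<subseteq> zariski_closure m S) \<and> (\<forall>i<d. C i \<subset> C (Suc i))"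
  proof (rule ccontr)
    assume *: "\<not> ?thesis"
    \<comment> \<open>Without a chain of length at least \<open>l\<close> every member of the
      supremum is at most \<open>l - 1\<close>; since \<open>l > 0\<close>, the truncated
      subtraction is a true one.\<close>
    have "zariski_dim m S \<le> enat (l - 1)" unfolding zariski_dim_def
    proof (rule Sup_least)
      fix x assume "x \<in> {enat d | d. \<exists>C. (\<forall>i\<le>d. irreducible_variety m (C i) \<and> C i \<subseteq> zariski_closure m S) \<and>
         (\<forall>i<d. C i \<subset> C (Suc i))}"
      then obtain d where "x = enat d" "\<exists>C. (\<forall>i\<le>d. irreducible_variety m (C i) \<and> C i \<subseteq> zariski_closure m S) \<and>
         (\<forall>i<d. C i \<subset> C (Suc i))" by blast
      then have "x = enat d" "\<not> d \<ge> l" using * by blast+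
      then show "x \<le> enat (l - 1)" by simp
    qed
    then have "enat l \<le> enat (l - 1)" using assms(1) by (rule order_trans[rotated])
    then show False using assms(2) by simp
  qed
  then obtain d C where d: "d \<ge> l" and C: "\<And>i. i \<le> d \<Longrightarrow> irreducible_variety m (C i)"
      "\<And>i. i < d \<Longrightarrow> C i \<subset> C (Suc i)" and CS: "C d \<subseteq> zariski_closure m S"
    by blast
  obtain ss where ss: "distinct ss" "set ss \<subseteq> {..<m}" "length ss = d" "indep (cyl m (C d)) (base m ss)"
    using chain_indep[of d m C d] C by blast
  have "indep (cyl m S) (base m ss)"
    by (rule indep_zariski_closure[OF indep_mono[OF ss(4) cyl_mono[OF CS]] ss(2) assms(3)])
  then show ?thesis using ss d by auto
qed

text \<open>A relation for a single coordinate leaves it finitely many values. The product of the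
  differences to these values vanishes on \<open>X\<close>, so by irreducibility one factor does and
  the coordinate is constant.\<close>

lemma indep_nonconstant:
  assumes X: "irr X" and nc: "\<not> (\<exists>c. \<forall>x\<in>X. x k = c)"
    and cyl: "\<And>x x'. x \<in> X \<Longrightarrow> (\<And>i. i < m \<Longrightarrow> x' i = x i) \<Longrightarrow> x' \<in> X" and k: "k < m"
  shows "indep X (base m [k])"
  unfolding indep_def
proof (intro allI impI, rule ccontr)
  fix P assume P: "\<forall>x\<in>X. pev P (pmap (base m [k]) x) = 0" and "P \<noteq> 0"
  then obtain y where y: "pev P y \<noteq> 0" by (auto simp: pfun_neq0)
  \<comment> \<open>All variables but the first are frozen at the values of \<open>y\<close>, which
    turns \<open>P\<close> into a polynomial \<open>q\<close> in the coordinate \<open>k\<close>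
    alone.\<close>
  obtain q where q: "\<And>s. pev P (\<lambda>i. (if i = 0 then 0 else y i) + s * (if i = 0 then 1 else 0)) = poly q s"
    using pev_line[of P "\<lambda>i. if i = 0 then 0 else y i" "\<lambda>i. if i = 0 then 1 else 0"] by blast
  have "(\<lambda>i. (if i = 0 then 0 else y i) + y 0 * (if i = 0 then 1 else 0)) = y" by auto
  then have q0: "q \<noteq> 0" using q[of "y 0"] y by auto
  have "poly q (x k) = 0" if "x \<in> X" for x
  proof -
    define x' where "x' = (\<lambda>i. if i < m then x i else y (Suc (i - m)))"
    have "x' \<in> X" by (rule cyl[OF that]) (simp add: x'_def)
    moreover have "pmap (base m [k]) x' = (\<lambda>i. (if i = 0 then 0 else y i) + x k * (if i = 0 then 1 else 0))"
    proof
      fix i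
      show "pmap (base m [k]) x' i = (if i = 0 then 0 else y i) + x k * (if i = 0 then 1 else 0)"
        using k by (cases i) (simp_all add: pmap_base x'_def)
    qed
    ultimately show ?thesis using P q by metis
  qed
  then have *: "pev (\<Prod>r\<in>{r. poly q r = 0}. pvar k - pconst r) x = 0" if "x \<in> X" for x
    using that poly_roots_finite[OF q0] by auto
  have "\<exists>x\<in>X. pev (\<Prod>r\<in>{r. poly q r = 0}. pvar k - pconst r) x \<noteq> 0"
    by (rule irr_prod[OF X poly_roots_finite[OF q0]]) (use nc in auto)
  then show False using * by blast
qed

lemma indep_projection:
  assumes V: "V \<subseteq> affine_space (2 * n)" and ss: "set ss \<subseteq> {..<2 * length ks}"
    and ks: "set ks \<subseteq> {..<n}"
    and ind: "indep (cyl (2 * length ks) (pr_idx n ks ` V)) (base (2 * length ks) ss)"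
  shows "indep (cyl (2 * n) V) (base (2 * n)
    (map (\<lambda>i. if i < length ks then ks ! i else n + ks ! (i - length ks)) ss))"
  unfolding indep_def
proof (intro allI impI)
  let ?l = "length ks" and ?g = "\<lambda>i. if i < length ks then ks ! i else n + ks ! (i - length ks)"
  fix P assume P: "\<forall>x\<in>cyl (2 * n) V. pev P (pmap (base (2 * n) (map ?g ss)) x) = 0"
  have g: "?g i < 2 * n" if "i < 2 * ?l" for i
  proof -
    have "ks ! j < n" if "j < ?l" for j using ks nth_mem[OF that] by auto
    from this[of i] this[of "i - ?l"] that show ?thesis by auto
  qed
  have "pev P (pmap (base (2 * ?l) ss) x) = 0" if x: "x \<in> cyl (2 * ?l) (pr_idx n ks ` V)" for x
  proof -
    obtain v where v: "v \<in> V" "restrict x {..<2 * ?l} = pr_idx n ks v" using x by (auto simp: cyl_def)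
    have xg: "x i = v (?g i)" if "i < 2 * ?l" for i
      using fun_cong[OF v(2), of i] that by (simp add: pr_idx_def)
    \<comment> \<open>A point over \<open>v\<close> with the parameters of \<open>x\<close>,
      renumbered from \<open>2 * n\<close> on.\<close>
    define z where "z = (\<lambda>i. if i < 2 * n then v i else x (2 * ?l + (i - 2 * n)))"
    have "v \<in> cyl (2 * n) V" using v cyl_superset[OF V] by auto
    then have "z \<in> cyl (2 * n) V" by (rule cyl_cong) (simp add: z_def)
    moreover have "pmap (base (2 * n) (map ?g ss)) z = pmap (base (2 * ?l) ss) x"
    proof
      fix i
      show "pmap (base (2 * n) (map ?g ss)) z i = pmap (base (2 * ?l) ss) x i"
      proof (cases "i < length ss")
        case True
        then have "ss ! i < 2 * ?l" using ss nth_mem[OF True] lessThan_iff by blast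
        then show ?thesis using True g[of "ss ! i"] xg[of "ss ! i"] by (simp add: pmap_base z_def)
      qed (simp add: pmap_base z_def del: Nat.add_diff_assoc)
    qed
    ultimately show ?thesis using P by metis
  qed
  then show "P = 0" using ind by (auto simp: indep_def)
qed

section \<open>Varieties as hypersurfaces\<close>

text \<open>The partial derivative in the \<open>i\<close>-th variable of the coefficients, picked
  by the chain rule it satisfies; \<open>pderiv\<close> is the derivative in the distinguished
  variable.\<close>

definition partial2 :: "pfun poly \<Rightarrow> nat \<Rightarrow> pfun poly" where
  "partial2 Q = (SOME G. \<exists>N. \<forall>M\<ge>N. \<forall>x \<tau> \<xi> \<xi>' s S. (\<forall>i. ((\<lambda>t. x t i) has_field_derivative \<tau> i) (at s within S)) \<longrightarrow>
     (\<xi> has_field_derivative \<xi>') (at s within S) \<longrightarrow>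
     ((\<lambda>t. ev2 Q (x t) (\<xi> t)) has_field_derivative
       ((\<Sum>i<M. ev2 (G i) (x s) (\<xi> s) * \<tau> i) + ev2 (pderiv Q) (x s) (\<xi> s) * \<xi>')) (at s within S))"

lemma ev2_has_derivative:
  "\<exists>N. \<forall>M\<ge>N. \<forall>x \<tau> \<xi> \<xi>' s S. (\<forall>i. ((\<lambda>t. x t i) has_field_derivative \<tau> i) (at s within S)) \<longrightarrow>
     (\<xi> has_field_derivative \<xi>') (at s within S) \<longrightarrow>
     ((\<lambda>t. ev2 Q (x t) (\<xi> t)) has_field_derivative
       ((\<Sum>i<M. ev2 (partial2 Q i) (x s) (\<xi> s) * \<tau> i) + ev2 (pderiv Q) (x s) (\<xi> s) * \<xi>')) (at s within S)"
proof -
  have "\<exists>G N. \<forall>M\<ge>N. \<forall>x \<tau> \<xi> \<xi>' s S. (\<forall>i. ((\<lambda>t. x t i) has_field_derivative \<tau> i) (at s within S)) \<longrightarrow>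
     (\<xi> has_field_derivative \<xi>') (at s within S) \<longrightarrow>
     ((\<lambda>t. ev2 Q (x t) (\<xi> t)) has_field_derivative
       ((\<Sum>i<M. ev2 (G i) (x s) (\<xi> s) * \<tau> i) + ev2 (pderiv Q) (x s) (\<xi> s) * \<xi>')) (at s within S)"
    using ev2_deriv_exists[of Q] by blast
  from someI_ex[OF this] show ?thesis unfolding partial2_def .
qed

lemma ev2_has_derivative_finite:
  assumes "\<And>i. ((\<lambda>t. x t i) has_field_derivative \<tau> i) (at s within S)"
    "(\<xi> has_field_derivative \<xi>') (at s within S)" "\<And>i. i \<ge> d \<Longrightarrow> \<tau> i = 0"
  shows "((\<lambda>t. ev2 Q (x t) (\<xi> t)) has_field_derivative
       ((\<Sum>i<d. ev2 (partial2 Q i) (x s) (\<xi> s) * \<tau> i) + ev2 (pderiv Q) (x s) (\<xi> s) * \<xi>')) (at s within S)"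
proof -
  obtain N where N: "\<And>M. M \<ge> N \<Longrightarrow> ((\<lambda>t. ev2 Q (x t) (\<xi> t)) has_field_derivative
       ((\<Sum>i<M. ev2 (partial2 Q i) (x s) (\<xi> s) * \<tau> i) + ev2 (pderiv Q) (x s) (\<xi> s) * \<xi>')) (at s within S)"
    using ev2_has_derivative[of Q] assms(1,2) by blast
  have "(\<Sum>i<max N d. ev2 (partial2 Q i) (x s) (\<xi> s) * \<tau> i) = (\<Sum>i<d. ev2 (partial2 Q i) (x s) (\<xi> s) * \<tau> i)"
    using assms(3) by (intro sum.mono_neutral_right) auto
  then show ?thesis using N[of "max N d"] by simp
qed

text \<open>The assumptions cover two choices of \<eta>: coordinate functions, used for tangent
  vectors, and the linear forms of Noether normalization, used for density.\<close>

locale param_base =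
  fixes X :: "(nat \<Rightarrow> complex) set" and m d :: nat and \<eta> :: "nat \<Rightarrow> pfun"
  assumes X_irr: "irr X" and \<eta>_indep: "indep X \<eta>"
    and X_cyl: "\<And>x x'. x \<in> X \<Longrightarrow> (\<And>i. i < m \<Longrightarrow> x' i = x i) \<Longrightarrow> x' \<in> X"
    and X_closed: "\<And>x. (\<And>P. (\<forall>z\<in>X. pev P z = 0) \<Longrightarrow> pev P x = 0) \<Longrightarrow> x \<in> X"
    and \<eta>_param: "\<And>i. \<eta> (d + i) = pvar (m + i)"
    and \<eta>_cong: "\<And>i x x'. i < d \<Longrightarrow> (\<And>j. j < m \<Longrightarrow> x' j = x j) \<Longrightarrow> pev (\<eta> i) x' = pev (\<eta> i) x"

definition generic_form :: "nat \<Rightarrow> pfun" where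
  "generic_form m = (\<Sum>i<m. pvar (m + i) * pvar i)"

lemma pev_generic_form: "pev (generic_form m) x = (\<Sum>i<m. x (m + i) * x i)"
  by (simp add: generic_form_def)

text \<open>Kronecker's trick: \<open>F\<close> is a minimal relation of the generic linear form in the first \<open>m\<close>
  coordinates, whose coefficients are the parameters with index at least \<open>m\<close>. Differentiating the
  relation with respect to the parameters expresses the coordinates rationally by \<open>\<eta>\<close> and the form.\<close>

locale hypersurface = param_base +
  fixes F :: "pfun poly"
  assumes F: "minrel X \<eta> (generic_form m) F"
begin

sublocale min_relation X \<eta> "generic_form m" F
  by standard (fact X_irr \<eta>_indep F)+

abbreviation g where "g \<equiv> pev (generic_form m)"

lemma \<eta>_param': "i \<ge> d \<Longrightarrow> \<eta> i = pvar (m + (i - d))"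
  using \<eta>_param[of "i - d"] by simp

lemma coordinate_relation:
  assumes x: "x \<in> X" and i: "i < m"
  shows "ev2 (pderiv F) (pmap \<eta> x) (g x) * x i = - ev2 (partial2 F (d + i)) (pmap \<eta> x) (g x)"
proof -
  \<comment> \<open>Only the parameter with index \<open>m + i\<close> varies. Slot
    \<open>d + i\<close> of \<eta> then moves at unit speed and the generic form at speed
    \<open>x i\<close>, while the point stays on the cylinder.\<close>
  define z where "z t = x(m + i := t)" for t
  have zX: "z t \<in> X" for t by (rule X_cyl[OF x]) (simp add: z_def)
  let ?\<tau> = "\<lambda>j. if j = d + i then 1 else (0::complex)"
  have \<eta>z: "pmap \<eta> (z t) = (pmap \<eta> x)(d + i := t)" for t
  proof
    fix j
    show "pmap \<eta> (z t) j = ((pmap \<eta> x)(d + i := t)) j"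
    proof (cases "j < d")
      case True
      then show ?thesis using \<eta>_cong[of j "z t" x] by (simp add: pmap_def z_def)
    next
      case False
      then show ?thesis using \<eta>_param'[of j] by (auto simp: pmap_def z_def)
    qed
  qed
  have gz: "g (z t) = g x + (t - x (m + i)) * x i" for t
  proof -
    have "g (z t) = (\<Sum>j<m. x (m + j) * x j + (if j = i then (t - x (m + i)) * x i else 0))"
      unfolding pev_generic_form by (rule sum.cong) (auto simp: z_def algebra_simps)
    then show ?thesis using i by (simp add: sum.distrib sum.delta pev_generic_form)
  qed
  have "((\<lambda>t. ev2 F (pmap \<eta> (z t)) (g (z t))) has_field_derivative
     ((\<Sum>j<Suc (d + i). ev2 (partial2 F j) (pmap \<eta> (z (x (m + i)))) (g (z (x (m + i)))) * ?\<tau> j) +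
      ev2 (pderiv F) (pmap \<eta> (z (x (m + i)))) (g (z (x (m + i)))) * x i)) (at (x (m + i)))"
  proof (rule ev2_has_derivative_finite)
    show "((\<lambda>t. pmap \<eta> (z t) j) has_field_derivative ?\<tau> j) (at (x (m + i)))" for j
      by (auto simp: \<eta>z)
    show "((\<lambda>t. g (z t)) has_field_derivative x i) (at (x (m + i)))"
      unfolding gz by (auto intro!: derivative_eq_intros)
  qed auto
  moreover have "ev2 F (pmap \<eta> (z t)) (g (z t)) = 0" for t
    using F_rel zX by (auto simp: relation_def)
  ultimately have "((\<lambda>t. 0) has_field_derivative
     ((\<Sum>j<Suc (d + i). ev2 (partial2 F j) (pmap \<eta> (z (x (m + i)))) (g (z (x (m + i)))) * ?\<tau> j) +
      ev2 (pderiv F) (pmap \<eta> (z (x (m + i)))) (g (z (x (m + i)))) * x i)) (at (x (m + i)))"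
    by (simp only:)
  then have "(\<Sum>j<Suc (d + i). ev2 (partial2 F j) (pmap \<eta> (z (x (m + i)))) (g (z (x (m + i)))) * ?\<tau> j) +
      ev2 (pderiv F) (pmap \<eta> (z (x (m + i)))) (g (z (x (m + i)))) * x i = 0"
    using DERIV_unique DERIV_const by blast
  moreover have "z (x (m + i)) = x" by (simp add: z_def)
  ultimately have "ev2 (partial2 F (d + i)) (pmap \<eta> x) (g x) + ev2 (pderiv F) (pmap \<eta> x) (g x) * x i = 0"
    by simp
  then show ?thesis by (metis add.commute eq_neg_iff_add_eq_0)
qed

text \<open>The inverse of the map sending \<open>x\<close> to \<open>pmap \<eta> x\<close> and
  \<open>g x\<close>, at points of the hypersurface where \<open>disc\<close> is nonzero. The
  quotients solve \<open>coordinate_relation\<close>; from index \<open>m\<close> on the parameters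
  are read off from \<open>y\<close>.\<close>

definition pt :: "(nat \<Rightarrow> complex) \<Rightarrow> complex \<Rightarrow> nat \<Rightarrow> complex" where
  "pt y s i = (if i < m then - ev2 (partial2 F (d + i)) y s / ev2 (pderiv F) y s else y (d + (i - m)))"

definition res where "res = (SOME R. R \<noteq> 0 \<and> (\<exists>a c. [:R:] = a * F + c * pderiv F))"

text \<open>Where it does not vanish, \<open>F\<close> keeps its degree and has simple roots
  only.\<close>

definition disc where "disc = lead_coeff F * res"

lemma res: "res \<noteq> 0" "\<exists>a c. [:res:] = a * F + c * pderiv F"
  using someI_ex[of "\<lambda>R. R \<noteq> 0 \<and> (\<exists>a c. [:R:] = a * F + c * pderiv F)"] separable
  unfolding res_def by blast+

lemma disc_neq0: "disc \<noteq> 0"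
  using res F_neq0 by (simp add: disc_def)

lemma pderiv_neq0:
  assumes "ev2 F y s = 0" "pev disc y \<noteq> 0"
  shows "ev2 (pderiv F) y s \<noteq> 0"
proof
  assume *: "ev2 (pderiv F) y s = 0"
  obtain a c where "[:res:] = a * F + c * pderiv F" using res by blast
  then have "ev2 [:res:] y s = 0" using * assms by simp
  then show False using assms(2) by (simp add: disc_def)
qed

text \<open>Relations are known at images of points of \<open>X\<close> only. Being divisible by
  \<open>F\<close> up to a power of the leading coefficient, they hold on the whole hypersurface off
  the zeros of \<open>disc\<close>.\<close>

lemma relation_transfer:
  assumes "relation X \<eta> (generic_form m) S" "ev2 F y s = 0" "pev disc y \<noteq> 0"
  shows "ev2 S y s = 0"
proof -
  obtain k q where "smult (lead_coeff F ^ k) S = F * q" using relation_dvd[OF assms(1)] by blast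
  from arg_cong[OF this, of "\<lambda>Q. ev2 Q y s"] show ?thesis
    using assms by (simp add: disc_def)
qed

text \<open>The hypothesis on \<open>x\<close> is the definition of \<open>pt\<close> freed of
  quotients. Hence the same \<open>K\<close> and \<open>T\<close> serve for points of
  \<open>X\<close>, where \<open>pderiv F\<close> may vanish, and for \<open>pt y s\<close>.\<close>

lemma clear_denominators:
  "\<exists>K T. \<forall>y s x. (\<forall>i<m. ev2 (pderiv F) y s * x i = - ev2 (partial2 F (d + i)) y s) \<longrightarrow>
     (\<forall>i. x (m + i) = y (d + i)) \<longrightarrow> ev2 (pderiv F) y s ^ K * pev h x = ev2 T y s"
proof (induction h)
  case (const c)
  show ?case by (rule exI[of _ 0], rule exI[of _ "[:pconst c:]"]) simp
next
  case (var i)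
  show ?case
  proof (cases "i < m")
    case True
    then show ?thesis by (intro exI[of _ 1] exI[of _ "- partial2 F (d + i)"]) simp
  next
    case False
    then have "x i = y (d + (i - m))" if "\<forall>i. x (m + i) = y (d + i)" for x y :: "nat \<Rightarrow> complex"
      using that[rule_format, of "i - m"] by simp
    then show ?thesis
      by (intro exI[of _ 0] exI[of _ "[:pvar (d + (i - m)):]"]) (simp del: Nat.add_diff_assoc)
  qed
next
  case (add P Q)
  then obtain K S L T where *:
    "\<And>y s x. (\<forall>i<m. ev2 (pderiv F) y s * x i = - ev2 (partial2 F (d + i)) y s) \<Longrightarrow>
     (\<forall>i. x (m + i) = y (d + i)) \<Longrightarrow> ev2 (pderiv F) y s ^ K * pev P x = ev2 S y s"
    "\<And>y s x. (\<forall>i<m. ev2 (pderiv F) y s * x i = - ev2 (partial2 F (d + i)) y s) \<Longrightarrow>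
     (\<forall>i. x (m + i) = y (d + i)) \<Longrightarrow> ev2 (pderiv F) y s ^ L * pev Q x = ev2 T y s" by blast
  show ?case
    by (rule exI[of _ "K + L"], rule exI[of _ "pderiv F ^ L * S + pderiv F ^ K * T"])
       (simp add: power_add ring_distribs flip: *)
next
  case (mult P Q)
  then obtain K S L T where *:
    "\<And>y s x. (\<forall>i<m. ev2 (pderiv F) y s * x i = - ev2 (partial2 F (d + i)) y s) \<Longrightarrow>
     (\<forall>i. x (m + i) = y (d + i)) \<Longrightarrow> ev2 (pderiv F) y s ^ K * pev P x = ev2 S y s"
    "\<And>y s x. (\<forall>i<m. ev2 (pderiv F) y s * x i = - ev2 (partial2 F (d + i)) y s) \<Longrightarrow>
     (\<forall>i. x (m + i) = y (d + i)) \<Longrightarrow> ev2 (pderiv F) y s ^ L * pev Q x = ev2 T y s" by blast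
  show ?case
    by (rule exI[of _ "K + L"], rule exI[of _ "S * T"]) (simp add: power_add flip: *)
qed

lemma cleared:
  obtains K T where
    "\<And>x. x \<in> X \<Longrightarrow> ev2 (pderiv F) (pmap \<eta> x) (g x) ^ K * pev h x = ev2 T (pmap \<eta> x) (g x)"
    "\<And>y s. ev2 F y s = 0 \<Longrightarrow> pev disc y \<noteq> 0 \<Longrightarrow> ev2 (pderiv F) y s ^ K * pev h (pt y s) = ev2 T y s"
proof -
  obtain K T where KT: "\<And>y s x. (\<forall>i<m. ev2 (pderiv F) y s * x i = - ev2 (partial2 F (d + i)) y s) \<Longrightarrow>
     (\<forall>i. x (m + i) = y (d + i)) \<Longrightarrow> ev2 (pderiv F) y s ^ K * pev h x = ev2 T y s"
    using clear_denominators[of h] by blast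
  show thesis
  proof (rule that)
    fix x assume "x \<in> X"
    then show "ev2 (pderiv F) (pmap \<eta> x) (g x) ^ K * pev h x = ev2 T (pmap \<eta> x) (g x)"
      using coordinate_relation by (intro KT) (auto simp: pmap_def \<eta>_param)
  next
    fix y s assume "ev2 F y s = 0" "pev disc y \<noteq> 0"
    then show "ev2 (pderiv F) y s ^ K * pev h (pt y s) = ev2 T y s"
      using pderiv_neq0 by (intro KT) (auto simp: pt_def)
  qed
qed

context
  fixes y s assumes y: "ev2 F y s = 0" "pev disc y \<noteq> 0"
begin

text \<open>An identity on \<open>X\<close> becomes, after clearing denominators, a relation of the
  generic form, which \<open>relation_transfer\<close> carries to the hypersurface. The next two
  lemmas argue in the same way.\<close>

lemma pt_in: "pt y s \<in> X"
proof (rule X_closed)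
  fix P assume P: "\<forall>z\<in>X. pev P z = 0"
  obtain K T where
    1: "\<And>x. x \<in> X \<Longrightarrow> ev2 (pderiv F) (pmap \<eta> x) (g x) ^ K * pev P x = ev2 T (pmap \<eta> x) (g x)" and
    2: "\<And>y s. ev2 F y s = 0 \<Longrightarrow> pev disc y \<noteq> 0 \<Longrightarrow> ev2 (pderiv F) y s ^ K * pev P (pt y s) = ev2 T y s"
    using cleared by blast
  have "relation X \<eta> (generic_form m) T" using P 1 by (auto simp: relation_def simp flip: 1)
  from relation_transfer[OF this y] show "pev P (pt y s) = 0" using 2[OF y] pderiv_neq0[OF y] by simp
qed

lemma \<eta>_pt: "pmap \<eta> (pt y s) = y"
proof
  fix i
  show "pmap \<eta> (pt y s) i = y i"
  proof (cases "i < d")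
    case True
    obtain K T where
      1: "\<And>x. x \<in> X \<Longrightarrow> ev2 (pderiv F) (pmap \<eta> x) (g x) ^ K * pev (\<eta> i) x = ev2 T (pmap \<eta> x) (g x)" and
      2: "\<And>y s. ev2 F y s = 0 \<Longrightarrow> pev disc y \<noteq> 0 \<Longrightarrow> ev2 (pderiv F) y s ^ K * pev (\<eta> i) (pt y s) = ev2 T y s"
      using cleared by blast
    have "relation X \<eta> (generic_form m) (T - smult (pvar i) (pderiv F ^ K))"
      by (auto simp: relation_def pmap_def simp flip: 1[unfolded pmap_def])
    from relation_transfer[OF this y] show ?thesis
      using 2[OF y] pderiv_neq0[OF y] by (simp add: pmap_def)
  next
    case False
    then show ?thesis using \<eta>_param'[of i] by (simp add: pmap_def pt_def del: Nat.add_diff_assoc)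
  qed
qed

lemma g_pt: "g (pt y s) = s"
proof -
  obtain K T where
    1: "\<And>x. x \<in> X \<Longrightarrow> ev2 (pderiv F) (pmap \<eta> x) (g x) ^ K * g x = ev2 T (pmap \<eta> x) (g x)" and
    2: "\<And>y s. ev2 F y s = 0 \<Longrightarrow> pev disc y \<noteq> 0 \<Longrightarrow> ev2 (pderiv F) y s ^ K * g (pt y s) = ev2 T y s"
    using cleared by blast
  have "relation X \<eta> (generic_form m) (T - [:0, 1:] * pderiv F ^ K)"
    by (simp add: relation_def flip: 1)
  from relation_transfer[OF this y] show ?thesis
    using 2[OF y] pderiv_neq0[OF y] by simp
qed

end

lemma pt_\<eta>:
  assumes "x \<in> X" "pev disc (pmap \<eta> x) \<noteq> 0"
  shows "pt (pmap \<eta> x) (g x) = x"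
proof
  fix i
  have "ev2 (pderiv F) (pmap \<eta> x) (g x) \<noteq> 0"
    using assms F_rel by (intro pderiv_neq0) (auto simp: relation_def)
  moreover have "pmap \<eta> x (d + (i - m)) = x (m + (i - m))" by (simp add: pmap_def \<eta>_param del: Nat.add_diff_assoc)
  ultimately show "pt (pmap \<eta> x) (g x) i = x i"
    using coordinate_relation[OF assms(1), of i] by (auto simp: pt_def field_simps)
qed

end

text \<open>The modulus at \<open>z\<close> is that of the leading coefficient times the product of
  the distances to the roots, none of which is below the distance to a nearest root.\<close>

lemma poly_root_near:
  fixes p :: "complex poly"
  assumes "degree p > 0"
  shows "\<exists>r. poly p r = 0 \<and> norm (lead_coeff p) * norm (z - r) ^ degree p \<le> norm (poly p z)"
  using assms
proof (induction "degree p" arbitrary: p rule: less_induct)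
  case less
  obtain r where r: "poly p r = 0"
    using less.prems alg_closed_imp_poly_has_root by blast
  then obtain q where q: "p = [:- r, 1:] * q" using poly_eq_0_iff_dvd by blast
  have q0: "q \<noteq> 0" using q less.prems by auto
  have dq: "degree p = Suc (degree q)" using q0 by (simp add: q degree_mult_eq del: mult_pCons_left)
  have lq: "lead_coeff p = lead_coeff q" by (simp add: q lead_coeff_mult del: mult_pCons_left)
  have pz: "norm (poly p z) = norm (z - r) * norm (poly q z)"
    by (simp add: q norm_mult flip: left_diff_distrib)
  show ?case
  proof (cases "degree q = 0")
    case True
    then obtain c where "q = [:c:]" by (metis degree_eq_zeroE)
    then have "norm (poly p z) = norm (lead_coeff p) * norm (z - r) ^ degree p"
      using pz lq by (simp add: dq)
    then show ?thesis using r by (intro exI[of _ r]) simp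
  next
    case False
    then obtain r' where r': "poly q r' = 0" "norm (lead_coeff q) * norm (z - r') ^ degree q \<le> norm (poly q z)"
      using less.hyps[of q] dq by auto
    show ?thesis
    proof (cases "norm (z - r) \<le> norm (z - r')")
      case True
      have "norm (lead_coeff p) * norm (z - r) ^ degree p = norm (z - r) * (norm (lead_coeff q) * norm (z - r) ^ degree q)"
        using lq by (simp add: dq)
      also have "\<dots> \<le> norm (z - r) * (norm (lead_coeff q) * norm (z - r') ^ degree q)"
        using True by (intro mult_left_mono power_mono) auto
      also have "\<dots> \<le> norm (poly p z)" unfolding pz using r' by (intro mult_left_mono) auto
      finally show ?thesis using r by blast
    next
      case False
      have "norm (lead_coeff p) * norm (z - r') ^ degree p = norm (z - r') * (norm (lead_coeff q) * norm (z - r') ^ degree q)"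
        using lq by (simp add: dq)
      also have "\<dots> \<le> norm (z - r) * norm (poly q z)" using False r' by (intro mult_mono) auto
      finally have "norm (lead_coeff p) * norm (z - r') ^ degree p \<le> norm (poly p z)" unfolding pz .
      moreover have "poly p r' = 0" using r' by (simp add: q)
      ultimately show ?thesis by blast
    qed
  qed
qed

text \<open>A linear factor with root bounded by \<open>B\<close> multiplies a common bound for the
  coefficients by at most \<open>1 + B\<close>.\<close>

lemma poly_coeff_bound:
  fixes p :: "complex poly"
  assumes "p \<noteq> 0" "\<And>r. poly p r = 0 \<Longrightarrow> norm r \<le> B" "B \<ge> 0"
  shows "norm (coeff p i) \<le> norm (lead_coeff p) * (1 + B) ^ degree p"
  using assms
proof (induction "degree p" arbitrary: p i rule: less_induct)
  case less
  show ?case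
  proof (cases "degree p = 0")
    case True
    then obtain c where "p = [:c:]" by (metis degree_eq_zeroE)
    then show ?thesis by (simp add: coeff_pCons split: nat.split)
  next
    case False
    then obtain r where r: "poly p r = 0"
      using False alg_closed_imp_poly_has_root[of p] by auto
    then obtain q where q: "p = [:- r, 1:] * q" using poly_eq_0_iff_dvd by blast
    have q0: "q \<noteq> 0" using q less.prems by auto
    have dq: "degree p = Suc (degree q)" using q0 by (simp add: q degree_mult_eq del: mult_pCons_left)
    have lq: "lead_coeff p = lead_coeff q" by (simp add: q lead_coeff_mult del: mult_pCons_left)
    have IH: "norm (coeff q j) \<le> norm (lead_coeff q) * (1 + B) ^ degree q" for j
      by (rule less.hyps) (use dq q0 q less.prems in auto)
    have rB: "norm r \<le> B" using less.prems r by auto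
    let ?L = "norm (lead_coeff q) * (1 + B) ^ degree q"
    have L0: "?L \<ge> 0" using less.prems by simp
    have "coeff p i = (case i of 0 \<Rightarrow> 0 | Suc j \<Rightarrow> coeff q j) - r * coeff q i"
      by (simp add: q coeff_pCons split: nat.split)
    also have "norm \<dots> \<le> norm (case i of 0 \<Rightarrow> 0 | Suc j \<Rightarrow> coeff q j) + norm r * norm (coeff q i)"
      by (metis norm_mult norm_triangle_ineq4)
    also have "\<dots> \<le> ?L + B * ?L"
    proof (rule add_mono)
      show "norm (case i of 0 \<Rightarrow> 0 | Suc j \<Rightarrow> coeff q j) \<le> ?L" using IH L0 by (auto split: nat.split)
      show "norm r * norm (coeff q i) \<le> B * ?L" using IH rB less.prems by (intro mult_mono) auto
    qed
    also have "\<dots> = norm (lead_coeff p) * (1 + B) ^ degree p" using lq by (simp add: dq algebra_simps)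
    finally show ?thesis .
  qed
qed

text \<open>A locally bounded quotient has no poles, so every root of \<open>p\<close> is a root of
  \<open>q\<close> of at least the same multiplicity.\<close>

lemma poly_dvd_bounded:
  fixes p q :: "complex poly" and G :: "complex \<Rightarrow> real"
  assumes "p \<noteq> 0" "\<And>s. norm (poly q s) \<le> G s * norm (poly p s)" "continuous_on UNIV G"
  shows "p dvd q"
  using assms(1,2)
proof (induction "degree p" arbitrary: p q rule: less_induct)
  case less
  show ?case
  proof (cases "degree p = 0")
    case True
    then show ?thesis using less.prems by (metis is_unit_iff_degree unit_imp_dvd)
  next
    case False
    then obtain r where r: "poly p r = 0"
      using False alg_closed_imp_poly_has_root[of p] by auto
    have rq: "poly q r = 0" using less.prems(2)[of r] r by simp
    obtain p' where p': "p = [:- r, 1:] * p'" using r poly_eq_0_iff_dvd by blast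
    obtain q' where q': "q = [:- r, 1:] * q'" using rq poly_eq_0_iff_dvd by blast
    have p'0: "p' \<noteq> 0" using p' less.prems by auto
    have dp: "degree p = Suc (degree p')" using p'0 by (simp add: p' degree_mult_eq del: mult_pCons_left)
    have *: "norm (poly q' s) \<le> G s * norm (poly p' s)" if "s \<noteq> r" for s
    proof -
      have "norm (s - r) * norm (poly q' s) \<le> norm (s - r) * (G s * norm (poly p' s))"
        using less.prems(2)[of s] by (simp add: p' q' norm_mult mult_ac flip: left_diff_distrib)
      then show ?thesis using that by simp
    qed
    \<comment> \<open>Cancelling the common factor loses the inequality at \<open>r\<close> itself;
      it returns by continuity.\<close>
    have "norm (poly q' s) \<le> G s * norm (poly p' s)" for s
    proof (cases "s = r")
      case True
      have "((\<lambda>s. norm (poly q' s)) \<longlongrightarrow> norm (poly q' r)) (at r)"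
        "((\<lambda>s. G s * norm (poly p' s)) \<longlongrightarrow> G r * norm (poly p' r)) (at r)"
        using assms(3) by (auto intro!: tendsto_intros simp: continuous_on_def)
      moreover have "\<forall>\<^sub>F s in at r. norm (poly q' s) \<le> G s * norm (poly p' s)"
        using * by (auto simp: eventually_at_filter)
      ultimately show ?thesis unfolding True by (intro tendsto_le[of "at r"]) auto
    qed (fact *)
    then have "p' dvd q'" using less.hyps[of p' q'] dp p'0 by auto
    then show ?thesis unfolding p' q' by (rule mult_dvd_mono[OF dvd_refl])
  qed
qed

section \<open>Noether normalization\<close>

definition in_span :: "(nat \<Rightarrow> complex) set \<Rightarrow> (nat \<Rightarrow> pfun) \<Rightarrow> pfun set \<Rightarrow> pfun \<Rightarrow> bool" where
  "in_span X \<eta> B h \<longleftrightarrow> (\<exists>A. \<forall>x\<in>X. pev h x = (\<Sum>b\<in>B. pev (A b) (pmap \<eta> x) * pev b x))"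

lemma in_span_add:
  assumes "in_span X \<eta> B g" "in_span X \<eta> B h"
  shows "in_span X \<eta> B (g + h)"
proof -
  obtain A A' where "\<forall>x\<in>X. pev g x = (\<Sum>b\<in>B. pev (A b) (pmap \<eta> x) * pev b x)"
    "\<forall>x\<in>X. pev h x = (\<Sum>b\<in>B. pev (A' b) (pmap \<eta> x) * pev b x)"
    using assms unfolding in_span_def by blast
  then show ?thesis unfolding in_span_def
    by (intro exI[of _ "\<lambda>b. A b + A' b"]) (simp add: ring_distribs sum.distrib)
qed

lemma in_span_scale:
  assumes "in_span X \<eta> B h"
  shows "in_span X \<eta> B (psubst \<eta> P * h)"
proof -
  obtain A where "\<forall>x\<in>X. pev h x = (\<Sum>b\<in>B. pev (A b) (pmap \<eta> x) * pev b x)"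
    using assms unfolding in_span_def by blast
  then show ?thesis unfolding in_span_def
    by (intro exI[of _ "\<lambda>b. P * A b"]) (simp add: sum_distrib_left mult.assoc pmap_def)
qed

lemma in_span_0: "in_span X \<eta> B 0"
  unfolding in_span_def by (rule exI[of _ "\<lambda>_. 0"]) simp

lemma in_span_sum: "(\<And>a. a \<in> S \<Longrightarrow> in_span X \<eta> B (f a)) \<Longrightarrow> in_span X \<eta> B (sum f S)"
  by (induction S rule: infinite_finite_induct) (auto intro: in_span_0 in_span_add)

lemma in_span_gen:
  assumes "finite B" "b \<in> B"
  shows "in_span X \<eta> B b"
proof -
  have "(\<Sum>c\<in>B. pev (if c = b then 1 else 0) (pmap \<eta> x) * pev c x) = (\<Sum>c\<in>B. if c = b then pev b x else 0)" for x
    by (rule sum.cong) auto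
  then show ?thesis unfolding in_span_def using assms
    by (intro exI[of _ "\<lambda>c. if c = b then 1 else 0"]) simp
qed

lemma in_span_cong:
  "in_span X \<eta> B g \<Longrightarrow> (\<And>x. x \<in> X \<Longrightarrow> pev h x = pev g x) \<Longrightarrow> in_span X \<eta> B h"
  unfolding in_span_def by auto

text \<open>The functions on \<open>X\<close> form a finite module over the polynomials in \<eta>;
  geometrically, \<eta> is a finite map on \<open>X\<close>.\<close>

definition module_finite :: "(nat \<Rightarrow> complex) set \<Rightarrow> (nat \<Rightarrow> pfun) \<Rightarrow> pfun set \<Rightarrow> bool" where
  "module_finite X \<eta> B \<longleftrightarrow> finite B \<and> (\<forall>h. in_span X \<eta> B h)"

lemma line_expansion: "\<exists>\<alpha>. \<forall>y s. pev P (\<lambda>i. y i + s * w i) = ev2 \<alpha> y s"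
proof (induction P)
  case (const c) show ?case by (rule exI[of _ "[:pconst c:]"]) simp
next
  case (var i) show ?case by (rule exI[of _ "[:pvar i, pconst (w i):]"]) simp
next
  case (add P Q)
  then obtain A B where "\<forall>y s. pev P (\<lambda>i. y i + s * w i) = ev2 A y s" "\<forall>y s. pev Q (\<lambda>i. y i + s * w i) = ev2 B y s"
    by blast
  then show ?case by (intro exI[of _ "A + B"]) simp
next
  case (mult P Q)
  then obtain A B where "\<forall>y s. pev P (\<lambda>i. y i + s * w i) = ev2 A y s" "\<forall>y s. pev Q (\<lambda>i. y i + s * w i) = ev2 B y s"
    by blast
  then show ?case by (intro exI[of _ "A * B"]) simp
qed

definition noether_base :: "nat \<Rightarrow> nat \<Rightarrow> (nat \<Rightarrow> pfun) \<Rightarrow> bool" where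
  "noether_base m r \<eta> \<longleftrightarrow> (\<forall>i. \<eta> (r + i) = pvar (m + i)) \<and>
    (\<forall>i<r. \<forall>x x'. (\<forall>j<m. x' j = x j) \<longrightarrow> pev (\<eta> i) x' = pev (\<eta> i) x)"

text \<open>Along a direction \<open>w\<close> in which its top form is nonzero, a relation among
  the functions \<eta> has a constant leading coefficient. The coordinate \<open>s\<close> along
  \<open>w\<close> is then integral over the coordinates transversal to it, which saves one
  function.\<close>

lemma noether_step:
  assumes B: "module_finite X \<eta> B" and base: "noether_base m r \<eta>" and dep: "\<not> indep X \<eta>"
    and cyl: "\<And>x x'. x \<in> X \<Longrightarrow> (\<And>i. i < m \<Longrightarrow> x' i = x i) \<Longrightarrow> x' \<in> X" and ne: "X \<noteq> {}"
  shows "\<exists>\<eta>' B' r'. r' < r \<and> module_finite X \<eta>' B' \<and> noether_base m r' \<eta>'"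
proof -
  have \<eta>p: "\<eta> i = pvar (m + (i - r))" if "i \<ge> r" for i
    using base that unfolding noether_base_def by (metis le_add_diff_inverse)
  have \<eta>c: "pev (\<eta> i) x' = pev (\<eta> i) x" if "i < r" "\<And>j. j < m \<Longrightarrow> x' j = x j" for i x x'
    using base that unfolding noether_base_def by blast
  obtain P0 where P0: "P0 \<noteq> 0" "\<And>x. x \<in> X \<Longrightarrow> pev P0 (pmap \<eta> x) = 0"
    using dep by (auto simp: indep_def)
  then obtain y0 where y0: "pev P0 y0 \<noteq> 0" by (auto simp: pfun_neq0)
  \<comment> \<open>The parameters are frozen at values of \<open>y0\<close>, so that the relation
    involves the first \<open>r\<close> functions only and the others stay free coordinates.\<close>
  obtain P where P: "\<And>z. pev P z = pev P0 (\<lambda>i. if i < r then z i else y0 i)"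
    using pfun_fix_params by blast
  have P_X: "pev P (pmap \<eta> x) = 0" if "x \<in> X" for x
  proof -
    define x' where "x' = (\<lambda>i. if i < m then x i else y0 (r + (i - m)))"
    have "x' \<in> X" by (rule cyl[OF that]) (simp add: x'_def)
    moreover have "pmap \<eta> x' = (\<lambda>i. if i < r then pmap \<eta> x i else y0 i)"
    proof
      fix i
      show "pmap \<eta> x' i = (if i < r then pmap \<eta> x i else y0 i)"
        using \<eta>c[of i x' x] \<eta>p[of i] by (auto simp: pmap_def x'_def)
    qed
    ultimately show ?thesis using P0(2) P by metis
  qed
  have "pev P y0 \<noteq> 0" using y0 by (simp add: P)
  then have "P \<noteq> 0" by auto
  define \<sigma> where "\<sigma> = (\<lambda>i. if i < r then pvar i else 0)"
  have \<sigma>P: "psubst \<sigma> P = P"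
    by (rule pfun_eqI) (auto simp: P \<sigma>_def intro!: arg_cong[of _ _ "pev P0"])
  have \<sigma>: "phom 1 (\<sigma> i)" "psubst \<sigma> (\<sigma> i) = \<sigma> i" for i
    using phom.var[of i] phom.zero[of 1] by (auto simp: \<sigma>_def intro: pfun_eqI)
  obtain K T where T: "T \<noteq> 0" "psubst \<sigma> T = T" and
    line: "\<And>u. \<exists>\<alpha>. degree \<alpha> \<le> K \<and> coeff \<alpha> K = pconst (pev T u) \<and> (\<forall>y s. pev P (\<lambda>i. y i + s * u i) = ev2 \<alpha> y s)"
  proof (rule pfun_top[OF \<open>P \<noteq> 0\<close> \<sigma> \<sigma>P])
    fix K T
    assume a: "T \<noteq> 0" "psubst \<sigma> T = T"
      "\<And>u. \<exists>\<alpha>. degree \<alpha> \<le> K \<and> coeff \<alpha> K = pconst (pev T u) \<and> (\<forall>y s. pev P (\<lambda>i. y i + s * u i) = ev2 \<alpha> y s)"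
    show thesis by (rule that[OF a])
  qed
  have r: "r > 0"
  proof (rule ccontr)
    assume "\<not> r > 0"
    then have "pev P z = pev P0 y0" for z by (simp add: P)
    then show False using P_X ne y0 by auto
  qed
  \<comment> \<open>Besides the top form, the last entry of \<open>w\<close> must be nonzero, since
    \<open>\<eta> (r - 1)\<close> is the function to be eliminated.\<close>
  have "pvar (r - 1) \<noteq> 0" by (auto simp: pfun_neq0 intro!: exI[of _ "\<lambda>_. 1"])
  then have "T * pvar (r - 1) \<noteq> 0" using T by simp
  then obtain w0 where w0: "pev (T * pvar (r - 1)) w0 \<noteq> 0" using pfun_neq0 by blast
  define w where "w = (\<lambda>i. if i < r then w0 i else 0)"
  have "pev T w = pev (psubst \<sigma> T) w0" by (auto simp: w_def \<sigma>_def intro!: arg_cong[of _ _ "pev T"])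
  then have w: "pev T w \<noteq> 0" "w (r - 1) \<noteq> 0" "\<And>i. i \<ge> r \<Longrightarrow> w i = 0"
    using w0 T r by (auto simp: w_def)
  obtain \<alpha> where \<alpha>: "degree \<alpha> \<le> K" "coeff \<alpha> K = pconst (pev T w)"
    "\<And>y s. pev P (\<lambda>i. y i + s * w i) = ev2 \<alpha> y s" using line by blast
  have "pconst (pev T w) \<noteq> 0" using w by (auto simp: pfun_neq0)
  then have d\<alpha>: "degree \<alpha> = K" using \<alpha> by (metis le_antisym le_degree)
  \<comment> \<open>The first \<open>r - 1\<close> new functions do not change when the old ones
    move along \<open>w\<close>; the parameters move down by one place.\<close>
  define \<eta>' where "\<eta>' i = (if i < r - 1 then \<eta> i - pconst (w i / w (r - 1)) * \<eta> (r - 1) else \<eta> (i + 1))" for i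
  define s where "s = pconst (1 / w (r - 1)) * \<eta> (r - 1)"
  \<comment> \<open>A zero is inserted at place \<open>r - 1\<close>: \<open>Y x\<close> is the
    point with vanishing entry there on the line through \<open>pmap \<eta> x\<close> in direction
    \<open>w\<close>.\<close>
  define \<iota> where "\<iota> i = (if i < r - 1 then pvar i else if i = r - 1 then 0 else pvar (i - 1))" for i
  define Y where "Y x = (\<lambda>i. pev (\<iota> i) (pmap \<eta>' x))" for x
  have \<eta>Y: "pmap \<eta> x = (\<lambda>i. Y x i + pev s x * w i)" for x
  proof
    fix i
    consider "i < r - 1" | "i = r - 1" | "i \<ge> r" using r by linarith
    then show "pmap \<eta> x i = Y x i + pev s x * w i"
    proof cases
      case 3
      then have "i - 1 + 1 = i" "\<not> i - 1 < r - 1" using r by auto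
      then show ?thesis using 3 w r by (auto simp: pmap_def Y_def \<iota>_def \<eta>'_def)
    qed (use w in \<open>simp_all add: pmap_def Y_def \<iota>_def \<eta>'_def s_def\<close>)
  qed
  have \<alpha>0: "ev2 \<alpha> (Y x) (pev s x) = 0" if "x \<in> X" for x
    using P_X[OF that] by (simp add: \<eta>Y \<alpha>(3))
  define B' where "B' = (\<lambda>(l, b). s ^ l * b) ` ({..<K} \<times> B)"
  have finB: "finite B" using B by (simp add: module_finite_def)
  then have finB': "finite B'" by (simp add: B'_def)
  have red: "in_span X \<eta>' B' (psubst \<eta> A * b)" if b: "b \<in> B" for A b
  proof -
    \<comment> \<open>A coefficient in the old functions is a polynomial in \<open>s\<close> over
      the new ones, and division by \<alpha> brings its degree below \<open>K\<close>.\<close>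
    obtain \<beta> where \<beta>: "\<And>y t. pev A (\<lambda>i. y i + t * w i) = ev2 \<beta> y t" using line_expansion by blast
    obtain \<gamma> \<rho> where \<gamma>: "\<beta> = \<alpha> * \<gamma> + \<rho>" "\<rho> = 0 \<or> degree \<rho> < degree \<alpha>"
      using poly_division_const_lead[of \<alpha> "pev T w" \<beta>] \<alpha>(2) d\<alpha> w by auto
    have "pev A (pmap \<eta> x) = (\<Sum>l<K. pev (coeff \<rho> l) (Y x) * pev s x ^ l)" if "x \<in> X" for x
    proof -
      have "pev A (pmap \<eta> x) = ev2 \<rho> (Y x) (pev s x)"
        using \<alpha>0[OF that] by (simp add: \<eta>Y \<beta> \<gamma>(1))
      also have "\<dots> = (\<Sum>l<K. pev (coeff \<rho> l) (Y x) * pev s x ^ l)"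
      proof (cases "\<rho> = 0")
        case False
        then have "degree \<rho> \<le> K - 1" "K > 0" using \<gamma>(2) d\<alpha> by auto
        then show ?thesis using ev2_altdef[of \<rho> "K - 1"] lessThan_Suc_atMost[of "K - 1"] by simp
      qed simp
      finally show ?thesis .
    qed
    moreover have "in_span X \<eta>' B' (\<Sum>l<K. psubst \<eta>' (psubst \<iota> (coeff \<rho> l)) * (s ^ l * b))"
      using b by (intro in_span_sum in_span_scale in_span_gen[OF finB']) (auto simp: B'_def)
    ultimately show ?thesis
      by (rule_tac in_span_cong) (auto simp: Y_def pmap_def sum_distrib_left sum_distrib_right mult_ac)
  qed
  have "in_span X \<eta>' B' h" for h
  proof -
    obtain A where A: "\<forall>x\<in>X. pev h x = (\<Sum>b\<in>B. pev (A b) (pmap \<eta> x) * pev b x)"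
      using B unfolding module_finite_def in_span_def by blast
    have "in_span X \<eta>' B' (\<Sum>b\<in>B. psubst \<eta> (A b) * b)"
      by (intro in_span_sum red)
    then show ?thesis by (rule in_span_cong) (use A in \<open>simp add: pmap_def\<close>)
  qed
  then have "module_finite X \<eta>' B'" using finB' by (simp add: module_finite_def)
  moreover have "noether_base m (r - 1) \<eta>'"
    unfolding noether_base_def
  proof (intro conjI allI impI)
    fix i
    have "r - 1 + i + 1 = r + i" "\<not> r - 1 + i < r - 1" using r by auto
    then have "\<eta>' (r - 1 + i) = \<eta> (r + i)" by (simp only: \<eta>'_def if_False)
    then show "\<eta>' (r - 1 + i) = pvar (m + i)" using \<eta>p[of "r + i"] by simp
  next
    fix i and x x' :: "nat \<Rightarrow> complex" assume "i < r - 1" "\<forall>j<m. x' j = x j"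
    then show "pev (\<eta>' i) x' = pev (\<eta>' i) x"
      using \<eta>c[of i x' x] \<eta>c[of "r - 1" x' x] r by (simp add: \<eta>'_def)
  qed
  ultimately show ?thesis using r by (intro exI[of _ \<eta>'] exI[of _ B'] exI[of _ "r - 1"]) simp
qed

lemma noether_normalization:
  assumes cyl: "\<And>x x'. x \<in> X \<Longrightarrow> (\<And>i. i < m \<Longrightarrow> x' i = x i) \<Longrightarrow> x' \<in> X" and ne: "X \<noteq> {}"
  obtains \<eta> B r where "module_finite X \<eta> B" "noether_base m r \<eta>" "indep X \<eta>"
proof -
  let ?P = "\<lambda>r. \<exists>\<eta> B. module_finite X \<eta> B \<and> noether_base m r \<eta>"
  have "in_span X pvar {1} h" for h
    unfolding in_span_def by (rule exI[of _ "\<lambda>_. h"]) (simp add: pmap_def)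
  then have "?P m"
    by (intro exI[of _ pvar] exI[of _ "{1}"]) (auto simp: module_finite_def noether_base_def)
  then obtain r where r: "?P r" and min: "\<And>r'. ?P r' \<Longrightarrow> r \<le> r'"
    using ex_has_least_nat[of ?P m "\<lambda>r. r"] by blast
  then obtain \<eta> B where *: "module_finite X \<eta> B" "noether_base m r \<eta>" by blast
  have "indep X \<eta>"
  proof (rule ccontr)
    assume dep: "\<not> indep X \<eta>"
    have "\<exists>\<eta>' B' r'. r' < r \<and> module_finite X \<eta>' B' \<and> noether_base m r' \<eta>'"
      by (rule noether_step[OF * dep _ ne]) (rule cyl)
    then obtain r' where "r' < r" "?P r'" by blast
    then show False using min[of r'] by simp
  qed
  then show thesis using that * by blast
qed

section \<open>Finite fibres and bounds for integral functions\<close>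

lemma module_finite_alg:
  assumes "module_finite X \<eta> B"
  shows "alg X \<eta> h"
proof -
  have fin: "finite B" using assms by (simp add: module_finite_def)
  have "\<forall>l. \<exists>A. \<forall>x\<in>X. pev (h ^ l) x = (\<Sum>b\<in>B. pev (A b) (pmap \<eta> x) * pev b x)"
    using assms unfolding module_finite_def in_span_def by blast
  from choice[OF this] obtain A where
    A: "\<And>l x. x \<in> X \<Longrightarrow> pev h x ^ l = (\<Sum>b\<in>B. pev (A l b) (pmap \<eta> x) * pev b x)" by auto
  obtain \<mu> where \<mu>: "\<exists>l\<in>{..card B}. \<mu> l \<noteq> 0" "\<And>b. b \<in> B \<Longrightarrow> (\<Sum>l\<in>{..card B}. \<mu> l * A l b) = 0"
    using lin_dep[of B "{..card B}" A] fin by auto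
  define Q where "Q = (\<Sum>l\<le>card B. monom (\<mu> l) l)"
  have "coeff Q l = \<mu> l" if "l \<le> card B" for l
    using that by (simp add: Q_def coeff_sum sum.delta)
  then have "Q \<noteq> 0" using \<mu>(1) by auto
  moreover have "relation X \<eta> h Q" unfolding relation_def
  proof
    fix x assume x: "x \<in> X"
    have "ev2 Q (pmap \<eta> x) (pev h x) = (\<Sum>l\<le>card B. pev (\<mu> l) (pmap \<eta> x) * pev h x ^ l)"
      by (simp add: Q_def)
    also have "\<dots> = (\<Sum>l\<le>card B. \<Sum>b\<in>B. pev (\<mu> l * A l b) (pmap \<eta> x) * pev b x)"
      by (simp only: A[OF x] sum_distrib_left) (simp add: mult.assoc)
    also have "\<dots> = (\<Sum>b\<in>B. pev (\<Sum>l\<le>card B. \<mu> l * A l b) (pmap \<eta> x) * pev b x)"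
      by (subst sum.swap) (simp add: sum_distrib_right)
    also have "\<dots> = 0" using \<mu>(2) by (intro sum.neutral) auto
    finally show "ev2 Q (pmap \<eta> x) (pev h x) = 0" .
  qed
  ultimately show ?thesis by (auto simp: alg_def)
qed

lemma pfun_separate:
  assumes "finite S" "x \<in> S"
  shows "\<exists>h. pev h x = 1 \<and> (\<forall>z\<in>S - {x}. pev h z = 0)"
proof -
  have "\<forall>z\<in>S - {x}. \<exists>i. x i \<noteq> z i" by (metis DiffD2 ext singletonI)
  then obtain i where i: "\<And>z. z \<in> S - {x} \<Longrightarrow> x (i z) \<noteq> z (i z)" by metis
  let ?h = "\<Prod>z\<in>S - {x}. pconst (1 / (x (i z) - z (i z))) * (pvar (i z) - pconst (z (i z)))"
  show ?thesis
    by (rule exI[of _ ?h]) (use assms i in \<open>auto intro!: prod.neutral prod_zero\<close>)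
qed

text \<open>Functions separating the points of a fibre are combinations of \<open>B\<close> with
  coefficients that are constant on the fibre, so there are at most \<open>card B\<close> such
  points.\<close>

lemma module_finite_fibre:
  assumes "module_finite X \<eta> B"
  shows "finite {x \<in> X. pmap \<eta> x = y}"
proof (rule ccontr)
  have finB: "finite B" using assms by (simp add: module_finite_def)
  assume "infinite {x \<in> X. pmap \<eta> x = y}"
  then obtain S where S: "S \<subseteq> {x \<in> X. pmap \<eta> x = y}" "finite S" "card S = Suc (card B)"
    by (meson infinite_arbitrarily_large)
  obtain h where h: "\<And>x. x \<in> S \<Longrightarrow> pev (h x) x = 1" "\<And>x z. x \<in> S \<Longrightarrow> z \<in> S \<Longrightarrow> z \<noteq> x \<Longrightarrow> pev (h x) z = 0"
    using pfun_separate[OF S(2)] by (metis DiffI singletonD)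
  have "\<forall>z. \<exists>A. \<forall>x\<in>X. pev (h z) x = (\<Sum>b\<in>B. pev (A b) (pmap \<eta> x) * pev b x)"
    using assms unfolding module_finite_def in_span_def by blast
  from choice[OF this] obtain A where
    A: "\<And>z x. x \<in> X \<Longrightarrow> pev (h z) x = (\<Sum>b\<in>B. pev (A z b) (pmap \<eta> x) * pev b x)" by blast
  obtain \<mu> where \<mu>: "\<exists>z\<in>S. \<mu> z \<noteq> 0" "\<And>b. b \<in> B \<Longrightarrow> (\<Sum>z\<in>S. \<mu> z * pev (A z b) y) = 0"
    using lin_dep[of B S "\<lambda>z b. pev (A z b) y"] S finB by auto
  have "\<mu> x = 0" if "x \<in> S" for x
  proof -
    have "\<mu> x = (\<Sum>z\<in>S. if z = x then \<mu> x else 0)" using that S by simp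
    also have "\<dots> = (\<Sum>z\<in>S. \<mu> z * pev (h z) x)" using h that by (intro sum.cong) auto
    also have "\<dots> = (\<Sum>z\<in>S. \<mu> z * (\<Sum>b\<in>B. pev (A z b) y * pev b x))"
      using A[of x] S that by (intro sum.cong) auto
    also have "\<dots> = (\<Sum>z\<in>S. \<Sum>b\<in>B. \<mu> z * pev (A z b) y * pev b x)"
      by (simp only: sum_distrib_left mult.assoc)
    also have "\<dots> = (\<Sum>b\<in>B. (\<Sum>z\<in>S. \<mu> z * pev (A z b) y) * pev b x)"
      by (subst sum.swap) (simp add: sum_distrib_right)
    finally show ?thesis using \<mu>(2) by simp
  qed
  then show False using \<mu>(1) by blast
qed

text \<open>Multiplication by \<open>h\<close> acts on the generators through a matrix that depends
  on \<open>pmap \<eta> x\<close> only. The row of a generator of largest modulus at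
  \<open>x\<close> bounds \<open>h\<close> by the sum of the moduli of the entries.\<close>

lemma module_finite_bound:
  assumes "module_finite X \<eta> B"
  obtains \<Gamma> :: "(nat \<Rightarrow> complex) \<Rightarrow> real" where "continuous_on UNIV \<Gamma>" "\<And>y. \<Gamma> y \<ge> 0"
    "\<And>x. x \<in> X \<Longrightarrow> norm (pev h x) \<le> \<Gamma> (pmap \<eta> x)"
proof -
  have finB: "finite B" and sp: "\<And>h. in_span X \<eta> B h" using assms by (auto simp: module_finite_def)
  have "\<forall>c. \<exists>A. \<forall>x\<in>X. pev (h * c) x = (\<Sum>b\<in>B. pev (A b) (pmap \<eta> x) * pev b x)"
    using sp unfolding in_span_def by blast
  from choice[OF this] obtain A where
    A: "\<And>c x. x \<in> X \<Longrightarrow> pev h x * pev c x = (\<Sum>b\<in>B. pev (A c b) (pmap \<eta> x) * pev b x)" by auto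
  define \<Gamma> where "\<Gamma> y = (\<Sum>c\<in>B. \<Sum>b\<in>B. norm (pev (A c b) y))" for y
  show thesis
  proof (rule that)
    show "continuous_on UNIV \<Gamma>" unfolding \<Gamma>_def by (intro continuous_intros continuous_on_pev)
    show "\<Gamma> y \<ge> 0" for y unfolding \<Gamma>_def by (intro sum_nonneg) auto
    fix x assume x: "x \<in> X"
    \<comment> \<open>Since \<open>1\<close> lies in the span, the generators have no common zero on
      \<open>X\<close>.\<close>
    obtain A1 where "\<forall>x\<in>X. pev 1 x = (\<Sum>b\<in>B. pev (A1 b) (pmap \<eta> x) * pev b x)"
      using sp unfolding in_span_def by blast
    then have "(\<Sum>b\<in>B. pev (A1 b) (pmap \<eta> x) * pev b x) \<noteq> 0" using x by (metis pev_simps(2) zero_neq_one)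
    then obtain b0 where b0: "b0 \<in> B" "pev b0 x \<noteq> 0" by (metis (no_types, lifting) mult_zero_right sum.neutral)
    let ?M = "Max ((\<lambda>b. norm (pev b x)) ` B)"
    have "?M \<in> (\<lambda>b. norm (pev b x)) ` B" using finB b0 by (intro Max_in) auto
    then obtain c where c: "c \<in> B" "norm (pev c x) = ?M" by auto
    have le: "norm (pev b x) \<le> norm (pev c x)" if "b \<in> B" for b
      unfolding c(2) using finB that by (intro Max_ge) auto
    have c0: "norm (pev c x) > 0" using le[OF b0(1)] b0(2) by (meson less_le_trans zero_less_norm_iff)
    have "norm (pev h x) * norm (pev c x) = norm (\<Sum>b\<in>B. pev (A c b) (pmap \<eta> x) * pev b x)"
      using A[OF x, of c] by (simp flip: norm_mult)
    also have "\<dots> \<le> (\<Sum>b\<in>B. norm (pev (A c b) (pmap \<eta> x)) * norm (pev c x))"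
      by (rule sum_norm_le) (simp add: norm_mult mult_left_mono le)
    also have "\<dots> = (\<Sum>b\<in>B. norm (pev (A c b) (pmap \<eta> x))) * norm (pev c x)" by (simp add: sum_distrib_right)
    also have "\<dots> \<le> \<Gamma> (pmap \<eta> x) * norm (pev c x)"
    proof (rule mult_right_mono)
      show "(\<Sum>b\<in>B. norm (pev (A c b) (pmap \<eta> x))) \<le> \<Gamma> (pmap \<eta> x)"
        unfolding \<Gamma>_def using c finB
        by (intro member_le_sum[of c B "\<lambda>c. \<Sum>b\<in>B. norm (pev (A c b) (pmap \<eta> x))"]) (auto intro: sum_nonneg)
    qed simp
    finally show "norm (pev h x) \<le> \<Gamma> (pmap \<eta> x)" using c0 by simp
  qed
qed

section \<open>Density of generic points\<close>

lemma ev2_at_0: "ev2 Q y 0 = pev (coeff Q 0) y"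
  by (simp add: ev2_def poly_0_coeff_0)

lemma dense_le:
  fixes \<phi> \<psi> :: "(nat \<Rightarrow> complex) \<Rightarrow> real"
  assumes "P \<noteq> 0" "\<And>y. pev P y \<noteq> 0 \<Longrightarrow> \<phi> y \<le> \<psi> y" "continuous_on UNIV \<phi>" "continuous_on UNIV \<psi>"
  shows "\<phi> y \<le> \<psi> y"
proof -
  obtain w where w: "pev P w \<noteq> 0" using assms(1) pfun_neq0 by blast
  define l where "l s = (\<lambda>i. y i + s * (w i - y i))" for s :: complex
  have l: "(l \<longlongrightarrow> y) (at 0)"
    unfolding tendsto_fun_iff l_def by (auto intro!: tendsto_eq_intros)
  have cont: "((\<lambda>s. f (l s)) \<longlongrightarrow> f y) (at 0)" if "continuous_on UNIV f" for f :: "(nat \<Rightarrow> complex) \<Rightarrow> real"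
    using l that by (metis UNIV_I continuous_on_eq_continuous_at isCont_tendsto_compose open_UNIV)
  have "pev P (\<lambda>i. y i + 1 * (w i - y i)) \<noteq> 0" using w by simp
  then have "\<forall>\<^sub>F s in at 0. pev P (l s) \<noteq> 0" unfolding l_def by (rule eventually_line_neq0)
  then have "\<forall>\<^sub>F s in at 0. \<phi> (l s) \<le> \<psi> (l s)" by eventually_elim (rule assms(2))
  then show ?thesis using cont[OF assms(3)] cont[OF assms(4)] by (intro tendsto_le[of "at 0"]) auto
qed

text \<open>On the hypersurface the values of the generic form are bounded in terms of
  \<open>y\<close>, hence so are the coefficients of \<open>F\<close> divided by the leading one. A
  locally bounded quotient of polynomials is a polynomial, so the leading coefficient
  \<open>b\<close> can be divided out.\<close>

lemma (in hypersurface) monic_relation: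
  assumes fin: "module_finite X \<eta> B"
  shows "\<exists>F'. minrel X \<eta> (generic_form m) F' \<and> lead_coeff F' = 1"
proof -
  define b where "b = lead_coeff F"
  have b0: "b \<noteq> 0" using F_neq0 by (simp add: b_def)
  obtain \<Gamma> :: "(nat \<Rightarrow> complex) \<Rightarrow> real" where \<Gamma>: "continuous_on UNIV \<Gamma>" "\<And>y. \<Gamma> y \<ge> 0"
    "\<And>x. x \<in> X \<Longrightarrow> norm (g x) \<le> \<Gamma> (pmap \<eta> x)"
    using module_finite_bound[OF fin] by blast
  define \<Gamma>' where "\<Gamma>' y = (1 + \<Gamma> y) ^ degree F" for y
  have \<Gamma>'c: "continuous_on UNIV \<Gamma>'" unfolding \<Gamma>'_def by (intro continuous_intros \<Gamma>)
  have bound: "norm (pev (coeff F i) y) \<le> \<Gamma>' y * norm (pev b y)" for i y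
  proof (rule dense_le[OF disc_neq0, where \<phi> = "\<lambda>y. norm (pev (coeff F i) y)" and \<psi> = "\<lambda>y. \<Gamma>' y * norm (pev b y)"])
    fix y assume y: "pev disc y \<noteq> 0"
    then have by0: "pev b y \<noteq> 0" by (simp add: disc_def b_def)
    have s0: "spec F y \<noteq> 0" using by0 by (metis b_def coeff_0 coeff_spec)
    have deg: "degree (spec F y) = degree F"
      using by0 by (intro antisym degree_spec_le le_degree) (simp add: b_def)
    have "norm r \<le> \<Gamma> y" if "poly (spec F y) r = 0" for r
    proof -
      have r: "ev2 F y r = 0" using that by (simp add: ev2_def)
      show ?thesis using \<Gamma>(3)[OF pt_in[OF r y]] by (simp add: \<eta>_pt[OF r y] g_pt[OF r y])
    qed
    from poly_coeff_bound[OF s0 this \<Gamma>(2), of i]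
    show "norm (pev (coeff F i) y) \<le> \<Gamma>' y * norm (pev b y)" by (simp add: deg \<Gamma>'_def b_def mult.commute)
  qed (intro continuous_intros continuous_on_pev \<Gamma>'c)+
  have "b dvd coeff F i" for i
  proof -
    have pv: "psubst pvar b = b" "psubst pvar (pvar i) = pvar i" for i by (rule pfun_eqI; simp)+
    obtain K T where T: "T \<noteq> 0" and
      line: "\<And>u. \<exists>\<alpha>. degree \<alpha> \<le> K \<and> coeff \<alpha> K = pconst (pev T u) \<and> (\<forall>y s. pev b (\<lambda>i. y i + s * u i) = ev2 \<alpha> y s)"
    proof (rule pfun_top[OF b0 phom.var pv(2) pv(1)])
      fix K T
      assume a: "T \<noteq> 0" "psubst pvar T = T"
        "\<And>u. \<exists>\<alpha>. degree \<alpha> \<le> K \<and> coeff \<alpha> K = pconst (pev T u) \<and> (\<forall>y s. pev b (\<lambda>i. y i + s * u i) = ev2 \<alpha> y s)"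
      show thesis by (rule that[OF a(1,3)])
    qed
    \<comment> \<open>Along this direction \<open>b\<close> has a constant leading coefficient, so
      that division with remainder applies and divisibility can be tested line by line.\<close>
    obtain w where w: "pev T w \<noteq> 0" using T pfun_neq0 by blast
    obtain \<beta> where \<beta>: "degree \<beta> \<le> K" "coeff \<beta> K = pconst (pev T w)"
      "\<And>y s. pev b (\<lambda>i. y i + s * w i) = ev2 \<beta> y s" using line by blast
    have "pconst (pev T w) \<noteq> 0" using w by (auto simp: pfun_neq0)
    then have d\<beta>: "degree \<beta> = K" using \<beta> by (metis le_antisym le_degree)
    obtain \<alpha> where \<alpha>: "\<And>y s. pev (coeff F i) (\<lambda>i. y i + s * w i) = ev2 \<alpha> y s" using line_expansion by blast
    obtain \<gamma> \<rho> where \<gamma>: "\<alpha> = \<beta> * \<gamma> + \<rho>" "\<rho> = 0 \<or> degree \<rho> < degree \<beta>"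
      using poly_division_const_lead[of \<beta> "pev T w" \<alpha>] \<beta>(2) d\<beta> w by auto
    have deg: "degree (spec \<beta> y) = K" "spec \<beta> y \<noteq> 0" for y
    proof -
      have c: "coeff (spec \<beta> y) K \<noteq> 0" using w by (simp add: \<beta>(2))
      then show "spec \<beta> y \<noteq> 0" by (metis coeff_0)
      show "degree (spec \<beta> y) = K" using le_degree[OF c] degree_spec_le[of \<beta> y] d\<beta> by simp
    qed
    have "spec \<rho> y = 0" for y
    proof -
      let ?l = "\<lambda>s i. y i + s * w i"
      have "spec \<beta> y dvd spec \<alpha> y"
      proof (rule poly_dvd_bounded[where G = "\<lambda>s. \<Gamma>' (?l s)"])
        show "norm (poly (spec \<alpha> y) s) \<le> \<Gamma>' (?l s) * norm (poly (spec \<beta> y) s)" for s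
          using bound[of i "?l s"] by (simp add: \<alpha> \<beta>(3) ev2_def)
        have "continuous_on UNIV ?l"
          by (intro continuous_on_coordinatewise_then_product continuous_intros)
        then show "continuous_on UNIV (\<lambda>s. \<Gamma>' (?l s))"
          by (rule continuous_on_compose2[OF \<Gamma>'c]) auto
      qed (fact deg)
      then have "spec \<beta> y dvd spec \<rho> y" by (simp add: \<gamma>(1) dvd_add_right_iff)
      moreover have "\<rho> = 0 \<or> degree (spec \<rho> y) < K" using \<gamma>(2) d\<beta> degree_spec_le[of \<rho> y] by auto
      ultimately show ?thesis using deg[of y] by (metis dvd_imp_degree_le leD spec_simps(1))
    qed
    then have "\<rho> = 0" using ev2_neq0[of \<rho>] by (auto simp: ev2_def)
    then have "pev (coeff F i) y = pev b y * pev (coeff \<gamma> 0) y" for y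
      using \<alpha>[of y 0] \<beta>(3)[of y 0] ev2_at_0[of \<gamma> y] by (simp add: \<gamma>(1))
    then have "coeff F i = b * coeff \<gamma> 0" by (intro pfun_eqI) simp
    then show ?thesis by simp
  qed
  then have "[:b:] dvd F" by (simp add: const_poly_dvd_iff)
  then obtain F' where F': "F = [:b:] * F'" by blast
  have "lead_coeff F = b * lead_coeff F'" unfolding F' lead_coeff_mult by simp
  then have "b * lead_coeff F' = b * 1" by (simp only: b_def mult_1_right)
  then have lead: "lead_coeff F' = 1" using b0 mult_cancel_left by blast
  have "\<not> relation X \<eta> (generic_form m) [:b:]" using relation_const[OF \<eta>_indep] b0 by blast
  then have "relation X \<eta> (generic_form m) F'"
    using relation_mult[OF X_irr, of \<eta> "generic_form m" "[:b:]" F'] F_rel F' by auto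
  moreover have "degree F' = degree F" using b0 by (simp add: F')
  ultimately have "minrel X \<eta> (generic_form m) F'"
    using minrel lead by (auto simp: minrel_def)
  then show ?thesis using lead by blast
qed

text \<open>Where the constant coefficient of \<open>Q\<close> is nonzero, \<open>h\<close> cannot
  vanish. The condition on \<open>h\<close> thus becomes a condition on the values of \<eta>, which
  can be met over a prescribed region.\<close>

lemma alg_nonvanishing:
  assumes X: "irr X" and "alg X \<eta> h" and x1: "x1 \<in> X" "pev h x1 \<noteq> 0"
  obtains Q where "relation X \<eta> h Q" "coeff Q 0 \<noteq> 0"
proof -
  obtain Q where Q: "Q \<noteq> 0" "relation X \<eta> h Q" using assms(2) by (auto simp: alg_def)
  define k where "k = order 0 Q"
  obtain Q' where Q': "Q = [:- 0, 1:] ^ k * Q'" "\<not> [:- 0, 1:] dvd Q'"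
    using order_decomp[OF Q(1), of 0] unfolding k_def by blast
  have c: "coeff Q' 0 \<noteq> 0" using Q'(2) by (simp only: poly_eq_0_iff_dvd[symmetric] poly_0_coeff_0) simp
  have "pev h x ^ k * pev (psubst2 \<eta> h Q') x = 0" if "x \<in> X" for x
    using Q(2) that by (auto simp: relation_def Q')
  from irr_power[OF X this x1] have "relation X \<eta> h Q'" by (simp add: relation_def)
  then show thesis using that c by blast
qed

lemma (in hypersurface) root_near:
  assumes "pev (lead_coeff F) y \<noteq> 0"
  shows "\<exists>r. ev2 F y r = 0 \<and> norm (pev (lead_coeff F) y) * norm (z - r) ^ degree F \<le> norm (ev2 F y z)"
proof -
  have deg: "degree (spec F y) = degree F"
    using assms by (intro antisym degree_spec_le le_degree) simp
  have "degree (spec F y) > 0" using degree_F deg by simp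
  from poly_root_near[OF this, of z] show ?thesis by (simp add: ev2_def deg)
qed

lemma compact_box: "compact {x :: nat \<Rightarrow> complex. \<forall>i. norm (x i) \<le> M i}"
proof -
  have "compactin (product_topology (\<lambda>_. euclidean) UNIV) (Pi\<^sub>E UNIV (\<lambda>i. cball (0::complex) (M i)))"
    unfolding compactin_PiE by simp
  moreover have "Pi\<^sub>E UNIV (\<lambda>i. cball (0::complex) (M i)) = {x. \<forall>i. norm (x i) \<le> M i}"
    by (auto simp: PiE_def Pi_def)
  ultimately show ?thesis by (simp add: euclidean_product_topology)
qed

text \<open>Over generic points near the image of \<open>p\<close>, roots of the monic relation
  close to the value of the form give points of \<open>X\<close>. They stay bounded because \<eta>
  is finite, and a limit has the image of \<open>p\<close> and the same value of the form. For
  suitable parameters this value singles out \<open>p\<close> in its finite fibre.\<close>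

theorem density:
  assumes X: "irr X" and cyl: "\<And>x x'. x \<in> X \<Longrightarrow> (\<And>i. i < m \<Longrightarrow> x' i = x i) \<Longrightarrow> x' \<in> X"
    and closed: "\<And>x. (\<And>P. (\<forall>z\<in>X. pev P z = 0) \<Longrightarrow> pev P x = 0) \<Longrightarrow> x \<in> X"
    and p: "p \<in> X" and h: "x1 \<in> X" "pev h x1 \<noteq> 0" and e: "e > 0"
  shows "\<exists>x\<in>X. pev h x \<noteq> 0 \<and> (\<forall>i<m. norm (x i - p i) < e)"
proof (rule ccontr)
  assume none: "\<not> ?thesis"
  have "X \<noteq> {}" using p by auto
  obtain \<eta> B d where B: "module_finite X \<eta> B" and base: "noether_base m d \<eta>" and ind: "indep X \<eta>"
    by (rule noether_normalization[of X m]) (use cyl \<open>X \<noteq> {}\<close> in blast)+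
  interpret param_base X m d \<eta>
  proof
    show "irr X" "indep X \<eta>" by fact+
    show "x' \<in> X" if "x \<in> X" "\<And>i. i < m \<Longrightarrow> x' i = x i" for x x' using cyl that .
    show "x \<in> X" if "\<And>P. (\<forall>z\<in>X. pev P z = 0) \<Longrightarrow> pev P x = 0" for x using closed that .
    show "\<eta> (d + i) = pvar (m + i)" for i using base by (simp add: noether_base_def)
    show "pev (\<eta> i) x' = pev (\<eta> i) x" if "i < d" "\<And>j. j < m \<Longrightarrow> x' j = x j" for i x x'
      using base that unfolding noether_base_def by blast
  qed
  obtain F0 where "minrel X \<eta> (generic_form m) F0" using alg_minrel[OF module_finite_alg[OF B]] .
  then interpret F0: hypersurface X m d \<eta> F0 by unfold_locales
  obtain F where Fmin: "minrel X \<eta> (generic_form m) F" and monic: "lead_coeff F = 1" using F0.monic_relation[OF B] by blast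
  interpret hypersurface X m d \<eta> F using Fmin by unfold_locales
  obtain Q where Q: "relation X \<eta> h Q" "coeff Q 0 \<noteq> 0" using alg_nonvanishing[OF X module_finite_alg[OF B] h] .
  have h_neq0: "pev h x \<noteq> 0" if "x \<in> X" "pev (coeff Q 0) (pmap \<eta> x) \<noteq> 0" for x
    using Q(1) that by (auto simp: relation_def simp flip: ev2_at_0)
  define \<Phi> where "\<Phi> = {x \<in> X. pmap \<eta> x = pmap \<eta> p}"
  have fin\<Phi>: "finite \<Phi>" unfolding \<Phi>_def by (rule module_finite_fibre[OF B])
  \<comment> \<open>At \<open>u\<close> this is the difference of the form with coefficients
    \<open>u\<close> between \<open>q\<close> and \<open>p\<close>; one \<open>u\<close> outside of
    the zeros of all these functions separates \<open>p\<close> from the rest of the fibre.\<close>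
  define L where "L q = (\<Sum>i<m. pconst (q i - p i) * pvar i)" for q
  have L: "L q \<noteq> 0" if q: "q \<in> \<Phi>" "q \<noteq> p" for q
  proof -
    obtain i where i: "q i \<noteq> p i" using q(2) by auto
    have "i < m"
    proof (rule ccontr)
      assume "\<not> i < m"
      then have "x i = pmap \<eta> x (d + (i - m))" for x by (simp add: pmap_def \<eta>_param del: Nat.add_diff_assoc)
      from this[of p] this[of q] show False using q(1) i by (simp only: \<Phi>_def mem_Collect_eq)
    qed
    have "pev (L q) (\<lambda>j. if j = i then 1 else 0) = (\<Sum>j<m. if j = i then q i - p i else 0)"
      unfolding L_def pev_sum by (rule sum.cong) auto
    then have "pev (L q) (\<lambda>j. if j = i then 1 else 0) \<noteq> 0" using i \<open>i < m\<close> by simp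
    then show ?thesis by auto
  qed
  have "(\<Prod>q\<in>\<Phi> - {p}. L q) \<noteq> 0" using L fin\<Phi> by simp
  then obtain u where "pev (\<Prod>q\<in>\<Phi> - {p}. L q) u \<noteq> 0" using pfun_neq0 by blast
  then have u: "(\<Sum>i<m. (q i - p i) * u i) \<noteq> 0" if "q \<in> \<Phi>" "q \<noteq> p" for q
    using that fin\<Phi> by (auto simp: L_def)
  define p0 where "p0 = (\<lambda>i. if i < m then p i else u (i - m))"
  have p0: "p0 \<in> X" by (rule X_cyl[OF p]) (simp add: p0_def)
  define y0 where "y0 = pmap \<eta> p0"
  have y0_less: "y0 i = pmap \<eta> p i" if "i < d" for i
    using \<eta>_cong[OF that, of p0 p] by (simp add: y0_def pmap_def p0_def)
  have root0: "ev2 F y0 (g p0) = 0" using F_rel p0 by (simp add: relation_def y0_def)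
  have "disc * coeff Q 0 \<noteq> 0" using disc_neq0 Q by simp
  then obtain w where w: "pev (disc * coeff Q 0) w \<noteq> 0" using pfun_neq0 by blast
  \<comment> \<open>The points approach \<open>y0\<close> from a point \<open>w\<close> outside of
    the zeros of \<open>disc\<close>, where \<open>pt\<close> is available, and of the constant
    coefficient of \<open>Q\<close>, which keeps \<open>h\<close> nonzero.\<close>
  define y where "y n = (\<lambda>i. y0 i + inverse (of_nat (Suc n)) * (w i - y0 i))" for n
  have s: "(\<lambda>n. inverse (of_nat (Suc n)) :: complex) \<longlonglongrightarrow> 0" by (rule LIMSEQ_Suc[OF lim_inverse_n])
  have y_lim: "(\<lambda>n. y n i) \<longlonglongrightarrow> y0 i" for i
    using tendsto_add[OF tendsto_const[of "y0 i"] tendsto_mult[OF s tendsto_const[of "w i - y0 i"]]]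
    by (simp add: y_def del: of_nat_Suc)
  have "\<forall>\<^sub>F s in at 0. pev (disc * coeff Q 0) (\<lambda>i. y0 i + s * (w i - y0 i)) \<noteq> 0"
    by (rule eventually_line_neq0[of _ _ 1]) (use w in simp)
  moreover have "filterlim (\<lambda>n. inverse (of_nat (Suc n)) :: complex) (at 0) sequentially"
    using s by (simp add: filterlim_at del: of_nat_Suc)
  ultimately have ev_disc: "\<forall>\<^sub>F n in sequentially. pev (disc * coeff Q 0) (y n) \<noteq> 0"
    unfolding y_def by (rule eventually_compose_filterlim)
  have "\<forall>n. \<exists>r. ev2 F (y n) r = 0 \<and> norm (g p0 - r) ^ degree F \<le> norm (ev2 F (y n) (g p0))"
    using root_near monic by simp
  from choice[OF this] obtain r where r: "\<And>n. ev2 F (y n) (r n) = 0"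
    "\<And>n. norm (g p0 - r n) ^ degree F \<le> norm (ev2 F (y n) (g p0))" by blast
  have "(\<lambda>n. norm (ev2 F (y n) (g p0))) \<longlonglongrightarrow> norm (ev2 F y0 (g p0))"
    by (intro tendsto_norm tendsto_ev2 y_lim tendsto_const)
  then have F_lim: "(\<lambda>n. norm (ev2 F (y n) (g p0))) \<longlonglongrightarrow> 0" by (simp add: root0)
  have "(\<lambda>n. norm (g p0 - r n) ^ degree F) \<longlonglongrightarrow> 0"
    by (rule tendsto_sandwich[OF _ _ tendsto_const F_lim]) (use r in auto)
  then have "(\<lambda>n. root (degree F) (norm (g p0 - r n) ^ degree F)) \<longlonglongrightarrow> root (degree F) 0"
    by (rule tendsto_real_root)
  then have "(\<lambda>n. norm (g p0 - r n)) \<longlonglongrightarrow> 0" using degree_F by (simp add: real_root_power_cancel)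
  then have "(\<lambda>n. g p0 - r n) \<longlonglongrightarrow> 0" by (simp add: tendsto_norm_zero_iff)
  from tendsto_diff[OF tendsto_const[of "g p0"] this] have r_lim: "r \<longlonglongrightarrow> g p0" by simp
  have "\<forall>i. \<exists>\<Gamma> :: (nat \<Rightarrow> complex) \<Rightarrow> real. continuous_on UNIV \<Gamma> \<and> (\<forall>x\<in>X. norm (x i) \<le> \<Gamma> (pmap \<eta> x))"
  proof
    fix i
    show "\<exists>\<Gamma> :: (nat \<Rightarrow> complex) \<Rightarrow> real. continuous_on UNIV \<Gamma> \<and> (\<forall>x\<in>X. norm (x i) \<le> \<Gamma> (pmap \<eta> x))"
    proof (rule module_finite_bound[OF B, of "pvar i"])
      fix \<Gamma> :: "(nat \<Rightarrow> complex) \<Rightarrow> real"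
      assume "continuous_on UNIV \<Gamma>" "\<And>x. x \<in> X \<Longrightarrow> norm (pev (pvar i) x) \<le> \<Gamma> (pmap \<eta> x)"
      then show ?thesis by (intro exI[of _ \<Gamma>]) simp
    qed
  qed
  from choice[OF this] obtain \<Gamma> :: "nat \<Rightarrow> (nat \<Rightarrow> complex) \<Rightarrow> real" where
    \<Gamma>: "\<And>i. continuous_on UNIV (\<Gamma> i)" "\<And>i x. x \<in> X \<Longrightarrow> norm (x i) \<le> \<Gamma> i (pmap \<eta> x)" by blast
  have "(\<lambda>n. \<Gamma> i (y n)) \<longlonglongrightarrow> \<Gamma> i y0" for i
    by (rule continuous_on_tendsto_compose[OF \<Gamma>(1)]) (use y_lim in \<open>auto simp: tendsto_fun_iff\<close>)
  then have "\<forall>\<^sub>F n in sequentially. \<Gamma> i (y n) < \<Gamma> i y0 + 1" for i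
    by (rule order_tendstoD) simp
  then have "\<forall>\<^sub>F n in sequentially. \<forall>i<m. \<Gamma> i (y n) < \<Gamma> i y0 + 1"
    using eventually_ball_finite[of "{..<m}" "\<lambda>n i. \<Gamma> i (y n) < \<Gamma> i y0 + 1" sequentially] by (simp add: Ball_def)
  with ev_disc have "\<forall>\<^sub>F n in sequentially. pev (disc * coeff Q 0) (y n) \<noteq> 0 \<and> (\<forall>i<m. \<Gamma> i (y n) < \<Gamma> i y0 + 1)"
    by eventually_elim auto
  then obtain N where N: "\<And>n. n \<ge> N \<Longrightarrow> pev disc (y n) \<noteq> 0" "\<And>n. n \<ge> N \<Longrightarrow> pev (coeff Q 0) (y n) \<noteq> 0"
    "\<And>n i. n \<ge> N \<Longrightarrow> i < m \<Longrightarrow> \<Gamma> i (y n) < \<Gamma> i y0 + 1" by (auto simp: eventually_sequentially)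
  define x where "x n = pt (y (N + n)) (r (N + n))" for n
  have x: "x n \<in> X" "pmap \<eta> (x n) = y (N + n)" "g (x n) = r (N + n)" for n
    using pt_in[OF r(1) N(1)] \<eta>_pt[OF r(1) N(1)] g_pt[OF r(1) N(1)] by (auto simp: x_def)
  have far: "\<exists>i<m. norm (x n i - p i) \<ge> e" for n
  proof -
    have "pev h (x n) \<noteq> 0" using h_neq0[OF x(1)[of n]] x(2)[of n] N(2)[of "N + n"] by simp
    then show ?thesis using none x(1)[of n] by (meson not_le)
  qed
  \<comment> \<open>Compactness of the infinite product needs a bound for each coordinate; the
    parameters run on the segments from \<open>y0\<close> to \<open>w\<close>.\<close>
  define M where "M i = (if i < m then \<Gamma> i y0 + 1 else norm (y0 (d + (i - m))) + norm (w (d + (i - m)) - y0 (d + (i - m))))" for i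
  have xM: "norm (x n i) \<le> M i" for n i
  proof (cases "i < m")
    case True
    have "norm (x n i) \<le> \<Gamma> i (y (N + n))" using \<Gamma>(2)[OF x(1), of n i] x(2) by simp
    also have "\<dots> < \<Gamma> i y0 + 1" using N(3)[of "N + n" i] True by simp
    finally show ?thesis using True by (simp add: M_def)
  next
    case False
    let ?j = "d + (i - m)"
    have "x n i = y (N + n) ?j" using False by (simp add: x_def pt_def)
    also have "norm \<dots> \<le> norm (y0 ?j) + norm (inverse (of_nat (Suc (N + n))) * (w ?j - y0 ?j))"
      unfolding y_def by (rule norm_triangle_ineq)
    also have "norm (inverse (of_nat (Suc (N + n))) * (w ?j - y0 ?j)) \<le> 1 * norm (w ?j - y0 ?j)"
      unfolding norm_mult by (rule mult_right_mono) (simp_all add: norm_inverse inverse_le_1_iff del: of_nat_Suc)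
    finally show ?thesis using False by (simp add: M_def)
  qed
  have "seq_compact {x :: nat \<Rightarrow> complex. \<forall>i. norm (x i) \<le> M i}"
    by (rule compact_imp_seq_compact[OF compact_box])
  then obtain l \<rho> where l: "strict_mono \<rho>" "(x \<circ> \<rho>) \<longlonglongrightarrow> l"
    using xM by (rule_tac seq_compactE[of _ x]) auto
  have l_i: "(\<lambda>n. x (\<rho> n) i) \<longlonglongrightarrow> l i" for i
    using l(2) by (simp add: tendsto_fun_iff o_def)
  have sub: "(\<lambda>n. f (N + \<rho> n)) \<longlonglongrightarrow> c" if "f \<longlonglongrightarrow> c" for f :: "nat \<Rightarrow> complex" and c
  proof -
    have "strict_mono (\<lambda>n. N + \<rho> n)" using l(1) by (simp add: strict_mono_def)
    from LIMSEQ_subseq_LIMSEQ[OF that this] show ?thesis by (simp add: o_def)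
  qed
  have lX: "l \<in> X"
  proof (rule X_closed)
    fix P assume "\<forall>z\<in>X. pev P z = 0"
    then have "(\<lambda>n. pev P (x (\<rho> n))) \<longlonglongrightarrow> 0" using x(1) by simp
    moreover have "(\<lambda>n. pev P (x (\<rho> n))) \<longlonglongrightarrow> pev P l" by (rule tendsto_pev[OF l_i])
    ultimately show "pev P l = 0" using LIMSEQ_unique by blast
  qed
  have \<eta>l: "pmap \<eta> l = y0"
  proof
    fix i
    have "(\<lambda>n. pev (\<eta> i) (x (\<rho> n))) \<longlonglongrightarrow> pev (\<eta> i) l" by (rule tendsto_pev[OF l_i])
    moreover have "pev (\<eta> i) (x (\<rho> n)) = y (N + \<rho> n) i" for n
      using fun_cong[OF x(2)[of "\<rho> n"], of i] by (simp add: pmap_def)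
    ultimately have "(\<lambda>n. y (N + \<rho> n) i) \<longlonglongrightarrow> pmap \<eta> l i" by (simp add: pmap_def)
    then show "pmap \<eta> l i = y0 i" using sub[OF y_lim] LIMSEQ_unique by blast
  qed
  have "(\<lambda>n. g (x (\<rho> n))) \<longlonglongrightarrow> g l" by (rule tendsto_pev[OF l_i])
  then have gl: "g l = g p0" using sub[OF r_lim] LIMSEQ_unique by (auto simp: x(3))
  have l_par: "l (m + i) = u i" for i
    using fun_cong[OF \<eta>l, of "d + i"] by (simp add: y0_def pmap_def \<eta>_param p0_def)
  \<comment> \<open>The limit has the parameters \<open>u\<close>; those of \<open>p\<close> are
    restored in order to compare it inside the fibre of \<open>p\<close>.\<close>
  define q where "q = (\<lambda>i. if i < m then l i else p i)"
  have qX: "q \<in> X" by (rule X_cyl[OF lX]) (simp add: q_def)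
  have "pmap \<eta> q i = pmap \<eta> p i" for i
  proof (cases "i < d")
    case True
    then show ?thesis
      using \<eta>_cong[OF True, of q l] fun_cong[OF \<eta>l, of i] y0_less[OF True] by (simp add: pmap_def q_def)
  next
    case False
    then show ?thesis using \<eta>_param'[of i] by (simp add: pmap_def q_def del: Nat.add_diff_assoc)
  qed
  then have "q \<in> \<Phi>" using qX by (auto simp: \<Phi>_def)
  moreover have "(\<Sum>i<m. (q i - p i) * u i) = 0"
  proof -
    have "g l - g p0 = (\<Sum>i<m. (q i - p i) * u i)"
      unfolding pev_generic_form sum_subtractf[symmetric]
      by (rule sum.cong) (simp_all add: l_par q_def p0_def right_diff_distrib mult.commute)
    then show ?thesis using gl by simp
  qed
  ultimately have "q = p" using u by blast
  then have lp: "l i = p i" if "i < m" for i using that by (auto simp: q_def dest: fun_cong[of _ _ i])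
  have "(\<lambda>n. \<Sum>i<m. norm (x (\<rho> n) i - p i)) \<longlonglongrightarrow> (\<Sum>i<m. norm (l i - p i))"
    by (intro tendsto_intros l_i)
  moreover have "(\<Sum>i<m. norm (x (\<rho> n) i - p i)) \<ge> e" for n
  proof -
    obtain i where "i < m" "norm (x (\<rho> n) i - p i) \<ge> e" using far by blast
    then show ?thesis using member_le_sum[of i "{..<m}" "\<lambda>i. norm (x (\<rho> n) i - p i)"] by auto
  qed
  ultimately have "(\<Sum>i<m. norm (l i - p i)) \<ge> e" by (intro tendsto_lowerbound[of _ _ sequentially]) auto
  then show False using e by (simp add: lp)
qed

section \<open>Eisenstein series and the modular function\<close>

lemma sum_int_Suc:
  fixes f :: "int \<Rightarrow> real"
  shows "(\<Sum>a\<in>{- int (Suc N)..int (Suc N)}. f a) = (\<Sum>a\<in>{- int N..int N}. f a) + f (int (Suc N)) + f (- int (Suc N))"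
proof -
  have "{- int (Suc N)..int (Suc N)} = insert (- int (Suc N)) (insert (int (Suc N)) {- int N..int N})" by auto
  then show ?thesis by simp
qed

text \<open>The sums tend to \<open>pi^2 / 3\<close>, about \<open>3.2899\<close>; the term at
  \<open>0\<close> is \<open>0\<close> by the convention for division.\<close>

lemma sum_inverse_squares_le: "(\<Sum>a\<in>{- int N..int N}. 1 / (of_int a)\<^sup>2) \<le> (33 / 10 :: real)"
proof -
  let ?f = "\<lambda>N. \<Sum>a\<in>{- int N..int N}. 1 / (of_int a)\<^sup>2 :: real"
  have step: "?f (Suc N) = ?f N + 2 / (real N + 1)\<^sup>2" for N
    by (subst sum_int_Suc) (simp add: power2_eq_square algebra_simps)
  \<comment> \<open>The subtracted term telescopes against the increments. The constant makes the
    start an equality: \<open>5 / 2 = 33 / 10 - 4 / 5\<close>.\<close>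
  have "?f (Suc (Suc N)) \<le> 33 / 10 - 4 / (2 * real N + 5)" for N
  proof (induction N)
    case 0
    show ?case unfolding step by (simp add: power2_eq_square)
  next
    case (Suc N)
    have "2 / (real N + 3)\<^sup>2 \<le> 4 / (2 * real N + 5) - 4 / (2 * real N + 7)"
      by (simp add: divide_simps power2_eq_square) (simp add: algebra_simps)
    then show ?case using Suc.IH step[of "Suc (Suc N)"] by (simp add: add.commute)
  qed
  then have 2: "?f (Suc (Suc N)) \<le> 33 / 10" for N by (rule order_trans) simp
  have 1: "?f (Suc 0) \<le> 33 / 10" unfolding step by simp
  show ?thesis
  proof (cases N)
    case (Suc M)
    then show ?thesis using 1 2 by (cases M) (simp_all only: Suc)
  qed simp
qed

lemma box_summable:
  fixes f :: "int \<times> int \<Rightarrow> real"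
  assumes "\<And>p. f p \<ge> 0" and C: "\<And>N. (\<Sum>a\<in>{- int N..int N}. \<Sum>b\<in>{- int N..int N}. f (a, b)) \<le> C"
  shows "f summable_on A" "infsum f A \<le> C"
proof -
  have bd: "sum f F \<le> C" if F: "finite F" for F
  proof -
    obtain N where N: "fst ` F \<union> snd ` F \<subseteq> {- int N..int N}"
    proof -
      let ?S = "fst ` F \<union> snd ` F"
      have fin: "finite ?S" using F by simp
      have "\<bar>x\<bar> \<le> (\<Sum>x\<in>?S. \<bar>x\<bar>)" if "x \<in> ?S" for x
        using that fin by (intro member_le_sum) auto
      moreover have "(\<Sum>x\<in>?S. \<bar>x\<bar>) \<ge> 0" by (rule sum_nonneg) simp
      ultimately show thesis by (intro that[of "nat (\<Sum>x\<in>?S. \<bar>x\<bar>)"]) (force simp: abs_le_iff)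
    qed
    have "F \<subseteq> {- int N..int N} \<times> {- int N..int N}"
    proof
      fix p assume "p \<in> F"
      then have "fst p \<in> fst ` F" "snd p \<in> snd ` F" by auto
      then have "fst p \<in> {- int N..int N}" "snd p \<in> {- int N..int N}" using N by blast+
      then show "p \<in> {- int N..int N} \<times> {- int N..int N}" by (simp add: mem_Times_iff)
    qed
    then have "sum f F \<le> sum f ({- int N..int N} \<times> {- int N..int N})" using assms by (intro sum_mono2) auto
    also have "\<dots> = (\<Sum>a\<in>{- int N..int N}. \<Sum>b\<in>{- int N..int N}. f (a, b))"
      by (simp add: sum.cartesian_product)
    finally show ?thesis using C[of N] by simp
  qed
  show s: "f summable_on A" using assms bd
    by (intro nonneg_bdd_above_summable_on) (auto intro!: bdd_aboveI[of _ C])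
  show "infsum f A \<le> C" using s bd by (intro infsum_le_finite_sums) auto
qed

section \<open>Convergence and transformation laws of the Eisenstein series\<close>

definition lattice_weight :: "int \<times> int \<Rightarrow> real" where
  "lattice_weight p = (if fst p = 0 then 1 else 1 / (of_int (fst p))\<^sup>2) * (if snd p = 0 then 1 else 1 / (of_int (snd p))\<^sup>2)"

lemma lattice_weight_nonneg: "lattice_weight p \<ge> 0"
  by (simp add: lattice_weight_def)

lemma lattice_weight_summable: "lattice_weight summable_on A"
proof (rule box_summable[OF lattice_weight_nonneg])
  fix N
  let ?B = "{- int N..int N}"
  let ?q = "\<lambda>a::int. if a = 0 then 1 else 1 / (of_int a)\<^sup>2 :: real"
  have "(\<Sum>a\<in>?B. ?q a) = (\<Sum>a\<in>?B. (if a = 0 then 1 else 0) + 1 / (of_int a)\<^sup>2)"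
    by (rule sum.cong) auto
  also have "\<dots> \<le> 1 + 33 / 10" using sum_inverse_squares_le[of N] by (simp add: sum.distrib)
  finally have q: "(\<Sum>a\<in>?B. ?q a) \<le> 43 / 10" by simp
  have "(\<Sum>a\<in>?B. \<Sum>b\<in>?B. lattice_weight (a, b)) = (\<Sum>a\<in>?B. ?q a) * (\<Sum>b\<in>?B. ?q b)"
    unfolding lattice_weight_def fst_conv snd_conv sum_product ..
  also have "\<dots> \<le> 43 / 10 * (43 / 10)"
    using q by (intro mult_mono sum_nonneg) auto
  finally show "(\<Sum>a\<in>?B. \<Sum>b\<in>?B. lattice_weight (a, b)) \<le> 43 / 10 * (43 / 10)" .
qed

text \<open>\<open>t\<close> times the modulus of a nonzero lattice point dominates \<open>1\<close>
  and both integer coordinates. As \<open>k \<ge> 4\<close>, two factors are available for each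
  coordinate; \<open>t\<close> depends on \<open>y\<close> and \<open>Z\<close> only, which makes
  the bound uniform in \<open>z\<close>.\<close>

lemma lattice_term_bound:
  fixes z :: complex and y Z t :: real
  assumes "Im z \<ge> y" "y > 0" "norm z \<le> Z" "k \<ge> 4" "p \<noteq> (0, 0)" and t: "t = 1 + Z / y + 1 / y"
  shows "norm (1 / (of_int (fst p) + of_int (snd p) * z) ^ k) \<le> t ^ k * lattice_weight p"
proof -
  obtain a b where p: "p = (a, b)" by (cases p)
  define N where "N = norm (of_int a + of_int b * z)"
  have Z0: "Z \<ge> 0" using assms(3) norm_ge_zero order_trans by blast
  have "\<bar>of_int b\<bar> * y \<le> \<bar>of_int b\<bar> * Im z" using assms by (intro mult_left_mono) auto
  also have "\<dots> = \<bar>Im (of_int a + of_int b * z)\<bar>" using assms by (simp add: abs_mult)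
  also have "\<dots> \<le> N" unfolding N_def by (rule abs_Im_le_cmod)
  finally have b: "\<bar>of_int b\<bar> \<le> N / y" using assms by (simp add: field_simps)
  have N0: "N \<ge> 0" by (simp add: N_def)
  have t0: "t > 0" using assms Z0 by (simp add: add_pos_nonneg)
  have tb: "\<bar>of_int b\<bar> \<le> t * N"
  proof -
    have "N / y \<le> t * N" using N0 Z0 assms by (simp add: t algebra_simps)
    then show ?thesis using b by simp
  qed
  have ta: "\<bar>of_int a\<bar> \<le> t * N"
  proof -
    have "\<bar>of_int a\<bar> = norm ((of_int a + of_int b * z) - of_int b * z)" by simp
    also have "\<dots> \<le> N + \<bar>of_int b\<bar> * norm z" unfolding N_def
      by (metis norm_mult norm_of_int norm_triangle_ineq4)
    also have "\<dots> \<le> N + N / y * Z" using b assms N0 by (intro add_left_mono mult_mono) auto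
    also have "\<dots> \<le> t * N" using N0 Z0 assms by (simp add: t algebra_simps)
    finally show ?thesis .
  qed
  have tN: "t * N \<ge> 1"
  proof (cases "a = 0")
    case True
    then have "1 \<le> \<bar>b\<bar>" using assms(5) p by auto
    then have "real_of_int 1 \<le> real_of_int \<bar>b\<bar>" by (simp only: of_int_le_iff)
    then show ?thesis using tb by simp
  next
    case False
    then have "1 \<le> \<bar>a\<bar>" by auto
    then have "real_of_int 1 \<le> real_of_int \<bar>a\<bar>" by (simp only: of_int_le_iff)
    then show ?thesis using ta by simp
  qed
  have q: "1 / (t * N)\<^sup>2 \<le> (if c = 0 then 1 else 1 / (of_int c)\<^sup>2)" if "\<bar>of_int c\<bar> \<le> t * N" for c :: int
  proof (cases "c = 0")
    case True
    then show ?thesis using tN by (simp add: divide_le_eq)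
  next
    case False
    have "(of_int c)\<^sup>2 \<le> (t * N)\<^sup>2" using that by (metis abs_ge_zero power2_abs power_mono)
    then show ?thesis using False by (simp add: frac_le)
  qed
  have "1 / (t * N) ^ k \<le> 1 / (t * N) ^ 4"
  proof (rule divide_left_mono)
    show "(t * N) ^ 4 \<le> (t * N) ^ k" using tN assms by (intro power_increasing) auto
    have "t * N > 0" using tN by linarith
    then show "0 < (t * N) ^ k * (t * N) ^ 4" using mult_pos_pos[OF zero_less_power zero_less_power] by blast
  qed simp
  also have "\<dots> = 1 / (t * N)\<^sup>2 * (1 / (t * N)\<^sup>2)" by (simp add: power2_eq_square power4_eq_xxxx)
  also have "\<dots> \<le> lattice_weight p" unfolding lattice_weight_def p fst_conv snd_conv
    by (intro mult_mono q ta tb) auto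
  finally have "t ^ k * (1 / (t * N) ^ k) \<le> t ^ k * lattice_weight p" using t0 by (intro mult_left_mono) auto
  then show ?thesis using t0 by (simp add: p N_def norm_divide norm_power power_mult_distrib)
qed

lemma upper_half_plane_iff: "z \<in> upper_half_plane \<longleftrightarrow> Im z > 0"
  by (simp add: upper_half_plane_def)

lemma open_upper_half_plane: "open upper_half_plane"
  unfolding upper_half_plane_def by (rule open_halfspace_Im_gt)

lemma connected_upper_half_plane: "connected upper_half_plane"
  unfolding upper_half_plane_def by (intro convex_connected convex_halfspace_Im_gt)

definition eis_term :: "nat \<Rightarrow> complex \<Rightarrow> int \<times> int \<Rightarrow> complex" where
  "eis_term k z p = 1 / (of_int (fst p) + of_int (snd p) * z) ^ k"

lemma eisenstein_sum_altdef: "eisenstein_sum k z = infsum (eis_term k z) (UNIV - {(0, 0)})"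
  unfolding eisenstein_sum_def by (rule infsum_cong) (auto simp: eis_term_def)

lemma eis_term_abs_summable:
  assumes "Im z > 0" "k \<ge> 4" "(0, 0) \<notin> A"
  shows "(\<lambda>p. norm (eis_term k z p)) summable_on A"
proof (rule summable_on_comparison_test)
  define t where "t = 1 + norm z / Im z + 1 / Im z"
  show "(\<lambda>p. t ^ k * lattice_weight p) summable_on A"
    by (intro summable_on_cmult_right lattice_weight_summable)
  fix p assume "p \<in> A"
  then have "p \<noteq> (0, 0)" using assms by auto
  then show "norm (eis_term k z p) \<le> t ^ k * lattice_weight p" unfolding eis_term_def
    using assms by (intro lattice_term_bound[of "Im z" z "norm z"]) (auto simp: t_def)
qed simp

lemma lattice_point_neq0:
  assumes "Im z > 0" "p \<noteq> (0, 0)"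
  shows "of_int (fst p) + of_int (snd p) * z \<noteq> 0"
proof
  assume *: "of_int (fst p) + of_int (snd p) * z = 0"
  from arg_cong[OF this, of Im] assms have "snd p = 0" by simp
  then show False using * assms by (cases p) simp
qed

lemma eisenstein_sum_holomorphic:
  assumes "k \<ge> 4"
  shows "eisenstein_sum k holomorphic_on upper_half_plane"
proof -
  let ?L = "UNIV - {(0, 0)} :: (int \<times> int) set"
  have "eisenstein_sum k field_differentiable (at z)" if z: "Im z > 0" for z
  proof -
    \<comment> \<open>Half the height keeps the closed disc in the half-plane, with imaginary parts
      at least \<open>r\<close>.\<close>
    define r where "r = Im z / 2"
    have r: "r > 0" using z by (simp add: r_def)
    have cball: "Im w \<ge> r" "norm w \<le> norm z + r" if "w \<in> cball z r" for w
    proof -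
      have d: "norm (w - z) \<le> r" using that by (simp add: dist_norm norm_minus_commute)
      then have "\<bar>Im (w - z)\<bar> \<le> r" using abs_Im_le_cmod[of "w - z"] by linarith
      then have "- r \<le> Im w - Im z" by (simp add: abs_le_iff)
      then show "Im w \<ge> r" by (simp add: r_def field_simps)
      show "norm w \<le> norm z + r" using d norm_triangle_ineq[of "w - z" z] by simp
    qed
    define t where "t = 1 + (norm z + r) / r + 1 / r"
    have "uniform_limit (cball z r) (\<lambda>F w. \<Sum>p\<in>F. eis_term k w p) (\<lambda>w. infsum (eis_term k w) ?L) (finite_subsets_at_top ?L)"
    proof (rule Weierstrass_m_test_general[where f = "\<lambda>p w. eis_term k w p" and M = "\<lambda>p. t ^ k * lattice_weight p"])
      fix p :: "int \<times> int" and w assume p: "p \<in> ?L" and w: "w \<in> cball z r"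
      show "norm (eis_term k w p) \<le> t ^ k * lattice_weight p" unfolding eis_term_def
        using assms p cball[OF w] r by (intro lattice_term_bound[of r w "norm z + r"]) (auto simp: t_def)
    qed (intro summable_on_cmult_right lattice_weight_summable)
    moreover have "\<forall>\<^sub>F F in finite_subsets_at_top ?L. continuous_on (cball z r) (\<lambda>w. \<Sum>p\<in>F. eis_term k w p) \<and>
        (\<lambda>w. \<Sum>p\<in>F. eis_term k w p) holomorphic_on ball z r"
    proof (rule eventually_finite_subsets_at_top_weakI)
      fix F assume F: "finite F" "F \<subseteq> ?L"
      have "(\<lambda>w. \<Sum>p\<in>F. eis_term k w p) holomorphic_on cball z r"
      proof (intro holomorphic_on_sum)
        fix p assume "p \<in> F"
        then have "of_int (fst p) + of_int (snd p) * w \<noteq> 0" if "w \<in> cball z r" for w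
          using F cball(1)[OF that] r by (intro lattice_point_neq0) auto
        then show "(\<lambda>w. eis_term k w p) holomorphic_on cball z r"
          unfolding eis_term_def by (intro holomorphic_intros) auto
      qed
      then show "continuous_on (cball z r) (\<lambda>w. \<Sum>p\<in>F. eis_term k w p) \<and>
        (\<lambda>w. \<Sum>p\<in>F. eis_term k w p) holomorphic_on ball z r"
        by (meson ball_subset_cball holomorphic_on_imp_continuous_on holomorphic_on_subset)
    qed
    ultimately have "(\<lambda>w. infsum (eis_term k w) ?L) holomorphic_on ball z r"
      by (rule_tac holomorphic_uniform_limit[of z r "\<lambda>F w. \<Sum>p\<in>F. eis_term k w p" "finite_subsets_at_top ?L"]) auto
    then have "eisenstein_sum k holomorphic_on ball z r"
      by (rule holomorphic_transform) (simp add: eisenstein_sum_altdef)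
    then show ?thesis using r by (intro holomorphic_on_imp_differentiable_at[of _ "ball z r"]) auto
  qed
  then show ?thesis
    by (auto simp: holomorphic_on_def upper_half_plane_def intro: field_differentiable_at_within)
qed

lemma eisenstein_sum_shift: "eisenstein_sum k (z + 1) = eisenstein_sum k z"
proof -
  let ?L = "UNIV - {(0, 0)} :: (int \<times> int) set"
  have bij: "bij_betw (\<lambda>(a, b). (a + b, b)) ?L ?L"
    by (rule bij_betw_byWitness[where f' = "\<lambda>(a, b). (a - b, b)"]) auto
  have "eis_term k (z + 1) = (\<lambda>p. eis_term k z ((\<lambda>(a, b). (a + b, b)) p))"
    by (rule ext) (auto simp: eis_term_def algebra_simps split: prod.splits)
  then show ?thesis unfolding eisenstein_sum_altdef
    using infsum_reindex_bij_betw[OF bij, of "eis_term k z"] by simp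
qed

lemma eisenstein_sum_inversion:
  assumes "z \<noteq> 0"
  shows "eisenstein_sum k (- 1 / z) = z ^ k * eisenstein_sum k z"
proof -
  let ?L = "UNIV - {(0, 0)} :: (int \<times> int) set"
  have bij: "bij_betw (\<lambda>(a, b). (- b, a)) ?L ?L"
    by (rule bij_betw_byWitness[where f' = "\<lambda>(a, b). (b, - a)"]) auto
  have "eis_term k (- 1 / z) p = z ^ k * eis_term k z ((\<lambda>(a, b). (- b, a)) p)" for p
  proof -
    have "of_int (fst p) + of_int (snd p) * (- 1 / z) = (of_int (- snd p) + of_int (fst p) * z) / z"
      using assms by (simp add: field_simps)
    then show ?thesis by (simp add: eis_term_def power_divide split: prod.splits)
  qed
  then have "eisenstein_sum k (- 1 / z) = infsum (\<lambda>p. z ^ k * eis_term k z ((\<lambda>(a, b). (- b, a)) p)) ?L"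
    unfolding eisenstein_sum_altdef by (intro infsum_cong)
  also have "\<dots> = infsum (\<lambda>p. z ^ k * eis_term k z p) ?L"
    by (rule infsum_reindex_bij_betw[OF bij])
  also have "\<dots> = z ^ k * eisenstein_sum k z"
    unfolding eisenstein_sum_altdef by (rule infsum_cmult_right')
  finally show ?thesis .
qed

text \<open>For \<open>z = \<i>\<close> and \<open>z = 2 * \<i>\<close> the weights bound the terms of the lattice points other than the four units.\<close>

definition tail_weight :: "int \<times> int \<Rightarrow> real" where
  "tail_weight p = 1 / 4 * (1 / (of_int (fst p))\<^sup>2 * (1 / (of_int (snd p))\<^sup>2)) +
     (if snd p = 0 \<and> \<bar>fst p\<bar> \<ge> 2 then 1 / 4 * (1 / (of_int (fst p))\<^sup>2) else 0) +
     (if fst p = 0 \<and> \<bar>snd p\<bar> \<ge> 2 then 1 / 4 * (1 / (of_int (snd p))\<^sup>2) else 0)"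

lemma tail_weight_nonneg: "tail_weight p \<ge> 0"
  by (simp add: tail_weight_def)

text \<open>The estimates add up to
  \<open>1 / 4 * (33 / 10)^2 + 2 * (1 / 4) * (13 / 10) = 3.3725\<close>, where
  \<open>13 / 10\<close> is \<open>33 / 10\<close> without the terms at \<open>1\<close> and
  \<open>- 1\<close>. The bound has to stay below \<open>4\<close>, the contribution of the units to
  \<open>eisenstein_sum 4 \<i>\<close>.\<close>

lemma tail_weight_sum: "tail_weight summable_on A" "infsum tail_weight A \<le> 339 / 100"
proof -
  have "(\<Sum>a\<in>{- int N..int N}. \<Sum>b\<in>{- int N..int N}. tail_weight (a, b)) \<le> 339 / 100" for N
  proof -
    let ?B = "{- int N..int N}"
    let ?q = "\<lambda>a::int. 1 / (of_int a)\<^sup>2 :: real"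
    let ?r = "\<lambda>a::int. if \<bar>a\<bar> \<ge> 2 then 1 / (of_int a)\<^sup>2 else 0 :: real"
    have q: "(\<Sum>a\<in>?B. ?q a) \<le> 33 / 10" by (rule sum_inverse_squares_le)
    have r: "(\<Sum>a\<in>?B. ?r a) \<le> 13 / 10"
    proof (cases "N = 0")
      case False
      have "(\<Sum>a\<in>?B. ?r a) = (\<Sum>a\<in>?B. ?q a - (if a = 1 then 1 else 0) - (if a = - 1 then 1 else 0))"
        by (rule sum.cong) (auto simp: abs_if split: if_splits)
      then show ?thesis using q False by (simp add: sum_subtractf sum.delta)
    qed simp
    have "(\<Sum>a\<in>?B. \<Sum>b\<in>?B. tail_weight (a, b)) =
       (\<Sum>a\<in>?B. \<Sum>b\<in>?B. 1 / 4 * (?q a * ?q b) + (if b = 0 then 1 / 4 * ?r a else 0) + (if a = 0 then 1 / 4 * ?r b else 0))"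
      by (intro sum.cong refl) (auto simp: tail_weight_def)
    also have "\<dots> = 1 / 4 * ((\<Sum>a\<in>?B. ?q a) * (\<Sum>b\<in>?B. ?q b)) + 1 / 4 * (\<Sum>a\<in>?B. ?r a) + 1 / 4 * (\<Sum>b\<in>?B. ?r b)"
    proof -
      have 1: "(\<Sum>a\<in>?B. \<Sum>b\<in>?B. 1 / 4 * (?q a * ?q b)) = 1 / 4 * ((\<Sum>a\<in>?B. ?q a) * (\<Sum>b\<in>?B. ?q b))"
        unfolding sum_product by (simp only: sum_distrib_left)
      have 2: "(\<Sum>a\<in>?B. \<Sum>b\<in>?B. if b = 0 then 1 / 4 * ?r a else 0) = 1 / 4 * (\<Sum>a\<in>?B. ?r a)"
        by (simp add: sum.delta sum_distrib_left)
      have "(\<Sum>a\<in>?B. \<Sum>b\<in>?B. if a = 0 then 1 / 4 * ?r b else 0) = (\<Sum>a\<in>?B. if a = 0 then (\<Sum>b\<in>?B. 1 / 4 * ?r b) else 0)"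
        by (rule sum.cong) auto
      also have "\<dots> = 1 / 4 * (\<Sum>b\<in>?B. ?r b)" by (simp add: sum.delta sum_distrib_left)
      finally show ?thesis by (simp only: sum.distrib 1 2)
    qed
    also have "\<dots> \<le> 1 / 4 * (33 / 10 * (33 / 10)) + 1 / 4 * (13 / 10) + 1 / 4 * (13 / 10)"
      using q r by (intro add_mono mult_left_mono mult_mono sum_nonneg) auto
    finally show ?thesis by simp
  qed
  note * = box_summable[OF tail_weight_nonneg this]
  show "tail_weight summable_on A" "infsum tail_weight A \<le> 339 / 100" by (fact *)+
qed

text \<open>The subtracted expression is the part of the sum over the lattice points
  \<open>1\<close>, \<open>- 1\<close>, \<open>z\<close> and \<open>- z\<close>.\<close>

lemma eisenstein_sum_units:
  assumes z: "Im z > 0" "k \<ge> 4" and c: "c \<ge> 0"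
    and bound: "\<And>p. p \<notin> {(0, 0), (1, 0), (- 1, 0), (0, 1), (0, - 1)} \<Longrightarrow> norm (eis_term k z p) \<le> c * tail_weight p"
  shows "norm (eisenstein_sum k z - (1 + (- 1) ^ k) * (1 + 1 / z ^ k)) \<le> c * (339 / 100)"
proof -
  let ?U = "{(1, 0), (- 1, 0), (0, 1), (0, - 1)} :: (int \<times> int) set"
  let ?R = "UNIV - insert (0, 0) ?U :: (int \<times> int) set"
  have split: "UNIV - {(0, 0)} = ?U \<union> ?R" by auto
  have R: "(\<lambda>p. norm (eis_term k z p)) summable_on ?R" using z by (intro eis_term_abs_summable) auto
  have "eisenstein_sum k z = infsum (eis_term k z) ?U + infsum (eis_term k z) ?R"
    unfolding eisenstein_sum_altdef split
    by (rule infsum_Un_disjoint) (use abs_summable_summable[OF R] in auto)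
  also have "infsum (eis_term k z) ?U = sum (eis_term k z) ?U" by (rule infsum_finite) simp
  also have "\<dots> = (1 + (- 1) ^ k) * (1 + 1 / z ^ k)"
  proof -
    have "1 / (- 1 :: complex) ^ k = (- 1) ^ k" by (metis div_by_1 minus_one_power_iff division_ring_divide_zero divide_minus1 minus_divide_right)
    moreover have "1 / (- z) ^ k = (- 1) ^ k * (1 / z ^ k)"
      by (metis calculation mult_minus1 power_mult_distrib times_divide_times_eq mult_1)
    ultimately show ?thesis by (simp add: eis_term_def algebra_simps)
  qed
  finally have "eisenstein_sum k z - (1 + (- 1) ^ k) * (1 + 1 / z ^ k) = infsum (eis_term k z) ?R" by simp
  also have "norm \<dots> \<le> infsum (\<lambda>p. norm (eis_term k z p)) ?R" by (rule norm_infsum_bound[OF R])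
  also have "\<dots> \<le> infsum (\<lambda>p. c * tail_weight p) ?R"
    using R by (intro infsum_mono summable_on_cmult_right tail_weight_sum bound) auto
  also have "\<dots> = c * infsum tail_weight ?R" by (rule infsum_cmult_right')
  also have "\<dots> \<le> c * (339 / 100)" using tail_weight_sum c by (intro mult_left_mono) auto
  finally show ?thesis .
qed

lemma tail_weight_axis:
  "p \<notin> {(0, 0), (1, 0), (- 1, 0), (0, 1), (0, - 1)} \<Longrightarrow> fst p = 0 \<or> snd p = 0 \<Longrightarrow>
   (fst p = 0 \<and> \<bar>snd p\<bar> \<ge> 2 \<and> tail_weight p = 1 / 4 * (1 / (of_int (snd p))\<^sup>2)) \<or>
   (snd p = 0 \<and> \<bar>fst p\<bar> \<ge> 2 \<and> tail_weight p = 1 / 4 * (1 / (of_int (fst p))\<^sup>2))"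
  by (cases p) (auto simp: tail_weight_def)

lemma tail_weight_generic:
  "fst p \<noteq> 0 \<Longrightarrow> snd p \<noteq> 0 \<Longrightarrow> tail_weight p = 1 / 4 * (1 / (of_int (fst p))\<^sup>2 * (1 / (of_int (snd p))\<^sup>2))"
  by (auto simp: tail_weight_def)

section \<open>The modular forms of weights 4, 6 and 12\<close>

definition g2 :: "complex \<Rightarrow> complex" where "g2 z = 60 * eisenstein_sum 4 z"
definition g3 :: "complex \<Rightarrow> complex" where "g3 z = 140 * eisenstein_sum 6 z"

lemma modular_j_altdef: "modular_j z = 1728 * g2 z ^ 3 / (g2 z ^ 3 - 27 * g3 z ^ 2)"
  by (simp add: modular_j_def g2_def g3_def Let_def)

lemma g2_holomorphic: "g2 holomorphic_on upper_half_plane"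
  unfolding g2_def[abs_def] by (intro holomorphic_intros eisenstein_sum_holomorphic) auto

lemma g3_holomorphic: "g3 holomorphic_on upper_half_plane"
  unfolding g3_def[abs_def] by (intro holomorphic_intros eisenstein_sum_holomorphic) auto

lemma g_shift: "g2 (z + 1) = g2 z" "g3 (z + 1) = g3 z"
  by (simp_all add: g2_def g3_def eisenstein_sum_shift)

lemma g_inversion: "z \<noteq> 0 \<Longrightarrow> g2 (- 1 / z) = z ^ 4 * g2 z" "z \<noteq> 0 \<Longrightarrow> g3 (- 1 / z) = z ^ 6 * g3 z"
  using eisenstein_sum_inversion[of z 4] eisenstein_sum_inversion[of z 6] by (simp_all add: g2_def g3_def)

text \<open>\<open>\<i>\<close> is fixed by the inversion, under which \<open>g3\<close> acquires
  the factor \<open>\<i> ^ 6 = - 1\<close>.\<close>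

lemma g3_i: "g3 \<i> = 0"
proof -
  have "g3 (- 1 / \<i>) = \<i> ^ 6 * g3 \<i>" by (rule g_inversion) simp
  moreover have "- 1 / \<i> = \<i>" by simp
  moreover have "\<i> ^ 6 = (- 1 :: complex)" by (simp add: eval_nat_numeral)
  ultimately show ?thesis by simp
qed

text \<open>The units contribute \<open>4\<close> and the other lattice points at most
  \<open>3.39\<close>. Off the axes the comparison is the inequality of the arithmetic and geometric
  mean for \<open>a^2\<close> and \<open>b^2\<close>.\<close>

lemma g2_i: "g2 \<i> \<noteq> 0"
proof -
  have "norm (eisenstein_sum 4 \<i> - (1 + (- 1) ^ 4) * (1 + 1 / \<i> ^ 4)) \<le> 1 * (339 / 100)"
  proof (rule eisenstein_sum_units)
    fix p :: "int \<times> int" assume p: "p \<notin> {(0, 0), (1, 0), (- 1, 0), (0, 1), (0, - 1)}"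
    define a b where "a = real_of_int (fst p)" and "b = real_of_int (snd p)"
    have "norm (of_int (fst p) + of_int (snd p) * \<i>) ^ 2 = a\<^sup>2 + b\<^sup>2"
      by (simp add: cmod_power2 a_def b_def)
    then have "norm (of_int (fst p) + of_int (snd p) * \<i>) ^ 4 = (a\<^sup>2 + b\<^sup>2)\<^sup>2"
      by (metis (no_types, lifting) mult_2_right numeral_Bit0 power_add power2_eq_square)
    then have n: "norm (eis_term 4 \<i> p) = 1 / (a\<^sup>2 + b\<^sup>2)\<^sup>2"
      by (simp add: eis_term_def norm_divide norm_power)
    show "norm (eis_term 4 \<i> p) \<le> 1 * tail_weight p"
    proof (cases "fst p = 0 \<or> snd p = 0")
      case True
      have ax: "1 / (c\<^sup>2)\<^sup>2 \<le> 1 / 4 * (1 / c\<^sup>2)" if "\<bar>k\<bar> \<ge> 2" "c = real_of_int k" for k c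
      proof -
        have "real_of_int 2 \<le> real_of_int \<bar>k\<bar>" using that by (simp only: of_int_le_iff)
        then have "2\<^sup>2 \<le> \<bar>c\<bar>\<^sup>2" using that by (intro power_mono) auto
        then have "4 \<le> c\<^sup>2" by simp
        then show ?thesis by (simp add: field_simps power2_eq_square)
      qed
      from tail_weight_axis[OF p True] show ?thesis
        unfolding n using ax[of "fst p" a] ax[of "snd p" b] by (auto simp: a_def b_def)
    next
      case False
      then have ab: "a\<^sup>2 > 0" "b\<^sup>2 > 0" by (auto simp: a_def b_def)
      have "4 * (a\<^sup>2 * b\<^sup>2) \<le> (a\<^sup>2 + b\<^sup>2)\<^sup>2"
        using zero_le_power2[of "a\<^sup>2 - b\<^sup>2"] by (simp add: power2_eq_square algebra_simps)
      then have "1 / (a\<^sup>2 + b\<^sup>2)\<^sup>2 \<le> 1 / (4 * (a\<^sup>2 * b\<^sup>2))"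
        using ab by (intro divide_left_mono) auto
      then show ?thesis unfolding n using tail_weight_generic[of p] False by (simp add: a_def b_def)
    qed
  qed auto
  moreover have "\<i> ^ 4 = (1 :: complex)" by (simp add: eval_nat_numeral)
  ultimately have "norm (eisenstein_sum 4 \<i> - 4) \<le> 339 / 100" by simp
  then have "eisenstein_sum 4 \<i> \<noteq> 0" by auto
  then show ?thesis by (simp add: g2_def)
qed

text \<open>The units contribute \<open>63 / 32\<close>. All other terms are at most a quarter of
  their weights, off the axes because of \<open>16 * a^2 * b^2 \<le> (a^2 + 4 * b^2)^2\<close>, and
  sum up to at most \<open>339 / 400\<close>.\<close>

lemma g3_2i: "g3 (2 * \<i>) \<noteq> 0"
proof -
  have "norm (eisenstein_sum 6 (2 * \<i>) - (1 + (- 1) ^ 6) * (1 + 1 / (2 * \<i>) ^ 6)) \<le> 1 / 4 * (339 / 100)"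
  proof (rule eisenstein_sum_units)
    fix p :: "int \<times> int" assume p: "p \<notin> {(0, 0), (1, 0), (- 1, 0), (0, 1), (0, - 1)}"
    define a b where "a = real_of_int (fst p)" and "b = real_of_int (snd p)"
    have "norm (of_int (fst p) + of_int (snd p) * (2 * \<i>)) ^ 2 = a\<^sup>2 + 4 * b\<^sup>2"
      by (simp add: cmod_power2 a_def b_def power_mult_distrib)
    then have "(norm (of_int (fst p) + of_int (snd p) * (2 * \<i>)) ^ 2) ^ 3 = (a\<^sup>2 + 4 * b\<^sup>2) ^ 3" by (simp only:)
    then have n: "norm (eis_term 6 (2 * \<i>) p) = 1 / (a\<^sup>2 + 4 * b\<^sup>2) ^ 3"
      by (simp add: eis_term_def norm_divide norm_power flip: power_mult)
    show "norm (eis_term 6 (2 * \<i>) p) \<le> 1 / 4 * tail_weight p"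
    proof (cases "fst p = 0 \<or> snd p = 0")
      case True
      have ax: "1 / (e * c\<^sup>2) ^ 3 \<le> 1 / 4 * (1 / 4 * (1 / c\<^sup>2))" if "\<bar>k\<bar> \<ge> 2" "c = real_of_int k" "e \<ge> 1" for k c e
      proof -
        have "real_of_int 2 \<le> real_of_int \<bar>k\<bar>" using that by (simp only: of_int_le_iff)
        then have "2\<^sup>2 \<le> \<bar>c\<bar>\<^sup>2" using that by (intro power_mono) auto
        then have c: "4 \<le> c\<^sup>2" by simp
        have "16 * c\<^sup>2 \<le> (c\<^sup>2 * c\<^sup>2) * c\<^sup>2" using mult_mono[OF c c] c by (intro mult_right_mono) auto
        also have "\<dots> = (1 * c\<^sup>2) ^ 3" by (simp add: power3_eq_cube)
        also have "\<dots> \<le> (e * c\<^sup>2) ^ 3" using that c by (intro power_mono mult_right_mono) auto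
        finally have "1 / (e * c\<^sup>2) ^ 3 \<le> 1 / (16 * c\<^sup>2)"
          using c that by (intro divide_left_mono) auto
        then show ?thesis by simp
      qed
      from tail_weight_axis[OF p True] show ?thesis
        unfolding n using ax[of "fst p" a 1] ax[of "snd p" b 4] by (auto simp: a_def b_def)
    next
      case False
      then have "1 \<le> \<bar>fst p\<bar>" "1 \<le> \<bar>snd p\<bar>" by auto
      then have "real_of_int 1 \<le> real_of_int \<bar>fst p\<bar>" "real_of_int 1 \<le> real_of_int \<bar>snd p\<bar>"
        by (simp_all only: of_int_le_iff)
      then have ab1: "1 \<le> \<bar>a\<bar>" "1 \<le> \<bar>b\<bar>" by (simp_all add: a_def b_def)
      have ab: "1 \<le> a\<^sup>2" "1 \<le> b\<^sup>2" using power_mono[OF ab1(1), of 2] power_mono[OF ab1(2), of 2] by auto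
      have 16: "16 * (a\<^sup>2 * b\<^sup>2) \<le> (a\<^sup>2 + 4 * b\<^sup>2)\<^sup>2"
        using zero_le_power2[of "a\<^sup>2 - 4 * b\<^sup>2"] by (simp add: power2_eq_square algebra_simps)
      have "16 * (a\<^sup>2 * b\<^sup>2) * 1 \<le> (a\<^sup>2 + 4 * b\<^sup>2)\<^sup>2 * (a\<^sup>2 + 4 * b\<^sup>2)"
        using 16 ab by (intro mult_mono) auto
      also have "\<dots> = (a\<^sup>2 + 4 * b\<^sup>2) ^ 3" by (simp add: power2_eq_square power3_eq_cube)
      finally have le: "16 * (a\<^sup>2 * b\<^sup>2) \<le> (a\<^sup>2 + 4 * b\<^sup>2) ^ 3" by simp
      have "1 / (a\<^sup>2 + 4 * b\<^sup>2) ^ 3 \<le> 1 / (16 * (a\<^sup>2 * b\<^sup>2))"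
      proof (rule divide_left_mono[OF le])
        have p: "0 < a\<^sup>2" "0 < b\<^sup>2" using ab by linarith+
        have "0 < (a\<^sup>2 + 4 * b\<^sup>2) ^ 3" by (rule zero_less_power) (use p in linarith)
        moreover have "0 < 16 * (a\<^sup>2 * b\<^sup>2)" using mult_pos_pos[OF p] by simp
        ultimately show "0 < (a\<^sup>2 + 4 * b\<^sup>2) ^ 3 * (16 * (a\<^sup>2 * b\<^sup>2))" by (rule mult_pos_pos)
      qed simp
      then show ?thesis unfolding n using tail_weight_generic[of p] False by (simp add: a_def b_def)
    qed
  qed auto
  moreover have "(2 * \<i>) ^ 6 = (- 64 :: complex)" by (simp add: eval_nat_numeral)
  ultimately have "norm (eisenstein_sum 6 (2 * \<i>) - 63 / 32) \<le> 339 / 400" by simp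
  then have "eisenstein_sum 6 (2 * \<i>) \<noteq> 0" by (auto simp: norm_divide)
  then show ?thesis by (simp add: g3_def)
qed

text \<open>At \<open>\<i>\<close> only \<open>g2\<close> survives; \<open>2 * \<i>\<close> then
  settles \<open>g3\<close>. This is the source of all later claims that a combination of
  \<open>g2 ^ 3\<close> and \<open>g3 ^ 2\<close> is not identically zero.\<close>

lemma g2_g3_independent:
  assumes "\<And>z. z \<in> upper_half_plane \<Longrightarrow> \<alpha> * g2 z ^ 3 = \<beta> * g3 z ^ 2"
  shows "\<alpha> = 0" "\<beta> = 0"
proof -
  show "\<alpha> = 0" using assms[of \<i>] g3_i g2_i by (simp add: upper_half_plane_iff)
  then show "\<beta> = 0" using assms[of "2 * \<i>"] g3_2i by (simp add: upper_half_plane_iff)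
qed

text \<open>The denominator of \<open>modular_j\<close>. Its zeros are not excluded here; at a zero
  the quotient would be \<open>0\<close> by the convention for division, so points with
  \<open>mod_disc z \<noteq> 0\<close> are singled out below.\<close>

definition mod_disc :: "complex \<Rightarrow> complex" where
  "mod_disc z = g2 z ^ 3 - 27 * g3 z ^ 2"

lemma mod_disc_holomorphic: "mod_disc holomorphic_on upper_half_plane"
  unfolding mod_disc_def[abs_def] by (intro holomorphic_intros g2_holomorphic g3_holomorphic)

text \<open>Below height \<open>1 / 2\<close> a shift makes the real part at most
  \<open>1 / 2\<close> in absolute value. The squared modulus is then at most \<open>1 / 2\<close>,
  so the inversion at least doubles the height, and finitely many steps reach
  \<open>1 / 2\<close>.\<close>

lemma reduction:
  fixes h :: "complex \<Rightarrow> complex"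
  assumes shift: "\<And>z. z \<in> upper_half_plane \<Longrightarrow> h (z + 1) = h z"
    and inv: "\<And>z. z \<in> upper_half_plane \<Longrightarrow> h (- 1 / z) = h z"
  shows "z \<in> upper_half_plane \<Longrightarrow> h (z + of_int n) = h z"
    and "z \<in> upper_half_plane \<Longrightarrow> \<exists>z'. Im z' \<ge> 1 / 2 \<and> h z' = h z"
proof -
  have nat_shift: "h (z + of_nat n) = h z" if "z \<in> upper_half_plane" for z n
  proof (induction n)
    case (Suc n)
    have "h (z + of_nat n + 1) = h (z + of_nat n)" using that by (intro shift) (simp add: upper_half_plane_iff)
    then show ?case using Suc by (simp add: add_ac)
  qed simp
  show int_shift: "h (z + of_int n) = h z" if z: "z \<in> upper_half_plane" for z n
  proof (cases "n \<ge> 0")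
    case True
    then show ?thesis using nat_shift[OF z, of "nat n"] by simp
  next
    case False
    have "h (z + of_int n + of_nat (nat (- n))) = h (z + of_int n)"
      by (rule nat_shift) (use z in \<open>simp add: upper_half_plane_iff\<close>)
    then show ?thesis using False by simp
  qed
  have "\<exists>z'. Im z' \<ge> 1 / 2 \<and> h z' = h z" if "z \<in> upper_half_plane" "Im z * 2 ^ k \<ge> 1 / 2" for z and k :: nat
    using that
  proof (induction k arbitrary: z)
    case (Suc k)
    show ?case
    proof (cases "Im z \<ge> 1 / 2")
      case False
      define z1 where "z1 = z - of_int (round (Re z))"
      have im: "Im z1 = Im z" by (simp add: z1_def)
      have re: "\<bar>Re z1\<bar> \<le> 1 / 2" using of_int_round_abs_le[of "Re z"] by (simp add: z1_def abs_minus_commute)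
      have pos: "Im z > 0" using Suc.prems by (simp add: upper_half_plane_iff)
      have z1: "z1 \<in> upper_half_plane" using pos im by (simp add: upper_half_plane_iff)
      have sq: "(Re z1)\<^sup>2 + (Im z1)\<^sup>2 \<le> 1 / 2"
      proof -
        have "(Re z1)\<^sup>2 \<le> (1 / 2)\<^sup>2" using re by (metis abs_ge_zero power2_abs power_mono)
        moreover have "(Im z1)\<^sup>2 \<le> (1 / 2)\<^sup>2" using im pos False by (intro power_mono) auto
        ultimately show ?thesis by (simp add: power2_eq_square)
      qed
      have im2: "Im (- 1 / z1) = Im z / ((Re z1)\<^sup>2 + (Im z1)\<^sup>2)"
        by (simp add: Im_divide im)
      have p2: "(Re z1)\<^sup>2 + (Im z1)\<^sup>2 > 0" using pos im by (simp add: add_nonneg_pos)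
      have "Im z * 2 \<le> Im (- 1 / z1)" unfolding im2
        using sq p2 pos mult_left_mono[OF sq, of "Im z"] by (simp add: field_simps)
      then have "Im z * 2 * 2 ^ k \<le> Im (- 1 / z1) * 2 ^ k" by (rule mult_right_mono) simp
      then have "Im (- 1 / z1) * 2 ^ k \<ge> 1 / 2" using Suc.prems by (simp add: mult.assoc)
      moreover have "- 1 / z1 \<in> upper_half_plane" unfolding upper_half_plane_iff im2 using p2 pos by simp
      ultimately obtain z' where "Im z' \<ge> 1 / 2" "h z' = h (- 1 / z1)" using Suc.IH by blast
      moreover have "h (- 1 / z1) = h z" using inv[OF z1] int_shift[OF z1, of "round (Re z)"] by (simp add: z1_def)
      ultimately show ?thesis by auto
    qed auto
  qed auto
  moreover have "\<exists>k::nat. Im z * 2 ^ k \<ge> 1 / 2" if "z \<in> upper_half_plane" for z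
  proof -
    have pos: "Im z > 0" using that by (simp add: upper_half_plane_iff)
    obtain k :: nat where "1 / Im z < 2 ^ k" using real_arch_pow[of 2 "1 / Im z"] by auto
    then show ?thesis using pos by (intro exI[of _ k]) (simp add: field_simps)
  qed
  ultimately show "z \<in> upper_half_plane \<Longrightarrow> \<exists>z'. Im z' \<ge> 1 / 2 \<and> h z' = h z" by blast
qed

text \<open>The function becomes holomorphic in \<open>q = exp (2 * pi * \<i> * z)\<close>, also at the cusp \<open>q = 0\<close>, and
  every orbit of the modular group meets the compact disc of radius \<open>exp (- pi)\<close>.\<close>

lemma bounded_modular_constant:
  assumes hol: "h holomorphic_on upper_half_plane"
    and bounded: "\<And>z. z \<in> upper_half_plane \<Longrightarrow> norm (h z) \<le> C"
    and shift: "\<And>z. z \<in> upper_half_plane \<Longrightarrow> h (z + 1) = h z"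
    and inv: "\<And>z. z \<in> upper_half_plane \<Longrightarrow> h (- 1 / z) = h z"
  shows "\<exists>c. \<forall>z\<in>upper_half_plane. h z = c"
proof -
  have int_shift: "h (z + of_int n) = h z" if "z \<in> upper_half_plane" for z n
    by (rule reduction(1)) (use shift inv that in auto)
  have reduce: "\<exists>z'. Im z' \<ge> 1 / 2 \<and> h z' = h z" if "z \<in> upper_half_plane" for z
    by (rule reduction(2)) (use shift inv that in auto)
  \<comment> \<open>The branch of the logarithm does not affect \<open>h (L q)\<close>, since
    \<open>h\<close> has period 1.\<close>
  define L where "L q = Ln q / (2 * complex_of_real pi * \<i>)" for q
  define F where "F q = h (L q)" for q
  have Im_w: "Im (w / (2 * complex_of_real pi * \<i>)) = - Re w / (2 * pi)" for w
    by (simp add: Im_divide power2_eq_square)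
  have L_H: "L q \<in> upper_half_plane" if "q \<noteq> 0" "norm q < 1" for q
  proof -
    have "ln (norm q) < 0" using that by simp
    then show ?thesis using that by (simp add: L_def upper_half_plane_iff Im_w Re_Ln divide_neg_pos)
  qed
  have F_exp: "F (exp w) = h (w / (2 * complex_of_real pi * \<i>))" if "Re w < 0" for w
  proof -
    have "exp (Ln (exp w)) = exp w" by simp
    then obtain n :: int where n: "w = Ln (exp w) + of_int (2 * n) * complex_of_real pi * \<i>"
      using exp_eq[of w "Ln (exp w)"] by auto
    have "w / (2 * complex_of_real pi * \<i>) = L (exp w) + of_int n"
      by (subst n) (simp add: L_def field_simps)
    moreover have "L (exp w) \<in> upper_half_plane" using that by (intro L_H) auto
    ultimately show ?thesis using int_shift by (simp add: F_def)
  qed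
  have F_local: "F field_differentiable (at q)" if q: "q \<noteq> 0" "norm q < 1" for q
  proof -
    \<comment> \<open>On the branch cut the argument is multiplied by \<open>- 1\<close>, so that
      \<open>Ln (s * q) + Ln s\<close> is a holomorphic logarithm of \<open>q\<close>
      nearby.\<close>
    define s where "s = (if q \<in> \<real>\<^sub>\<le>\<^sub>0 then - 1 else (1 :: complex))"
    define S where "S = ball 0 1 \<inter> {q. s * q \<notin> \<real>\<^sub>\<le>\<^sub>0}"
    have s: "s \<noteq> 0" "norm s = 1" "s * s = 1" by (auto simp: s_def)
    have qS: "s * q \<notin> \<real>\<^sub>\<le>\<^sub>0"
      using q by (auto simp: s_def complex_nonpos_Reals_iff complex_eq_iff)
    have openS: "open S"
    proof -
      have "open ((\<lambda>q. s * q) -` (- \<real>\<^sub>\<le>\<^sub>0))"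
        by (intro continuous_open_vimage continuous_intros open_Compl closed_nonpos_Reals_complex)
      then show ?thesis unfolding S_def by (intro open_Int) (auto simp: vimage_def)
    qed
    define l where "l q = (Ln (s * q) + Ln s) / (2 * complex_of_real pi * \<i>)" for q
    have lH: "l q \<in> upper_half_plane \<and> F q = h (l q)" if "q \<in> S" for q
    proof -
      have q0: "q \<noteq> 0" "norm q < 1" using that by (auto simp: S_def)
      then have Re: "Re (Ln (s * q) + Ln s) < 0" using s by (simp add: norm_mult)
      have "exp (Ln (s * q) + Ln s) = q" using q0 s by (simp add: exp_add)
      then show ?thesis using F_exp[OF Re] Re by (simp add: l_def upper_half_plane_iff Im_w divide_neg_pos)
    qed
    have "l holomorphic_on S" unfolding l_def[abs_def]
      by (intro holomorphic_intros) (auto simp: S_def)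
    then have "(h \<circ> l) holomorphic_on S"
      using lH by (intro holomorphic_on_compose_gen[OF _ hol]) auto
    then have "F holomorphic_on S" by (rule holomorphic_transform) (use lH in auto)
    then show ?thesis using openS q qS by (intro holomorphic_on_imp_differentiable_at[of _ S]) (auto simp: S_def)
  qed
  have "F holomorphic_on ball 0 1 - {0}"
    unfolding holomorphic_on_def by (rule ballI, rule field_differentiable_at_within[OF F_local]) auto
  moreover have "\<exists>B. \<forall>\<^sub>F q in at 0. norm (F q) \<le> B"
  proof (intro exI[of _ C])
    have "\<forall>\<^sub>F q in at 0. q \<in> ball 0 1 - {0 :: complex}" by (intro eventually_at_in_open) auto
    then show "\<forall>\<^sub>F q in at 0. norm (F q) \<le> C"
      by eventually_elim (use L_H bounded in \<open>auto simp: F_def\<close>)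
  qed
  ultimately obtain G where G: "G holomorphic_on ball 0 1" "\<And>q. q \<in> ball 0 1 - {0} \<Longrightarrow> G q = F q"
    using holomorphic_on_extend_bounded[of F "ball 0 1" 0] by auto
  have G_exp: "G (exp (2 * complex_of_real pi * \<i> * z)) = h z" if "z \<in> upper_half_plane" for z
  proof -
    have Re: "Re (2 * complex_of_real pi * \<i> * z) < 0" using that by (simp add: upper_half_plane_iff)
    then show ?thesis using G(2)[of "exp (2 * complex_of_real pi * \<i> * z)"] F_exp[OF Re] by simp
  qed
  \<comment> \<open>\<open>exp (- pi)\<close> is the modulus of \<open>q\<close> at height
    \<open>1 / 2\<close>, the height reached by \<open>reduce\<close>.\<close>
  define \<rho> where "\<rho> = exp (- pi)"
  have \<rho>: "0 < \<rho>" "\<rho> < 1" by (auto simp: \<rho>_def)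
  have "continuous_on (cball 0 \<rho>) (\<lambda>q. norm (G q))"
    using \<rho> by (intro continuous_on_norm holomorphic_on_imp_continuous_on holomorphic_on_subset[OF G(1)]) auto
  then obtain q0 where q0: "q0 \<in> cball 0 \<rho>" "\<And>q. q \<in> cball 0 \<rho> \<Longrightarrow> norm (G q) \<le> norm (G q0)"
    using continuous_attains_sup[of "cball 0 \<rho>" "\<lambda>q. norm (G q)"] \<rho> by auto
  have max: "norm (G q) \<le> norm (G q0)" if "q \<in> ball 0 1" for q
  proof (cases "q = 0")
    case False
    then have q: "q \<noteq> 0" "norm q < 1" using that by auto
    obtain z' where z': "Im z' \<ge> 1 / 2" "h z' = h (L q)" using reduce[OF L_H[OF q]] by blast
    have "norm (exp (2 * complex_of_real pi * \<i> * z')) \<le> \<rho>" using z'(1) by (simp add: \<rho>_def)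
    then have "norm (G (exp (2 * complex_of_real pi * \<i> * z'))) \<le> norm (G q0)" by (intro q0) simp
    moreover have "G (exp (2 * complex_of_real pi * \<i> * z')) = G q"
      using G_exp[of z'] z' G(2)[of q] q by (simp add: upper_half_plane_iff F_def)
    ultimately show ?thesis by simp
  qed (use q0 \<rho> in auto)
  have "G constant_on ball 0 1"
    by (rule maximum_modulus_principle[OF G(1), of "ball 0 1" q0]) (use max q0 \<rho> in auto)
  then obtain c where c: "\<And>q. q \<in> ball 0 1 \<Longrightarrow> G q = c" by (auto simp: constant_on_def)
  have "h z = c" if "z \<in> upper_half_plane" for z
    using G_exp[OF that] c[of "exp (2 * complex_of_real pi * \<i> * z)"] that by (simp add: upper_half_plane_iff)
  then show ?thesis by blast
qed

text \<open>The zeros of \<open>N\<close> are isolated, as \<open>N\<close> is not identically zero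
  on the connected set, and the bound makes each of them a removable singularity of the
  quotient.\<close>

lemma bounded_quotient_extends:
  assumes A: "A holomorphic_on S" and N: "N holomorphic_on S" and S: "open S" "connected S"
    and le: "\<And>z. z \<in> S \<Longrightarrow> norm (A z) \<le> C * norm (N z)" and N0: "w0 \<in> S" "N w0 \<noteq> 0"
  obtains h where "h holomorphic_on S" "\<And>z. z \<in> S \<Longrightarrow> norm (h z) \<le> C" "\<And>z. z \<in> S \<Longrightarrow> A z = h z * N z"
    "\<And>z. z \<in> S \<Longrightarrow> \<forall>\<^sub>F w in at z. N w \<noteq> 0"
proof -
  have nz: "\<forall>\<^sub>F w in at z. N w \<noteq> 0" if z: "z \<in> S" for z
  proof (cases "N z = 0")
    case True
    obtain r where r: "0 < r" "ball z r \<subseteq> S" "\<And>w. w \<in> ball z r - {z} \<Longrightarrow> N w \<noteq> 0"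
      using isolated_zeros[OF N S z True N0] by blast
    have "\<forall>\<^sub>F w in at z. w \<in> ball z r - {z}" using r(1) by (intro eventually_at_in_open) auto
    then show ?thesis by eventually_elim (use r in auto)
  next
    case False
    have "continuous (at z) N"
      using N S z by (meson continuous_on_eq_continuous_at holomorphic_on_imp_continuous_on)
    then show ?thesis using False by (simp add: isCont_def tendsto_imp_eventually_ne)
  qed
  define f where "f = (\<lambda>z. A z / N z)"
  have bound: "\<forall>\<^sub>F w in at z. norm (f w) \<le> C" if z: "z \<in> S" for z
  proof -
    have "\<forall>\<^sub>F w in at z. w \<in> S" using S z by (intro eventually_at_in_open') auto
    with nz[OF z] show ?thesis
    proof eventually_elim
      case (elim w)
      then show ?case using le[of w] by (simp add: f_def norm_divide divide_le_eq)
    qed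
  qed
  have mero: "f meromorphic_on S"
    unfolding f_def using A N S by (intro meromorphic_intros) (auto simp: analytic_on_open intro!: analytic_on_imp_meromorphic_on)
  have lim: "\<exists>c. f \<midarrow>z\<rightarrow> c" if z: "z \<in> S" for z
  proof -
    have "not_essential f z" using mero z by (simp add: meromorphic_on_altdef)
    moreover have "\<not> is_pole f z"
    proof
      assume "is_pole f z"
      then have "\<forall>\<^sub>F w in at z. norm (f w) > C"
        unfolding is_pole_def filterlim_at_infinity_conv_norm_at_top filterlim_at_top_dense by blast
      with bound[OF z] have "\<forall>\<^sub>F w in at z. False" by eventually_elim simp
      then show False by simp
    qed
    ultimately show ?thesis by (auto simp: not_essential_def)
  qed
  define h where "h = remove_sings f"
  have f_h: "f \<midarrow>z\<rightarrow> h z" if "z \<in> S" for z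
    using lim[OF that] remove_sings_eqI unfolding h_def by metis
  have "h analytic_on {z}" if "z \<in> S" for z
    unfolding h_def
    by (rule remove_sings_analytic_at[OF _ f_h[OF that]]) (use mero that in \<open>simp add: meromorphic_on_altdef\<close>)
  then have "h analytic_on S" using analytic_on_analytic_at by blast
  then have "h holomorphic_on S" by (rule analytic_imp_holomorphic)
  moreover have "norm (h z) \<le> C" if "z \<in> S" for z
    by (rule Lim_norm_ubound[OF _ f_h[OF that] bound[OF that]]) simp
  moreover have "A z = h z * N z" if z: "z \<in> S" for z
  proof -
    have AN: "A \<midarrow>z\<rightarrow> A z" "N \<midarrow>z\<rightarrow> N z"
      using A N S z by (meson continuous_on_eq_continuous_at holomorphic_on_imp_continuous_on isCont_def)+
    have "\<forall>\<^sub>F w in at z. f w * N w = A w" using nz[OF z] by eventually_elim (simp add: f_def)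
    from Lim_transform_eventually[OF tendsto_mult[OF f_h[OF z] AN(2)] this]
    show ?thesis using tendsto_unique[OF at_neq_bot AN(1)] by blast
  qed
  ultimately show thesis using that nz by blast
qed

lemma modular_j_near:
  assumes r: "r > 0"
  shows "\<exists>z\<in>upper_half_plane. mod_disc z \<noteq> 0 \<and> norm (modular_j z - c) < r"
proof (rule ccontr)
  assume none: "\<not> ?thesis"
  let ?H = upper_half_plane
  \<comment> \<open>\<open>mod_disc z / N z\<close> equals \<open>1 / (modular_j z - c)\<close>
    where \<open>mod_disc z\<close> is nonzero, and extends across the zeros of
    \<open>mod_disc\<close>. Both forms have weight 12.\<close>
  define N where "N z = 1728 * g2 z ^ 3 - c * mod_disc z" for z
  have N_hol: "N holomorphic_on ?H" unfolding N_def[abs_def]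
    by (intro holomorphic_intros g2_holomorphic mod_disc_holomorphic)
  have le: "norm (mod_disc z) \<le> 1 / r * norm (N z)" if "z \<in> ?H" for z
  proof (cases "mod_disc z = 0")
    case False
    then have "r \<le> norm (modular_j z - c)" using none that by (meson not_le)
    also have "modular_j z - c = N z / mod_disc z"
      using False by (simp add: modular_j_altdef N_def mod_disc_def diff_divide_distrib)
    finally have "r * norm (mod_disc z) \<le> norm (N z)" using False by (simp add: norm_divide field_simps)
    then show ?thesis using r by (simp add: field_simps)
  qed (use r in simp)
  have "\<exists>w0\<in>?H. N w0 \<noteq> 0"
  proof (rule ccontr)
    assume "\<not> ?thesis"
    then have "(1728 - c) * g2 z ^ 3 = (- 27 * c) * g3 z ^ 2" if "z \<in> ?H" for z
      using that by (auto simp: N_def mod_disc_def algebra_simps)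
    from g2_g3_independent[OF this] show False by auto
  qed
  then obtain w0 where w0: "w0 \<in> ?H" "N w0 \<noteq> 0" by blast
  obtain h where h: "h holomorphic_on ?H" "\<And>z. z \<in> ?H \<Longrightarrow> norm (h z) \<le> 1 / r"
    "\<And>z. z \<in> ?H \<Longrightarrow> mod_disc z = h z * N z" and nz: "\<And>z. z \<in> ?H \<Longrightarrow> \<forall>\<^sub>F w in at z. N w \<noteq> 0"
    using bounded_quotient_extends[OF mod_disc_holomorphic N_hol open_upper_half_plane connected_upper_half_plane le w0]
    by blast
  \<comment> \<open>Used for the shift with \<open>k = 1\<close> and for the inversion with
    \<open>k w = w ^ 12\<close>; the equality holds off the zeros of \<open>N\<close> and extends by
    continuity.\<close>
  have invariant: "h (T z) = h z" if z: "z \<in> ?H" and T: "T holomorphic_on ?H" "\<And>w. w \<in> ?H \<Longrightarrow> T w \<in> ?H"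
    and disc: "\<And>w. w \<in> ?H \<Longrightarrow> mod_disc (T w) = k w * mod_disc w"
    and N: "\<And>w. w \<in> ?H \<Longrightarrow> N (T w) = k w * N w" and k: "\<And>w. w \<in> ?H \<Longrightarrow> k w \<noteq> 0" for T k z
  proof -
    have cont: "u \<midarrow>z\<rightarrow> u z" if "u holomorphic_on ?H" for u
      using that z open_upper_half_plane
      by (meson continuous_on_eq_continuous_at holomorphic_on_imp_continuous_on isCont_def)
    have "(h \<circ> T) holomorphic_on ?H" using T by (intro holomorphic_on_compose_gen[OF _ h(1)]) auto
    from cont[OF this] have 1: "(\<lambda>w. h (T w)) \<midarrow>z\<rightarrow> h (T z)" by (simp add: o_def)
    have "\<forall>\<^sub>F w in at z. w \<in> ?H" using open_upper_half_plane z by (intro eventually_at_in_open') auto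
    with nz[OF z] have "\<forall>\<^sub>F w in at z. h (T w) = h w"
    proof eventually_elim
      case (elim w)
      have "h (T w) * (k w * N w) = h w * (k w * N w)"
        using h(3)[of w] h(3)[of "T w"] disc[of w] N[of w] T(2)[of w] elim k[of w] by auto
      then show ?case using elim k[of w] by auto
    qed
    from tendsto_cong[OF this] 1 cont[OF h(1)] show ?thesis using tendsto_unique[of "at z"] by auto
  qed
  have shift: "h (z + 1) = h z" if z: "z \<in> ?H" for z
    by (rule invariant[OF z, of "\<lambda>z. z + 1" "\<lambda>_. 1"])
       (auto simp: upper_half_plane_iff N_def mod_disc_def g_shift intro!: holomorphic_intros)
  have neg: "w \<noteq> 0" "- 1 / w \<in> ?H" if "w \<in> ?H" for w
  proof -
    show "w \<noteq> 0" using that by (auto simp: upper_half_plane_iff)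
    then show "- 1 / w \<in> ?H" using that by (simp add: upper_half_plane_iff Im_divide add_nonneg_pos)
  qed
  have inv: "h (- 1 / z) = h z" if z: "z \<in> ?H" for z
  proof (rule invariant[OF z, of "\<lambda>z. - 1 / z" "\<lambda>z. z ^ 12"])
    show "(\<lambda>z. - 1 / z) holomorphic_on ?H" using neg(1) by (intro holomorphic_intros) auto
    fix w assume w: "w \<in> ?H"
    show "- 1 / w \<in> ?H" "w ^ 12 \<noteq> 0" using neg[OF w] by auto
    have e: "g2 (- 1 / w) ^ 3 = w ^ 12 * g2 w ^ 3" "g3 (- 1 / w) ^ 2 = w ^ 12 * g3 w ^ 2"
      unfolding g_inversion[OF neg(1)[OF w]] by (simp_all add: power_mult_distrib flip: power_mult)
    show disc: "mod_disc (- 1 / w) = w ^ 12 * mod_disc w" unfolding mod_disc_def e by (simp add: algebra_simps)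
    show "N (- 1 / w) = w ^ 12 * N w" unfolding N_def disc e by (simp add: algebra_simps)
  qed
  obtain \<kappa> where \<kappa>: "\<And>z. z \<in> ?H \<Longrightarrow> h z = \<kappa>"
    using bounded_modular_constant[OF h(1,2) shift inv] by blast
  \<comment> \<open>Comparing coefficients gives \<open>\<kappa> * (1728 - c) = 1\<close> and
    \<open>\<kappa> * c = - 1\<close>. Adding the two yields \<open>1728 * \<kappa> = 0\<close>,
    which contradicts the second.\<close>
  have "(1 - \<kappa> * (1728 - c)) * g2 z ^ 3 = (27 + 27 * \<kappa> * c) * g3 z ^ 2" if "z \<in> ?H" for z
    using h(3)[OF that] by (simp add: \<kappa>[OF that] N_def mod_disc_def algebra_simps)
  from g2_g3_independent[OF this] have e: "1 - \<kappa> * (1728 - c) = 0" "27 + 27 * \<kappa> * c = 0" by blast+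
  have "27 * (1 + \<kappa> * c) = 27 + 27 * \<kappa> * c" by (simp only: distrib_left mult.assoc mult_1_right)
  from trans[OF this e(2)] have "(27 :: complex) = 0 \<or> 1 + \<kappa> * c = 0" by (simp only: mult_eq_0_iff)
  then have k: "1 + \<kappa> * c = 0" by simp
  have "\<kappa> * 1728 = (1 + \<kappa> * c) - (1 - \<kappa> * (1728 - c))" by (simp add: right_diff_distrib)
  also have "\<dots> = 0" by (simp only: k e(1)) simp
  finally show False using k by simp
qed

text \<open>Local inverses of \<open>j\<close>. The nonzero derivative supplies the nonzero
  coefficients \<rho> demanded in \<open>generic_transversal\<close>.\<close>

definition j_section :: "complex set \<Rightarrow> (complex \<Rightarrow> complex) \<Rightarrow> bool" where
  "j_section U \<tau> \<longleftrightarrow> open U \<and> \<tau> holomorphic_on U \<and>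
     (\<forall>w\<in>U. \<tau> w \<in> upper_half_plane \<and> modular_j (\<tau> w) = w \<and> deriv \<tau> w \<noteq> 0)"

text \<open>Were the derivative zero near the point provided by \<open>modular_j_near\<close>,
  \<open>j\<close> would be constant there and the identity theorem would make \<open>g2 ^ 3\<close>
  and \<open>g3 ^ 2\<close> dependent. So some nearby point admits a holomorphic inverse.\<close>

lemma j_section_dense:
  assumes r: "r > 0"
  shows "\<exists>U \<tau> w. j_section U \<tau> \<and> w \<in> U \<and> norm (w - c) < r"
proof -
  let ?H = upper_half_plane
  obtain z0 where z0: "z0 \<in> ?H" "mod_disc z0 \<noteq> 0" "norm (modular_j z0 - c) < r"
    using modular_j_near[OF r] by blast
  define D where "D = {z \<in> ?H. mod_disc z \<noteq> 0}"
  have "D = ?H \<inter> mod_disc -` (- {0})" by (auto simp: D_def)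
  then have D: "open D" using continuous_open_preimage[OF holomorphic_on_imp_continuous_on[OF mod_disc_holomorphic] open_upper_half_plane,
      of "- {0}"] by auto
  have j_hol: "modular_j holomorphic_on D"
  proof -
    have sub: "D \<subseteq> ?H" by (auto simp: D_def)
    have "(\<lambda>z. 1728 * g2 z ^ 3 / mod_disc z) holomorphic_on D"
      by (intro holomorphic_intros holomorphic_on_subset[OF g2_holomorphic sub]
        holomorphic_on_subset[OF mod_disc_holomorphic sub]) (auto simp: D_def)
    then show ?thesis by (rule holomorphic_transform) (simp add: modular_j_altdef mod_disc_def)
  qed
  define W where "W = D \<inter> modular_j -` ball c r"
  have W: "open W" unfolding W_def
    using continuous_open_preimage[OF holomorphic_on_imp_continuous_on[OF j_hol] D] by simp
  have z0W: "z0 \<in> W" using z0 by (simp add: W_def D_def dist_norm norm_minus_commute)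
  have WD: "W \<subseteq> D" by (auto simp: W_def)
  have "\<exists>t\<in>W. deriv modular_j t \<noteq> 0"
  proof (rule ccontr)
    assume "\<not> ?thesis"
    then have d0: "deriv modular_j t = 0" if "t \<in> W" for t using that by blast
    obtain e where e: "e > 0" "ball z0 e \<subseteq> W" using W z0W open_contains_ball by blast
    have "\<exists>k. \<forall>t\<in>ball z0 e. modular_j t = k"
    proof (rule has_field_derivative_zero_constant)
      show "(modular_j has_field_derivative 0) (at t within ball z0 e)" if "t \<in> ball z0 e" for t
      proof -
        have "t \<in> W" using e that by auto
        then have "(modular_j has_field_derivative 0) (at t)"
          using holomorphic_derivI[OF j_hol D, of t UNIV] WD d0[of t] by auto
        then show ?thesis by (rule has_field_derivative_at_within)
      qed
    qed simp
    then obtain k where k: "\<And>t. t \<in> ball z0 e \<Longrightarrow> modular_j t = k" by blast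
    \<comment> \<open>The denominator is cleared because the identity theorem requires a function
      that is holomorphic on the whole half-plane.\<close>
    define u where "u z = 1728 * g2 z ^ 3 - k * mod_disc z" for z
    have u_hol: "u holomorphic_on ?H" unfolding u_def[abs_def]
      by (intro holomorphic_intros g2_holomorphic mod_disc_holomorphic)
    have u0: "u z = 0" if "z \<in> ball z0 e" for z
    proof -
      have "mod_disc z \<noteq> 0" using that e WD by (auto simp: D_def)
      then show ?thesis using k[OF that] by (simp add: u_def modular_j_altdef mod_disc_def field_simps)
    qed
    have sub: "ball z0 e \<subseteq> ?H" using e WD by (auto simp: D_def)
    have "u z = 0" if "z \<in> ?H" for z
      using analytic_continuation_open[of "ball z0 e" ?H u "\<lambda>_. 0" z] open_upper_half_plane connected_upper_half_plane
        u_hol u0 e(1) sub that by auto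
    then have "(1728 - k) * g2 z ^ 3 = (- 27 * k) * g3 z ^ 2" if "z \<in> ?H" for z
      using that by (auto simp: u_def mod_disc_def algebra_simps)
    from g2_g3_independent[OF this] show False by auto
  qed
  then obtain t where t: "t \<in> W" "deriv modular_j t \<noteq> 0" by blast
  have jW: "modular_j holomorphic_on W" by (rule holomorphic_on_subset[OF j_hol WD])
  obtain e where e: "e > 0" "ball t e \<subseteq> W" "open (modular_j ` ball t e)" "inj_on modular_j (ball t e)"
    using has_complex_derivative_locally_invertible[OF jW t(1) W t(2)] by blast
  have je: "modular_j holomorphic_on ball t e" by (rule holomorphic_on_subset[OF jW e(2)])
  obtain \<tau> where \<tau>: "\<tau> holomorphic_on (modular_j ` ball t e)"
    "\<And>z. z \<in> ball t e \<Longrightarrow> deriv modular_j z * deriv \<tau> (modular_j z) = 1"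
    "\<And>z. z \<in> ball t e \<Longrightarrow> \<tau> (modular_j z) = z"
    using holomorphic_has_inverse[OF je open_ball e(4)] by blast
  have "j_section (modular_j ` ball t e) \<tau>"
    unfolding j_section_def
  proof (intro conjI ballI)
    fix w assume "w \<in> modular_j ` ball t e"
    then obtain z where z: "z \<in> ball t e" "w = modular_j z" by blast
    have "z \<in> ?H" using z e WD by (auto simp: D_def)
    then show "\<tau> w \<in> ?H" "modular_j (\<tau> w) = w" using z \<tau>(3) by auto
    show "deriv \<tau> w \<noteq> 0" using \<tau>(2)[OF z(1)] z(2) by auto
  qed (use e \<tau> in auto)
  moreover have "modular_j t \<in> modular_j ` ball t e" using e by auto
  moreover have "norm (modular_j t - c) < r" using t by (auto simp: W_def dist_norm norm_minus_commute)
  ultimately show ?thesis by blast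
qed

section \<open>Vectors in general position\<close>

definition lindep_free :: "nat \<Rightarrow> 'i set \<Rightarrow> ('i \<Rightarrow> nat \<Rightarrow> complex) \<Rightarrow> bool" where
  "lindep_free d I v \<longleftrightarrow> (\<forall>t. (\<forall>l<d. (\<Sum>i\<in>I. t i * v i l) = 0) \<longrightarrow> (\<forall>i\<in>I. t i = 0))"

definition in_lspan :: "nat \<Rightarrow> 'i set \<Rightarrow> ('i \<Rightarrow> nat \<Rightarrow> complex) \<Rightarrow> (nat \<Rightarrow> complex) \<Rightarrow> bool" where
  "in_lspan d I v w \<longleftrightarrow> (\<exists>t. \<forall>l<d. w l = (\<Sum>i\<in>I. t i * v i l))"

lemma in_lspan_comb:
  assumes "in_lspan d I v w" "in_lspan d I v w'"
  shows "in_lspan d I v (\<lambda>l. x * w l + y * w' l)"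
proof -
  obtain t t' where "\<forall>l<d. w l = (\<Sum>i\<in>I. t i * v i l)" "\<forall>l<d. w' l = (\<Sum>i\<in>I. t' i * v i l)"
    using assms unfolding in_lspan_def by blast
  then show ?thesis unfolding in_lspan_def
    by (intro exI[of _ "\<lambda>i. x * t i + y * t' i"])
       (simp add: sum_distrib_left sum.distrib ring_distribs mult.assoc)
qed

lemma in_lspan_gen:
  assumes "finite I" "i \<in> I" shows "in_lspan d I v (v i)"
proof -
  have "(\<Sum>j\<in>I. (if j = i then 1 else 0) * v j l) = (\<Sum>j\<in>I. if j = i then v i l else 0)" for l
    by (rule sum.cong) auto
  then show ?thesis unfolding in_lspan_def using assms
    by (intro exI[of _ "\<lambda>j. if j = i then 1 else 0"]) simp
qed

lemma in_lspan_cong: "in_lspan d I v w \<Longrightarrow> (\<And>l. l < d \<Longrightarrow> w' l = w l) \<Longrightarrow> in_lspan d I v w'"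
  unfolding in_lspan_def by auto

lemma in_lspan_trans:
  assumes "in_lspan d J u w" "\<And>j. j \<in> J \<Longrightarrow> in_lspan d I v (u j)"
  shows "in_lspan d I v w"
proof -
  obtain t where t: "\<forall>l<d. w l = (\<Sum>j\<in>J. t j * u j l)" using assms(1) by (auto simp: in_lspan_def)
  have "\<forall>j. \<exists>r. j \<in> J \<longrightarrow> (\<forall>l<d. u j l = (\<Sum>i\<in>I. r i * v i l))"
    using assms(2) unfolding in_lspan_def by blast
  from choice[OF this] obtain r where r: "\<And>j l. j \<in> J \<Longrightarrow> l < d \<Longrightarrow> u j l = (\<Sum>i\<in>I. r j i * v i l)" by blast
  have "w l = (\<Sum>i\<in>I. (\<Sum>j\<in>J. t j * r j i) * v i l)" if "l < d" for l
  proof -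
    have "w l = (\<Sum>j\<in>J. t j * (\<Sum>i\<in>I. r j i * v i l))" using t r that by simp
    also have "\<dots> = (\<Sum>i\<in>I. (\<Sum>j\<in>J. t j * r j i) * v i l)"
      unfolding sum_distrib_left sum_distrib_right mult.assoc by (rule sum.swap)
    finally show ?thesis .
  qed
  then show ?thesis unfolding in_lspan_def by (intro exI[of _ "\<lambda>i. \<Sum>j\<in>J. t j * r j i"]) blast
qed

lemma lspan_card:
  assumes "lindep_free d I w" "finite I" "finite J" "\<And>i. i \<in> I \<Longrightarrow> in_lspan d J v (w i)"
  shows "card I \<le> card J"
proof (rule ccontr)
  assume "\<not> ?thesis"
  then have lt: "card J < card I" by simp
  have "\<forall>i. \<exists>r. i \<in> I \<longrightarrow> (\<forall>l<d. w i l = (\<Sum>j\<in>J. r j * v j l))"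
    using assms(4) unfolding in_lspan_def by blast
  from choice[OF this] obtain r where r: "\<And>i l. i \<in> I \<Longrightarrow> l < d \<Longrightarrow> w i l = (\<Sum>j\<in>J. r i j * v j l)" by blast
  obtain t where t: "\<exists>i\<in>I. t i \<noteq> 0" "\<And>j. j \<in> J \<Longrightarrow> (\<Sum>i\<in>I. t i * r i j) = 0"
    using lin_dep[OF assms(3,2) lt, of r] by blast
  have "(\<Sum>i\<in>I. t i * w i l) = 0" if "l < d" for l
  proof -
    have "(\<Sum>i\<in>I. t i * w i l) = (\<Sum>i\<in>I. t i * (\<Sum>j\<in>J. r i j * v j l))" using r that by simp
    also have "\<dots> = (\<Sum>j\<in>J. (\<Sum>i\<in>I. t i * r i j) * v j l)"
      unfolding sum_distrib_left sum_distrib_right mult.assoc by (rule sum.swap)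
    finally show ?thesis using t(2) by simp
  qed
  then show False using assms(1) t(1) unfolding lindep_free_def by blast
qed

lemma lindep_extend:
  assumes "finite J" "k \<in> J" "lindep_free d (J - {k}) v" "\<not> lindep_free d J v"
  shows "in_lspan d (J - {k}) v (v k)"
proof -
  obtain t where t: "\<And>l. l < d \<Longrightarrow> (\<Sum>i\<in>J. t i * v i l) = 0" "\<exists>i\<in>J. t i \<noteq> 0"
    using assms(4) unfolding lindep_free_def by blast
  have split: "(\<Sum>i\<in>J. t i * v i l) = t k * v k l + (\<Sum>i\<in>J - {k}. t i * v i l)" for l
    using assms by (simp add: sum.remove)
  have "t k \<noteq> 0"
  proof
    assume 0: "t k = 0"
    then have "\<forall>i\<in>J - {k}. t i = 0" using assms(3) t(1) split unfolding lindep_free_def by simp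
    then show False using 0 t(2) by auto
  qed
  then have "v k l = (\<Sum>i\<in>J - {k}. (- t i / t k) * v i l)" if "l < d" for l
  proof -
    have "(\<Sum>i\<in>J - {k}. (- t i / t k) * v i l) = - (\<Sum>i\<in>J - {k}. t i * v i l) / t k"
      by (simp add: sum_divide_distrib sum_negf)
    also have "(\<Sum>i\<in>J - {k}. t i * v i l) = - (t k * v k l)"
      using t(1)[OF that] unfolding split by (simp add: eq_neg_iff_add_eq_0 add.commute)
    finally show ?thesis using \<open>t k \<noteq> 0\<close> by simp
  qed
  then show ?thesis unfolding in_lspan_def by (intro exI[of _ "\<lambda>i. - t i / t k"]) blast
qed

lemma lindep_not_span:
  assumes "finite J" "k \<in> J" "lindep_free d J v"
  shows "\<not> in_lspan d (J - {k}) v (v k)"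
proof
  assume "in_lspan d (J - {k}) v (v k)"
  then obtain t where t: "\<And>l. l < d \<Longrightarrow> v k l = (\<Sum>i\<in>J - {k}. t i * v i l)" by (auto simp: in_lspan_def)
  have "(\<Sum>i\<in>J. (if i = k then - 1 else t i) * v i l) = 0" if "l < d" for l
  proof -
    have "(\<Sum>i\<in>J. (if i = k then - 1 else t i) * v i l) = - v k l + (\<Sum>i\<in>J - {k}. (if i = k then - 1 else t i) * v i l)"
      using assms by (simp add: sum.remove)
    also have "(\<Sum>i\<in>J - {k}. (if i = k then - 1 else t i) * v i l) = (\<Sum>i\<in>J - {k}. t i * v i l)"
      by (rule sum.cong) auto
    finally show ?thesis using t[OF that] by simp
  qed
  then have "(if k = k then - 1 else t k) = 0"
    using assms(2,3) unfolding lindep_free_def by (elim allE[of _ "\<lambda>i. if i = k then - 1 else t i"]) blast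
  then show False by simp
qed

lemma lindep_subset:
  assumes "finite J" "lindep_free d J v" "I \<subseteq> J"
  shows "lindep_free d I v"
  unfolding lindep_free_def
proof (intro allI impI)
  fix t assume t: "\<forall>l<d. (\<Sum>i\<in>I. t i * v i l) = 0"
  have "(\<Sum>i\<in>J. (if i \<in> I then t i else 0) * v i l) = (\<Sum>i\<in>I. t i * v i l)" for l
    using assms by (intro sum.mono_neutral_cong_right) auto
  then have "\<forall>i\<in>J. (if i \<in> I then t i else 0) = 0"
    using assms(2)[unfolded lindep_free_def, THEN spec, of "\<lambda>i. if i \<in> I then t i else 0"] t by simp
  then show "\<forall>i\<in>I. t i = 0" using assms(3) by (metis subsetD)
qed

lemma lindep_cong: "(\<And>i l. i \<in> I \<Longrightarrow> v i l = v' i l) \<Longrightarrow> lindep_free d I v = lindep_free d I v'"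
  unfolding lindep_free_def by (simp cong: sum.cong)

text \<open>A linear version of Rado's theorem. For generic coefficients every subset of the vectors
  \<open>c k\<close> is independent if this is possible at all. If they were dependent, a minimal dependent subset
  \<open>C\<close> would span all \<open>a k\<close> and \<open>b k\<close> with \<open>k \<in> C\<close>, contradicting the rank condition.\<close>

lemma generic_transversal:
  fixes a b :: "nat \<Rightarrow> nat \<Rightarrow> complex" and \<rho> :: "nat \<Rightarrow> complex"
  assumes rank: "\<And>K. K \<subseteq> {..<n} \<Longrightarrow> K \<noteq> {} \<Longrightarrow>
      \<exists>I. finite I \<and> card K \<le> card I \<and> I \<subseteq> K \<times> UNIV \<and> lindep_free d I (\<lambda>(k, z). if z then a k else b k)"
    and \<rho>: "\<And>k. k < n \<Longrightarrow> \<rho> k \<noteq> 0"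
  obtains \<kappa> where "\<And>k. k < n \<Longrightarrow> \<kappa> k \<noteq> 0" "lindep_free d {..<n} (\<lambda>k l. \<kappa> k * a k l - \<rho> k * b k l)"
proof -
  define c where "c = (\<lambda>\<kappa> k l. \<kappa> k * a k l - \<rho> k * b k l)"
  have upd: "c (\<kappa>(k := t)) j = c \<kappa> j" if "j \<noteq> k" for \<kappa> k t j
    using that by (simp add: c_def)
  have upd_lindep: "lindep_free d (J - {k}) (c (\<kappa>(k := t))) = lindep_free d (J - {k}) (c \<kappa>)" for J k \<kappa> t
    by (rule lindep_cong) (simp add: upd)
  have upd_span: "in_lspan d (J - {k}) (c (\<kappa>(k := t))) w = in_lspan d (J - {k}) (c \<kappa>) w" for J k \<kappa> t w
  proof -
    have "(\<Sum>i\<in>J - {k}. r i * c (\<kappa>(k := t)) i l) = (\<Sum>i\<in>J - {k}. r i * c \<kappa> i l)" for r l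
      by (rule sum.cong) (auto simp: upd)
    then show ?thesis unfolding in_lspan_def by simp
  qed
  have span_t: "in_lspan d (J - {k}) (c \<kappa>) (c (\<kappa>(k := t)) k)"
    if "finite J" "k \<in> J" "lindep_free d (J - {k}) (c \<kappa>)" "\<not> lindep_free d J (c (\<kappa>(k := t)))" for J k \<kappa> t
    using lindep_extend[OF that(1,2), of d "c (\<kappa>(k := t))"] that(3,4) by (simp add: upd_lindep upd_span)
  \<comment> \<open>The vector with index \<open>k\<close> is affine in its coefficient. If two
    values made \<open>J\<close> dependent, two points of this affine line would lie in the span of
    the other vectors, and with them the whole line.\<close>
  have at_most_one: "t = t'"
    if J: "finite J" and u: "lindep_free d J (c \<kappa>)" and t: "\<not> lindep_free d J (c (\<kappa>(k := t)))"
      and t': "\<not> lindep_free d J (c (\<kappa>(k := t')))" for J \<kappa> k t t'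
  proof (rule ccontr)
    assume ne: "t \<noteq> t'"
    have k: "k \<in> J"
    proof (rule ccontr)
      assume "k \<notin> J"
      then have "J - {k} = J" by auto
      then show False using upd_lindep[of J k \<kappa> t] u t by simp
    qed
    have ind: "lindep_free d (J - {k}) (c \<kappa>)" by (rule lindep_subset[OF J u]) auto
    have "in_lspan d (J - {k}) (c \<kappa>) (\<lambda>l. ((\<kappa> k - t') / (t - t')) * c (\<kappa>(k := t)) k l + ((t - \<kappa> k) / (t - t')) * c (\<kappa>(k := t')) k l)"
      by (intro in_lspan_comb span_t J k ind t t')
    then have "in_lspan d (J - {k}) (c \<kappa>) (c \<kappa> k)"
    proof (rule in_lspan_cong)
      fix l
      have e: "(t - t') * (\<kappa> k * a k l - \<rho> k * b k l) =
         (\<kappa> k - t') * (t * a k l - \<rho> k * b k l) + (t - \<kappa> k) * (t' * a k l - \<rho> k * b k l)"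
        by (simp add: algebra_simps)
      show "c \<kappa> k l = ((\<kappa> k - t') / (t - t')) * c (\<kappa>(k := t)) k l + ((t - \<kappa> k) / (t - t')) * c (\<kappa>(k := t')) k l"
        using ne e by (simp add: c_def add_divide_distrib[symmetric] eq_divide_eq mult.commute[of _ "t - t'"])
    qed
    then show False using lindep_not_span[OF J k u] by simp
  qed
  define \<G> where "\<G> = {J. J \<subseteq> {..<n} \<and> (\<exists>\<kappa>. lindep_free d J (c \<kappa>))}"
  have fin\<G>: "finite \<G>" by (rule finite_subset[of _ "Pow {..<n}"]) (auto simp: \<G>_def)
  \<comment> \<open>The coefficients are fixed one at a time such that every set in
    \<open>\<G>\<close> can still be made independent by the remaining ones; each set excludes at
    most one value, and \<open>0\<close> is excluded too.\<close>
  have "\<exists>\<kappa>. (\<forall>k<i. \<kappa> k \<noteq> 0) \<and> (\<forall>J\<in>\<G>. \<exists>\<kappa>'. (\<forall>k<i. \<kappa>' k = \<kappa> k) \<and> lindep_free d J (c \<kappa>'))" for i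
  proof (induction i)
    case 0
    show ?case by (auto simp: \<G>_def)
  next
    case (Suc i)
    then obtain \<kappa> where \<kappa>: "\<forall>k<i. \<kappa> k \<noteq> 0"
      "\<forall>J\<in>\<G>. \<exists>\<kappa>'. (\<forall>k<i. \<kappa>' k = \<kappa> k) \<and> lindep_free d J (c \<kappa>')" by blast
    from bchoice[OF \<kappa>(2)] obtain f where
      f: "\<And>J. J \<in> \<G> \<Longrightarrow> (\<forall>k<i. f J k = \<kappa> k) \<and> lindep_free d J (c (f J))" by blast
    define bad where "bad J = {t. \<not> lindep_free d J (c ((f J)(i := t)))}" for J
    have "finite (bad J)" if "J \<in> \<G>" for J
    proof (cases "bad J = {}")
      case False
      then obtain t where t: "t \<in> bad J" by auto
      have "finite J" using that finite_subset[of J "{..<n}"] by (auto simp: \<G>_def)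
      have "t' = t" if "t' \<in> bad J" for t'
        by (rule at_most_one[OF \<open>finite J\<close>, of "f J" i]) (use f[OF \<open>J \<in> \<G>\<close>] t that in \<open>simp_all only: bad_def mem_Collect_eq not_False_eq_True\<close>)
      then have "bad J \<subseteq> {t}" by blast
      then show ?thesis by (rule finite_subset) simp
    qed simp
    then have "finite (insert 0 (\<Union>J\<in>\<G>. bad J))" using fin\<G> by auto
    then obtain t where t: "t \<notin> insert 0 (\<Union>J\<in>\<G>. bad J)"
      using ex_new_if_finite[OF infinite_UNIV_char_0] by blast
    have "\<forall>k<Suc i. (\<kappa>(i := t)) k \<noteq> 0" using \<kappa> t by (auto simp: less_Suc_eq)
    moreover have "\<exists>\<kappa>'. (\<forall>k<Suc i. \<kappa>' k = (\<kappa>(i := t)) k) \<and> lindep_free d J (c \<kappa>')" if J: "J \<in> \<G>" for J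
      using f[OF J] t J by (intro exI[of _ "(f J)(i := t)"]) (auto simp: bad_def)
    ultimately show ?case by (intro exI[of _ "\<kappa>(i := t)"]) blast
  qed
  from this[of n] obtain \<kappa> where \<kappa>: "\<forall>k<n. \<kappa> k \<noteq> 0"
    "\<And>J. J \<in> \<G> \<Longrightarrow> \<exists>\<kappa>'. (\<forall>k<n. \<kappa>' k = \<kappa> k) \<and> lindep_free d J (c \<kappa>')" by blast
  have gen: "lindep_free d J (c \<kappa>)" if "J \<subseteq> {..<n}" "lindep_free d J (c \<kappa>')" for J \<kappa>'
  proof -
    have "J \<in> \<G>" using that by (auto simp: \<G>_def)
    then obtain \<kappa>'' where k: "\<forall>k<n. \<kappa>'' k = \<kappa> k" "lindep_free d J (c \<kappa>'')" using \<kappa>(2) by blast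
    have "lindep_free d J (c \<kappa>'') = lindep_free d J (c \<kappa>)"
      by (rule lindep_cong) (use k that in \<open>auto simp: c_def\<close>)
    then show ?thesis using k by simp
  qed
  have "lindep_free d {..<n} (c \<kappa>)"
  proof (rule ccontr)
    assume not: "\<not> ?thesis"
    obtain C where C: "C \<subseteq> {..<n}" "\<not> lindep_free d C (c \<kappa>)"
      and min: "\<And>C'. C' \<subseteq> {..<n} \<Longrightarrow> \<not> lindep_free d C' (c \<kappa>) \<Longrightarrow> card C \<le> card C'"
      using ex_has_least_nat[of "\<lambda>C. C \<subseteq> {..<n} \<and> \<not> lindep_free d C (c \<kappa>)" "{..<n}" card] not by blast
    have finC: "finite C" using C finite_subset by blast
    have sub: "lindep_free d (C - {k}) (c \<kappa>)" if "k \<in> C" for k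
    proof (rule ccontr)
      assume "\<not> ?thesis"
      then have "card C \<le> card (C - {k})" using C by (intro min) auto
      then show False using that finC by (metis card_Diff1_less not_le)
    qed
    have "C \<noteq> {}" using C(2) by (auto simp: lindep_free_def)
    then obtain k0 where k0: "k0 \<in> C" by auto
    have dep: "\<not> lindep_free d C (c \<kappa>')" for \<kappa>' using gen[OF C(1)] C(2) by blast
    have ck0: "in_lspan d (C - {k0}) (c \<kappa>) (c \<kappa> k)" if "k \<in> C" for k
    proof (cases "k = k0")
      case True
      then show ?thesis using lindep_extend[OF finC k0 sub[OF k0] C(2)] by simp
    qed (use in_lspan_gen[of "C - {k0}" k d "c \<kappa>"] finC that in auto)
    \<comment> \<open>Dependence persists for all values of the coefficient at \<open>k\<close>. The
      values \<open>1\<close> and \<open>0\<close> together give \<open>a k\<close>, and the value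
      \<open>0\<close> alone gives \<open>b k\<close> because \<open>\<rho> k\<close> is
      nonzero.\<close>
    have ab: "in_lspan d (C - {k0}) (c \<kappa>) (if z then a k else b k)" if k: "k \<in> C" for k z
    proof -
      have kn: "k < n" using k C by auto
      have s: "in_lspan d (C - {k0}) (c \<kappa>) (c (\<kappa>(k := t)) k)" for t
        by (rule in_lspan_trans[OF span_t[OF finC k sub[OF k] dep]]) (use ck0 in auto)
      have "in_lspan d (C - {k0}) (c \<kappa>) (\<lambda>l. 1 * c (\<kappa>(k := 1)) k l + (- 1) * c (\<kappa>(k := 0)) k l)"
        by (rule in_lspan_comb[OF s s])
      then have a: "in_lspan d (C - {k0}) (c \<kappa>) (a k)" by (rule in_lspan_cong) (simp add: c_def)
      have "in_lspan d (C - {k0}) (c \<kappa>) (\<lambda>l. (- 1 / \<rho> k) * c (\<kappa>(k := 0)) k l + 0 * c (\<kappa>(k := 0)) k l)"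
        by (rule in_lspan_comb[OF s s])
      then have b: "in_lspan d (C - {k0}) (c \<kappa>) (b k)"
        by (rule in_lspan_cong) (use \<rho>[OF kn] in \<open>simp add: c_def\<close>)
      show ?thesis using a b by simp
    qed
    obtain I where I: "finite I" "card C \<le> card I" "I \<subseteq> C \<times> UNIV" "lindep_free d I (\<lambda>(k, z). if z then a k else b k)"
      using rank[OF C(1) \<open>C \<noteq> {}\<close>] by blast
    have "card I \<le> card (C - {k0})"
      by (rule lspan_card[OF I(4,1)]) (use finC ab I(3) in auto)
    also have "\<dots> < card C" using finC k0 by (metis card_Diff1_less)
    finally show False using I(2) by simp
  qed
  then show thesis using that[of \<kappa>] \<kappa>(1) by (simp add: c_def)
qed

lemma dual_basis:
  fixes c :: "nat \<Rightarrow> nat \<Rightarrow> complex"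
  assumes "lindep_free d {..<n} c"
  shows "\<exists>B. \<forall>k<n. \<forall>j<n. (\<Sum>l<d. c k l * B j l) = (if k = j then 1 else 0)"
  using assms
proof (induction n)
  case (Suc n)
  have "lindep_free d {..<n} c" by (rule lindep_subset[OF _ Suc.prems]) auto
  then obtain B where B: "\<And>k j. k < n \<Longrightarrow> j < n \<Longrightarrow> (\<Sum>l<d. c k l * B j l) = (if k = j then 1 else 0)"
    using Suc.IH by blast
  define p where "p j = (\<Sum>l<d. c n l * B j l)" for j
  define r where "r l = c n l - (\<Sum>j<n. p j * c j l)" for l
  have "{..<Suc n} - {n} = {..<n}" by auto
  then have "\<not> in_lspan d {..<n} c (c n)" using lindep_not_span[OF _ _ Suc.prems, of n] by simp
  then obtain i where i: "i < d" "r i \<noteq> 0" unfolding in_lspan_def r_def by auto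
  \<comment> \<open>The \<open>i\<close>-th unit vector, corrected so that the earlier forms vanish
    on it; the new form takes the value \<open>r i\<close> there.\<close>
  define x where "x l = (if l = i then 1 else 0) - (\<Sum>j<n. c j i * B j l)" for l
  have dot_x: "(\<Sum>l<d. c k l * x l) = c k i - (\<Sum>j<n. c j i * (\<Sum>l<d. c k l * B j l))" for k
  proof -
    have "(\<Sum>l<d. c k l * x l) = (\<Sum>l<d. if l = i then c k i else 0) - (\<Sum>l<d. \<Sum>j<n. c j i * (c k l * B j l))"
      unfolding x_def right_diff_distrib sum_subtractf
      by (intro arg_cong2[of _ _ _ _ "(-)"] sum.cong) (auto simp: sum_distrib_left mult_ac)
    also have "(\<Sum>l<d. \<Sum>j<n. c j i * (c k l * B j l)) = (\<Sum>j<n. c j i * (\<Sum>l<d. c k l * B j l))"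
      by (subst sum.swap) (simp add: sum_distrib_left)
    finally show ?thesis using i by simp
  qed
  have x1: "(\<Sum>l<d. c k l * x l) = 0" if "k < n" for k
  proof -
    have "(\<Sum>j<n. c j i * (\<Sum>l<d. c k l * B j l)) = (\<Sum>j<n. if j = k then c k i else 0)"
      by (rule sum.cong) (auto simp: B that)
    then show ?thesis using that by (simp add: dot_x)
  qed
  have x2: "(\<Sum>l<d. c n l * x l) = r i"
    unfolding dot_x r_def p_def by (simp only: mult.commute)
  define B' where "B' j l = (if j = n then x l / r i else B j l - p j * (x l / r i))" for j l
  have "(\<Sum>l<d. c k l * B' j l) = (if k = j then 1 else 0)" if "k < Suc n" "j < Suc n" for k j
  proof -
    have xr: "(\<Sum>l<d. c k l * (x l / r i)) = (if k = n then 1 else 0)"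
      using x1[of k] x2 i that by (auto simp: less_Suc_eq simp flip: sum_divide_distrib)
    show ?thesis
    proof (cases "j = n")
      case True
      then show ?thesis using xr by (simp add: B'_def)
    next
      case False
      have "(\<Sum>l<d. c k l * B' j l) = (\<Sum>l<d. c k l * B j l) - p j * (\<Sum>l<d. c k l * (x l / r i))"
        using False by (simp add: B'_def right_diff_distrib sum_subtractf sum_distrib_left mult_ac)
      then show ?thesis using xr B[of k j] that False by (auto simp: less_Suc_eq p_def)
    qed
  qed
  then show ?case by blast
qed simp

lemma open_contains_tube:
  fixes U :: "(nat \<Rightarrow> complex) set"
  assumes "open U" "p \<in> U"
  obtains M r where "r > 0" "\<And>x. (\<And>i. i < M \<Longrightarrow> norm (x i - p i) < r) \<Longrightarrow> x \<in> U"
proof -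
  have "openin (product_topology (\<lambda>_. euclidean) UNIV) U"
    using assms(1) by (simp add: euclidean_product_topology)
  from product_topology_open_contains_basis[OF this assms(2)]
  obtain Y where Y: "p \<in> Pi\<^sub>E UNIV Y" "\<And>i. open (Y i)" "finite {i. Y i \<noteq> UNIV}" "Pi\<^sub>E UNIV Y \<subseteq> U"
    by (auto simp flip: open_openin)
  obtain M where M: "\<And>i. Y i \<noteq> UNIV \<Longrightarrow> i < M" using finite_nat_set_iff_bounded[of "{i. Y i \<noteq> UNIV}"] Y(3) by auto
  have "\<forall>i. \<exists>e>0. ball (p i) e \<subseteq> Y i" using Y(1,2) open_contains_ball by (metis PiE_mem UNIV_I)
  from choice[OF this] obtain e where e: "\<And>i. e i > 0" "\<And>i. ball (p i) (e i) \<subseteq> Y i" by blast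
  define r where "r = Min (insert 1 (e ` {..<M}))"
  have r: "r > 0" "\<And>i. i < M \<Longrightarrow> r \<le> e i" using e(1) by (auto simp: r_def)
  have "x \<in> U" if "\<And>i. i < M \<Longrightarrow> norm (x i - p i) < r" for x
  proof -
    have "x i \<in> Y i" for i
    proof (cases "i < M")
      case True
      then have "x i \<in> ball (p i) (e i)" using that[OF True] r(2)[OF True] by (simp add: dist_norm norm_minus_commute)
      then show ?thesis using e(2) by blast
    qed (use M in auto)
    then show ?thesis using Y(4) by auto
  qed
  then show thesis using that r by blast
qed

section \<open>Newton's method\<close>

text \<open>Continuous differentiability in the first \<open>M\<close> of infinitely many
  coordinates, with partial derivatives \<open>D i\<close>. It is phrased by derivatives along
  complex lines because the estimates are made on segments.\<close>

definition c1 :: "nat \<Rightarrow> (nat \<Rightarrow> complex) set \<Rightarrow> ((nat \<Rightarrow> complex) \<Rightarrow> complex) \<Rightarrow> (nat \<Rightarrow> (nat \<Rightarrow> complex) \<Rightarrow> complex) \<Rightarrow> bool" where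
  "c1 M S f D \<longleftrightarrow> continuous_on S f \<and> (\<forall>i. continuous_on S (D i)) \<and>
     (\<forall>b\<in>S. \<forall>v. (\<forall>i\<ge>M. v i = 0) \<longrightarrow>
        ((\<lambda>s. f (\<lambda>i. b i + s * v i)) has_field_derivative (\<Sum>i<M. D i b * v i)) (at 0))"

lemma c1_line:
  "c1 M S f D \<Longrightarrow> b \<in> S \<Longrightarrow> (\<And>i. i \<ge> M \<Longrightarrow> v i = 0) \<Longrightarrow>
   ((\<lambda>s. f (\<lambda>i. b i + s * v i)) has_field_derivative (\<Sum>i<M. D i b * v i)) (at 0)"
  by (simp add: c1_def)

lemma c1_const: "c1 M S (\<lambda>b. c) (\<lambda>i b. 0)"
  by (auto simp: c1_def intro!: continuous_intros)

lemma c1_coord: "c1 M S (\<lambda>b. b j) (\<lambda>i b. if i = j then 1 else 0)"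
  unfolding c1_def
proof (intro conjI allI ballI impI)
  show "continuous_on S (\<lambda>b. b j)" using continuous_on_pev[of S "pvar j"] by (simp add: pvar.rep_eq)
  show "continuous_on S (\<lambda>b. if i = j then 1 else 0 :: complex)" for i by (rule continuous_on_const)
  fix b v assume v: "\<forall>i\<ge>M. v i = (0 :: complex)"
  have "(\<Sum>i<M. (if i = j then 1 else 0) * v i) = (\<Sum>i<M. if i = j then v j else 0)"
    by (rule sum.cong) auto
  also have "\<dots> = v j" using v by (simp add: sum.delta)
  finally show "((\<lambda>s. b j + s * v j) has_field_derivative (\<Sum>i<M. (if i = j then 1 else 0) * v i)) (at 0)"
    by (auto intro!: derivative_eq_intros)
qed

lemma c1_add:
  assumes "c1 M S f D" "c1 M S f' D'"
  shows "c1 M S (\<lambda>b. f b + f' b) (\<lambda>i b. D i b + D' i b)"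
  unfolding c1_def
proof (intro conjI allI ballI impI)
  fix b v assume *: "b \<in> S" "\<forall>i\<ge>M. v i = (0 :: complex)"
  then have "((\<lambda>s. f (\<lambda>i. b i + s * v i) + f' (\<lambda>i. b i + s * v i)) has_field_derivative
     (\<Sum>i<M. D i b * v i) + (\<Sum>i<M. D' i b * v i)) (at 0)"
    using assms unfolding c1_def by (intro DERIV_add) blast+
  then show "((\<lambda>s. f (\<lambda>i. b i + s * v i) + f' (\<lambda>i. b i + s * v i)) has_field_derivative
     (\<Sum>i<M. (D i b + D' i b) * v i)) (at 0)" by (simp add: ring_distribs sum.distrib)
qed (use assms in \<open>auto simp: c1_def intro!: continuous_intros\<close>)

lemma c1_mult:
  assumes "c1 M S f D" "c1 M S f' D'"
  shows "c1 M S (\<lambda>b. f b * f' b) (\<lambda>i b. D i b * f' b + D' i b * f b)"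
  unfolding c1_def
proof (intro conjI allI ballI impI)
  fix b v assume *: "b \<in> S" "\<forall>i\<ge>M. v i = (0 :: complex)"
  then have "((\<lambda>s. f (\<lambda>i. b i + s * v i) * f' (\<lambda>i. b i + s * v i)) has_field_derivative
     (\<Sum>i<M. D i b * v i) * f' (\<lambda>i. b i + 0 * v i) + (\<Sum>i<M. D' i b * v i) * f (\<lambda>i. b i + 0 * v i)) (at 0)"
    using assms unfolding c1_def by (intro DERIV_mult) blast+
  then show "((\<lambda>s. f (\<lambda>i. b i + s * v i) * f' (\<lambda>i. b i + s * v i)) has_field_derivative
     (\<Sum>i<M. (D i b * f' b + D' i b * f b) * v i)) (at 0)"
    by (simp add: ring_distribs sum.distrib sum_distrib_left sum_distrib_right mult_ac)
qed (use assms in \<open>auto simp: c1_def intro!: continuous_intros\<close>)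

lemma c1_compose:
  assumes f: "c1 M S f D" and \<phi>: "\<phi> holomorphic_on U" "open U" "\<And>b. b \<in> S \<Longrightarrow> f b \<in> U"
  shows "c1 M S (\<lambda>b. \<phi> (f b)) (\<lambda>i b. deriv \<phi> (f b) * D i b)"
  unfolding c1_def
proof (intro conjI allI ballI impI)
  have fc: "continuous_on S f" "f ` S \<subseteq> U" using f \<phi>(3) by (auto simp: c1_def)
  show "continuous_on S (\<lambda>b. \<phi> (f b))"
    by (rule continuous_on_compose2[OF holomorphic_on_imp_continuous_on[OF \<phi>(1)] fc])
  have "continuous_on S (\<lambda>b. deriv \<phi> (f b))"
    by (rule continuous_on_compose2[OF holomorphic_on_imp_continuous_on[OF holomorphic_deriv[OF \<phi>(1,2)]] fc])
  then show "continuous_on S (\<lambda>b. deriv \<phi> (f b) * D i b)" for i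
    using f by (intro continuous_on_mult) (auto simp: c1_def)
  fix b v assume b: "b \<in> S" and v: "\<forall>i\<ge>M. v i = (0 :: complex)"
  have "((\<lambda>s. f (\<lambda>i. b i + s * v i)) has_field_derivative (\<Sum>i<M. D i b * v i)) (at 0)"
    using f b v by (auto simp: c1_def)
  moreover have "(\<phi> has_field_derivative deriv \<phi> (f b)) (at (f (\<lambda>i. b i + 0 * v i)))"
    using holomorphic_derivI[OF \<phi>(1,2), of "f b" UNIV] \<phi>(3)[OF b] by simp
  ultimately have "((\<lambda>s. \<phi> (f (\<lambda>i. b i + s * v i))) has_field_derivative deriv \<phi> (f b) * (\<Sum>i<M. D i b * v i)) (at 0)"
    by (rule DERIV_chain2[rotated])
  then show "((\<lambda>s. \<phi> (f (\<lambda>i. b i + s * v i))) has_field_derivative (\<Sum>i<M. deriv \<phi> (f b) * D i b * v i)) (at 0)"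
    by (simp add: sum_distrib_left mult.assoc)
qed

definition C1 :: "nat \<Rightarrow> (nat \<Rightarrow> complex) set \<Rightarrow> ((nat \<Rightarrow> complex) \<Rightarrow> complex) \<Rightarrow> bool" where
  "C1 M S f \<longleftrightarrow> (\<exists>D. c1 M S f D)"

lemma C1_continuous: "C1 M S f \<Longrightarrow> continuous_on S f"
  by (auto simp: C1_def c1_def)

lemma C1_intros:
  "C1 M S (\<lambda>b. c)" "C1 M S (\<lambda>b. b j)"
  "C1 M S f \<Longrightarrow> C1 M S f' \<Longrightarrow> C1 M S (\<lambda>b. f b + f' b)"
  "C1 M S f \<Longrightarrow> C1 M S f' \<Longrightarrow> C1 M S (\<lambda>b. f b * f' b)"
  unfolding C1_def using c1_const c1_coord c1_add c1_mult by blast+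

lemma C1_compose:
  "C1 M S f \<Longrightarrow> \<phi> holomorphic_on U \<Longrightarrow> open U \<Longrightarrow> (\<And>b. b \<in> S \<Longrightarrow> f b \<in> U) \<Longrightarrow> C1 M S (\<lambda>b. \<phi> (f b))"
  unfolding C1_def using c1_compose by blast

lemma C1_uminus: "C1 M S f \<Longrightarrow> C1 M S (\<lambda>b. - f b)"
  using C1_intros(4)[OF C1_intros(1)[of M S "-1"], of f] by simp

lemma C1_diff: "C1 M S f \<Longrightarrow> C1 M S f' \<Longrightarrow> C1 M S (\<lambda>b. f b - f' b)"
  using C1_intros(3)[OF _ C1_uminus[of M S f'], of f] by simp

lemma C1_divide:
  assumes "C1 M S f" "C1 M S f'" "\<And>b. b \<in> S \<Longrightarrow> f' b \<noteq> 0"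
  shows "C1 M S (\<lambda>b. f b / f' b)"
proof -
  have "C1 M S (\<lambda>b. inverse (f' b))"
    by (rule C1_compose[OF assms(2), of inverse "- {0}"]) (use assms(3) in \<open>auto intro!: holomorphic_intros\<close>)
  then show ?thesis using C1_intros(4)[OF assms(1)] by (simp add: divide_inverse)
qed

lemma C1_sum: "(\<And>a. a \<in> A \<Longrightarrow> C1 M S (f a)) \<Longrightarrow> C1 M S (\<lambda>b. \<Sum>a\<in>A. f a b)"
  by (induction A rule: infinite_finite_induct) (auto intro: C1_intros)

lemma C1_pev:
  assumes "\<And>i. C1 M S (\<lambda>b. y b i)"
  shows "C1 M S (\<lambda>b. pev P (y b))"
  by (induction P) (auto intro: C1_intros assms)

lemma C1_ev2:
  assumes "\<And>i. C1 M S (\<lambda>b. y b i)" "C1 M S t"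
  shows "C1 M S (\<lambda>b. ev2 Q (y b) (t b))"
  by (induction Q) (auto intro!: C1_intros assms C1_pev)

lemma C1_subset: "C1 M S f \<Longrightarrow> T \<subseteq> S \<Longrightarrow> C1 M T f"
proof -
  assume "C1 M S f" and T: "T \<subseteq> S"
  then obtain D where D: "c1 M S f D" by (auto simp: C1_def)
  then have "c1 M T f D" using T unfolding c1_def by (auto elim: continuous_on_subset)
  then show ?thesis by (auto simp: C1_def)
qed

lemma c1_derivative_at:
  assumes "c1 M S f D" "\<And>i. i \<ge> M \<Longrightarrow> v i = 0" "(\<lambda>i. b i + s1 * v i) \<in> S"
  shows "((\<lambda>s. f (\<lambda>i. b i + s * v i)) has_field_derivative (\<Sum>i<M. D i (\<lambda>i. b i + s1 * v i) * v i)) (at s1)"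
proof -
  let ?b = "\<lambda>i. b i + s1 * v i"
  have "((\<lambda>s. f (\<lambda>i. ?b i + s * v i)) has_field_derivative (\<Sum>i<M. D i ?b * v i)) (at 0)"
    by (rule c1_line[OF assms(1,3,2)])
  then have "((\<lambda>s. f (\<lambda>i. ?b i + s * v i)) has_field_derivative (\<Sum>i<M. D i ?b * v i)) (at (s1 + (- s1)))" by simp
  then have "((\<lambda>s. f (\<lambda>i. ?b i + (s + (- s1)) * v i)) has_field_derivative (\<Sum>i<M. D i ?b * v i)) (at s1)"
    by (subst (asm) DERIV_shift) simp
  then show ?thesis by (simp add: algebra_simps)
qed

text \<open>The Jacobian matrix is close to the identity, so \<open>b - H b\<close> is iterated.
  Deviations of at most \<open>1 / (2 * N)\<close> per entry give row sums of at most
  \<open>1 / 2\<close>, hence a contraction by \<open>1 / 2\<close> in the maximum norm; with a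
  first step of at most \<open>r / 2\<close> the iteration stays within \<open>r\<close>.\<close>

lemma newton_contraction:
  fixes H :: "nat \<Rightarrow> (nat \<Rightarrow> complex) \<Rightarrow> complex"
  assumes D: "\<And>k. k < N \<Longrightarrow> c1 M S (H k) (D k)" and NM: "N \<le> M" and r: "r > 0"
    and T: "\<And>b. (\<And>i. i < N \<Longrightarrow> norm (b i - q i) \<le> r) \<Longrightarrow> (\<And>i. i \<ge> N \<Longrightarrow> b i = q i) \<Longrightarrow>
       b \<in> S \<and> (\<forall>k<N. \<forall>l<N. norm (D k l b - (if k = l then 1 else 0)) \<le> 1 / (2 * real N))"
    and Hq: "\<And>k. k < N \<Longrightarrow> norm (H k q) \<le> r / 2"
  shows "\<exists>b\<in>S. (\<forall>i<N. norm (b i - q i) \<le> r) \<and> (\<forall>i\<ge>N. b i = q i) \<and> (\<forall>k<N. H k b = 0)"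
proof -
  define B where "B = {b. (\<forall>i<N. norm (b i - q i) \<le> r) \<and> (\<forall>i\<ge>N. b i = q i)}"
  have BS: "b \<in> S" "\<And>k l. k < N \<Longrightarrow> l < N \<Longrightarrow> norm (D k l b - (if k = l then 1 else 0)) \<le> 1 / (2 * real N)"
    if "b \<in> B" for b
    using T[of b] that by (auto simp: B_def)
  define \<Psi> where "\<Psi> b = (\<lambda>k. if k < N then b k - H k b else b k)" for b
  have contr: "norm (\<Psi> b' k - \<Psi> b k) \<le> c / 2"
    if b: "b \<in> B" "b' \<in> B" and k: "k < N" and c: "\<And>l. l < N \<Longrightarrow> norm (b' l - b l) \<le> c" for b b' k c
  proof -
    define v where "v i = b' i - b i" for i
    have v0: "v i = 0" if "i \<ge> N" for i using b that by (auto simp: B_def v_def)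
    \<comment> \<open>The coordinate \<open>k\<close> of \<Psi> along the segment from
      \<open>b\<close> to \<open>b'\<close>, to which the mean value estimate is applied.\<close>
    define f where "f s = (b k + s * v k) - H k (\<lambda>i. b i + s * v i)" for s
    have seg: "(\<lambda>i. b i + s * v i) \<in> B" if s: "s \<in> closed_segment 0 1" for s
    proof -
      obtain u where u: "0 \<le> u" "u \<le> 1" "s = of_real u" using s by (auto simp: closed_segment_def scaleR_conv_of_real)
      have "norm (b i + s * v i - q i) \<le> r" if "i < N" for i
      proof -
        have "b i + s * v i - q i = of_real (1 - u) * (b i - q i) + of_real u * (b' i - q i)"
          by (simp add: u v_def algebra_simps)
        also have "norm \<dots> \<le> (1 - u) * norm (b i - q i) + u * norm (b' i - q i)"
          using norm_triangle_ineq[of "of_real (1 - u) * (b i - q i)" "of_real u * (b' i - q i)"] u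
          unfolding norm_mult norm_of_real by simp
        also have "\<dots> \<le> (1 - u) * r + u * r"
          using b that u by (intro add_mono mult_left_mono) (auto simp: B_def)
        finally show ?thesis by (simp add: algebra_simps)
      qed
      then show ?thesis using b v0 by (auto simp: B_def)
    qed
    have df: "(f has_field_derivative (v k - (\<Sum>i<M. D k i (\<lambda>i. b i + s * v i) * v i))) (at s within closed_segment 0 1)"
      if "s \<in> closed_segment 0 1" for s
    proof -
      have "((\<lambda>s. H k (\<lambda>i. b i + s * v i)) has_field_derivative (\<Sum>i<M. D k i (\<lambda>i. b i + s * v i) * v i)) (at s)"
        by (rule c1_derivative_at[OF D[OF k]]) (use v0 NM BS(1)[OF seg[OF that]] in auto)
      then have "(f has_field_derivative (0 + 1 * v k) - (\<Sum>i<M. D k i (\<lambda>i. b i + s * v i) * v i)) (at s)"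
        unfolding f_def by (intro DERIV_diff DERIV_add DERIV_const DERIV_cmult_right DERIV_ident)
      then show ?thesis by (simp add: has_field_derivative_at_within)
    qed
    have bound: "norm (v k - (\<Sum>i<M. D k i (\<lambda>i. b i + s * v i) * v i)) \<le> c / 2"
      if "s \<in> closed_segment 0 1" for s
    proof -
      let ?b = "\<lambda>i. b i + s * v i"
      have "(\<Sum>i<M. D k i ?b * v i) = (\<Sum>i<N. D k i ?b * v i)"
        using NM v0 by (intro sum.mono_neutral_right) auto
      moreover have "v k = (\<Sum>i<N. (if k = i then 1 else 0) * v i)"
      proof -
        have "(\<Sum>i<N. (if k = i then 1 else 0) * v i) = (\<Sum>i<N. if i = k then v k else 0)"
          by (rule sum.cong) auto
        then show ?thesis using k by simp
      qed
      ultimately have "norm (v k - (\<Sum>i<M. D k i ?b * v i)) = norm (\<Sum>i<N. (D k i ?b - (if k = i then 1 else 0)) * v i)"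
        by (simp add: left_diff_distrib sum_subtractf norm_minus_commute)
      also have "\<dots> \<le> (\<Sum>i<N. 1 / (2 * real N) * c)"
      proof (rule sum_norm_le)
        fix i assume "i \<in> {..<N}"
        then show "norm ((D k i ?b - (if k = i then 1 else 0)) * v i) \<le> 1 / (2 * real N) * c"
          unfolding norm_mult using BS(2)[OF seg[OF that] k, of i] c[of i] by (intro mult_mono) (auto simp: v_def)
      qed
      also have "\<dots> = c / 2" using k by simp
      finally show ?thesis .
    qed
    have "norm (f 1 - f 0) \<le> c / 2 * norm (1 - 0 :: complex)"
      by (rule field_differentiable_bound[OF convex_closed_segment df bound]) auto
    moreover have "f 1 = \<Psi> b' k" "f 0 = \<Psi> b k" using k by (auto simp: f_def \<Psi>_def v_def)
    ultimately show ?thesis by simp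
  qed
  define x where "x j = (\<Psi> ^^ j) q" for j
  have x0: "x 0 = q" and xS: "x (Suc j) = \<Psi> (x j)" for j by (simp_all add: x_def)
  have qB: "q \<in> B" using r by (simp add: B_def)
  have step: "x j \<in> B \<and> x (Suc j) \<in> B \<and> (\<forall>k<N. norm (x (Suc j) k - x j k) \<le> r / 2 / 2 ^ j) \<and>
     (\<forall>k<N. norm (x (Suc j) k - q k) \<le> r - r / 2 / 2 ^ j)" for j
  proof (induction j)
    case 0
    have *: "norm (x (Suc 0) k - q k) \<le> r / 2" if "k < N" for k
      using Hq[OF that] that by (simp add: xS x0 \<Psi>_def)
    then have "norm (x (Suc 0) k - q k) \<le> r" if "k < N" for k using r that by (smt (verit) field_sum_of_halves)
    then have "x (Suc 0) \<in> B" by (auto simp: B_def xS x0 \<Psi>_def)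
    then show ?case using qB * by (simp add: x0)
  next
    case (Suc j)
    have d: "norm (x (Suc (Suc j)) k - x (Suc j) k) \<le> r / 2 / 2 ^ Suc j" if "k < N" for k
      using contr[of "x j" "x (Suc j)" k "r / 2 / 2 ^ j"] Suc that by (simp add: xS)
    have n: "norm (x (Suc (Suc j)) k - q k) \<le> r - r / 2 / 2 ^ Suc j" if "k < N" for k
    proof -
      have "norm (x (Suc (Suc j)) k - q k) \<le> norm (x (Suc (Suc j)) k - x (Suc j) k) + norm (x (Suc j) k - q k)"
        using norm_triangle_ineq[of "x (Suc (Suc j)) k - x (Suc j) k" "x (Suc j) k - q k"] by simp
      also have "\<dots> \<le> r / 2 / 2 ^ Suc j + (r - r / 2 / 2 ^ j)" using d[OF that] Suc that by (intro add_mono) auto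
      also have "\<dots> = r - r / 2 / 2 ^ Suc j" by (simp add: field_simps)
      finally show ?thesis .
    qed
    have "x (Suc (Suc j)) \<in> B" unfolding B_def
    proof (intro CollectI conjI allI impI)
      fix i assume "i < N"
      then have "norm (x (Suc (Suc j)) i - q i) \<le> r - r / 2 / 2 ^ Suc j" by (rule n)
      also have "\<dots> \<le> r" using r by simp
      finally show "norm (x (Suc (Suc j)) i - q i) \<le> r" .
    next
      fix i assume "N \<le> i"
      then show "x (Suc (Suc j)) i = q i" using Suc by (auto simp: xS[of "Suc j"] \<Psi>_def B_def)
    qed
    then show ?case using Suc d n by blast
  qed
  have conv: "\<exists>l. (\<lambda>j. x j k) \<longlonglongrightarrow> l" for k
  proof (cases "k < N")
    case True
    have "summable (\<lambda>j. r / 2 * (1 / 2) ^ j)" by (intro summable_mult summable_geometric) simp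
    moreover have "norm (x (Suc j) k - x j k) \<le> r / 2 * (1 / 2) ^ j" for j
    proof -
      have "norm (x (Suc j) k - x j k) \<le> r / 2 / 2 ^ j" using step[of j] True by blast
      also have "\<dots> = r / 2 * (1 / 2) ^ j" by (simp add: power_one_over)
      finally show ?thesis .
    qed
    ultimately have "summable (\<lambda>j. x (Suc j) k - x j k)"
      by (rule summable_comparison_test'[of _ 0])
    then have "(\<lambda>n. \<Sum>j<n. x (Suc j) k - x j k) \<longlonglongrightarrow> suminf (\<lambda>j. x (Suc j) k - x j k)"
      by (rule summable_LIMSEQ)
    moreover have "(\<lambda>n. \<Sum>j<n. x (Suc j) k - x j k) = (\<lambda>n. x n k - x 0 k)"
      by (intro ext sum_lessThan_telescope[of "\<lambda>j. x j k"])
    ultimately have "(\<lambda>n. x n k - x 0 k) \<longlonglongrightarrow> suminf (\<lambda>j. x (Suc j) k - x j k)"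
      by (simp only:)
    from tendsto_add[OF this tendsto_const[of "x 0 k"]] show ?thesis by auto
  next
    case False
    then have "x j k = q k" for j using step[of j] by (auto simp: B_def)
    then show ?thesis by auto
  qed
  define l where "l k = lim (\<lambda>j. x j k)" for k
  have l: "(\<lambda>j. x j k) \<longlonglongrightarrow> l k" for k
    unfolding l_def using conv[of k] by (simp add: convergent_LIMSEQ_iff[symmetric] convergent_def)
  have lB: "l \<in> B" unfolding B_def
  proof (intro CollectI conjI allI impI)
    fix i assume "i < N"
    have "(\<lambda>j. norm (x j i - q i)) \<longlonglongrightarrow> norm (l i - q i)" by (intro tendsto_intros l)
    then show "norm (l i - q i) \<le> r"
      by (rule tendsto_upperbound) (use step \<open>i < N\<close> in \<open>auto simp: B_def\<close>)
  next
    fix i assume "N \<le> i"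
    then have "x j i = q i" for j using step[of j] by (auto simp: B_def)
    then have "(\<lambda>j. x j i) \<longlonglongrightarrow> q i" by simp
    then show "l i = q i" by (rule LIMSEQ_unique[OF l])
  qed
  have "H k l = 0" if k: "k < N" for k
  proof -
    have "continuous_on S (H k)" using D[OF k] by (simp add: c1_def)
    then have "(\<lambda>j. H k (x j)) \<longlonglongrightarrow> H k l"
      by (rule continuous_on_tendsto_compose) (use l step BS(1) lB in \<open>auto simp: tendsto_fun_iff\<close>)
    moreover have "H k (x j) = x j k - x (Suc j) k" for j using k by (simp add: xS \<Psi>_def)
    ultimately have "(\<lambda>j. x j k - x (Suc j) k) \<longlonglongrightarrow> H k l" by (simp only:)
    moreover have "(\<lambda>j. x j k - x (Suc j) k) \<longlonglongrightarrow> l k - l k"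
      by (intro tendsto_diff l LIMSEQ_Suc)
    ultimately show ?thesis using LIMSEQ_unique by fastforce
  qed
  then show ?thesis using lB BS(1) by (intro bexI[of _ l]) (auto simp: B_def)
qed

text \<open>The first \<open>N\<close> coordinates are the unknowns, the others are parameters.\<close>

lemma newton_stability:
  fixes H :: "nat \<Rightarrow> (nat \<Rightarrow> complex) \<Rightarrow> complex"
  assumes S: "open S" "b0 \<in> S" and C1: "\<And>k. k < N \<Longrightarrow> C1 M S (H k)" and NM: "N \<le> M" and e: "e > 0"
    and H0: "\<And>k. k < N \<Longrightarrow> H k b0 = 0"
    and dH: "\<And>k l. k < N \<Longrightarrow> l < N \<Longrightarrow>
      ((\<lambda>s. H k (\<lambda>i. b0 i + s * (if i = l then 1 else 0))) has_field_derivative (if k = l then 1 else 0)) (at 0)"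
  shows "\<exists>\<delta>>0. \<forall>q. (\<forall>i<N. q i = b0 i) \<longrightarrow> (\<forall>i\<ge>N. norm (q i - b0 i) < \<delta>) \<longrightarrow>
     (\<exists>b\<in>S. (\<forall>i<N. norm (b i - b0 i) < e) \<and> (\<forall>i\<ge>N. b i = q i) \<and> (\<forall>k<N. H k b = 0))"
proof -
  have "\<forall>k. \<exists>D. k < N \<longrightarrow> c1 M S (H k) D" using C1 by (auto simp: C1_def)
  from choice[OF this] obtain D where D: "\<And>k. k < N \<Longrightarrow> c1 M S (H k) (D k)" by blast
  have D0: "D k l b0 = (if k = l then 1 else 0)" if "k < N" "l < N" for k l
  proof -
    let ?v = "\<lambda>i. if i = l then 1 else (0 :: complex)"
    have "((\<lambda>s. H k (\<lambda>i. b0 i + s * ?v i)) has_field_derivative (\<Sum>i<M. D k i b0 * ?v i)) (at 0)"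
      using D[OF that(1)] S(2) that NM by (auto simp: c1_def)
    moreover have "(\<Sum>i<M. D k i b0 * ?v i) = (\<Sum>i<M. if i = l then D k l b0 else 0)"
      by (rule sum.cong) auto
    ultimately show ?thesis using DERIV_unique[OF dH[OF that]] that NM by simp
  qed
  define S1 where "S1 = {b \<in> S. \<forall>k<N. \<forall>l<N. norm (D k l b - (if k = l then 1 else 0)) < 1 / (2 * real N)}"
  have S1_eq: "S1 = S \<inter> (\<Inter>k\<in>{..<N}. \<Inter>l\<in>{..<N}. S \<inter> D k l -` ball (if k = l then 1 else 0) (1 / (2 * real N)))"
    unfolding S1_def by (simp add: dist_norm norm_minus_commute set_eq_iff) blast
  have "open S1" unfolding S1_eq
    by (intro open_Int S(1) open_INT ballI continuous_open_preimage) (use D in \<open>auto simp: c1_def\<close>)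
  moreover have "b0 \<in> S1"
    using S(2) D0 by (auto simp: S1_def)
  ultimately obtain M1 r1 where r1: "r1 > 0" "\<And>b. (\<And>i. i < M1 \<Longrightarrow> norm (b i - b0 i) < r1) \<Longrightarrow> b \<in> S1"
    by (rule open_contains_tube) blast
  \<comment> \<open>Halving turns the non-strict bounds of \<open>newton_contraction\<close> into
    the strict ones required here.\<close>
  define r where "r = min r1 e / 2"
  have r: "r > 0" "r < r1" "r < e" using r1(1) e by (auto simp: r_def)
  define S2 where "S2 = {b \<in> S. \<forall>k<N. norm (H k b) < r / 2}"
  have S2_eq: "S2 = S \<inter> (\<Inter>k\<in>{..<N}. S \<inter> H k -` ball 0 (r / 2))"
    by (auto simp: S2_def)
  have "open S2" unfolding S2_eq
    by (intro open_Int S(1) open_INT ballI continuous_open_preimage) (use D in \<open>auto simp: c1_def\<close>)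
  moreover have "b0 \<in> S2" using S(2) H0 r by (auto simp: S2_def)
  ultimately obtain M2 r2 where r2: "r2 > 0" "\<And>b. (\<And>i. i < M2 \<Longrightarrow> norm (b i - b0 i) < r2) \<Longrightarrow> b \<in> S2"
    by (rule open_contains_tube) blast
  show ?thesis
  proof (intro exI[of _ "min r1 r2"] conjI allI impI)
    show "min r1 r2 > 0" using r1(1) r2(1) by simp
    fix q assume q: "\<forall>i<N. q i = b0 i" "\<forall>i\<ge>N. norm (q i - b0 i) < min r1 r2"
    have q2: "norm (q i - b0 i) < min r1 r2" for i using q r1(1) r2(1) by (cases "i < N") auto
    have "q \<in> S2" by (rule r2(2)) (use q2 in auto)
    then have Hq: "norm (H k q) \<le> r / 2" if "k < N" for k using that by (auto simp: S2_def less_imp_le)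
    have "\<exists>b\<in>S. (\<forall>i<N. norm (b i - q i) \<le> r) \<and> (\<forall>i\<ge>N. b i = q i) \<and> (\<forall>k<N. H k b = 0)"
    proof (rule newton_contraction[OF D NM r(1) _ Hq])
      fix b assume b: "\<And>i. i < N \<Longrightarrow> norm (b i - q i) \<le> r" "\<And>i. i \<ge> N \<Longrightarrow> b i = q i"
      have "b \<in> S1"
      proof (rule r1(2))
        fix i show "norm (b i - b0 i) < r1"
          using b[of i] q q2[of i] r by (cases "i < N") auto
      qed
      then show "b \<in> S \<and> (\<forall>k<N. \<forall>l<N. norm (D k l b - (if k = l then 1 else 0)) \<le> 1 / (2 * real N))"
        by (auto simp: S1_def less_imp_le)
    qed auto
    then obtain b where b: "b \<in> S" "\<forall>i<N. norm (b i - q i) \<le> r" "\<forall>i\<ge>N. b i = q i" "\<forall>k<N. H k b = 0" by blast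
    then show "\<exists>b\<in>S. (\<forall>i<N. norm (b i - b0 i) < e) \<and> (\<forall>i\<ge>N. b i = q i) \<and> (\<forall>k<N. H k b = 0)"
      using q(1) r(3) by (intro bexI[of _ b]) auto
  qed
qed

section \<open>Tangent vectors at generic points\<close>

lemma pev_has_derivative_exists:
  assumes "\<And>i. ((\<lambda>t. x t i) has_field_derivative \<tau> i) (at s)"
  shows "\<exists>D. ((\<lambda>t. pev P (x t)) has_field_derivative D) (at s)"
  using pev_deriv_exists[of P] assms by blast

context hypersurface
begin

text \<open>The quotient rule for \<open>pt\<close> at \<open>y\<close> and \<open>s\<close> in the
  direction given by \<alpha> and \<gamma>.\<close>

definition dpt :: "(nat \<Rightarrow> complex) \<Rightarrow> complex \<Rightarrow> (nat \<Rightarrow> complex) \<Rightarrow> complex \<Rightarrow> nat \<Rightarrow> complex" where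
  "dpt y s \<alpha> \<gamma> i = (let
     E = ev2 (partial2 F (d + i)) y s; E' = (\<Sum>l<d. ev2 (partial2 (partial2 F (d + i)) l) y s * \<alpha> l) + ev2 (pderiv (partial2 F (d + i))) y s * \<gamma>;
     D = ev2 (pderiv F) y s; D' = (\<Sum>l<d. ev2 (partial2 (pderiv F) l) y s * \<alpha> l) + ev2 (pderiv (pderiv F)) y s * \<gamma>
     in (- E' * D - (- E) * D') / (D * D))"

lemma pt_has_derivative:
  assumes x: "\<And>i. ((\<lambda>t. x t i) has_field_derivative \<alpha> i) (at u)" "\<And>i. i \<ge> d \<Longrightarrow> \<alpha> i = 0"
    and \<xi>: "(\<xi> has_field_derivative \<gamma>) (at u)" and D: "ev2 (pderiv F) (x u) (\<xi> u) \<noteq> 0" and i: "i < m"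
  shows "((\<lambda>t. pt (x t) (\<xi> t) i) has_field_derivative dpt (x u) (\<xi> u) \<alpha> \<gamma> i) (at u)"
proof -
  have "((\<lambda>t. - ev2 (partial2 F (d + i)) (x t) (\<xi> t) / ev2 (pderiv F) (x t) (\<xi> t)) has_field_derivative
      dpt (x u) (\<xi> u) \<alpha> \<gamma> i) (at u)"
    unfolding dpt_def Let_def
    by (intro DERIV_divide DERIV_minus ev2_has_derivative_finite x \<xi> D)
  then show ?thesis using i by (simp add: pt_def)
qed

text \<open>Dividing \<open>F\<close> by \<open>X - s0\<close> yields the derivative of the root at \<open>s0\<close>.\<close>

lemma root_curve:
  assumes x0: "x0 \<in> X" "pev disc (pmap \<eta> x0) \<noteq> 0" and \<alpha>: "\<And>i. i \<ge> d \<Longrightarrow> \<alpha> i = 0"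
  obtains \<xi> \<gamma> where "\<xi> 0 = g x0" "(\<xi> has_field_derivative \<gamma>) (at 0)"
    "\<forall>\<^sub>F s in nhds 0. ev2 F (\<lambda>i. pmap \<eta> x0 i + s * \<alpha> i) (\<xi> s) = 0 \<and> pev disc (\<lambda>i. pmap \<eta> x0 i + s * \<alpha> i) \<noteq> 0"
    "(\<Sum>l<d. ev2 (partial2 F l) (pmap \<eta> x0) (g x0) * \<alpha> l) + ev2 (pderiv F) (pmap \<eta> x0) (g x0) * \<gamma> = 0"
proof -
  define y0 s0 where "y0 = pmap \<eta> x0" and "s0 = g x0"
  define y where "y s = (\<lambda>i. y0 i + s * \<alpha> i)" for s
  have y0: "y 0 = y0" by (simp add: y_def)
  have dy: "((\<lambda>s. y s i) has_field_derivative \<alpha> i) (at s)" for i s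
    unfolding y_def by (auto intro!: derivative_eq_intros)
  have y_lim: "((\<lambda>s. y s i) \<longlongrightarrow> y0 i) (at 0)" for i
    using DERIV_isCont[OF dy[of i 0]] by (simp add: isCont_def y0)
  have root: "ev2 F y0 s0 = 0" using F_rel x0 by (simp add: relation_def y0_def s0_def)
  have D0: "ev2 (pderiv F) y0 s0 \<noteq> 0" using pderiv_neq0[OF root] x0 by (simp add: y0_def)
  have ev_disc: "\<forall>\<^sub>F s in nhds 0. pev disc (y s) \<noteq> 0"
  proof -
    have "((\<lambda>s. pev disc (y s)) \<longlongrightarrow> pev disc y0) (at 0)" by (rule tendsto_pev[OF y_lim])
    then have "\<forall>\<^sub>F s in at 0. pev disc (y s) \<noteq> 0"
      by (rule tendsto_imp_eventually_ne) (use x0 in \<open>simp add: y0_def\<close>)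
    then show ?thesis using x0 by (simp add: eventually_nhds_conv_at y0 y0_def)
  qed
  have lead: "pev (lead_coeff F) z \<noteq> 0" if "pev disc z \<noteq> 0" for z using that by (simp add: disc_def)
  \<comment> \<open>A root close to \<open>s0\<close> is chosen for each \<open>s\<close>
    separately. At \<open>s = 0\<close> the estimate forces it to be \<open>s0\<close>, and the
    derivative is taken at this point only.\<close>
  have "\<forall>s. \<exists>r. pev disc (y s) \<noteq> 0 \<longrightarrow> ev2 F (y s) r = 0 \<and>
      norm (pev (lead_coeff F) (y s)) * norm (s0 - r) ^ degree F \<le> norm (ev2 F (y s) s0)"
    using root_near lead by blast
  from choice[OF this] obtain \<xi> where \<xi>: "\<And>s. pev disc (y s) \<noteq> 0 \<Longrightarrow> ev2 F (y s) (\<xi> s) = 0"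
    "\<And>s. pev disc (y s) \<noteq> 0 \<Longrightarrow> norm (pev (lead_coeff F) (y s)) * norm (s0 - \<xi> s) ^ degree F \<le> norm (ev2 F (y s) s0)"
    by blast
  have d0: "pev disc (y 0) \<noteq> 0" using x0 by (simp add: y0 y0_def)
  have \<xi>0: "\<xi> 0 = s0"
  proof -
    have "norm (pev (lead_coeff F) y0) * norm (s0 - \<xi> 0) ^ degree F \<le> 0" using \<xi>(2)[OF d0] root by (simp add: y0)
    moreover have "norm (pev (lead_coeff F) y0) > 0" using lead[OF d0] by (simp add: y0)
    ultimately have "norm (s0 - \<xi> 0) ^ degree F \<le> 0" by (simp add: mult_le_0_iff)
    then show ?thesis using degree_F by (auto simp: power_le_zero_eq)
  qed
  have \<xi>_lim: "(\<xi> \<longlongrightarrow> s0) (at 0)"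
  proof -
    have "((\<lambda>s. norm (ev2 F (y s) s0) / norm (pev (lead_coeff F) (y s))) \<longlongrightarrow> norm (ev2 F y0 s0) / norm (pev (lead_coeff F) y0)) (at 0)"
      using lead[OF d0] by (intro tendsto_divide tendsto_norm tendsto_ev2 tendsto_pev y_lim tendsto_const) (simp add: y0)
    then have lim0: "((\<lambda>s. norm (ev2 F (y s) s0) / norm (pev (lead_coeff F) (y s))) \<longlongrightarrow> 0) (at 0)" by (simp add: root)
    have "\<forall>\<^sub>F s in at 0. pev disc (y s) \<noteq> 0" using ev_disc by (simp add: eventually_nhds_conv_at)
    then have le: "\<forall>\<^sub>F s in at 0. norm (s0 - \<xi> s) ^ degree F \<le> norm (ev2 F (y s) s0) / norm (pev (lead_coeff F) (y s))"
    proof eventually_elim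
      case (elim s)
      then show ?case using \<xi>(2)[OF elim] lead[OF elim] by (simp add: field_simps)
    qed
    have "((\<lambda>s. norm (s0 - \<xi> s) ^ degree F) \<longlongrightarrow> 0) (at 0)"
      by (rule tendsto_sandwich[OF _ le tendsto_const lim0]) simp
    then have "((\<lambda>s. root (degree F) (norm (s0 - \<xi> s) ^ degree F)) \<longlongrightarrow> root (degree F) 0) (at 0)"
      by (rule tendsto_real_root)
    then have "((\<lambda>s. norm (s0 - \<xi> s)) \<longlongrightarrow> 0) (at 0)" using degree_F by (simp add: real_root_power_cancel)
    then have "((\<lambda>s. s0 - \<xi> s) \<longlongrightarrow> 0) (at 0)" by (simp add: tendsto_norm_zero_iff)
    from tendsto_diff[OF tendsto_const[of s0] this] show ?thesis by simp
  qed
  \<comment> \<open>The remainder is the value of \<open>F\<close> at \<open>s0\<close>, which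
    vanishes at \<open>y0\<close>, while \<open>B\<close> agrees with \<open>pderiv F\<close> at
    \<open>y0\<close> and \<open>s0\<close>. So \<open>\<xi> s - s0\<close> is minus the remainder
    divided by \<open>B\<close>, and the difference quotient converges.\<close>
  obtain B \<rho> where B: "F = [:- pconst s0, 1:] * B + \<rho>" "\<rho> = 0 \<or> degree \<rho> < degree [:- pconst s0, 1:]"
  proof -
    have "lead_coeff [:- pconst s0, 1:] = pconst 1" by (rule pfun_eqI) simp
    then show thesis using poly_division_const_lead[of "[:- pconst s0, 1:]" 1 F] that by auto
  qed
  then have "degree \<rho> = 0" by auto
  then obtain c where c: "\<rho> = [:c:]" by (metis degree_eq_zeroE)
  have FB: "ev2 F z t = (t - s0) * ev2 B z t + pev c z" for z t
    by (subst B(1)) (simp add: c algebra_simps)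
  have c0: "pev c y0 = 0" using FB[of y0 s0] root by simp
  have BD: "ev2 B y0 s0 = ev2 (pderiv F) y0 s0"
    by (subst B(1)) (simp add: c pderiv_add pderiv_diff pderiv_smult pderiv_mult pderiv_pCons)
  obtain c' where c': "((\<lambda>s. pev c (y s)) has_field_derivative c') (at 0)"
    using pev_has_derivative_exists[of y \<alpha> 0 c, OF dy] by blast
  define \<gamma> where "\<gamma> = - c' / ev2 B y0 s0"
  have d\<xi>: "(\<xi> has_field_derivative \<gamma>) (at 0)"
    unfolding has_field_derivative_iff
  proof -
    have "((\<lambda>s. (pev c (y s) - pev c (y 0)) / (s - 0)) \<longlongrightarrow> c') (at 0)"
      using c' by (simp add: has_field_derivative_iff)
    moreover have Bl: "((\<lambda>s. ev2 B (y s) (\<xi> s)) \<longlongrightarrow> ev2 B y0 s0) (at 0)" by (rule tendsto_ev2[OF y_lim \<xi>_lim])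
    ultimately have l: "((\<lambda>s. - (pev c (y s) / s) / ev2 B (y s) (\<xi> s)) \<longlongrightarrow> \<gamma>) (at 0)"
      unfolding \<gamma>_def using BD D0 by (intro tendsto_divide tendsto_minus) (simp_all add: y0 c0)
    have "\<forall>\<^sub>F s in at 0. ev2 B (y s) (\<xi> s) \<noteq> 0" by (rule tendsto_imp_eventually_ne[OF Bl]) (use BD D0 in simp)
    moreover have "\<forall>\<^sub>F s in at 0. pev disc (y s) \<noteq> 0" using ev_disc by (simp add: eventually_nhds_conv_at)
    ultimately have "\<forall>\<^sub>F s in at 0. - (pev c (y s) / s) / ev2 B (y s) (\<xi> s) = (\<xi> s - \<xi> 0) / (s - 0)"
    proof eventually_elim
      case (elim s)
      have "(\<xi> s - s0) * ev2 B (y s) (\<xi> s) = - pev c (y s)"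
        using FB[of "y s" "\<xi> s"] \<xi>(1)[OF elim(2)] by (simp add: eq_neg_iff_add_eq_0)
      then have "\<xi> s - s0 = - pev c (y s) / ev2 B (y s) (\<xi> s)" using elim by (simp add: field_simps)
      then show ?case by (simp add: \<xi>0)
    qed
    with l show "((\<lambda>s. (\<xi> s - \<xi> 0) / (s - 0)) \<longlongrightarrow> \<gamma>) (at 0)" by (rule Lim_transform_eventually)
  qed
  have ev: "\<forall>\<^sub>F s in nhds 0. ev2 F (y s) (\<xi> s) = 0 \<and> pev disc (y s) \<noteq> 0"
    using ev_disc by eventually_elim (use \<xi>(1) in blast)
  have "((\<lambda>s. ev2 F (y s) (\<xi> s)) has_field_derivative
      ((\<Sum>l<d. ev2 (partial2 F l) (y 0) (\<xi> 0) * \<alpha> l) + ev2 (pderiv F) (y 0) (\<xi> 0) * \<gamma>)) (at 0)"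
    by (rule ev2_has_derivative_finite[OF dy d\<xi> \<alpha>])
  moreover have "((\<lambda>s. ev2 F (y s) (\<xi> s)) has_field_derivative 0) (at 0)"
  proof -
    have "\<forall>\<^sub>F s in nhds 0. ev2 F (y s) (\<xi> s) = 0" using ev by eventually_elim blast
    from DERIV_cong_ev[OF refl this refl] show ?thesis by simp
  qed
  ultimately have tang: "(\<Sum>l<d. ev2 (partial2 F l) y0 s0 * \<alpha> l) + ev2 (pderiv F) y0 s0 * \<gamma> = 0"
    using DERIV_unique by (fastforce simp: y0 \<xi>0)
  show thesis
    by (rule that[of \<xi> \<gamma>]) (use \<xi>0 d\<xi> ev tang in \<open>simp_all add: y_def y0_def s0_def\<close>)
qed

lemma curve:
  assumes x0: "x0 \<in> X" "pev disc (pmap \<eta> x0) \<noteq> 0" and \<alpha>: "\<And>i. i \<ge> d \<Longrightarrow> \<alpha> i = 0"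
  obtains \<zeta> \<tau> \<gamma> where "\<zeta> 0 = x0" "\<And>i. ((\<lambda>s. \<zeta> s i) has_field_derivative \<tau> i) (at 0)"
    "\<forall>\<^sub>F s in nhds 0. \<zeta> s \<in> X \<and> pmap \<eta> (\<zeta> s) = (\<lambda>i. pmap \<eta> x0 i + s * \<alpha> i)"
    "\<And>i. i \<ge> m \<Longrightarrow> \<tau> i = 0"
    "\<And>i. i < m \<Longrightarrow> \<tau> i = dpt (pmap \<eta> x0) (g x0) \<alpha> \<gamma> i"
    "(\<Sum>l<d. ev2 (partial2 F l) (pmap \<eta> x0) (g x0) * \<alpha> l) + ev2 (pderiv F) (pmap \<eta> x0) (g x0) * \<gamma> = 0"
proof -
  let ?y = "\<lambda>s i. pmap \<eta> x0 i + s * \<alpha> i"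
  obtain \<xi> \<gamma> where \<xi>: "\<xi> 0 = g x0" "(\<xi> has_field_derivative \<gamma>) (at 0)"
    and ev: "\<forall>\<^sub>F s in nhds 0. ev2 F (?y s) (\<xi> s) = 0 \<and> pev disc (?y s) \<noteq> 0"
    and tang: "(\<Sum>l<d. ev2 (partial2 F l) (pmap \<eta> x0) (g x0) * \<alpha> l) + ev2 (pderiv F) (pmap \<eta> x0) (g x0) * \<gamma> = 0"
    by (rule root_curve[OF x0 \<alpha>])
  define \<zeta> where "\<zeta> s = pt (?y s) (\<xi> s)" for s
  define \<tau> where "\<tau> i = (if i < m then dpt (pmap \<eta> x0) (g x0) \<alpha> \<gamma> i else 0)" for i
  have "((\<lambda>s. \<zeta> s i) has_field_derivative \<tau> i) (at 0)" for i
  proof (cases "i < m")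
    case True
    have dy: "((\<lambda>s. ?y s i) has_field_derivative \<alpha> i) (at 0)" for i by (auto intro!: derivative_eq_intros)
    have "ev2 (pderiv F) (?y 0) (\<xi> 0) \<noteq> 0"
      using pderiv_neq0[of "pmap \<eta> x0" "g x0"] x0 F_rel by (simp add: \<xi>(1) relation_def)
    from pt_has_derivative[OF dy \<alpha> \<xi>(2) this True] show ?thesis
      using True by (simp add: \<zeta>_def \<tau>_def \<xi>(1))
  next
    case False
    then have "\<zeta> s i = pmap \<eta> x0 (d + (i - m))" for s by (simp add: \<zeta>_def pt_def \<alpha>)
    then show ?thesis using False by (simp add: \<tau>_def)
  qed
  moreover have "\<forall>\<^sub>F s in nhds 0. \<zeta> s \<in> X \<and> pmap \<eta> (\<zeta> s) = ?y s"
    using ev by eventually_elim (auto simp: \<zeta>_def intro: pt_in \<eta>_pt)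
  moreover have "\<zeta> 0 = x0" using pt_\<eta>[OF x0] by (simp add: \<zeta>_def \<xi>(1))
  ultimately show thesis using that[of \<zeta> \<tau> \<gamma>] tang by (simp add: \<tau>_def)
qed

end

text \<open>The relation is differentiated along the curve, on which the parameters do not move. The
  velocity of every coordinate is therefore linear in those of the coordinates in
  \<open>ss\<close>.\<close>

lemma curve_relation:
  assumes \<zeta>: "\<And>i. ((\<lambda>s. \<zeta> s i) has_field_derivative \<tau> i) (at 0)" "\<forall>\<^sub>F s in nhds 0. \<zeta> s \<in> X"
    "\<And>i. i \<ge> m \<Longrightarrow> \<tau> i = 0" and Q: "relation X (base m ss) (pvar i) Q"
    and nz: "ev2 (pderiv Q) (pmap (base m ss) (\<zeta> 0)) (\<zeta> 0 i) \<noteq> 0"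
  shows "\<tau> i = (\<Sum>l<length ss. (- ev2 (partial2 Q l) (pmap (base m ss) (\<zeta> 0)) (\<zeta> 0 i) /
     ev2 (pderiv Q) (pmap (base m ss) (\<zeta> 0)) (\<zeta> 0 i)) * \<tau> (ss ! l))"
proof -
  let ?\<eta> = "pmap (base m ss)"
  let ?\<alpha> = "\<lambda>l. if l < length ss then \<tau> (ss ! l) else 0"
  have "((\<lambda>s. ev2 Q (?\<eta> (\<zeta> s)) (\<zeta> s i)) has_field_derivative
     ((\<Sum>l<length ss. ev2 (partial2 Q l) (?\<eta> (\<zeta> 0)) (\<zeta> 0 i) * ?\<alpha> l) + ev2 (pderiv Q) (?\<eta> (\<zeta> 0)) (\<zeta> 0 i) * \<tau> i)) (at 0)"
  proof (rule ev2_has_derivative_finite)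
    show "((\<lambda>s. ?\<eta> (\<zeta> s) l) has_field_derivative ?\<alpha> l) (at 0)" for l
      using \<zeta>(1)[of "ss ! l"] \<zeta>(1)[of "m + (l - length ss)"] \<zeta>(3)[of "m + (l - length ss)"]
      by (auto simp: pmap_base simp del: Nat.add_diff_assoc)
  qed (use \<zeta> in auto)
  moreover have "((\<lambda>s. ev2 Q (?\<eta> (\<zeta> s)) (\<zeta> s i)) has_field_derivative 0) (at 0)"
  proof -
    have "\<forall>\<^sub>F s in nhds 0. ev2 Q (?\<eta> (\<zeta> s)) (\<zeta> s i) = 0"
      using \<zeta>(2) by eventually_elim (use Q in \<open>auto simp: relation_def\<close>)
    from DERIV_cong_ev[OF refl this refl] show ?thesis by simp
  qed
  ultimately have "(\<Sum>l<length ss. ev2 (partial2 Q l) (?\<eta> (\<zeta> 0)) (\<zeta> 0 i) * ?\<alpha> l) + ev2 (pderiv Q) (?\<eta> (\<zeta> 0)) (\<zeta> 0 i) * \<tau> i = 0"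
    using DERIV_unique by blast
  then have "\<tau> i = - (\<Sum>l<length ss. ev2 (partial2 Q l) (?\<eta> (\<zeta> 0)) (\<zeta> 0 i) * \<tau> (ss ! l)) / ev2 (pderiv Q) (?\<eta> (\<zeta> 0)) (\<zeta> 0 i)"
    using nz by (simp add: field_simps eq_neg_iff_add_eq_0)
  then show ?thesis by (simp add: sum_divide_distrib sum_negf)
qed

section \<open>Generic points of closed cylinders\<close>

locale closed_cylinder =
  fixes X :: "(nat \<Rightarrow> complex) set" and m :: nat
  assumes X_irr: "irr X"
    and X_cyl: "\<And>x x'. x \<in> X \<Longrightarrow> (\<And>i. i < m \<Longrightarrow> x' i = x i) \<Longrightarrow> x' \<in> X"
    and X_closed: "\<And>x. (\<And>P. (\<forall>z\<in>X. pev P z = 0) \<Longrightarrow> pev P x = 0) \<Longrightarrow> x \<in> X"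
begin

text \<open>\<open>density\<close> controls the first \<open>m\<close> coordinates only. The
  parameters of the point found are moved back towards those of \<open>p\<close>; all but finitely
  many positions on the way keep \<open>h\<close> nonzero.\<close>

lemma density_open:
  assumes U: "open U" "p \<in> U" "p \<in> X" and h: "x1 \<in> X" "pev h x1 \<noteq> 0"
  shows "\<exists>x\<in>X \<inter> U. pev h x \<noteq> 0"
proof -
  obtain M r where r: "r > 0" "\<And>x. (\<And>i. i < M \<Longrightarrow> norm (x i - p i) < r) \<Longrightarrow> x \<in> U"
    by (rule open_contains_tube[OF U(1,2)]) blast
  have "\<exists>x\<in>X. pev h x \<noteq> 0 \<and> (\<forall>i<m. norm (x i - p i) < r)"
    using density[of X m, OF X_irr _ _ U(3) h r(1)] X_cyl X_closed by blast
  then obtain x' where x': "x' \<in> X" "pev h x' \<noteq> 0" "\<And>i. i < m \<Longrightarrow> norm (x' i - p i) < r" by blast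
  define a where "a i = (if i < m then x' i else p i)" for i
  define b where "b i = (if i < m then 0 else x' i - p i)" for i
  have "(\<lambda>i. a i + 1 * b i) = x'" by (auto simp: a_def b_def)
  then have "\<forall>\<^sub>F s in at 0. pev h (\<lambda>i. a i + s * b i) \<noteq> 0"
    using x'(2) by (intro eventually_line_neq0[of h a 1 b]) simp
  moreover have "\<forall>\<^sub>F s in at 0. \<forall>i<M. norm (a i + s * b i - p i) < r"
  proof -
    have "\<forall>\<^sub>F s in at 0. norm (a i + s * b i - p i) < r" for i
    proof -
      have "((\<lambda>s. norm (a i + s * b i - p i)) \<longlongrightarrow> norm (a i + 0 * b i - p i)) (at 0)" by (intro tendsto_intros)
      moreover have "norm (a i + 0 * b i - p i) < r" using x'(3)[of i] r(1) by (simp add: a_def)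
      ultimately show ?thesis by (rule order_tendstoD(2))
    qed
    then show ?thesis using eventually_ball_finite[of "{..<M}" "\<lambda>s i. norm (a i + s * b i - p i) < r" "at 0"]
      by (simp add: Ball_def)
  qed
  ultimately have "\<forall>\<^sub>F s in at 0. pev h (\<lambda>i. a i + s * b i) \<noteq> 0 \<and> (\<lambda>i. a i + s * b i) \<in> U"
    by eventually_elim (use r(2) in auto)
  then obtain s where s: "pev h (\<lambda>i. a i + s * b i) \<noteq> 0" "(\<lambda>i. a i + s * b i) \<in> U"
    using eventually_happens[of _ "at (0 :: complex)"] by auto
  have "(\<lambda>i. a i + s * b i) \<in> X" by (rule X_cyl[OF x'(1)]) (simp add: a_def b_def)
  then show ?thesis using s by blast
qed

lemma param_base_base:
  assumes "indep X (base m ss)" "set ss \<subseteq> {..<m}"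
  shows "param_base X m (length ss) (base m ss)"
proof
  show "pev (base m ss i) x' = pev (base m ss i) x"
    if "i < length ss" "\<And>j. j < m \<Longrightarrow> x' j = x j" for i x x'
  proof -
    have "ss ! i < m" using assms(2) nth_mem[OF that(1)] by blast
    then show ?thesis using that by (simp add: base_def)
  qed
  show "x' \<in> X" if "x \<in> X" "\<And>i. i < m \<Longrightarrow> x' i = x i" for x x' using X_cyl that .
  show "x \<in> X" if "\<And>P. (\<forall>z\<in>X. pev P z = 0) \<Longrightarrow> pev P x = 0" for x using X_closed that .
qed (use assms X_irr in \<open>simp_all add: base_def\<close>)

lemma hypersurface_base:
  assumes "indep X (base m ss)" "distinct ss" "set ss \<subseteq> {..<m}"
  obtains ext F where "hypersurface X m (length (ss @ ext)) (base m (ss @ ext)) F" "set (ss @ ext) \<subseteq> {..<m}"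
    "\<And>h. alg X (base m (ss @ ext)) h"
proof -
  obtain ext where ext: "indep X (base m (ss @ ext))" "distinct (ss @ ext)" "set (ss @ ext) \<subseteq> {..<m}"
    "\<And>i. alg X (base m (ss @ ext)) (pvar i)"
    using extend_to_base[OF assms] by blast
  have alg: "alg X (base m (ss @ ext)) h" for h by (rule alg_all[OF X_irr ext(1,4)])
  obtain F where "minrel X (base m (ss @ ext)) (generic_form m) F" using alg_minrel[OF alg] .
  then have "hypersurface X m (length (ss @ ext)) (base m (ss @ ext)) F"
    by (intro hypersurface.intro param_base_base ext hypersurface_axioms.intro)
  then show thesis using that ext alg by blast
qed

lemma pfun_neq0_on:
  assumes "indep X \<eta>" "P \<noteq> 0"
  shows "\<exists>x\<in>X. pev (psubst \<eta> P) x \<noteq> 0"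
  using assms unfolding indep_def by (auto simp: pmap_def)

text \<open>The coordinate \<open>c\<close> is made the first member of a base. Along the curve that
  moves this member alone its values fill a disc, which meets the dense set
  \<open>J\<close>.\<close>

lemma coordinate_meets:
  assumes U: "open U" "p \<in> U" "p \<in> X" and c: "c < m" "indep X (base m [c])"
    and dense: "\<And>w r. r > 0 \<Longrightarrow> \<exists>w'\<in>J. norm (w' - w) < r"
  shows "\<exists>x\<in>X \<inter> U. x c \<in> J"
proof -
  obtain ext F where F: "hypersurface X m (length ([c] @ ext)) (base m ([c] @ ext)) F"
  proof (rule hypersurface_base[OF c(2)])
    fix ext F
    assume "hypersurface X m (length ([c] @ ext)) (base m ([c] @ ext)) F"
    then show thesis by (rule that)
  qed (use c(1) in auto)
  interpret hypersurface X m "length ([c] @ ext)" "base m ([c] @ ext)" F by (fact F)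
  obtain x1 where "x1 \<in> X" "pev (psubst (base m ([c] @ ext)) disc) x1 \<noteq> 0"
    using pfun_neq0_on[OF \<eta>_indep disc_neq0] by blast
  from density_open[OF U this] obtain x0 where x0: "x0 \<in> X" "x0 \<in> U" "pev disc (pmap (base m ([c] @ ext)) x0) \<noteq> 0"
    by (auto simp: pmap_def)
  obtain \<zeta> \<tau> where \<zeta>: "\<zeta> 0 = x0" "\<And>i. ((\<lambda>s. \<zeta> s i) has_field_derivative \<tau> i) (at 0)"
    "\<forall>\<^sub>F s in nhds 0. \<zeta> s \<in> X \<and> pmap (base m ([c] @ ext)) (\<zeta> s) = (\<lambda>i. pmap (base m ([c] @ ext)) x0 i + s * (if i = 0 then 1 else 0))"
    by (rule curve[OF x0(1,3), of "\<lambda>i. if i = 0 then 1 else 0"]) auto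
  have "((\<lambda>s. \<zeta> s) \<longlongrightarrow> \<zeta> 0) (at 0)"
    unfolding tendsto_fun_iff using DERIV_isCont[OF \<zeta>(2)] by (simp add: isCont_def)
  then have "\<forall>\<^sub>F s in at 0. \<zeta> s \<in> U" using U(1) x0(2) \<zeta>(1) by (simp add: topological_tendstoD)
  then have "\<forall>\<^sub>F s in nhds 0. \<zeta> s \<in> U" using x0(2) \<zeta>(1) by (simp add: eventually_nhds_conv_at)
  with \<zeta>(3) have "\<forall>\<^sub>F s in nhds 0. \<zeta> s \<in> X \<inter> U \<and> \<zeta> s c = x0 c + s"
  proof eventually_elim
    case (elim s)
    then have "pmap (base m ([c] @ ext)) (\<zeta> s) 0 = pmap (base m ([c] @ ext)) x0 0 + s * (if (0::nat) = 0 then 1 else 0)"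
      by (simp only:)
    then have "\<zeta> s c = x0 c + s" by (simp add: pmap_base)
    then show ?case using elim by blast
  qed
  then obtain r where r: "r > 0" "\<And>s. dist s 0 < r \<Longrightarrow> \<zeta> s \<in> X \<inter> U \<and> \<zeta> s c = x0 c + s"
    unfolding eventually_nhds_metric by blast
  obtain w where w: "w \<in> J" "norm (w - x0 c) < r" using dense[OF r(1)] by blast
  have "dist (w - x0 c) 0 < r" using w(2) by (simp add: dist_norm)
  from r(2)[OF this] w(1) show ?thesis by (intro bexI[of _ "\<zeta> (w - x0 c)"]) auto
qed

end

locale base_hypersurface = hypersurface X m "length ss" "base m ss" F for X m ss F +
  assumes ss_sub: "set ss \<subseteq> {..<m}"
begin

abbreviation tangent where
  "tangent x \<alpha> \<gamma> \<equiv> (\<Sum>l<length ss. ev2 (partial2 F l) (pmap (base m ss) x) (g x) * \<alpha> l) +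
     ev2 (pderiv F) (pmap (base m ss) x) (g x) * \<gamma> = 0"

abbreviation regular where
  "regular x \<equiv> x \<in> X \<and> pev disc (pmap (base m ss) x) \<noteq> 0"

lemma regular_pderiv: "regular x \<Longrightarrow> ev2 (pderiv F) (pmap (base m ss) x) (g x) \<noteq> 0"
  using pderiv_neq0[of "pmap (base m ss) x" "g x"] F_rel by (simp add: relation_def)

end

text \<open>The coefficients of the differential of coordinate \<open>i\<close> with respect to
  those of the coordinates in \<open>ss\<close>, found by implicit differentiation of
  \<open>Q i\<close>.\<close>

definition grad :: "nat \<Rightarrow> nat list \<Rightarrow> (nat \<Rightarrow> pfun poly) \<Rightarrow> (nat \<Rightarrow> complex) \<Rightarrow> nat \<Rightarrow> nat \<Rightarrow> complex" where
  "grad m ss Q x i l = - ev2 (partial2 (Q i) l) (pmap (base m ss) x) (x i) / ev2 (pderiv (Q i)) (pmap (base m ss) x) (x i)"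

context base_hypersurface
begin

text \<open>The last clause admits any list \<open>ss0\<close>, so that differentials written in one
  base can be tested on tangent vectors built from another.\<close>

lemma velocity:
  assumes x: "regular x" and \<alpha>: "\<And>l. l \<ge> length ss \<Longrightarrow> \<alpha> l = 0"
  obtains \<tau> \<gamma> where "\<And>l. l < length ss \<Longrightarrow> \<tau> (ss ! l) = \<alpha> l"
    "\<And>i. i < m \<Longrightarrow> \<tau> i = dpt (pmap (base m ss) x) (g x) \<alpha> \<gamma> i" "tangent x \<alpha> \<gamma>"
    "\<And>ss0 Q i. relation X (base m ss0) (pvar i) (Q i) \<Longrightarrow> ev2 (pderiv (Q i)) (pmap (base m ss0) x) (x i) \<noteq> 0 \<Longrightarrow>
       \<tau> i = (\<Sum>l<length ss0. grad m ss0 Q x i l * \<tau> (ss0 ! l))"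
proof (rule curve[of x \<alpha>])
  fix \<zeta> \<tau> \<gamma>
  assume \<zeta>: "\<zeta> 0 = x" "\<And>i. ((\<lambda>s. \<zeta> s i) has_field_derivative \<tau> i) (at 0)"
    "\<forall>\<^sub>F s in nhds 0. \<zeta> s \<in> X \<and> pmap (base m ss) (\<zeta> s) = (\<lambda>i. pmap (base m ss) x i + s * \<alpha> i)"
    "\<And>i. i \<ge> m \<Longrightarrow> \<tau> i = 0"
    and d: "\<And>i. i < m \<Longrightarrow> \<tau> i = dpt (pmap (base m ss) x) (g x) \<alpha> \<gamma> i" and t: "tangent x \<alpha> \<gamma>"
  have "\<tau> (ss ! l) = \<alpha> l" if l: "l < length ss" for l
  proof -
    have "\<forall>\<^sub>F s in nhds 0. \<zeta> s (ss ! l) = x (ss ! l) + s * \<alpha> l"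
      using \<zeta>(3)
    proof eventually_elim
      case (elim s)
      then have "pmap (base m ss) (\<zeta> s) l = pmap (base m ss) x l + s * \<alpha> l" by (simp only:)
      then show ?case using l by (simp add: pmap_base)
    qed
    moreover have "((\<lambda>s. x (ss ! l) + s * \<alpha> l) has_field_derivative \<alpha> l) (at 0)"
      by (auto intro!: derivative_eq_intros)
    ultimately have "((\<lambda>s. \<zeta> s (ss ! l)) has_field_derivative \<alpha> l) (at 0)"
      using DERIV_cong_ev[OF refl _ refl] by fast
    then show ?thesis using DERIV_unique[OF \<zeta>(2)] by blast
  qed
  moreover have "\<tau> i = (\<Sum>l<length ss0. grad m ss0 Q x i l * \<tau> (ss0 ! l))"
    if "relation X (base m ss0) (pvar i) (Q i)" "ev2 (pderiv (Q i)) (pmap (base m ss0) x) (x i) \<noteq> 0" for ss0 Q i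
  proof -
    have "\<forall>\<^sub>F s in nhds 0. \<zeta> s \<in> X" using \<zeta>(3) by eventually_elim blast
    from curve_relation[OF \<zeta>(2) this \<zeta>(4) that(1)] that(2) show ?thesis by (simp add: \<zeta>(1) grad_def)
  qed
  ultimately show thesis using that d t by blast
qed (use x \<alpha> in auto)

text \<open>The tangent equation determines \<gamma> because \<open>pderiv F\<close> is nonzero. The
  direction is thus the velocity of a curve, and the relations apply to it.\<close>

lemma tangent_grad:
  assumes x: "regular x" and \<alpha>: "\<And>l. l \<ge> length ss \<Longrightarrow> \<alpha> l = 0" and t: "tangent x \<alpha> \<gamma>" and i: "i < m"
    and Q: "relation X (base m ss) (pvar i) (Q i)" "ev2 (pderiv (Q i)) (pmap (base m ss) x) (x i) \<noteq> 0"
  shows "dpt (pmap (base m ss) x) (g x) \<alpha> \<gamma> i = (\<Sum>l<length ss. grad m ss Q x i l * \<alpha> l)"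
proof (rule velocity[OF x \<alpha>])
  fix \<tau> \<gamma>'
  assume a: "\<And>l. l < length ss \<Longrightarrow> \<tau> (ss ! l) = \<alpha> l"
    "\<And>i. i < m \<Longrightarrow> \<tau> i = dpt (pmap (base m ss) x) (g x) \<alpha> \<gamma>' i" and t': "tangent x \<alpha> \<gamma>'"
    and b: "\<And>ss0 Q i. relation X (base m ss0) (pvar i) (Q i) \<Longrightarrow> ev2 (pderiv (Q i)) (pmap (base m ss0) x) (x i) \<noteq> 0 \<Longrightarrow>
       \<tau> i = (\<Sum>l<length ss0. grad m ss0 Q x i l * \<tau> (ss0 ! l))"
  have "ev2 (pderiv F) (pmap (base m ss) x) (g x) * \<gamma> = ev2 (pderiv F) (pmap (base m ss) x) (g x) * \<gamma>'"
    using t t' by (metis add_left_cancel)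
  then have "\<gamma>' = \<gamma>" using regular_pderiv[OF x] by simp
  then show ?thesis using a b[of ss i Q, OF Q] i by simp
qed auto

text \<open>A linear relation among the differentials is evaluated on the tangent vector that moves
  one coordinate of \<open>ss\<close> and fixes the others, which isolates a single
  coefficient.\<close>

lemma grad_free:
  assumes x: "regular x"
    and Q: "\<And>i. i < m \<Longrightarrow> relation X (base m ss0) (pvar i) (Q i)" "\<And>i. i < m \<Longrightarrow> ev2 (pderiv (Q i)) (pmap (base m ss0) x) (x i) \<noteq> 0"
  shows "lindep_free (length ss0) (set ss) (grad m ss0 Q x)"
  unfolding lindep_free_def
proof (intro allI impI ballI)
  fix t i assume t: "\<forall>l<length ss0. (\<Sum>i\<in>set ss. t i * grad m ss0 Q x i l) = 0" and "i \<in> set ss"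
  then obtain j where j: "j < length ss" "ss ! j = i" by (auto simp: in_set_conv_nth)
  show "t i = 0"
  proof (rule velocity[OF x, of "\<lambda>l. if l = j then 1 else 0"])
    fix \<tau> \<gamma>
    assume a: "\<And>l. l < length ss \<Longrightarrow> \<tau> (ss ! l) = (if l = j then 1 else 0)"
      and b: "\<And>ss0 Q i. relation X (base m ss0) (pvar i) (Q i) \<Longrightarrow> ev2 (pderiv (Q i)) (pmap (base m ss0) x) (x i) \<noteq> 0 \<Longrightarrow>
         \<tau> i = (\<Sum>l<length ss0. grad m ss0 Q x i l * \<tau> (ss0 ! l))"
    have \<tau>: "\<tau> i' = (if i' = i then 1 else 0)" if "i' \<in> set ss" for i'
      using a j that by (auto simp: in_set_conv_nth)
    have "t i = (\<Sum>i'\<in>set ss. if i' = i then t i else 0)" using \<open>i \<in> set ss\<close> by simp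
    also have "\<dots> = (\<Sum>i'\<in>set ss. t i' * \<tau> i')" by (rule sum.cong) (auto simp: \<tau>)
    also have "\<dots> = (\<Sum>i'\<in>set ss. \<Sum>l<length ss0. t i' * grad m ss0 Q x i' l * \<tau> (ss0 ! l))"
    proof (rule sum.cong)
      fix i' assume "i' \<in> set ss"
      then have "i' < m" using ss_sub by auto
      from b[of ss0 i' Q, OF Q[OF this]] show "t i' * \<tau> i' = (\<Sum>l<length ss0. t i' * grad m ss0 Q x i' l * \<tau> (ss0 ! l))"
        by (simp add: sum_distrib_left mult.assoc)
    qed simp
    also have "\<dots> = (\<Sum>l<length ss0. (\<Sum>i'\<in>set ss. t i' * grad m ss0 Q x i' l) * \<tau> (ss0 ! l))"
      by (subst sum.swap) (simp add: sum_distrib_right)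
    finally show "t i = 0" using t by simp
  qed (use j in auto)
qed

end

context closed_cylinder
begin

lemma base_hypersurface_exists:
  assumes "indep X (base m ss)" "distinct ss" "set ss \<subseteq> {..<m}"
  obtains ext F where "base_hypersurface X m (ss @ ext) F" "\<And>h. alg X (base m (ss @ ext)) h"
proof (rule hypersurface_base[OF assms])
  fix ext F
  assume *: "hypersurface X m (length (ss @ ext)) (base m (ss @ ext)) F" "set (ss @ ext) \<subseteq> {..<m}"
    "\<And>h. alg X (base m (ss @ ext)) h"
  show thesis
    by (rule that[OF base_hypersurface.intro[OF *(1) base_hypersurface_axioms.intro[OF *(2)]] *(3)])
qed

text \<open>\<open>s\<close> is extended to a base, and \<open>h\<close> is the \<open>disc\<close>
  of the resulting hypersurface. It does not depend on \<open>ss0\<close> and \<open>Q\<close>, so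
  that several lists \<open>s\<close> can be compared in one common base.\<close>

lemma grad_generic_free:
  assumes "indep X (base m s)" "distinct s" "set s \<subseteq> {..<m}"
  shows "\<exists>h. (\<exists>x\<in>X. pev h x \<noteq> 0) \<and> (\<forall>x\<in>X. \<forall>ss0 Q. pev h x \<noteq> 0 \<longrightarrow>
    (\<forall>i<m. relation X (base m ss0) (pvar i) (Q i) \<and> ev2 (pderiv (Q i)) (pmap (base m ss0) x) (x i) \<noteq> 0) \<longrightarrow>
    lindep_free (length ss0) (set s) (grad m ss0 Q x))"
proof (rule base_hypersurface_exists[OF assms])
  fix ext F assume "base_hypersurface X m (s @ ext) F"
  then interpret base_hypersurface X m "s @ ext" F .
  show ?thesis
  proof (intro exI[of _ "psubst (base m (s @ ext)) disc"] conjI ballI allI impI)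
    show "\<exists>x\<in>X. pev (psubst (base m (s @ ext)) disc) x \<noteq> 0" by (rule pfun_neq0_on[OF \<eta>_indep disc_neq0])
    fix x ss0 Q
    assume *: "x \<in> X" "pev (psubst (base m (s @ ext)) disc) x \<noteq> 0"
      "\<forall>i<m. relation X (base m ss0) (pvar i) (Q i) \<and> ev2 (pderiv (Q i)) (pmap (base m ss0) x) (x i) \<noteq> 0"
    have "lindep_free (length ss0) (set (s @ ext)) (grad m ss0 Q x)"
      by (rule grad_free) (use * in \<open>auto simp: pmap_def\<close>)
    then show "lindep_free (length ss0) (set s) (grad m ss0 Q x)"
      by (rule lindep_subset[rotated]) auto
  qed
qed

text \<open>One point has to serve for all lists in \<open>S\<close> and all coordinates. Each
  condition follows from the nonvanishing of a function that is not zero on \<open>X\<close>, and by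
  irreducibility neither is the product of these finitely many functions.\<close>

lemma generic_point:
  assumes fin: "finite S" and S: "\<And>s. s \<in> S \<Longrightarrow> indep X (base m s) \<and> distinct s \<and> set s \<subseteq> {..<m}"
    and empty: "indep X (base m [])" and U: "open U" "p \<in> U" "p \<in> X"
  obtains ss F x Q where "base_hypersurface X m ss F" "x \<in> U" "base_hypersurface.regular X m ss F x"
    "\<And>i. i < m \<Longrightarrow> relation X (base m ss) (pvar i) (Q i)"
    "\<And>i. i < m \<Longrightarrow> ev2 (pderiv (Q i)) (pmap (base m ss) x) (x i) \<noteq> 0"
    "\<And>s. s \<in> S \<Longrightarrow> lindep_free (length ss) (set s) (grad m ss Q x)"
proof (rule base_hypersurface_exists[OF empty])
  fix ss F assume H: "base_hypersurface X m ([] @ ss) F" and alg: "\<And>h. alg X (base m ([] @ ss)) h"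
  interpret base_hypersurface X m ss F using H by simp
  have "\<forall>i. \<exists>Q. minrel X (base m ss) (pvar i) Q" using alg_minrel[OF alg] by (metis append_Nil)
  from choice[OF this] obtain Q where Q: "\<And>i. minrel X (base m ss) (pvar i) (Q i)" by blast
  have rel: "relation X (base m ss) (pvar i) (Q i)" for i using Q by (simp add: minrel_def)
  have nrel: "\<exists>x\<in>X. pev (psubst2 (base m ss) (pvar i) (pderiv (Q i))) x \<noteq> 0" for i
  proof -
    interpret q: min_relation X "base m ss" "pvar i" "Q i" by standard (fact X_irr \<eta>_indep Q)+
    show ?thesis using q.pderiv_not_relation by (simp add: relation_def)
  qed
  define good where "good s h \<longleftrightarrow> (\<exists>x\<in>X. pev h x \<noteq> 0) \<and> (\<forall>x\<in>X. \<forall>ss0 Q. pev h x \<noteq> 0 \<longrightarrow>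
    (\<forall>i<m. relation X (base m ss0) (pvar i) (Q i) \<and> ev2 (pderiv (Q i)) (pmap (base m ss0) x) (x i) \<noteq> 0) \<longrightarrow>
    lindep_free (length ss0) (set s) (grad m ss0 Q x))" for s h
  have "\<exists>h. s \<in> S \<longrightarrow> good s h" for s
    using grad_generic_free[of s] S[of s] unfolding good_def by (cases "s \<in> S") simp_all
  then obtain h where h: "\<And>s. s \<in> S \<Longrightarrow> good s (h s)" by metis
  define h1 where "h1 = psubst (base m ss) disc"
  define h2 where "h2 = (\<Prod>i<m. psubst2 (base m ss) (pvar i) (pderiv (Q i)))"
  define h3 where "h3 = prod h S"
  have "\<exists>x\<in>X. pev h1 x \<noteq> 0" unfolding h1_def by (rule pfun_neq0_on[OF \<eta>_indep disc_neq0])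
  moreover have "\<exists>x\<in>X. pev h2 x \<noteq> 0" unfolding h2_def by (rule irr_prod[OF X_irr]) (use nrel in auto)
  moreover have "\<exists>x\<in>X. pev h3 x \<noteq> 0" unfolding h3_def by (rule irr_prod[OF X_irr fin]) (use h in \<open>auto simp: good_def\<close>)
  ultimately have "\<exists>x\<in>X. pev (prod (\<lambda>j. if j = 0 then h1 else if j = 1 then h2 else h3) {0, 1, 2 :: nat}) x \<noteq> 0"
    by (intro irr_prod[OF X_irr]) auto
  then obtain x1 where "x1 \<in> X" "pev (h1 * (h2 * h3)) x1 \<noteq> 0" by auto
  from density_open[OF U this] obtain x where x: "x \<in> X" "x \<in> U" "pev (h1 * (h2 * h3)) x \<noteq> 0" by blast
  have x2: "ev2 (pderiv (Q i)) (pmap (base m ss) x) (x i) \<noteq> 0" if "i < m" for i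
    using x(3) that by (auto simp: h2_def)
  have x3: "pev (h s) x \<noteq> 0" if "s \<in> S" for s
    using x(3) that fin by (auto simp: h3_def)
  show thesis
  proof (rule that[of ss F x Q])
    show "regular x" using x by (auto simp: h1_def pmap_def)
    show "lindep_free (length ss) (set s) (grad m ss Q x)" if "s \<in> S" for s
      using h[OF that] x(1) x3[OF that] rel x2 by (simp add: good_def)
  qed (use x x2 rel base_hypersurface_axioms in auto)
qed simp_all

end

section \<open>Solutions near a generic point\<close>

lemma (in hypersurface) continuous_on_pt:
  assumes "\<And>i. continuous_on S (\<lambda>b. y b i)" "continuous_on S s" "\<And>b. b \<in> S \<Longrightarrow> ev2 (pderiv F) (y b) (s b) \<noteq> 0"
  shows "continuous_on S (\<lambda>b. pt (y b) (s b))"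
proof (rule continuous_on_coordinatewise_then_product)
  have ev2: "continuous_on S (\<lambda>b. ev2 Q (y b) (s b))" for Q
    unfolding continuous_on_def
  proof
    fix x assume x: "x \<in> S"
    show "((\<lambda>b. ev2 Q (y b) (s b)) \<longlongrightarrow> ev2 Q (y x) (s x)) (at x within S)"
      by (rule tendsto_ev2) (use assms(1,2) x in \<open>auto simp: continuous_on_def\<close>)
  qed
  show "continuous_on S (\<lambda>b. pt (y b) (s b) i)" for i
    unfolding pt_def using assms ev2 by (cases "i < m") (auto intro!: continuous_intros)
qed

lemma (in hypersurface) C1_pt:
  assumes "\<And>i. C1 M S (\<lambda>b. y b i)" "C1 M S s" "\<And>b. b \<in> S \<Longrightarrow> ev2 (pderiv F) (y b) (s b) \<noteq> 0"
  shows "C1 M S (\<lambda>b. pt (y b) (s b) i)"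
  unfolding pt_def using assms by (cases "i < m") (auto intro!: C1_divide C1_uminus C1_ev2)

text \<open>The unknowns \<open>b i\<close> for \<open>i \<le> n\<close> move the point \<open>pt y s\<close>, the direction \<open>n\<close> being transversal to the
  hypersurface; the parameters \<open>b (Suc n + 4 * k + c)\<close> are the entries of the \<open>k\<close>-th matrix. Subtracting a multiple
  of the equation \<open>F\<close> from the others turns the Jacobian matrix into the identity.\<close>

lemma (in base_hypersurface) solutions_near:
  fixes n :: nat and W :: "nat \<Rightarrow> complex set" and \<phi> :: "nat \<Rightarrow> complex \<Rightarrow> complex" and \<kappa> :: "nat \<Rightarrow> complex"
  defines "P0 \<equiv> \<lambda>x k c. if c = 0 then \<kappa> k else if c = 1 then \<phi> k (x (n + k)) - \<kappa> k * x k else if c = 2 then 0 else 1 :: complex"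
  assumes m: "m = 2 * n" and x: "regular x"
    and Q: "\<And>i. i < m \<Longrightarrow> relation X (base m ss) (pvar i) (Q i)"
      "\<And>i. i < m \<Longrightarrow> ev2 (pderiv (Q i)) (pmap (base m ss) x) (x i) \<noteq> 0"
    and W: "\<And>k. k < n \<Longrightarrow> open (W k)" "\<And>k. k < n \<Longrightarrow> x (n + k) \<in> W k"
    and \<phi>: "\<And>k. k < n \<Longrightarrow> \<phi> k holomorphic_on W k"
    and free: "lindep_free (length ss) {..<n}
      (\<lambda>k l. \<kappa> k * grad m ss Q x k l - deriv (\<phi> k) (x (n + k)) * grad m ss Q x (n + k) l)"
    and U: "open U" "x \<in> U"
  shows "\<exists>\<delta>>0. \<forall>a. (\<forall>k<n. \<forall>c<4. norm (a k c - P0 x k c) < \<delta>) \<longrightarrow>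
    (\<exists>x'\<in>X \<inter> U. \<forall>k<n. x' (n + k) \<in> W k \<and> a k 2 * x' k + a k 3 \<noteq> 0 \<and>
       a k 0 * x' k + a k 1 = \<phi> k (x' (n + k)) * (a k 2 * x' k + a k (3 :: nat)))"
proof -
  let ?d = "length ss" and ?\<eta> = "pmap (base m ss)"
  define N where "N = Suc n"
  define M where "M = N + 4 * n"
  define FX where "FX = ev2 (pderiv F) (?\<eta> x) (g x)"
  have FX: "FX \<noteq> 0" using regular_pderiv[OF x] by (simp add: FX_def)
  define \<rho> where "\<rho> k = deriv (\<phi> k) (x (n + k))" for k
  \<comment> \<open>Directions dual to the linearized equations: moving along the
    \<open>j\<close>-th one changes only the \<open>j\<close>-th equation to first order.\<close>
  obtain B where B: "\<And>k j. k < n \<Longrightarrow> j < n \<Longrightarrow>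
      (\<Sum>l<?d. (\<kappa> k * grad m ss Q x k l - \<rho> k * grad m ss Q x (n + k) l) * B j l) = (if k = j then 1 else 0)"
    using dual_basis[OF free] unfolding \<rho>_def by blast
  define D where "D j = (\<lambda>l. if j < n \<and> l < ?d then B j l else 0 :: complex)" for j
  \<comment> \<open>For \<open>j < n\<close> the direction becomes tangent to the hypersurface; the
    direction \<open>n\<close> leaves \<open>y\<close> fixed and changes \<open>F\<close> at unit
    rate.\<close>
  define \<gamma> where "\<gamma> j = (if j < n then - (\<Sum>l<?d. ev2 (partial2 F l) (?\<eta> x) (g x) * D j l) / FX else 1 / FX)" for j
  have D0: "D j l = 0" if "l \<ge> ?d" for j l using that by (simp add: D_def)
  have F_dir: "(\<Sum>l<?d. ev2 (partial2 F l) (?\<eta> x) (g x) * D j l) + FX * \<gamma> j = (if j = n then 1 else 0)" if "j < N" for j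
    using that FX by (auto simp: \<gamma>_def N_def D_def)
  define v where "v j i = dpt (?\<eta> x) (g x) (D j) (\<gamma> j) i" for j i
  have v: "v j i = (\<Sum>l<?d. grad m ss Q x i l * D j l)" if "j < n" "i < m" for i j
    unfolding v_def
  proof (rule tangent_grad[where \<alpha> = "D j" and \<gamma> = "\<gamma> j" and Q = Q, OF x D0 _ that(2) Q[OF that(2)]])
    show "tangent x (D j) (\<gamma> j)"
      using F_dir[of j] that(1) unfolding FX_def N_def by (auto split: if_splits)
  qed
  have v_dual: "\<kappa> k * v j k - \<rho> k * v j (n + k) = (if k = j then 1 else 0)" if "k < n" "j < n" for k j
  proof -
    have "\<kappa> k * v j k - \<rho> k * v j (n + k) =
        (\<Sum>l<?d. (\<kappa> k * grad m ss Q x k l - \<rho> k * grad m ss Q x (n + k) l) * D j l)"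
      using that m by (simp add: v sum_distrib_left sum_subtractf left_diff_distrib mult.assoc)
    also have "\<dots> = (\<Sum>l<?d. (\<kappa> k * grad m ss Q x k l - \<rho> k * grad m ss Q x (n + k) l) * B j l)"
      by (rule sum.cong) (use that in \<open>auto simp: D_def\<close>)
    finally show ?thesis using B[OF that] by simp
  qed
  \<comment> \<open>The derivative of the \<open>k\<close>-th equation along the direction
    \<open>n\<close>; subtracting \<open>e k\<close> times \<open>F\<close> clears the last column
    of the Jacobian matrix.\<close>
  define e where "e k = \<kappa> k * v n k - \<rho> k * v n (n + k)" for k
  define y where "y b i = ?\<eta> x i + (\<Sum>j<N. b j * D j i)" for b :: "nat \<Rightarrow> complex" and i
  define t where "t b = g x + (\<Sum>j<N. b j * \<gamma> j)" for b :: "nat \<Rightarrow> complex"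
  define f where "f b = pt (y b) (t b)" for b
  define a where "a b k c = b (N + 4 * k + c)" for b :: "nat \<Rightarrow> complex" and k c :: nat
  define E where "E k b = (a b k 0 * f b k + a b k 1) - \<phi> k (f b (n + k)) * (a b k 2 * f b k + a b k 3)" for k b
  define H where "H k b = (if k < n then E k b - e k * ev2 F (y b) (t b) else ev2 F (y b) (t b))" for k b
  \<comment> \<open>The unknowns measure displacements from \<open>x\<close> and start at zero;
    division by 4 with remainder recovers the matrix and the entry from the index of a
    parameter.\<close>
  define b0 where "b0 i = (if i < N then 0 else P0 x ((i - N) div 4) ((i - N) mod 4))" for i
  have b0a: "a b0 k c = P0 x k c" if "c < 4" for k c
  proof -
    have "(N + 4 * k + c - N) div 4 = k" "(N + 4 * k + c - N) mod 4 = c" using that by simp_all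
    then show ?thesis by (simp add: a_def b0_def)
  qed
  have y0: "y b0 = ?\<eta> x" and t0: "t b0 = g x" by (auto simp: y_def t_def b0_def)
  have f0: "f b0 = x" using pt_\<eta>[of x] x by (simp add: f_def y0 t0)
  have C1y: "C1 M T (\<lambda>b. y b i)" and C1t: "C1 M T t" for T i
    unfolding y_def t_def by (intro C1_intros C1_sum)+
  have C1a: "C1 M T (\<lambda>b. a b k c)" for T k c unfolding a_def by (rule C1_intros)
  define S1 where "S1 = {b. ev2 (pderiv F) (y b) (t b) \<noteq> 0}"
  have S1: "open S1"
  proof -
    have "continuous_on UNIV (\<lambda>b. ev2 (pderiv F) (y b) (t b))"
      by (rule C1_continuous[OF C1_ev2[OF C1y C1t]])
    then have "open (UNIV \<inter> (\<lambda>b. ev2 (pderiv F) (y b) (t b)) -` (- {0}))"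
      by (rule continuous_open_preimage) auto
    moreover have "UNIV \<inter> (\<lambda>b. ev2 (pderiv F) (y b) (t b)) -` (- {0}) = S1" by (auto simp: S1_def)
    ultimately show ?thesis by simp
  qed
  have C1f: "C1 M S1 (\<lambda>b. f b i)" for i
    unfolding f_def by (rule C1_pt[OF C1y C1t]) (simp add: S1_def)
  have cf: "continuous_on S1 f"
    unfolding f_def by (rule continuous_on_pt) (auto simp: S1_def intro: C1_continuous C1y C1t)
  define O' where "O' = U \<inter> (\<Inter>k<n. (\<lambda>x. x (n + k)) -` W k)"
  have O': "open O'"
    unfolding O'_def by (intro open_Int U(1) open_INT ballI open_vimage W(1) continuous_on_product_coordinates) auto
  \<comment> \<open>On \<open>S\<close> the point \<open>f b\<close> is well defined, lies in the
    prescribed open sets and is not sent to infinity by the matrices; nonzero \<open>disc\<close>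
    lets \<open>pt_in\<close> apply. A solution inherits all this by lying in
    \<open>S\<close>.\<close>
  define S where "S = (S1 \<inter> f -` O') \<inter> (S1 \<inter> (\<lambda>b. pev disc (y b)) -` (- {0})) \<inter>
      (S1 \<inter> (\<Inter>k<n. S1 \<inter> (\<lambda>b. a b k 2 * f b k + a b k 3) -` (- {0})))"
  have S: "open S"
    unfolding S_def
    by (intro open_Int open_INT ballI continuous_open_preimage S1 O' cf open_Compl closed_singleton
        C1_continuous[of M] C1_pev C1y C1_intros C1a C1f) auto
  have b0S: "b0 \<in> S"
    using W(2) U(2) x FX b0a[of 2] b0a[of 3] by (auto simp: S_def S1_def O'_def y0 t0 f0 FX_def P0_def)
  have SS1: "S \<subseteq> S1" by (auto simp: S_def)
  have C1H: "C1 M S (H k)" for k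
  proof -
    have F: "C1 M S (\<lambda>b. ev2 F (y b) (t b))" by (rule C1_ev2[OF C1y C1t])
    have fS: "C1 M S (\<lambda>b. f b i)" for i by (rule C1_subset[OF C1f SS1])
    have "C1 M S (\<lambda>b. \<phi> k (f b (n + k)))" if "k < n"
      by (rule C1_compose[OF fS \<phi>[OF that] W(1)[OF that]]) (use that in \<open>auto simp: S_def O'_def\<close>)
    then show ?thesis unfolding H_def E_def
      by (cases "k < n") (auto intro!: C1_diff C1_intros F fS C1a)
  qed
  have F0: "ev2 F (y b0) (t b0) = 0" using F_rel x by (simp add: y0 t0 relation_def)
  have H0: "H k b0 = 0" for k
    using F0 b0a[of 0 k] b0a[of 1 k] b0a[of 2 k] b0a[of 3 k] by (simp add: H_def E_def f0 P0_def)
  have dH: "((\<lambda>s. H k (\<lambda>i. b0 i + s * (if i = j then 1 else 0))) has_field_derivative (if k = j then 1 else 0)) (at 0)"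
    if k: "k < N" and j: "j < N" for k j
  proof -
    let ?b = "\<lambda>s i. b0 i + s * (if i = j then 1 else 0 :: complex)"
    have sum_j: "(\<Sum>i<N. ?b s i * c i) = s * c j" for s and c :: "nat \<Rightarrow> complex"
    proof -
      have "(\<Sum>i<N. ?b s i * c i) = (\<Sum>i<N. if i = j then s * c j else 0)"
        by (rule sum.cong) (auto simp: b0_def)
      then show ?thesis using j by simp
    qed
    have yb: "y (?b s) = (\<lambda>i. ?\<eta> x i + s * D j i)" and tb: "t (?b s) = g x + s * \<gamma> j" for s
      by (intro ext, simp only: y_def sum_j) (simp only: t_def sum_j)
    have ab: "a (?b s) k c = a b0 k c" for s c using j by (simp add: a_def)
    have dy: "((\<lambda>s. ?\<eta> x i + s * D j i) has_field_derivative D j i) (at 0)" for i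
      by (auto intro!: derivative_eq_intros)
    have dt: "((\<lambda>s. g x + s * \<gamma> j) has_field_derivative \<gamma> j) (at 0)"
      by (auto intro!: derivative_eq_intros)
    have dF: "((\<lambda>s. ev2 F (y (?b s)) (t (?b s))) has_field_derivative (if j = n then 1 else 0)) (at 0)"
      using ev2_has_derivative_finite[where Q = F and x = "\<lambda>s i. ?\<eta> x i + s * D j i" and d = ?d and \<tau> = "D j", OF dy dt D0] F_dir[OF j] by (simp add: yb tb FX_def)
    show ?thesis
    proof (cases "k < n")
      case False
      then have "k = n" using k by (simp add: N_def)
      then show ?thesis using dF by (auto simp: H_def)
    next
      case True
      have df: "((\<lambda>s. f (?b s) i) has_field_derivative v j i) (at 0)" if "i < m" for i
      proof -
        have "ev2 (pderiv F) (\<lambda>i. ?\<eta> x i + 0 * D j i) (g x + 0 * \<gamma> j) \<noteq> 0" using FX by (simp add: FX_def)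
        from pt_has_derivative[OF dy D0 dt this that] show ?thesis by (simp add: f_def yb tb v_def)
      qed
      have fb0: "f (?b 0) = x" using f0 by simp
      have "(\<phi> k has_field_derivative \<rho> k) (at (f (?b 0) (n + k)))"
        unfolding fb0 \<rho>_def by (rule holomorphic_derivI[OF \<phi>[OF True] W(1)[OF True] W(2)[OF True]])
      from DERIV_chain2[OF this df[of "n + k"]]
      have d\<phi>: "((\<lambda>s. \<phi> k (f (?b s) (n + k))) has_field_derivative \<rho> k * v j (n + k)) (at 0)"
        using True m by simp
      have E: "E k (?b s) = (\<kappa> k * f (?b s) k + P0 x k 1) - \<phi> k (f (?b s) (n + k))" for s
        unfolding E_def ab using b0a[of 0 k] b0a[of 1 k] b0a[of 2 k] b0a[of 3 k] by (simp add: P0_def)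
      have "((\<lambda>s. E k (?b s) - e k * ev2 F (y (?b s)) (t (?b s))) has_field_derivative
         (\<kappa> k * v j k + 0 - \<rho> k * v j (n + k)) - e k * (if j = n then 1 else 0)) (at 0)"
        unfolding E by (intro DERIV_diff DERIV_add DERIV_cmult DERIV_const d\<phi> dF df) (use True m in simp)
      moreover have "(\<kappa> k * v j k + 0 - \<rho> k * v j (n + k)) - e k * (if j = n then 1 else 0) = (if k = j then 1 else 0)"
        using True j v_dual[of k j] by (cases "j = n") (auto simp: e_def N_def)
      ultimately show ?thesis using True by (simp add: H_def)
    qed
  qed
  \<comment> \<open>The radius \<open>1\<close> is arbitrary, as membership in \<open>S\<close>
    already confines the solution to \<open>U\<close> and the sets \<open>W k\<close>.\<close>
  obtain \<delta> where \<delta>: "\<delta> > 0" and sol: "\<And>q. (\<forall>i<N. q i = b0 i) \<Longrightarrow> (\<forall>i\<ge>N. norm (q i - b0 i) < \<delta>) \<Longrightarrow>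
     \<exists>b\<in>S. (\<forall>i<N. norm (b i - b0 i) < 1) \<and> (\<forall>i\<ge>N. b i = q i) \<and> (\<forall>k<N. H k b = 0)"
    using newton_stability[OF S b0S C1H _ zero_less_one H0 dH, of N] by (auto simp: M_def)
  show ?thesis
  proof (intro exI[of _ \<delta>] conjI allI impI \<delta>)
    fix A assume A: "\<forall>k<n. \<forall>c<4. norm (A k c - P0 x k c) < \<delta>"
    define q where "q i = (if N \<le> i \<and> i < M then A ((i - N) div 4) ((i - N) mod 4) else b0 i)" for i
    have "norm (q i - b0 i) < \<delta>" if "i \<ge> N" for i
    proof (cases "i < M")
      case True
      then have "(i - N) div 4 < n" using that by (simp add: M_def less_mult_imp_div_less mult.commute)
      then show ?thesis using A True that by (simp add: q_def b0_def)
    qed (use \<delta> in \<open>simp add: q_def\<close>)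
    then obtain b where b: "b \<in> S" "\<And>i. i \<ge> N \<Longrightarrow> b i = q i" "\<And>k. k < N \<Longrightarrow> H k b = 0"
      using sol[of q] by (auto simp: q_def)
    have ab: "a b k c = A k c" if "k < n" "c < 4" for k c
    proof -
      have "(N + 4 * k + c - N) div 4 = k" "(N + 4 * k + c - N) mod 4 = c" using that by simp_all
      moreover have "N + 4 * k + c < M" using that by (simp add: M_def)
      ultimately show ?thesis using b(2)[of "N + 4 * k + c"] by (simp add: a_def q_def)
    qed
    have Fb: "ev2 F (y b) (t b) = 0" using b(3)[of n] by (simp add: H_def N_def)
    have "f b \<in> X" unfolding f_def by (rule pt_in[OF Fb]) (use b(1) in \<open>simp add: S_def\<close>)
    moreover have "E k b = 0" if "k < n" for k using b(3)[of k] that Fb by (simp add: H_def N_def)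
    moreover have "A k 2 * f b k + A k 3 \<noteq> 0" if "k < n" for k
    proof -
      have "a b k 2 * f b k + a b k 3 \<noteq> 0" using b(1) that unfolding S_def by blast
      then show ?thesis using ab that by simp
    qed
    ultimately show "\<exists>x'\<in>X \<inter> U. \<forall>k<n. x' (n + k) \<in> W k \<and> A k 2 * x' k + A k 3 \<noteq> 0 \<and>
       A k 0 * x' k + A k 1 = \<phi> k (x' (n + k)) * (A k 2 * x' k + A k 3)"
      using b(1) ab by (intro bexI[of _ "f b"]) (auto simp: S_def O'_def E_def)
  qed
qed

section \<open>Density of the blurring\<close>

lemma lindep_free_reindex:
  assumes "inj_on \<psi> I" "lindep_free d (\<psi> ` I) v"
  shows "lindep_free d I (\<lambda>i. v (\<psi> i))"
  unfolding lindep_free_def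
proof (intro allI impI ballI)
  fix t i assume t: "\<forall>l<d. (\<Sum>i\<in>I. t i * v (\<psi> i) l) = 0" and i: "i \<in> I"
  have "(\<Sum>c\<in>\<psi> ` I. t (inv_into I \<psi> c) * v c l) = (\<Sum>i\<in>I. t i * v (\<psi> i) l)" for l
    unfolding sum.reindex[OF assms(1)] by (rule sum.cong) (simp_all add: assms(1))
  then have "\<forall>c\<in>\<psi> ` I. t (inv_into I \<psi> c) = 0"
    using assms(2)[unfolded lindep_free_def, rule_format, of "\<lambda>c. t (inv_into I \<psi> c)"] t by simp
  then show "t i = 0" using assms(1) i by simp
qed

text \<open>The independent coordinates of the projection are translated back: its first half
  consists of z-coordinates and its second half of w-coordinates, all with index from
  \<open>K\<close>. The count is the rank condition of \<open>generic_transversal\<close>.\<close>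

lemma j_broad_indep:
  assumes V: "V \<subseteq> affine_space (2 * n)" and br: "j_broad n V" and K: "K \<subseteq> {..<n}" "K \<noteq> {}"
  shows "\<exists>s. indep (cyl (2 * n) V) (base (2 * n) s) \<and> distinct s \<and> set s \<subseteq> K \<union> (\<lambda>k. n + k) ` K \<and> card K \<le> length s"
proof -
  define ks where "ks = sorted_list_of_set K"
  have fin: "finite K" using K(1) finite_subset by blast
  have ks: "set ks = K" "length ks = card K" "sorted_wrt (<) ks" "distinct ks" "ks \<noteq> []"
    using fin K(2) by (auto simp: ks_def)
  have "enat (length ks) \<le> zariski_dim (2 * length ks) (pr_idx n ks ` V)"
    using br[unfolded j_broad_def, rule_format, of ks] ks K(1) by simp
  moreover have "pr_idx n ks ` V \<subseteq> affine_space (2 * length ks)"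
    unfolding pr_idx_def by (rule image_subsetI) (rule restrict_affine)
  ultimately obtain ss where ss: "distinct ss" "set ss \<subseteq> {..<2 * length ks}" "length ss \<ge> length ks"
    "indep (cyl (2 * length ks) (pr_idx n ks ` V)) (base (2 * length ks) ss)"
    using zariski_dim_indep[of "length ks"] ks(5) by blast
  let ?f = "\<lambda>i. if i < length ks then ks ! i else n + ks ! (i - length ks)"
  have in_K: "ks ! i \<in> K" if "i < length ks" for i using ks(1) nth_mem[OF that] by simp
  have inj: "inj_on ?f {..<2 * length ks}"
  proof (rule inj_onI)
    fix i j assume *: "i \<in> {..<2 * length ks}" "j \<in> {..<2 * length ks}" "?f i = ?f j"
    have lt: "ks ! i < n" if "i < length ks" for i using in_K[OF that] K(1) by auto
    have half: "i' - length ks < length ks" if "\<not> i' < length ks" "i' < 2 * length ks" for i'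
      using that by linarith
    show "i = j"
      using half[of i] half[of j] * lt[of i] lt[of j] nth_eq_iff_index_eq[OF ks(4), of i j]
        nth_eq_iff_index_eq[OF ks(4), of "i - length ks" "j - length ks"]
      by (auto split: if_splits)
  qed
  show ?thesis
  proof (intro exI[of _ "map ?f ss"] conjI)
    show "indep (cyl (2 * n) V) (base (2 * n) (map ?f ss))"
      by (rule indep_projection[OF V ss(2) _ ss(4)]) (use ks K in simp)
    show "distinct (map ?f ss)" using ss inj by (simp only: distinct_map) (blast intro: inj_on_subset)
    show "set (map ?f ss) \<subseteq> K \<union> (\<lambda>k. n + k) ` K"
    proof
      fix c assume "c \<in> set (map ?f ss)"
      then obtain i where i: "i \<in> set ss" "c = ?f i" by auto
      then have "i < 2 * length ks" using ss(2) by auto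
      then show "c \<in> K \<union> (\<lambda>k. n + k) ` K" using i(2) in_K[of i] in_K[of "i - length ks"] by auto
    qed
  qed (use ss ks in simp)
qed

text \<open>The matrix to be approximated is upper triangular with diagonal entries \<kappa> and
  \<open>1\<close>, so \<open>\<kappa> \<noteq> 0\<close> makes it invertible.\<close>

lemma GL2_approx:
  assumes G: "carrier GL2 \<subseteq> closure G" and "\<kappa> \<noteq> 0" "\<delta> > 0"
  shows "\<exists>A\<in>G. norm (A $ 1 $ 1 - \<kappa>) < \<delta> \<and> norm (A $ 1 $ 2 - \<mu>) < \<delta> \<and> norm (A $ 2 $ 1) < \<delta> \<and> norm (A $ 2 $ 2 - 1) < \<delta>"
proof -
  define A0 :: "complex^2^2" where "A0 = vector [vector [\<kappa>, \<mu>], vector [0, 1]]"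
  have A0: "A0 $ 1 $ 1 = \<kappa>" "A0 $ 1 $ 2 = \<mu>" "A0 $ 2 $ 1 = 0" "A0 $ 2 $ 2 = 1" by (simp_all add: A0_def)
  have "det A0 \<noteq> 0" using assms(2) by (simp add: det_2 A0)
  then have "A0 \<in> carrier GL2" by (simp add: GL2_def invertible_det_nz)
  then obtain A where A: "A \<in> G" "norm (A - A0) < \<delta>"
    using G assms(3) by (auto simp: closure_approachable dist_norm subset_iff)
  have "norm (A $ i $ j - A0 $ i $ j) < \<delta>" for i j
  proof -
    have "norm ((A - A0) $ i $ j) \<le> norm ((A - A0) $ i)" by (rule Finite_Cartesian_Product.norm_nth_le)
    also have "\<dots> \<le> norm (A - A0)" by (rule Finite_Cartesian_Product.norm_nth_le)
    finally show ?thesis using A(2) by simp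
  qed
  from this[of 1 1] this[of 1 2] this[of 2 1] this[of 2 2] show ?thesis using A(1) by (auto simp: A0)
qed

lemma blurring_meets:
  assumes V: "irreducible_variety (2 * n) V" and br: "j_broad n V" and fr: "j_free n V"
    and G: "carrier GL2 \<subseteq> closure G" and O: "open O'" "p \<in> O'" "p \<in> V"
  shows "\<exists>x\<in>V \<inter> blurring n G. x \<in> O'"
proof -
  define X where "X = cyl (2 * n) V"
  have Vz: "zariski_closed (2 * n) V" and VA: "V \<subseteq> affine_space (2 * n)"
    using V zariski_closed_affine by (auto simp: irreducible_variety_def)
  have VX: "V \<subseteq> X" unfolding X_def by (rule cyl_superset[OF VA])
  interpret closed_cylinder X "2 * n"
  proof
    show "irr X" unfolding X_def by (rule irreducible_variety_irr[OF V])
    show "x' \<in> X" if "x \<in> X" "\<And>i. i < 2 * n \<Longrightarrow> x' i = x i" for x x' using that unfolding X_def by (rule cyl_cong)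
    show "x \<in> X" if "\<And>P. (\<forall>z\<in>X. pev P z = 0) \<Longrightarrow> pev P x = 0" for x
      using that unfolding X_def by (rule zariski_closed_cyl[OF Vz])
  qed
  define J where "J = \<Union>{U. \<exists>\<tau>. j_section U \<tau>}"
  have J: "open J" by (auto simp: J_def j_section_def)
  have J_dense: "\<exists>w'\<in>J. norm (w' - w) < r" if "r > 0" for w r
    using j_section_dense[OF that, of w] by (auto simp: J_def)
  obtain M r where r: "r > 0" "\<And>x. (\<And>i. i < M \<Longrightarrow> norm (x i - p i) < r) \<Longrightarrow> x \<in> O'"
    by (rule open_contains_tube[OF O(1,2)]) blast
  \<comment> \<open>Only coordinates below \<open>2 * n\<close> are constrained, because the
    solution on the cylinder is finally cut down to an extensional point.\<close>
  define O1 where "O1 = (\<Inter>i<2 * n. {x. norm (x i - p i) < r})"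
  have O1: "open O1" unfolding O1_def
    by (intro open_INT ballI open_Collect_less continuous_on_norm continuous_on_diff
        continuous_on_product_coordinates continuous_on_const) auto
  have pO1: "p \<in> O1" using r by (simp add: O1_def)
  define OJ where "OJ j = O1 \<inter> (\<Inter>k<j. (\<lambda>x. x (n + k)) -` J)" for j
  have OJ: "open (OJ j)" for j unfolding OJ_def
    by (intro open_Int O1 open_INT ballI open_vimage J continuous_on_product_coordinates) auto
  \<comment> \<open>The w-coordinates are brought into \<open>J\<close> one after the other.
    Conditions already met are open and become part of the neighbourhood in which the next point is
    sought.\<close>
  have "\<exists>x\<in>X. x \<in> OJ j" if "j \<le> n" for j
    using that
  proof (induction j)
    case 0
    then show ?case using pO1 O(3) VX by (auto simp: OJ_def)
  next
    case (Suc j)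
    then obtain x where x: "x \<in> X" "x \<in> OJ j" by auto
    have "\<not> (\<exists>c. \<forall>x\<in>X. x (n + j) = c)"
    proof
      assume "\<exists>c. \<forall>x\<in>X. x (n + j) = c"
      then obtain c where "\<forall>x\<in>X. x (n + j) = c" by blast
      then have "\<forall>w\<in>pr_w n ` V. w j = c" using VX Suc.prems by (auto simp: pr_w_def)
      moreover have "\<not> (\<exists>c. \<forall>w\<in>pr_w n ` V. w j = c)" using fr Suc.prems by (simp add: j_free_def)
      ultimately show False by blast
    qed
    then have "indep X (base (2 * n) [n + j])"
      by (rule indep_nonconstant[OF X_irr]) (use X_cyl Suc.prems in auto)
    from coordinate_meets[OF OJ x(2,1) _ this J_dense] obtain x' where "x' \<in> X" "x' \<in> OJ j" "x' (n + j) \<in> J"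
      using Suc.prems by auto
    then show ?case by (intro bexI[of _ x']) (auto simp: OJ_def less_Suc_eq)
  qed
  then obtain p1 where p1: "p1 \<in> X" "p1 \<in> OJ n" by blast
  \<comment> \<open>The rank condition is required for all \<open>K\<close> at the same point, so
    the lists are collected before the generic point is chosen.\<close>
  have "\<forall>K. \<exists>s. K \<subseteq> {..<n} \<and> K \<noteq> {} \<longrightarrow> indep X (base (2 * n) s) \<and> distinct s \<and>
      set s \<subseteq> K \<union> (\<lambda>k. n + k) ` K \<and> card K \<le> length s"
    unfolding X_def using j_broad_indep[OF VA br] by simp
  from choice[OF this] obtain sK where sK: "\<forall>K. K \<subseteq> {..<n} \<and> K \<noteq> {} \<longrightarrow> indep X (base (2 * n) (sK K)) \<and> distinct (sK K) \<and>
      set (sK K) \<subseteq> K \<union> (\<lambda>k. n + k) ` K \<and> card K \<le> length (sK K)" by (rule exE)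
  have sK': "indep X (base (2 * n) (sK K))" "distinct (sK K)" "set (sK K) \<subseteq> K \<union> (\<lambda>k. n + k) ` K"
    "card K \<le> length (sK K)" if "K \<subseteq> {..<n}" "K \<noteq> {}" for K
    using sK that by simp_all
  define S where "S = sK ` {K. K \<subseteq> {..<n} \<and> K \<noteq> {}}"
  have S: "indep X (base (2 * n) s) \<and> distinct s \<and> set s \<subseteq> {..<2 * n}" if "s \<in> S" for s
  proof -
    obtain K where K: "K \<subseteq> {..<n}" "K \<noteq> {}" "s = sK K" using \<open>s \<in> S\<close> by (auto simp: S_def)
    have "K \<union> (\<lambda>k. n + k) ` K \<subseteq> {..<2 * n}" using K(1) by auto
    then show ?thesis using sK'[OF K(1,2)] K(3) by blast
  qed
  have fin: "finite S" unfolding S_def by simp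
  have ind: "indep X (base (2 * n) [])"
    unfolding X_def by (rule indep_empty) (use p1 X_def in auto)
  show ?thesis
  proof (rule generic_point[OF fin S ind OJ p1(2,1)])
    fix ss F x Q
    assume H: "base_hypersurface X (2 * n) ss F" and xO: "x \<in> OJ n" and x: "base_hypersurface.regular X (2 * n) ss F x"
      and Q: "\<And>i. i < 2 * n \<Longrightarrow> relation X (base (2 * n) ss) (pvar i) (Q i)"
        "\<And>i. i < 2 * n \<Longrightarrow> ev2 (pderiv (Q i)) (pmap (base (2 * n) ss) x) (x i) \<noteq> 0"
      and free: "\<And>s. s \<in> S \<Longrightarrow> lindep_free (length ss) (set s) (grad (2 * n) ss Q x)"
    interpret base_hypersurface X "2 * n" ss F by (fact H)
    have "\<forall>k. \<exists>U\<tau>. k < n \<longrightarrow> j_section (fst U\<tau>) (snd U\<tau>) \<and> x (n + k) \<in> fst U\<tau>"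
      using xO by (auto simp: OJ_def J_def)
    from choice[OF this] obtain U\<tau> where U\<tau>:
      "\<And>k. k < n \<Longrightarrow> j_section (fst (U\<tau> k)) (snd (U\<tau> k)) \<and> x (n + k) \<in> fst (U\<tau> k)" by auto
    define U \<tau> where "U k = fst (U\<tau> k)" and "\<tau> k = snd (U\<tau> k)" for k
    have sec: "j_section (U k) (\<tau> k)" "x (n + k) \<in> U k" if "k < n" for k
      using U\<tau>[OF that] by (simp_all add: U_def \<tau>_def)
    define \<rho> where "\<rho> k = deriv (\<tau> k) (x (n + k))" for k
    have \<rho>: "\<rho> k \<noteq> 0" if "k < n" for k using sec[OF that] by (simp add: \<rho>_def j_section_def)
    let ?D = "grad (2 * n) ss Q x"
    have rank: "\<exists>I. finite I \<and> card K \<le> card I \<and> I \<subseteq> K \<times> UNIV \<and>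
        lindep_free (length ss) I (\<lambda>(k, z). if z then ?D k else ?D (n + k))" if K: "K \<subseteq> {..<n}" "K \<noteq> {}" for K
    proof -
      \<comment> \<open>A coordinate is encoded as a pair: \<open>True\<close> marks a z-coordinate
        and \<open>False\<close> a w-coordinate, as in \<open>generic_transversal\<close>.\<close>
      let ?\<psi> = "\<lambda>(k, z). if z then k else n + k"
      define I where "I = {kz \<in> K \<times> UNIV. ?\<psi> kz \<in> set (sK K)}"
      have inj: "inj_on ?\<psi> I"
        using K(1) by (fastforce simp: I_def inj_on_def split: if_splits)
      have im: "?\<psi> ` I = set (sK K)"
      proof (intro equalityI subsetI)
        fix c assume c: "c \<in> set (sK K)"
        then consider "c \<in> K" | k where "k \<in> K" "c = n + k" using sK'(3)[OF K] by blast
        then show "c \<in> ?\<psi> ` I"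
        proof cases
          case 1
          then show ?thesis using c by (intro image_eqI[of _ _ "(c, True)"]) (auto simp: I_def)
        next
          case 2
          then show ?thesis using c by (intro image_eqI[of _ _ "(k, False)"]) (auto simp: I_def)
        qed
      qed (auto simp: I_def)
      have "card I = card (set (sK K))" using card_image[OF inj] im by simp
      moreover have "card K \<le> card (set (sK K))" using sK'(2,4)[OF K] by (simp add: distinct_card)
      moreover have "sK K \<in> S" using K by (auto simp: S_def)
      then have "lindep_free (length ss) I (\<lambda>i. ?D (?\<psi> i))"
        using lindep_free_reindex[OF inj] free im by simp
      moreover have "(\<lambda>i. ?D (?\<psi> i)) = (\<lambda>(k, z). if z then ?D k else ?D (n + k))" by auto
      moreover have "finite I" using finite_imageD[OF _ inj] im by simp
      ultimately show ?thesis by (intro exI[of _ I]) (auto simp: I_def)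
    qed
    show "\<exists>x\<in>V \<inter> blurring n G. x \<in> O'"
    proof (rule generic_transversal[OF rank \<rho>])
      fix \<kappa>
      assume \<kappa>: "\<And>k. k < n \<Longrightarrow> \<kappa> k \<noteq> 0" and tr: "lindep_free (length ss) {..<n} (\<lambda>k l. \<kappa> k * ?D k l - \<rho> k * ?D (n + k) l)"
      let ?P = "\<lambda>k c. if c = 0 then \<kappa> k else if c = 1 then \<tau> k (x (n + k)) - \<kappa> k * x k else if c = 2 then 0 else 1"
      have "\<exists>\<delta>>0. \<forall>a. (\<forall>k<n. \<forall>c<4. norm (a k c - ?P k c) < \<delta>) \<longrightarrow>
        (\<exists>x'\<in>X \<inter> O1. \<forall>k<n. x' (n + k) \<in> U k \<and> a k 2 * x' k + a k 3 \<noteq> 0 \<and>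
           a k 0 * x' k + a k 1 = \<tau> k (x' (n + k)) * (a k 2 * x' k + a k (3 :: nat)))"
        by (rule solutions_near[OF refl x Q])
           (use sec tr O1 xO in \<open>auto simp: j_section_def \<rho>_def OJ_def\<close>)
      then obtain \<delta> where \<delta>: "\<delta> > 0" and sol: "\<And>a. (\<forall>k<n. \<forall>c<4. norm (a k c - ?P k c) < \<delta>) \<Longrightarrow>
        \<exists>x'\<in>X \<inter> O1. \<forall>k<n. x' (n + k) \<in> U k \<and> a k 2 * x' k + a k 3 \<noteq> 0 \<and>
           a k 0 * x' k + a k 1 = \<tau> k (x' (n + k)) * (a k 2 * x' k + a k (3 :: nat))" by blast
      have "\<forall>k. \<exists>A. k < n \<longrightarrow> A \<in> G \<and> norm (A $ 1 $ 1 - \<kappa> k) < \<delta> \<and>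
        norm (A $ 1 $ 2 - (\<tau> k (x (n + k)) - \<kappa> k * x k)) < \<delta> \<and> norm (A $ 2 $ 1) < \<delta> \<and> norm (A $ 2 $ 2 - 1) < \<delta>"
        using GL2_approx[OF G \<kappa> \<delta>] by blast
      from choice[OF this] obtain A where A: "\<forall>k. k < n \<longrightarrow> A k \<in> G \<and> norm (A k $ 1 $ 1 - \<kappa> k) < \<delta> \<and>
        norm (A k $ 1 $ 2 - (\<tau> k (x (n + k)) - \<kappa> k * x k)) < \<delta> \<and> norm (A k $ 2 $ 1) < \<delta> \<and> norm (A k $ 2 $ 2 - 1) < \<delta>"
        by (rule exE)
      define a where "a k c = (if c = 0 then A k $ 1 $ 1 else if c = 1 then A k $ 1 $ 2 else if c = 2 then A k $ 2 $ 1 else A k $ 2 $ 2)"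
        for k and c :: nat
      have "\<forall>k<n. \<forall>c<4. norm (a k c - ?P k c) < \<delta>" using A by (simp add: a_def)
      from sol[OF this] obtain x' where x': "x' \<in> X" "x' \<in> O1" and eq: "\<And>k. k < n \<Longrightarrow> x' (n + k) \<in> U k"
        "\<And>k. k < n \<Longrightarrow> A k $ 2 $ 1 * x' k + A k $ 2 $ 2 \<noteq> 0"
        "\<And>k. k < n \<Longrightarrow> A k $ 1 $ 1 * x' k + A k $ 1 $ 2 = \<tau> k (x' (n + k)) * (A k $ 2 $ 1 * x' k + A k $ 2 $ 2)"
        by (auto simp: a_def)
      define v where "v = restrict x' {..<2 * n}"
      have vV: "v \<in> V" using x'(1) by (simp add: v_def X_def cyl_def)
      have "v \<in> O'"
      proof (rule r(2))
        fix i
        show "norm (v i - p i) < r"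
        proof (cases "i < 2 * n")
          case True
          then show ?thesis using x'(2) by (simp add: v_def O1_def)
        next
          case False
          \<comment> \<open>Extensional points agree outside of the index set, so any further
            coordinates restricted by \<open>O'\<close> impose nothing.\<close>
          then have "p i = undefined" using O(3) VA by (auto simp: affine_space_def PiE_def extensional_def)
          then show ?thesis using False r(1) by (simp add: v_def)
        qed
      qed
      moreover have "v \<in> blurring n G" unfolding blurring_def
      proof (intro CollectI conjI exI[of _ A] allI impI)
        show "v \<in> affine_space (2 * n)" by (simp add: v_def)
        fix k assume k: "k < n"
        have v: "v k = x' k" "v (n + k) = x' (n + k)" using k by (simp_all add: v_def)
        have mo: "moebius (A k) (v k) = \<tau> k (x' (n + k))"
          unfolding moebius_def v eq(3)[OF k] using eq(2)[OF k] by simp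
        show "A k \<in> G" using A k by simp
        show "moebius (A k) (v k) \<in> upper_half_plane" "v (n + k) = modular_j (moebius (A k) (v k))"
          using sec(1)[OF k] eq(1)[OF k] by (simp_all add: mo v(2) j_section_def)
      qed
      ultimately show ?thesis using vV by blast
    qed
  qed
qed

theorem theorem1p5:
  fixes n :: nat and V :: "(nat \<Rightarrow> complex) set" and G :: "(complex^2^2) set"
  assumes "n \<ge> 1"
    and "irreducible_variety (2 * n) V"
    and "j_broad n V"
    and "j_free n V"
    and "subgroup G GL2"
    and "carrier GL2 \<subseteq> closure G"
  shows "V \<subseteq> closure (V \<inter> blurring n G) \<and> V \<inter> blurring n G \<noteq> {}"
proof
  show "V \<subseteq> closure (V \<inter> blurring n G)"
  proof
    fix p assume "p \<in> V"
    then show "p \<in> closure (V \<inter> blurring n G)"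
      using blurring_meets[OF assms(2-4,6)] by (auto simp: closure_iff_nhds_not_empty)
  qed
  moreover have "V \<noteq> {}" using assms(2) by (simp add: irreducible_variety_def)
  ultimately show "V \<inter> blurring n G \<noteq> {}" by auto
qed

end
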